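(* Let $N\ge2$, $\Omega\subset\mathbb R^N$ and $\Gamma=(\Gamma_t)_{t\in[0,T]}$, $T>0$, with $90^\circ$-contact angle (mean curvature flow is not required), $\delta>0$ and the coordinates be as in the context, and let $u^A_\varepsilon$ be functions of the structure described in the context (built from $\theta_0$, height functions $h_1,h_2$ bounded by $\overline C_0$, and $\hat u^C_1$). Then there are $\varepsilon_0,C,c_0>0$, independent of the $h_j$ for fixed $\overline C_0$, such that for all $\varepsilon\in(0,\varepsilon_0]$, $t\in[0,T]$ and $\psi\in H^1(\Omega)$ $$\int_\Omega|\nabla\psi|^2+\frac1{\varepsilon^2}f''(u^A_\varepsilon(\cdot,t))\psi^2\,dx\ \ge\ -C\|\psi\|_{L^2(\Omega)}^2+\|\nabla\psi\|_{L^2(\Omega\setminus\Gamma_t(\delta))}^2+c_0\|\nabla_\tau\psi\|_{L^2(\Gamma_t(\delta))}^2.$$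
   Context: **Potential.** $f\in C^\infty(\mathbb R)$, $f'(\pm1)=0$, $f''(\pm1)>0$, $f(-1)=f(1)$, $f>f(1)$ in $(-1,1)$. $\theta_0$ is the unique $C^2$-solution of $-\theta_0''+f'(\theta_0)=0$ on $\mathbb R$, $\theta_0(0)=0$, $\lim_{z\to\pm\infty}\theta_0(z)=\pm1$. **Evolving hypersurface with contact angle $\pi/2$.** $\Omega\subset\mathbb R^N$ is a bounded smooth domain with outer unit normal $N_{\partial\Omega}$, $Q_T=\Omega\times(0,T)$. $\Sigma\subset\mathbb R^N$ is a smooth, orientable, compact, connected hypersurface with boundary $\partial\Sigma$ and outer unit conormal $\vec n_{\partial\Sigma}$; $X_0:\Sigma\times[0,T]\to\overline\Omega$ is smooth with $X_0(\cdot,t)$ an injective immersion for each $t$. (Technical assumption: there are smooth orientable connected hypersurfaces $\Sigma\subsetneq\tilde\Sigma^\circ$, $\tilde\Sigma\subsetneq\Sigma_0$, $\tilde\Sigma$ compact with boundary, $\Sigma_0$ without boundary, and $X_0$ extends smoothly to $\Sigma_0\times(-\tau_0,T+\tau_0)$, $\tau_0>0$, as injective immersions for each $t$.) $\Gamma_t:=X_0(\Sigma,t)$, $\Gamma:=\bigcup_t\Gamma_t\times\{t\}$, $\overline X_0:=(X_0,\mathrm{pr}_t)$; $(\Gamma_t)^\circ\subset\Omega$, $\partial\Gamma_t\subset\partial\Omega$; $\vec n$ is a smooth unit normal field; $N_{\partial\Omega}(X_0(\sigma,t))\cdot\vec n(\sigma,t)=0$ for $(\sigma,t)\in\partial\Sigma\times[0,T]$.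 $V=\vec n\cdot\partial_tX_0$ is the normal velocity, $H$ the mean curvature (sum of principal curvatures). **Coordinates.** For some $\mu_1>0$, $Y:\partial\Sigma\times[0,2\mu_1]\to\Sigma$ are the tubular neighbourhood coordinates of $\partial\Sigma$ in $\Sigma$ (normal exponential map), $Y(\sigma,0)=\sigma$, $\partial_bY(\sigma,0)=-\vec n_{\partial\Sigma}(\sigma)$. $\delta>0$ is such that there is a smooth $X:[-2\delta,2\delta]\times\Sigma\times[0,T]\to\overline\Omega$ (fixed) with: (i) $\overline X:=(X,\mathrm{pr}_t)$ is a homeomorphism onto a neighbourhood of $\Gamma$ in $\overline\Omega\times[0,T]$, extends to a smooth diffeomorphism between an open neighbourhood of $[-2\delta,2\delta]\times\Sigma\times[0,T]$ in $\mathbb R\times\tilde\Sigma\times\mathbb R$ and an open set of $\mathbb R^{N+1}$, and $\Gamma(\eta):=\overline X((-\eta,\eta)\times\Sigma\times[0,T])$ is an open neighbourhood of $\Gamma$ in $\overline\Omega\times[0,T]$ for $\eta\in(0,2\delta]$; (ii) $X|_{r=0}=X_0$, $X(r,s,t)=X_0(s,t)+r\vec n(s,t)$ for $s\in\Sigma\setminus Y(\partial\Sigma\times[0,\mu_0])$ for some $\mu_0\in(0,\mu_1]$, and $X(r,s,t)\in\partial\Omega$ iff $s\in\partial\Sigma$; (iii) with $(r,s,\mathrm{pr}_t):=\overline X^{-1}$: the $\partial_{x_j}s$ generate $T_s\Sigma$, $|\nabla r|\ge c>0$, $D_xs(D_xs)^\top$ is uniformly positive definite on $T_s\Sigma$,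 $|\nabla r|^2|_\Gamma=1$, $\partial_r(|\nabla r|^2\circ\overline X)|_{r=0}=0$, $D_xs\nabla r|_\Gamma=0$, $\nabla r\circ\overline X_0=\vec n$, $V=-\partial_tr\circ\overline X_0$, $H=-\Delta r\circ\overline X_0$, and $\nabla r|_{\overline X(r,s,t)}=\vec n(s,t)$, $D_xs|_{\overline X(r,s,t)}\vec n(s,t)=0$ for $s\in\Sigma\setminus Y(\partial\Sigma\times[0,\mu_0])$; (iv) for $(\sigma,b):=Y^{-1}\circ s$ (where defined): $N_{\partial\Omega}\cdot\nabla b=-(D_xsN_{\partial\Omega})\cdot\vec n_{\partial\Sigma}$, $|N_{\partial\Omega}\cdot\nabla b|\ge c>0$, $\nabla b\cdot\nabla r=0$, $|\nabla b|\ge c>0$ at all $\overline X_0(\sigma,t)$, $(\sigma,t)\in\partial\Sigma\times[0,T]$. $Q_T^\pm$: the unique connected sets with $\overline{Q_T}=Q_T^-\cup Q_T^+\cup\Gamma$ (disjoint) and $\operatorname{sign}r=\pm1$ on $Q_T^\pm\cap\Gamma(\delta)$. $\Gamma^C(\eta,\mu):=\overline X((-\eta,\eta)\times Y(\partial\Sigma\times(0,\mu))\times[0,T])$, $\Gamma(\eta,\mu):=\Gamma(\eta)\setminus\overline{\Gamma^C(\eta,\mu)}$. A subscript $t$ (as in $\Gamma_t(\eta)$) denotes the time slice at $t$ projected to $\mathbb R^N$. $\partial_n\psi:=\partial_r(\psi\circ\overline X)\circ\overline X^{-1}$, $\nabla_\tau\psi:=(D_xs)^\top[\nabla_\Sigma(\psi\circ\overline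 X)\circ\overline X^{-1}]$ (same at fixed $t$), $\nabla_\Sigma$ the surface gradient. **Structure of $u^A_\varepsilon$.** $\hat\Sigma:=Y(\partial\Sigma\times[0,2\mu_0])$. $B([0,T],Z)$ denotes bounded maps $[0,T]\to Z$. $h_1$ and $h_2=h_2(\varepsilon)$ lie in $B([0,T],C^0(\Sigma)\cap C^2(\hat\Sigma))$ with norms $\le\overline C_0$; $h_\varepsilon:=h_1+\varepsilon h_2$; $\rho_\varepsilon:=\frac{r-\varepsilon h_\varepsilon(s,t)}\varepsilon$ in $\overline{\Gamma(2\delta)}$, $H_\varepsilon:=\frac b\varepsilon$ in $\overline{\Gamma^C(2\delta,2\mu_1)}$. $\hat u^C_1=\hat u^C_1(\rho,H,\sigma,t)\in B([0,T];C^2(\partial\Sigma,H^2_{(0,\gamma)}(\mathbb R^2_+)))$ for some $\gamma>0$, where $\mathbb R^2_+=\{(\rho,H):H>0\}$ and $H^2_{(0,\gamma)}(\mathbb R^2_+)$ consists of $u$ with $e^{\gamma H}u\in H^2(\mathbb R^2_+)$; $u^C_1(x,t):=\hat u^C_1(\rho_\varepsilon(x,t),H_\varepsilon(x,t),\sigma(x,t),t)$. For small $\varepsilon>0$: $$u^A_\varepsilon=\begin{cases}\theta_0(\rho_\varepsilon)+O(\varepsilon^2)&\text{in }\Gamma(\delta,\mu_0),\\ \theta_0(\rho_\varepsilon)+\varepsilon u^C_1+O(\varepsilon^2)&\text{in }\Gamma^C(\delta,2\mu_0),\\ \pm1+O(\varepsilon)&\text{in }Q_T^\pm\setminus\Gamma(\delta),\end{cases}$$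 where $O(\varepsilon^k)$ are measurable functions bounded by a constant times $\varepsilon^k$. *)

theory Defs
  imports "HOL-Analysis.Analysis"
begin

section \<open>Smooth maps and gradients\<close>

text \<open>Intended for open \<open>U\<close> and finite-dimensional domains.\<close>

primrec Ck_on :: "nat \<Rightarrow> 'a::real_normed_vector set \<Rightarrow> ('a \<Rightarrow> 'b::real_normed_vector) \<Rightarrow> bool" where
  "Ck_on 0 U f \<longleftrightarrow> continuous_on U f"
| "Ck_on (Suc k) U f \<longleftrightarrow>
     (\<forall>x\<in>U. f differentiable (at x)) \<and> (\<forall>v. Ck_on k U (\<lambda>x. frechet_derivative f (at x) v))"

text \<open>Smoothness on an arbitrary subset of a Euclidean space (a hypersurface with boundary, a
  product of one with a closed interval, ...): locally the restriction of a \<open>C\<^sup>\<infinity>\<close> map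
  defined on an open set.\<close>

definition smooth_on :: "'a::real_normed_vector set \<Rightarrow> ('a \<Rightarrow> 'b::real_normed_vector) \<Rightarrow> bool" where
  "smooth_on A f \<longleftrightarrow>
     (\<forall>x\<in>A. \<exists>U g. open U \<and> x \<in> U \<and> (\<forall>k. Ck_on k U g) \<and> (\<forall>y\<in>A \<inter> U. g y = f y))"

definition grad_within :: "'a set \<Rightarrow> ('a::euclidean_space \<Rightarrow> real) \<Rightarrow> 'a \<Rightarrow> 'a" where
  "grad_within S f x = (\<Sum>b\<in>Basis. frechet_derivative f (at x within S) b *\<^sub>R b)"

abbreviation grad :: "('a::euclidean_space \<Rightarrow> real) \<Rightarrow> 'a \<Rightarrow> 'a" where
  "grad \<equiv> grad_within UNIV"

definition laplace_within :: "'a set \<Rightarrow> ('a::euclidean_space \<Rightarrow> real) \<Rightarrow> 'a \<Rightarrow> real" where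
  "laplace_within S f x =
     (\<Sum>b\<in>Basis. frechet_derivative (grad_within S f) (at x within S) b \<bullet> b)"


section \<open>Sobolev spaces\<close>

definition test_function :: "'a::euclidean_space set \<Rightarrow> ('a \<Rightarrow> real) \<Rightarrow> bool" where
  "test_function S \<phi> \<longleftrightarrow>
     smooth_on UNIV \<phi> \<and> compact (closure {x. \<phi> x \<noteq> 0}) \<and> closure {x. \<phi> x \<noteq> 0} \<subseteq> S"

definition L2_on :: "'a::euclidean_space set \<Rightarrow> ('a \<Rightarrow> 'b::euclidean_space) \<Rightarrow> bool" where
  "L2_on S u \<longleftrightarrow>
     set_borel_measurable lebesgue S u \<and> set_integrable lebesgue S (\<lambda>x. (norm (u x))\<^sup>2)"

definition L2_norm :: "'a::euclidean_space set \<Rightarrow> ('a \<Rightarrow> 'b::euclidean_space) \<Rightarrow> real" where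
  "L2_norm S u = sqrt (LINT x:S|lebesgue. (norm (u x))\<^sup>2)"

definition has_weak_gradient ::
    "'a::euclidean_space set \<Rightarrow> ('a \<Rightarrow> real) \<Rightarrow> ('a \<Rightarrow> 'a) \<Rightarrow> bool" where
  "has_weak_gradient S u g \<longleftrightarrow>
     (\<forall>K. compact K \<and> K \<subseteq> S \<longrightarrow> set_integrable lebesgue K u \<and> set_integrable lebesgue K g) \<and>
     (\<forall>\<phi> b. test_function S \<phi> \<and> b \<in> Basis \<longrightarrow>
        (LINT x:S|lebesgue. u x * frechet_derivative \<phi> (at x) b)
          = - (LINT x:S|lebesgue. (g x \<bullet> b) * \<phi> x))"

text \<open>Determined up to null sets.\<close>

definition weak_grad :: "'a::euclidean_space set \<Rightarrow> ('a \<Rightarrow> real) \<Rightarrow> 'a \<Rightarrow> 'a" where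
  "weak_grad S u = (SOME g. has_weak_gradient S u g)"

definition H1 :: "'a::euclidean_space set \<Rightarrow> ('a \<Rightarrow> real) set" where
  "H1 S = {u. L2_on S u \<and> (\<exists>g. has_weak_gradient S u g \<and> L2_on S g)}"

definition H2 :: "'a::euclidean_space set \<Rightarrow> ('a \<Rightarrow> real) set" where
  "H2 S = {u \<in> H1 S. \<forall>b\<in>Basis. (\<lambda>x. weak_grad S u x \<bullet> b) \<in> H1 S}"

definition H2_norm :: "'a::euclidean_space set \<Rightarrow> ('a \<Rightarrow> real) \<Rightarrow> real" where
  "H2_norm S u = sqrt ((L2_norm S u)\<^sup>2 + (L2_norm S (weak_grad S u))\<^sup>2
     + (\<Sum>b\<in>Basis. (L2_norm S (weak_grad S (\<lambda>x. weak_grad S u x \<bullet> b)))\<^sup>2))"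

definition half_plane :: "(real \<times> real) set" where
  "half_plane = {p. snd p > 0}"

definition H2w :: "real \<Rightarrow> (real \<times> real \<Rightarrow> real) set" where
  "H2w \<gamma> = {u. (\<lambda>p. exp (\<gamma> * snd p) * u p) \<in> H2 half_plane}"

definition H2w_norm :: "real \<Rightarrow> (real \<times> real \<Rightarrow> real) \<Rightarrow> real" where
  "H2w_norm \<gamma> u = H2_norm half_plane (\<lambda>p. exp (\<gamma> * snd p) * u p)"


section \<open>Hypersurfaces and smooth domains\<close>

text \<open>Embedded hypersurfaces in terms of local defining functions: near an interior point
  \<open>M = {g = 0}\<close>, near a boundary point \<open>M = {g = 0, h \<ge> 0}\<close>, with \<open>\<nabla>g\<close> nonzero and
  \<open>\<nabla>g, \<nabla>h\<close> linearly independent, respectively.\<close>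

definition interior_chart ::
    "'a::euclidean_space set \<Rightarrow> 'a \<Rightarrow> 'a set \<Rightarrow> ('a \<Rightarrow> real) \<Rightarrow> bool" where
  "interior_chart M p U g \<longleftrightarrow>
     open U \<and> p \<in> U \<and> smooth_on U g \<and> (\<forall>x\<in>U. grad g x \<noteq> 0) \<and>
     p \<in> M \<and> M \<inter> U = {x \<in> U. g x = 0}"

definition boundary_chart ::
    "'a::euclidean_space set \<Rightarrow> 'a \<Rightarrow> 'a set \<Rightarrow> ('a \<Rightarrow> real) \<Rightarrow> ('a \<Rightarrow> real) \<Rightarrow> bool" where
  "boundary_chart M p U g h \<longleftrightarrow>
     open U \<and> p \<in> U \<and> smooth_on U g \<and> smooth_on U h \<and>
     (\<forall>x\<in>U. \<forall>\<alpha> \<beta>. \<alpha> *\<^sub>R grad g x + \<beta> *\<^sub>R grad h x = 0 \<longrightarrow> \<alpha> = 0 \<and> \<beta> = 0) \<and>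
     p \<in> M \<and> h p = 0 \<and> M \<inter> U = {x \<in> U. g x = 0 \<and> h x \<ge> 0}"

definition surf_interior :: "'a::euclidean_space set \<Rightarrow> 'a set" where
  "surf_interior M = {p. \<exists>U g. interior_chart M p U g}"

definition surf_boundary :: "'a::euclidean_space set \<Rightarrow> 'a set" where
  "surf_boundary M = {p. \<exists>U g h. boundary_chart M p U g h}"

definition hypersurface :: "'a::euclidean_space set \<Rightarrow> bool" where
  "hypersurface M \<longleftrightarrow> M = surf_interior M \<union> surf_boundary M"

text \<open>At boundary points this is the full \<open>(N - 1)\<close>-dimensional tangent space.\<close>

definition tangent_space :: "'a::euclidean_space set \<Rightarrow> 'a \<Rightarrow> 'a set" where
  "tangent_space M p =
     {v. \<exists>U g. (interior_chart M p U g \<or> (\<exists>h. boundary_chart M p U g h)) \<and> grad g p \<bullet> v = 0}"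

definition orientable :: "'a::euclidean_space set \<Rightarrow> bool" where
  "orientable M \<longleftrightarrow>
     (\<exists>\<nu>. continuous_on M \<nu> \<and>
       (\<forall>p\<in>M. norm (\<nu> p) = 1 \<and> (\<forall>v\<in>tangent_space M p. \<nu> p \<bullet> v = 0)))"

definition outer_conormal :: "'a::euclidean_space set \<Rightarrow> 'a \<Rightarrow> 'a" where
  "outer_conormal M \<sigma> = (THE m. m \<in> tangent_space M \<sigma> \<and> norm m = 1 \<and>
     (\<exists>U g h. boundary_chart M \<sigma> U g h \<and>
        (\<forall>v. grad g \<sigma> \<bullet> v = 0 \<and> grad h \<sigma> \<bullet> v = 0 \<longrightarrow> m \<bullet> v = 0) \<and> grad h \<sigma> \<bullet> m < 0))"

text \<open>The derivative along a hypersurface \<open>M\<close> is the Frechet derivative within \<open>M\<close>. That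
  derivative is determined only on vectors tangent to \<open>M\<close>, and it is applied only to such
  vectors below.\<close>

definition immersion_on :: "'a::euclidean_space set \<Rightarrow> ('a \<Rightarrow> 'a) \<Rightarrow> bool" where
  "immersion_on M F \<longleftrightarrow>
     (\<forall>p\<in>M. \<forall>v\<in>tangent_space M p. frechet_derivative F (at p within M) v = 0 \<longrightarrow> v = 0)"

text \<open>Sum of the principal curvatures, with respect to the unit normal field \<open>\<nu>\<close>, of the
  hypersurface \<open>F ` M\<close> at \<open>F s\<close>, where \<open>F\<close> is an immersion of \<open>M\<close> and \<open>\<nu>\<close> is given as a
  function on \<open>M\<close>. The principal curvatures are the eigenvalues of the Weingarten map
  \<open>dF v \<mapsto> - d\<nu> v\<close>, so the unit sphere with its inner normal has curvature \<open>N - 1\<close>.\<close>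

definition mean_curvature ::
    "'a::euclidean_space set \<Rightarrow> ('a \<Rightarrow> 'a) \<Rightarrow> ('a \<Rightarrow> 'a) \<Rightarrow> 'a \<Rightarrow> real" where
  "mean_curvature M F \<nu> s = (THE H. \<exists>E \<kappa>.
     pairwise orthogonal E \<and> (\<forall>e\<in>E. norm e = 1) \<and>
     span E = frechet_derivative F (at s within M) ` tangent_space M s \<and>
     (\<forall>e\<in>E. \<exists>v\<in>tangent_space M s. frechet_derivative F (at s within M) v = e \<and>
        - frechet_derivative \<nu> (at s within M) v = \<kappa> e *\<^sub>R e) \<and>
     H = (\<Sum>e\<in>E. \<kappa> e))"

definition domain_chart ::
    "'a::euclidean_space set \<Rightarrow> 'a \<Rightarrow> 'a set \<Rightarrow> ('a \<Rightarrow> real) \<Rightarrow> bool" where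
  "domain_chart D p U g \<longleftrightarrow>
     open U \<and> p \<in> U \<and> smooth_on U g \<and> (\<forall>x\<in>U. grad g x \<noteq> 0) \<and>
     D \<inter> U = {x \<in> U. g x < 0} \<and> g p = 0"

definition smooth_bounded_domain :: "'a::euclidean_space set \<Rightarrow> bool" where
  "smooth_bounded_domain D \<longleftrightarrow>
     open D \<and> connected D \<and> D \<noteq> {} \<and> bounded D \<and> (\<forall>p\<in>frontier D. \<exists>U g. domain_chart D p U g)"

definition outer_normal :: "'a::euclidean_space set \<Rightarrow> 'a \<Rightarrow> 'a" where
  "outer_normal D p = (THE \<nu>. \<exists>U g. domain_chart D p U g \<and> \<nu> = grad g p /\<^sub>R norm (grad g p))"

text \<open>Weak surface gradient \<open>\<nabla>\<^sub>\<Sigma>\<phi>\<close> (with respect to \<open>s\<close>) of a function \<open>\<phi>(r, s)\<close> on the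
  \<open>N\<close>-dimensional manifold \<open>I \<times> M\<close>: in every local parametrization \<open>F\<close> of \<open>I \<times> M\<close> by an
  open subset of the \<open>N\<close>-dimensional space \<open>'a\<close>, \<open>\<phi> \<circ> F\<close> has a weak gradient, and
  \<open>\<nabla>\<^sub>\<Sigma>\<phi>\<close> represents the weak differential of \<open>\<phi>\<close> on the tangent vectors \<open>(0, v)\<close>, \<open>v\<close> tangent
  to \<open>M\<close>.\<close>

definition product_chart ::
    "real set \<Rightarrow> 'a::euclidean_space set \<Rightarrow> 'a set \<Rightarrow> ('a \<Rightarrow> real \<times> 'a) \<Rightarrow> bool" where
  "product_chart I M W F \<longleftrightarrow>
     open W \<and> smooth_on W F \<and> F ` W \<subseteq> I \<times> surf_interior M \<and>
     (\<forall>w\<in>W. inj (frechet_derivative F (at w)))"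

definition has_weak_surface_gradient ::
    "real set \<Rightarrow> 'a::euclidean_space set \<Rightarrow> (real \<times> 'a \<Rightarrow> real) \<Rightarrow> (real \<times> 'a \<Rightarrow> 'a) \<Rightarrow> bool" where
  "has_weak_surface_gradient I M \<phi> w \<longleftrightarrow>
     (\<forall>r\<in>I. \<forall>s\<in>M. w (r, s) \<in> tangent_space M s) \<and>
     (\<forall>W F. product_chart I M W F \<longrightarrow>
       (\<exists>g. has_weak_gradient W (\<phi> \<circ> F) g \<and>
         (AE y in lebesgue. y \<in> W \<longrightarrow>
           (\<forall>k. fst (frechet_derivative F (at y) k) = 0 \<longrightarrow>
                w (F y) \<bullet> snd (frechet_derivative F (at y) k) = g y \<bullet> k))))"

definition weak_surface_grad ::
    "real set \<Rightarrow> 'a::euclidean_space set \<Rightarrow> (real \<times> 'a \<Rightarrow> real) \<Rightarrow> real \<times> 'a \<Rightarrow> 'a" where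
  "weak_surface_grad I M \<phi> = (SOME w. has_weak_surface_gradient I M \<phi> w)"


section \<open>Evolving hypersurfaces with contact angle \<open>\<pi>/2\<close> and curvilinear coordinates\<close>

record 'a interface_geometry =
  gOmega :: "'a set"
  gT :: real
  gSigma :: "'a set"
  gSigma_ext :: "'a set"
  gX0 :: "'a \<times> real \<Rightarrow> 'a"
  gnormal :: "'a \<times> real \<Rightarrow> 'a"
  gY :: "'a \<times> real \<Rightarrow> 'a"
  gmu1 :: real
  gmu0 :: real
  gdelta :: real
  gX :: "real \<times> 'a \<times> real \<Rightarrow> 'a"
  gQm :: "('a \<times> real) set"
  gQp :: "('a \<times> real) set"

text \<open>\<open>gSigma_ext\<close> is the compact hypersurface extending \<open>\<Sigma>\<close> beyond its boundary.
  All functions in this record are total, but only their values on the domains occurring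
  in the context of the problem matter: \<open>\<Sigma> \<times> [0,T]\<close> for \<open>gX0\<close> and \<open>gnormal\<close>,
  \<open>\<partial>\<Sigma> \<times> [0,2\<mu>\<^sub>1]\<close> for \<open>gY\<close>, and the following set for \<open>gX\<close>.\<close>

definition coord_dom :: "'a::euclidean_space interface_geometry \<Rightarrow> (real \<times> 'a \<times> real) set" where
  "coord_dom G = {- 2 * gdelta G .. 2 * gdelta G} \<times> gSigma G \<times> {0..gT G}"

definition Xbar :: "'a::euclidean_space interface_geometry \<Rightarrow> real \<times> 'a \<times> real \<Rightarrow> 'a \<times> real" where
  "Xbar G p = (gX G p, snd (snd p))"

definition time_slice :: "('a \<times> real) set \<Rightarrow> real \<Rightarrow> 'a set" where
  "time_slice S t = {x. (x, t) \<in> S}"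

definition interface :: "'a::euclidean_space interface_geometry \<Rightarrow> ('a \<times> real) set" where
  "interface G = {(gX0 G (s, t), t) |s t. s \<in> gSigma G \<and> t \<in> {0..gT G}}"

definition tube :: "'a::euclidean_space interface_geometry \<Rightarrow> real \<Rightarrow> ('a \<times> real) set" where
  "tube G \<eta> = Xbar G ` ({- \<eta> <..< \<eta>} \<times> gSigma G \<times> {0..gT G})"

definition corner_tube ::
    "'a::euclidean_space interface_geometry \<Rightarrow> real \<Rightarrow> real \<Rightarrow> ('a \<times> real) set" where
  "corner_tube G \<eta> \<mu> =
     Xbar G ` ({- \<eta> <..< \<eta>} \<times> gY G ` (surf_boundary (gSigma G) \<times> {0<..<\<mu>}) \<times> {0..gT G})"

definition inner_tube ::
    "'a::euclidean_space interface_geometry \<Rightarrow> real \<Rightarrow> real \<Rightarrow> ('a \<times> real) set" where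
  "inner_tube G \<eta> \<mu> = tube G \<eta> - closure (corner_tube G \<eta> \<mu>)"

definition r_coord :: "'a::euclidean_space interface_geometry \<Rightarrow> 'a \<times> real \<Rightarrow> real" where
  "r_coord G p = fst (inv_into (coord_dom G) (Xbar G) p)"

definition s_coord :: "'a::euclidean_space interface_geometry \<Rightarrow> 'a \<times> real \<Rightarrow> 'a" where
  "s_coord G p = fst (snd (inv_into (coord_dom G) (Xbar G) p))"

definition Y_inv :: "'a::euclidean_space interface_geometry \<Rightarrow> 'a \<Rightarrow> 'a \<times> real" where
  "Y_inv G = inv_into (surf_boundary (gSigma G) \<times> {0..2 * gmu1 G}) (gY G)"

definition sigma_coord :: "'a::euclidean_space interface_geometry \<Rightarrow> 'a \<times> real \<Rightarrow> 'a" where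
  "sigma_coord G p = fst (Y_inv G (s_coord G p))"

definition b_coord :: "'a::euclidean_space interface_geometry \<Rightarrow> 'a \<times> real \<Rightarrow> real" where
  "b_coord G p = snd (Y_inv G (s_coord G p))"

text \<open>The coordinates are defined on \<open>\<Gamma>(2\<delta>)\<close>, which is relatively open in
  \<open>closure \<Omega> \<times> [0,T]\<close> and meets \<open>\<partial>\<Omega>\<close>. Hence spatial derivatives are taken within \<open>closure \<Omega>\<close>
  and time derivatives within \<open>[0,T]\<close>.\<close>

definition grad_r :: "'a::euclidean_space interface_geometry \<Rightarrow> 'a \<times> real \<Rightarrow> 'a" where
  "grad_r G p = grad_within (closure (gOmega G)) (\<lambda>y. r_coord G (y, snd p)) (fst p)"

definition laplace_r :: "'a::euclidean_space interface_geometry \<Rightarrow> 'a \<times> real \<Rightarrow> real" where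
  "laplace_r G p = laplace_within (closure (gOmega G)) (\<lambda>y. r_coord G (y, snd p)) (fst p)"

definition dt_r :: "'a::euclidean_space interface_geometry \<Rightarrow> 'a \<times> real \<Rightarrow> real" where
  "dt_r G p = vector_derivative (\<lambda>t. r_coord G (fst p, t)) (at (snd p) within {0..gT G})"

definition Dx_s :: "'a::euclidean_space interface_geometry \<Rightarrow> 'a \<times> real \<Rightarrow> 'a \<Rightarrow> 'a" where
  "Dx_s G p = frechet_derivative (\<lambda>y. s_coord G (y, snd p)) (at (fst p) within closure (gOmega G))"

definition grad_b :: "'a::euclidean_space interface_geometry \<Rightarrow> 'a \<times> real \<Rightarrow> 'a" where
  "grad_b G p = grad_within (closure (gOmega G)) (\<lambda>y. b_coord G (y, snd p)) (fst p)"

definition evolving_hypersurface :: "'a::euclidean_space interface_geometry \<Rightarrow> bool" where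
  "evolving_hypersurface G \<longleftrightarrow>
   (let \<Omega> = gOmega G; T = gT G; S = gSigma G; S' = gSigma_ext G;
        X0 = gX0 G; n = gnormal G in
     smooth_bounded_domain \<Omega> \<and> 0 < T \<and>
     hypersurface S \<and> orientable S \<and> compact S \<and> connected S \<and> S \<noteq> {} \<and>
     smooth_on (S \<times> {0..T}) X0 \<and> X0 ` (S \<times> {0..T}) \<subseteq> closure \<Omega> \<and>
     (\<forall>t\<in>{0..T}. inj_on (\<lambda>s. X0 (s, t)) S \<and> immersion_on S (\<lambda>s. X0 (s, t))) \<and>
     hypersurface S' \<and> orientable S' \<and> connected S' \<and> compact S' \<and> S \<subset> surf_interior S' \<and>
     (\<exists>S0 \<tau>0 X0'.
        hypersurface S0 \<and> orientable S0 \<and> connected S0 \<and> surf_boundary S0 = {} \<and> S' \<subset> S0 \<and>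
        0 < \<tau>0 \<and> smooth_on (S0 \<times> {- \<tau>0 <..< T + \<tau>0}) X0' \<and>
        (\<forall>p\<in>S \<times> {0..T}. X0' p = X0 p) \<and>
        (\<forall>t\<in>{- \<tau>0 <..< T + \<tau>0}.
           inj_on (\<lambda>s. X0' (s, t)) S0 \<and> immersion_on S0 (\<lambda>s. X0' (s, t)))) \<and>
     (\<forall>t\<in>{0..T}. (\<forall>s\<in>surf_interior S. X0 (s, t) \<in> \<Omega>) \<and>
                 (\<forall>\<sigma>\<in>surf_boundary S. X0 (\<sigma>, t) \<in> frontier \<Omega>)) \<and>
     smooth_on (S \<times> {0..T}) n \<and>
     (\<forall>s\<in>S. \<forall>t\<in>{0..T}. norm (n (s, t)) = 1 \<and>
        (\<forall>v\<in>tangent_space S s.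
           n (s, t) \<bullet> frechet_derivative (\<lambda>s'. X0 (s', t)) (at s within S) v = 0)) \<and>
     (\<forall>\<sigma>\<in>surf_boundary S. \<forall>t\<in>{0..T}. outer_normal \<Omega> (X0 (\<sigma>, t)) \<bullet> n (\<sigma>, t) = 0))"

text \<open>The curves \<open>b \<mapsto> Y (\<sigma>, b)\<close> are the geodesics of \<open>\<Sigma>\<close> (acceleration normal to \<open>\<Sigma>\<close>) issuing
  from \<open>\<partial>\<Sigma>\<close> in the direction of the inner conormal.\<close>

definition tubular_coordinates :: "'a::euclidean_space interface_geometry \<Rightarrow> bool" where
  "tubular_coordinates G \<longleftrightarrow>
   (let S = gSigma G; B = surf_boundary S; Y = gY G; J = {0..2 * gmu1 G};
        dY = (\<lambda>\<sigma> b. vector_derivative (\<lambda>b'. Y (\<sigma>, b')) (at b within J)) in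
     0 < gmu1 G \<and>
     Y ` (B \<times> J) \<subseteq> S \<and> smooth_on (B \<times> J) Y \<and>
     (\<exists>Yi. homeomorphism (B \<times> J) (Y ` (B \<times> J)) Y Yi \<and> smooth_on (Y ` (B \<times> J)) Yi) \<and>
     (\<forall>\<mu>\<in>{0<..2 * gmu1 G}. openin (top_of_set S) (Y ` (B \<times> {0..<\<mu>}))) \<and>
     (\<forall>\<sigma>\<in>B. Y (\<sigma>, 0) = \<sigma> \<and> dY \<sigma> 0 = - outer_conormal S \<sigma> \<and>
        (\<forall>b\<in>J. \<forall>v\<in>tangent_space S (Y (\<sigma>, b)).
           vector_derivative (dY \<sigma>) (at b within J) \<bullet> v = 0)))"

definition curvilinear_coordinates :: "'a::euclidean_space interface_geometry \<Rightarrow> bool" where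
  "curvilinear_coordinates G \<longleftrightarrow>
   (let \<Omega> = gOmega G; T = gT G; S = gSigma G; B = surf_boundary S; X0 = gX0 G; n = gnormal G;
        X = gX G; \<delta> = gdelta G;
        QT = closure \<Omega> \<times> {0..T};
        far = S - gY G ` (B \<times> {0..gmu0 G}) in
     0 < \<delta> \<and> 0 < gmu0 G \<and> gmu0 G \<le> gmu1 G \<and>
     smooth_on (coord_dom G) X \<and> X ` coord_dom G \<subseteq> closure \<Omega> \<and>
     (\<exists>Xi. homeomorphism (coord_dom G) (Xbar G ` coord_dom G) (Xbar G) Xi) \<and>
     (\<exists>W Z Zi. openin (top_of_set (UNIV \<times> gSigma_ext G \<times> UNIV)) W \<and> coord_dom G \<subseteq> W \<and>
        (\<forall>p\<in>coord_dom G. Z p = Xbar G p) \<and> open (Z ` W) \<and>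
        homeomorphism W (Z ` W) Z Zi \<and> smooth_on W Z \<and> smooth_on (Z ` W) Zi) \<and>
     (\<exists>O'. openin (top_of_set QT) O' \<and> interface G \<subseteq> O' \<and> O' \<subseteq> Xbar G ` coord_dom G) \<and>
     (\<forall>\<eta>\<in>{0<..2 * \<delta>}. openin (top_of_set QT) (tube G \<eta>) \<and> interface G \<subseteq> tube G \<eta>) \<and>
     (\<forall>s\<in>S. \<forall>t\<in>{0..T}. X (0, s, t) = X0 (s, t)) \<and>
     (\<forall>r\<in>{- 2 * \<delta>..2 * \<delta>}. \<forall>s\<in>far. \<forall>t\<in>{0..T}. X (r, s, t) = X0 (s, t) + r *\<^sub>R n (s, t)) \<and>
     (\<forall>(r, s, t)\<in>coord_dom G. X (r, s, t) \<in> frontier \<Omega> \<longleftrightarrow> s \<in> B) \<and>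
     (\<forall>p\<in>tube G (2 * \<delta>). span (Dx_s G p ` Basis) = tangent_space S (s_coord G p)) \<and>
     (\<exists>c>0. \<forall>p\<in>tube G (2 * \<delta>). norm (grad_r G p) \<ge> c) \<and>
     (\<exists>c>0. \<forall>p\<in>tube G (2 * \<delta>). \<forall>v\<in>tangent_space S (s_coord G p).
        Dx_s G p (adjoint (Dx_s G p) v) \<bullet> v \<ge> c * (norm v)\<^sup>2) \<and>
     (\<forall>s\<in>S. \<forall>t\<in>{0..T}.
        (norm (grad_r G (X0 (s, t), t)))\<^sup>2 = 1 \<and>
        ((\<lambda>r. (norm (grad_r G (Xbar G (r, s, t))))\<^sup>2) has_real_derivative 0) (at 0) \<and>
        Dx_s G (X0 (s, t), t) (grad_r G (X0 (s, t), t)) = 0 \<and>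
        grad_r G (X0 (s, t), t) = n (s, t) \<and>
        n (s, t) \<bullet> vector_derivative (\<lambda>t'. X0 (s, t')) (at t within {0..T})
          = - dt_r G (X0 (s, t), t) \<and>
        mean_curvature S (\<lambda>s'. X0 (s', t)) (\<lambda>s'. n (s', t)) s = - laplace_r G (X0 (s, t), t)) \<and>
     (\<forall>r\<in>{- 2 * \<delta><..<2 * \<delta>}. \<forall>s\<in>far. \<forall>t\<in>{0..T}.
        grad_r G (Xbar G (r, s, t)) = n (s, t) \<and> Dx_s G (Xbar G (r, s, t)) (n (s, t)) = 0) \<and>
     (\<exists>c>0. \<forall>\<sigma>\<in>B. \<forall>t\<in>{0..T}.
        let p = (X0 (\<sigma>, t), t); N = outer_normal \<Omega> (X0 (\<sigma>, t)) in
          N \<bullet> grad_b G p = - (Dx_s G p N \<bullet> outer_conormal S \<sigma>) \<and>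
          \<bar>N \<bullet> grad_b G p\<bar> \<ge> c \<and> grad_b G p \<bullet> grad_r G p = 0 \<and> norm (grad_b G p) \<ge> c))"

definition bulk_partition ::
    "'a::euclidean_space interface_geometry \<Rightarrow> ('a \<times> real) set \<Rightarrow> ('a \<times> real) set \<Rightarrow> bool" where
  "bulk_partition G Qm Qp \<longleftrightarrow>
     connected Qm \<and> connected Qp \<and>
     closure (gOmega G \<times> {0<..<gT G}) = Qm \<union> Qp \<union> interface G \<and>
     Qm \<inter> Qp = {} \<and> Qm \<inter> interface G = {} \<and> Qp \<inter> interface G = {} \<and>
     (\<forall>p\<in>Qm \<inter> tube G (gdelta G). sgn (r_coord G p) = -1) \<and>
     (\<forall>p\<in>Qp \<inter> tube G (gdelta G). sgn (r_coord G p) = 1)"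

text \<open>Uniqueness is essential: it forces the interface to separate the space-time cylinder, so
  that the two sets are the components of its complement.\<close>

definition bulk_regions :: "'a::euclidean_space interface_geometry \<Rightarrow> bool" where
  "bulk_regions G \<longleftrightarrow> bulk_partition G (gQm G) (gQp G) \<and>
     (\<forall>Qm Qp. bulk_partition G Qm Qp \<longrightarrow> Qm = gQm G \<and> Qp = gQp G)"

definition contact_angle_geometry :: "'a::euclidean_space interface_geometry \<Rightarrow> bool" where
  "contact_angle_geometry G \<longleftrightarrow>
     evolving_hypersurface G \<and> tubular_coordinates G \<and> curvilinear_coordinates G \<and> bulk_regions G"

definition tangential_grad ::
    "'a::euclidean_space interface_geometry \<Rightarrow> real \<Rightarrow> ('a \<Rightarrow> real) \<Rightarrow> 'a \<Rightarrow> 'a" where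
  "tangential_grad G t \<psi> x =
     adjoint (Dx_s G (x, t))
       (weak_surface_grad {- gdelta G <..< gdelta G} (gSigma G) (\<lambda>(r, s). \<psi> (gX G (r, s, t)))
          (r_coord G (x, t), s_coord G (x, t)))"


section \<open>Potential, optimal profile and approximate solutions\<close>

definition double_well :: "(real \<Rightarrow> real) \<Rightarrow> bool" where
  "double_well f \<longleftrightarrow>
     smooth_on UNIV f \<and> deriv f 1 = 0 \<and> deriv f (-1) = 0 \<and>
     deriv (deriv f) 1 > 0 \<and> deriv (deriv f) (-1) > 0 \<and>
     f (-1) = f 1 \<and> (\<forall>x\<in>{-1<..<1}. f x > f 1)"

definition optimal_profile :: "(real \<Rightarrow> real) \<Rightarrow> (real \<Rightarrow> real) \<Rightarrow> bool" where
  "optimal_profile f \<theta> \<longleftrightarrow>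
     Ck_on 2 UNIV \<theta> \<and> (\<forall>z. - deriv (deriv \<theta>) z + deriv f (\<theta> z) = 0) \<and> \<theta> 0 = 0 \<and>
     (\<theta> \<longlongrightarrow> 1) at_top \<and> (\<theta> \<longlongrightarrow> -1) at_bot"

text \<open>\<open>C\<^sup>2\<close> norm on \<open>A\<close> at most \<open>C\<close>, where \<open>C\<^sup>2(A)\<close> consists of the restrictions to \<open>A\<close> of \<open>C\<^sup>2\<close>
  functions on neighbourhoods of \<open>A\<close>, normed by the infimum over all such extensions. On a compact
  hypersurface with boundary this norm is equivalent to the intrinsic one.\<close>

definition C2_bounded :: "'a::euclidean_space set \<Rightarrow> ('a \<Rightarrow> real) \<Rightarrow> real \<Rightarrow> bool" where
  "C2_bounded A h C \<longleftrightarrow>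
     (\<exists>U g. open U \<and> A \<subseteq> U \<and> Ck_on 2 U g \<and> (\<forall>x\<in>A. g x = h x \<and> \<bar>g x\<bar> \<le> C \<and>
        (\<forall>v w. norm v = 1 \<and> norm w = 1 \<longrightarrow>
           \<bar>frechet_derivative g (at x) v\<bar> \<le> C \<and>
           \<bar>frechet_derivative (\<lambda>y. frechet_derivative g (at y) v) (at x) w\<bar> \<le> C)))"

definition height_function ::
    "'a::euclidean_space interface_geometry \<Rightarrow> real \<Rightarrow> ('a \<Rightarrow> real \<Rightarrow> real) \<Rightarrow> bool" where
  "height_function G C h \<longleftrightarrow>
     (\<forall>t\<in>{0..gT G}.
        continuous_on (gSigma G) (\<lambda>s. h s t) \<and> (\<forall>s\<in>gSigma G. \<bar>h s t\<bar> \<le> C) \<and>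
        C2_bounded (gY G ` (surf_boundary (gSigma G) \<times> {0..2 * gmu0 G})) (\<lambda>s. h s t) C)"

text \<open>Maps \<open>F\<close> from an open set into a space \<open>Z\<close> of functions with norm \<open>nrm\<close>, with first and
  second partial derivatives \<open>D1\<close>, \<open>D2\<close> (the limits being taken in the norm), the latter continuous.\<close>

definition has_partial_in ::
    "('p \<Rightarrow> real) set \<Rightarrow> (('p \<Rightarrow> real) \<Rightarrow> real) \<Rightarrow>
     ('a::euclidean_space \<Rightarrow> 'p \<Rightarrow> real) \<Rightarrow> 'a \<Rightarrow> 'a \<Rightarrow> ('p \<Rightarrow> real) \<Rightarrow> bool" where
  "has_partial_in Z nrm F x b D \<longleftrightarrow>
     D \<in> Z \<and> ((\<lambda>k. nrm (\<lambda>p. (F (x + k *\<^sub>R b) p - F x p) / k - D p)) \<longlongrightarrow> 0) (at 0)"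

definition C2_into ::
    "('p \<Rightarrow> real) set \<Rightarrow> (('p \<Rightarrow> real) \<Rightarrow> real) \<Rightarrow> 'a::euclidean_space set \<Rightarrow>
     ('a \<Rightarrow> 'p \<Rightarrow> real) \<Rightarrow> ('a \<Rightarrow> 'a \<Rightarrow> 'p \<Rightarrow> real) \<Rightarrow> ('a \<Rightarrow> 'a \<Rightarrow> 'a \<Rightarrow> 'p \<Rightarrow> real) \<Rightarrow> bool" where
  "C2_into Z nrm U F D1 D2 \<longleftrightarrow>
     (\<forall>x\<in>U. F x \<in> Z \<and>
       (\<forall>b\<in>Basis. has_partial_in Z nrm F x b (D1 b x) \<and>
         (\<forall>c\<in>Basis. has_partial_in Z nrm (D1 b) x c (D2 b c x) \<and>
           ((\<lambda>y. nrm (\<lambda>p. D2 b c y p - D2 b c x p)) \<longlongrightarrow> 0) (at x))))"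

text \<open>\<open>B([0,T]; C\<^sup>2(\<partial>\<Sigma>, H\<^sup>2\<^sub>\<gamma>))\<close>, again via extensions of \<open>C\<^sup>2\<close> maps from \<open>\<partial>\<Sigma>\<close> to neighbourhoods of
  it. As elements of \<open>H\<^sup>2\<close> of the half-plane have a continuous representative and \<open>u\<close> is
  evaluated pointwise, \<open>u\<close> is required to be that representative.\<close>

definition corner_profile ::
    "'a::euclidean_space interface_geometry \<Rightarrow> real \<Rightarrow> (real \<times> real \<Rightarrow> 'a \<Rightarrow> real \<Rightarrow> real) \<Rightarrow> bool" where
  "corner_profile G \<gamma> u \<longleftrightarrow>
   (let B = surf_boundary (gSigma G); nrm = H2w_norm \<gamma> in
     (\<forall>\<sigma>\<in>B. \<forall>t\<in>{0..gT G}. continuous_on half_plane (\<lambda>p. u p \<sigma> t)) \<and>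
     (\<exists>C. \<forall>t\<in>{0..gT G}. \<exists>U F D1 D2.
        open U \<and> B \<subseteq> U \<and> C2_into (H2w \<gamma>) nrm U F D1 D2 \<and>
        (\<forall>\<sigma>\<in>B. F \<sigma> = (\<lambda>p. u p \<sigma> t) \<and> nrm (F \<sigma>) \<le> C \<and>
           (\<forall>b\<in>Basis. nrm (D1 b \<sigma>) \<le> C \<and> (\<forall>c\<in>Basis. nrm (D2 b c \<sigma>) \<le> C)))))"

definition rho_coord ::
    "'a::euclidean_space interface_geometry \<Rightarrow> ('a \<Rightarrow> real \<Rightarrow> real) \<Rightarrow> (real \<Rightarrow> 'a \<Rightarrow> real \<Rightarrow> real) \<Rightarrow>
     real \<Rightarrow> 'a \<times> real \<Rightarrow> real" where
  "rho_coord G h1 h2 \<epsilon> p =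
     (r_coord G p - \<epsilon> * (h1 (s_coord G p) (snd p) + \<epsilon> * h2 \<epsilon> (s_coord G p) (snd p))) / \<epsilon>"

definition corner_term ::
    "'a::euclidean_space interface_geometry \<Rightarrow> (real \<times> real \<Rightarrow> 'a \<Rightarrow> real \<Rightarrow> real) \<Rightarrow>
     ('a \<Rightarrow> real \<Rightarrow> real) \<Rightarrow> (real \<Rightarrow> 'a \<Rightarrow> real \<Rightarrow> real) \<Rightarrow> real \<Rightarrow> 'a \<times> real \<Rightarrow> real" where
  "corner_term G u h1 h2 \<epsilon> p =
     u (rho_coord G h1 h2 \<epsilon> p, b_coord G p / \<epsilon>) (sigma_coord G p) (snd p)"

definition remainder_on :: "('a::euclidean_space \<times> real) set \<Rightarrow> real \<Rightarrow> ('a \<times> real \<Rightarrow> real) \<Rightarrow> real \<Rightarrow> bool" where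
  "remainder_on S t R M \<longleftrightarrow>
     set_borel_measurable lebesgue (time_slice S t) (\<lambda>x. R (x, t)) \<and>
     (\<forall>x\<in>time_slice S t. \<bar>R (x, t)\<bar> \<le> M)"

text \<open>\<open>K\<close> is the constant in all the Landau symbols, and \<open>\<epsilon>1\<close> makes ``for small \<open>\<epsilon>\<close>'' precise.\<close>

definition approximate_solution ::
    "'a::euclidean_space interface_geometry \<Rightarrow> (real \<Rightarrow> real) \<Rightarrow> (real \<times> real \<Rightarrow> 'a \<Rightarrow> real \<Rightarrow> real) \<Rightarrow>
     ('a \<Rightarrow> real \<Rightarrow> real) \<Rightarrow> (real \<Rightarrow> 'a \<Rightarrow> real \<Rightarrow> real) \<Rightarrow> real \<Rightarrow> real \<Rightarrow>
     (real \<Rightarrow> 'a \<times> real \<Rightarrow> real) \<Rightarrow> bool" where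
  "approximate_solution G \<theta> u h1 h2 K \<epsilon>1 uA \<longleftrightarrow>
     (\<forall>\<epsilon>\<in>{0<..\<epsilon>1}. \<forall>t\<in>{0..gT G}.
        remainder_on (inner_tube G (gdelta G) (gmu0 G)) t
          (\<lambda>p. uA \<epsilon> p - \<theta> (rho_coord G h1 h2 \<epsilon> p)) (K * \<epsilon>\<^sup>2) \<and>
        remainder_on (corner_tube G (gdelta G) (2 * gmu0 G)) t
          (\<lambda>p. uA \<epsilon> p - (\<theta> (rho_coord G h1 h2 \<epsilon> p) + \<epsilon> * corner_term G u h1 h2 \<epsilon> p)) (K * \<epsilon>\<^sup>2) \<and>
        remainder_on (gQp G - tube G (gdelta G)) t (\<lambda>p. uA \<epsilon> p - 1) (K * \<epsilon>) \<and>
        remainder_on (gQm G - tube G (gdelta G)) t (\<lambda>p. uA \<epsilon> p + 1) (K * \<epsilon>))"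

end

theory Submission
  imports Defs
begin

text \<open>
  No spectral theory is used. Fix \<open>t\<close> and split \<open>\<nabla>\<psi>\<close> into \<open>p = \<partial>\<^sub>n\<psi>\<close> and \<open>\<tau> = \<nabla>\<^sub>\<tau>\<psi>\<close>; then
  \<open>|\<nabla>\<psi>|\<^sup>2 \<ge> (1 - C r\<^sup>2) p\<^sup>2 + |\<tau>|\<^sup>2 / 2\<close> near the interface. Integrating the divergence of \<open>\<psi>\<^sup>2 U\<close> for a
  vector field \<open>U = Q \<partial>\<^sub>rX - M W\<close> supported near the interface gives \<open>\<integral> \<psi>\<^sup>2 div U + 2 \<psi> U \<cdot> \<nabla>\<psi> = 0\<close>, and \<open>U\<close>
  is chosen so that adding this makes the integrand pointwise bounded below.
  The function \<open>g = \<theta>\<^sub>0'' / \<theta>\<^sub>0'\<close> solves the Riccati equation \<open>g' + g\<^sup>2 = f''(\<theta>\<^sub>0)\<close>, so \<open>Q = g(\<rho>\<^sub>\<epsilon>) / \<epsilon>\<close>, cut off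
  in \<open>r\<close> and corrected to second order, turns \<open>p\<^sup>2 + \<epsilon>\<^sup>-\<^sup>2 f''(\<theta>\<^sub>0) \<psi>\<^sup>2\<close> into a perfect square up to \<open>O(1) \<psi>\<^sup>2\<close>.
  The corner term contributes \<open>O(\<epsilon>\<^sup>-\<^sup>1 exp(- \<gamma> b / \<epsilon>))\<close> by the Sobolev embedding in the half-plane; it is
  dominated by the divergence of \<open>W = (1 - exp(- k \<beta> / \<epsilon>)) Y\<close>, where \<open>\<beta>\<close> is a regularized distance to
  \<open>\<partial>\<Omega>\<close> and \<open>Y\<close> is the part of \<open>\<nabla>\<beta>\<close> orthogonal to \<open>\<nabla>r\<close>. As \<open>U\<close> is tangential at \<open>\<partial>\<Omega>\<close>, the
  boundary term vanishes, which is seen with cut-offs in \<open>\<beta>\<close> and needs no traces. Height functions that are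
  merely continuous are replaced by polynomials uniformly close to them.
\<close>

text \<open>The weights are dictated by the terms of order 1 / ep. The cut-off in r is a cube y^3
  because Q then has the form y^2 B and the defect in the normal direction is y (y p - B \<psi>)^2:
  the derivative of the cut-off is absorbed into B, and the divergence of \<partial>_r X is removed
  by subtracting half of it from g / ep. Since s is constant along \<partial>_r X, no derivative of
  a height function enters a constant; this is why the uncontrolled gradients of the approximating
  polynomials do no harm. Two further obstacles lie in the definitions. \<open>weak_grad\<close> and
  \<open>weak_surface_grad\<close> are arbitrary choices, so uniqueness up to null sets and, for the
  surface gradient, existence in all product charts have to be shown; the latter rests on a chain
  rule for weak gradients under C^1 local diffeomorphisms. The approximate solution is described
  piece by piece, so its measurability has to be assembled, and there the uniqueness of the bulk
  regions serves to show that they are relatively open off the interface.\<close>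

abbreviation "Df f x \<equiv> frechet_derivative f (at x)"

section \<open>Differentiable functions\<close>

lemma Ck_on_subset: "Ck_on k U f ==> V \<subseteq> U ==> Ck_on k V f"
 by (induction k arbitrary: f) (auto intro: continuous_on_subset)

lemma Ck_on_cong:
 assumes "open U" "!!x. x : U ==> f x = g x"
 shows "Ck_on k U f \<longleftrightarrow> Ck_on k U g"
 using assms(2)
proof (induction k arbitrary: f g)
 case 0
 thus ?case by (simp cong: continuous_on_cong)
next
 case (Suc k)
 have tr: "(f has_derivative D) (at x) \<longleftrightarrow> (g has_derivative D) (at x)" if "x : U" for x D
  using has_derivative_transform_within_open[of _ D x UNIV U] Suc.prems assms(1) that
  by (metis)
 have "f differentiable (at x) \<longleftrightarrow> g differentiable (at x)" if "x : U" for x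
  using tr[OF that] by (auto simp: differentiable_def)
 moreover have "Df f x = Df g x" if "x : U" for x
  using tr[OF that] by (simp add: frechet_derivative_def)
 ultimately show ?case
  using Suc.IH[of "%x. Df f x v" "%x. Df g x v" for v]
  by auto
qed

text \<open>Lets any convenient expression for the derivative be used; its identification with
  \<open>frechet_derivative\<close> happens only here.\<close>

lemma Ck_on_SucI:
 assumes "open U" "!!x. x : U ==> (f has_derivative f' x) (at x)" "!!v. Ck_on k U (%x. f' x v)"
 shows "Ck_on (Suc k) U f"
proof -
 have "Df f x = f' x" if "x : U" for x
  using assms(2)[OF that] frechet_derivative_at by metis
 hence "Ck_on k U (%x. Df f x v)" for v
  using assms(3)[of v] Ck_on_cong[OF assms(1), of "%x. Df f x v" "%x. f' x v" k] by simp
 thus ?thesis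
  using assms(2) by (auto simp: differentiable_def)
qed

lemma Ck_on_DD: "Ck_on (Suc k) U f ==> x : U ==> (f has_derivative Df f x) (at x)"
 by (simp add: frechet_derivative_works)

lemma Ck_on_SucD: "Ck_on (Suc k) U f ==> Ck_on k U (%x. Df f x v)"
 by simp

lemma Ck_on_pred: "Ck_on (Suc k) U f ==> Ck_on k U f"
proof (induction k arbitrary: f)
 case 0
 thus ?case
  by (auto intro!: continuous_at_imp_continuous_on differentiable_imp_continuous_within)
next
 case (Suc k)
 thus ?case by auto
qed

lemma Ck_on_mono: "Ck_on k U f ==> j <= k ==> Ck_on j U f"
proof (induction k)
 case (Suc k)
 thus ?case using Ck_on_pred[OF Suc.prems(1)] by (auto simp: le_Suc_eq simp del: Ck_on.simps)
qed simp

lemma Ck_on_cont: "Ck_on k U f ==> continuous_on U f"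
 using Ck_on_mono[of k U f 0] by simp

lemma Ck_on_const [simp]: "Ck_on k U (%x. c)"
 by (induction k arbitrary: c) auto

lemma Ck_on_bounded_linear:
 assumes "open U" "bounded_linear h" "Ck_on k U f"
 shows "Ck_on k U (%x. h (f x))"
 using assms(3)
proof (induction k arbitrary: f)
 case 0
 thus ?case using bounded_linear.continuous_on[OF assms(2)] by auto
next
 case (Suc k)
 show ?case
  by (rule Ck_on_SucI[OF assms(1), where f'="%x v. h (Df f x v)"])
   (use Suc Ck_on_DD[OF Suc.prems] in \<open>auto intro: bounded_linear.has_derivative[OF assms(2)]\<close>)
qed

lemma Ck_on_add:
 assumes "open U" "Ck_on k U f" "Ck_on k U g"
 shows "Ck_on k U (%x. f x + g x)"
 using assms(2,3)
proof (induction k arbitrary: f g)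
 case 0
 thus ?case by (auto intro: continuous_intros)
next
 case (Suc k)
 show ?case
  by (rule Ck_on_SucI[OF assms(1), where
     f'="%x v. Df f x v + Df g x v"])
   (use Suc Ck_on_DD[OF Suc.prems(1)] Ck_on_DD[OF Suc.prems(2)] in
    \<open>auto intro!: has_derivative_add\<close>)
qed

lemma Ck_on_uminus: "open U ==> Ck_on k U f ==> Ck_on k U (%x. - f x)"
 by (rule Ck_on_bounded_linear[OF _ bounded_linear_minus[OF bounded_linear_ident]])

lemma Ck_on_diff:
 assumes "open U" "Ck_on k U f" "Ck_on k U g"
 shows "Ck_on k U (%x. f x - g x)"
 using Ck_on_add[OF assms(1,2) Ck_on_uminus[OF assms(1,3)]] by simp

lemma Ck_on_sum:
 assumes "open U" "!!i. i : I ==> Ck_on k U (f i)"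
 shows "Ck_on k U (%x. SUM i:I. f i x)"
 using assms(2)
 by (induction I rule: infinite_finite_induct) (auto intro!: Ck_on_add assms(1))

text \<open>One induction serves products, scalings and inner products: the derivative of B (f, g)
  is a sum of two terms of the same shape.\<close>

lemma Ck_on_bilinear:
 assumes "open U" "bounded_bilinear B" "Ck_on k U f" "Ck_on k U g"
 shows "Ck_on k U (%x. B (f x) (g x))"
 using assms(3,4)
proof (induction k arbitrary: f g)
 case 0
 thus ?case using bounded_bilinear.continuous_on[OF assms(2)] by auto
next
 case (Suc k)
 show ?case
 proof (rule Ck_on_SucI[OF assms(1), where
    f'="%x v. B (f x) (Df g x v) + B (Df f x v) (g x)"])
  fix v show "Ck_on k U (%x. B (f x) (Df g x v) + B (Df f x v) (g x))"
   using Suc.prems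
   by (intro Ck_on_add[OF assms(1) Suc.IH[OF Ck_on_pred Ck_on_SucD] Suc.IH[OF Ck_on_SucD Ck_on_pred]])
 qed (use Ck_on_DD[OF Suc.prems(1)] Ck_on_DD[OF Suc.prems(2)] in
   \<open>auto intro!: bounded_bilinear.FDERIV[OF assms(2)]\<close>)
qed

lemmas Ck_on_mult = Ck_on_bilinear[OF _ bounded_bilinear_mult]
lemmas Ck_on_scaleR = Ck_on_bilinear[OF _ bounded_bilinear_scaleR]
lemmas Ck_on_inner = Ck_on_bilinear[OF _ bounded_bilinear_inner]

lemma Ck_on_id [simp]: "Ck_on k U (%x. x)"
 by (cases k) (auto intro: continuous_on_id simp: frechet_derivative_ident)

lemma Ck_on_Pair:
 assumes "open U" "Ck_on k U f" "Ck_on k U g"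
 shows "Ck_on k U (%x. (f x, g x))"
proof -
 have "Ck_on k U (%x. (f x, 0) + (0, g x))"
  by (intro Ck_on_add assms Ck_on_bounded_linear[OF assms(1), where f=f]
    Ck_on_bounded_linear[OF assms(1), where f=g] bounded_linear_Pair bounded_linear_ident
    bounded_linear_zero)
 thus ?thesis by simp
qed

lemmas Ck_on_fst = Ck_on_bounded_linear[OF _ bounded_linear_fst]
lemmas Ck_on_snd = Ck_on_bounded_linear[OF _ bounded_linear_snd]

text \<open>Induction on the order with f arbitrary and g fixed. Expanding Dg(x) v in the basis
  writes the derivative of the composite as a sum of components of Dg times partial derivatives of f
  composed with g, and the induction hypothesis covers the latter.\<close>

lemma Ck_on_compose:
 fixes f :: "'b::euclidean_space => 'c::real_normed_vector"
 assumes "open U" "open V" "Ck_on k V f" "Ck_on k U g" "g ` U \<subseteq> V"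
 shows "Ck_on k U (%x. f (g x))"
 using assms(3,4)
proof (induction k arbitrary: f)
 case 0
 thus ?case
  using assms(5) continuous_on_compose2 by auto
next
 case (Suc k)
 have gV: "g x : V" if "x : U" for x using that assms(5) by auto
 show ?case
 proof (rule Ck_on_SucI[OF assms(1), where
    f'="%x v. Df f (g x) (Df g x v)"])
  fix x assume "x : U"
  thus "((%x. f (g x)) has_derivative
    (%v. Df f (g x) (Df g x v))) (at x)"
   using diff_chain_at[OF Ck_on_DD[OF Suc.prems(2)] Ck_on_DD[OF Suc.prems(1) gV]]
   by (simp add: o_def)
 next
  fix v
  have eq: "Df f (g x) (Df g x v) =
   (SUM b:Basis. (Df g x v \<bullet> b) *\<^sub>R Df f (g x) b)" if "x : U" for x
  proof -
   have "linear (Df f (g x))"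
    using Suc.prems(1) gV[OF that] by (simp add: linear_frechet_derivative)
   thus ?thesis
    by (subst (1) euclidean_representation[symmetric, of "Df g x v"])
     (simp only: linear_sum linear_scale)
  qed
  have "Ck_on k U (%x. SUM b:Basis. (Df g x v \<bullet> b) *\<^sub>R Df f (g x) b)"
   by (intro Ck_on_sum assms(1) Ck_on_scaleR Ck_on_inner Ck_on_const Suc.IH Ck_on_SucD Suc.prems
     Ck_on_pred[OF Suc.prems(2)])
  thus "Ck_on k U (%x. Df f (g x) (Df g x v))"
   by (subst Ck_on_cong[OF assms(1) eq])
 qed
qed

lemma Ck_on_SucI_real:
 fixes f :: "real => real"
 assumes "open U" "!!x. x : U ==> (f has_real_derivative f' x) (at x)" "Ck_on k U f'"
 shows "Ck_on (Suc k) U f"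
 by (rule Ck_on_SucI[OF assms(1), where f'="%x v. f' x * v"])
  (use assms in \<open>auto simp: has_field_derivative_def mult_commute_abs intro!: Ck_on_mult\<close>)

lemma Ck_on_real_deriv:
 fixes f :: "real => real"
 assumes "Ck_on (Suc k) U f"
 shows "x : U ==> (f has_real_derivative deriv f x) (at x)" "open U ==> Ck_on k U (deriv f)"
proof -
 show 1: "(f has_real_derivative deriv f x) (at x)" if "x : U" for x
  using assms that by (simp add: DERIV_deriv_iff_real_differentiable)
 show "Ck_on k U (deriv f)" if "open U"
 proof -
  have "Df f x 1 = deriv f x" if "x : U" for x
   using 1[OF that] frechet_derivative_at[of f "(*) (deriv f x)" x]
   by (simp add: has_field_derivative_def) (metis mult.right_neutral)
  thus ?thesis
   using Ck_on_SucD[OF assms, of 1] Ck_on_cong[OF that, of "%x. Df f x 1" "deriv f" k]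
   by simp
 qed
qed

lemma Ck_on_local:
 assumes "!!x. x : U ==> EX V. open V & x : V & Ck_on k V f"
 shows "Ck_on k U f"
 using assms
proof (induction k arbitrary: f)
 case 0
 show ?case
 proof -
  have "isCont f x" if "x : U" for x
   using 0[OF that] by (auto simp: continuous_on_eq_continuous_at)
  thus ?thesis by (auto intro: continuous_at_imp_continuous_on)
 qed
next
 case (Suc k)
 thus ?case by simp metis
qed

lemma Ck_on_inverse:
 fixes f :: "'a::real_normed_vector => real"
 assumes "open U" "Ck_on k U f" "!!x. x : U ==> f x ~= 0"
 shows "Ck_on k U (%x. inverse (f x))"
proof -
 have "Ck_on k (- {0}) (inverse :: real => real)" for k
 proof (induction k)
  case 0
  thus ?case by (auto intro!: continuous_intros)
 next
  case (Suc k)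
  show ?case
   by (rule Ck_on_SucI_real[where f'="%x. - (inverse x * inverse x)"])
    (auto intro!: Ck_on_uminus[OF _ Ck_on_mult[OF _ Suc Suc]] derivative_eq_intros)
 qed
 moreover have "f ` U \<subseteq> - {0}"
  using assms(3) by force
 ultimately show ?thesis
  using Ck_on_compose[OF assms(1) _ _ assms(2)] by (metis open_delete open_UNIV Compl_eq_Diff_UNIV)
qed

lemma Ck_on_divide:
 fixes f g :: "'a::real_normed_vector => real"
 assumes "open U" "Ck_on k U f" "Ck_on k U g" "!!x. x : U ==> g x ~= 0"
 shows "Ck_on k U (%x. f x / g x)"
 using Ck_on_mult[OF assms(1,2) Ck_on_inverse[OF assms(1,3,4)]] by (simp add: divide_inverse)

text \<open>The derivatives of exp (- 1/x), extended by 0 to x <= 0, stay in the span of this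
  family; hence the power of 1/x as a parameter.\<close>

definition fexp :: "nat => real => real" where
 "fexp n x = (if x > 0 then exp (- inverse x) * inverse x ^ n else 0)"

lemma fexp_DERIV:
 "(fexp n has_real_derivative (fexp (n + 2) x - real n * fexp (n + 1) x)) (at x)"
proof -
 consider "x > 0" | "x < 0" | "x = 0" by linarith
 thus ?thesis
 proof cases
  case 1
  have inv: "(inverse has_real_derivative - (inverse x ^ 2)) (at x)"
   using DERIV_inverse[of x] 1 by (simp add: numeral_2_eq_2)
  have pow: "((%x. inverse x ^ n) has_real_derivative - real n * inverse x ^ (n + 1)) (at x)"
   using DERIV_power[OF inv, of n] by (cases n) (auto simp: power2_eq_square algebra_simps)
  have "((%x. exp (- inverse x)) has_real_derivative exp (- inverse x) * inverse x ^ 2) (at x)"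
   using DERIV_fun_exp[OF DERIV_minus[OF inv]] by simp
  from DERIV_mult[OF this pow]
  have "((%x. exp (- inverse x) * inverse x ^ n) has_real_derivative
    (fexp (n + 2) x - real n * fexp (n + 1) x)) (at x)"
   using 1 by (simp add: fexp_def algebra_simps power2_eq_square)
  thus ?thesis
   by (rule has_field_derivative_transform_within_open[of _ _ _ "{0<..}"]) (use 1 in \<open>auto simp: fexp_def\<close>)
 next
  case 2
  have "((%x. 0) has_real_derivative 0) (at x)" by simp
  hence "(fexp n has_real_derivative 0) (at x)"
   by (rule has_field_derivative_transform_within_open[of _ _ _ "{..<0}"]) (use 2 in \<open>auto simp: fexp_def\<close>)
  thus ?thesis using 2 by (simp add: fexp_def)
 next
  case 3
  \<comment> \<open>With y = 1/h the right difference quotient at 0 becomes y^(n+1) / exp y.\<close>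
  have "((%y::real. y ^ (n + 1) / exp y) \<longlongrightarrow> 0) at_top"
   by (rule tendsto_power_div_exp_0)
  hence "((%h::real. inverse h ^ (n + 1) / exp (inverse h)) \<longlongrightarrow> 0) (at_right 0)"
   by (rule filterlim_compose[OF _ filterlim_inverse_at_top_right])
  moreover have "eventually (%h::real. inverse h ^ (n + 1) / exp (inverse h) = (fexp n h - fexp n 0) / h) (at_right 0)"
   using eventually_at_right_less[of "0::real"]
   by eventually_elim (auto simp: fexp_def exp_minus field_simps)
  ultimately have r: "((%h. (fexp n h - fexp n 0) / h) \<longlongrightarrow> 0) (at_right 0)"
   by (rule Lim_transform_eventually)
  have "eventually (%h::real. 0 = (fexp n h - fexp n 0) / h) (at_left 0)"
   by (rule eventually_at_leftI[of "-1"]) (auto simp: fexp_def)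
  hence l: "((%h. (fexp n h - fexp n 0) / h) \<longlongrightarrow> 0) (at_left 0)"
   by (rule Lim_transform_eventually[OF tendsto_const])
  have "((%h. (fexp n (0 + h) - fexp n 0) / h) \<longlongrightarrow> 0) (at 0)"
   using l r by (simp add: filterlim_at_split)
  hence "(fexp n has_real_derivative 0) (at 0)"
   by (simp add: DERIV_def)
  thus ?thesis using 3 by (simp add: fexp_def)
 qed
qed

lemma Ck_on_fexp: "Ck_on k UNIV (fexp n)"
proof (induction k arbitrary: n)
 case 0
 thus ?case
  using DERIV_isCont[OF fexp_DERIV] by (simp add: continuous_at_imp_continuous_on)
next
 case (Suc k)
 show ?case
  by (rule Ck_on_SucI_real[OF _ fexp_DERIV]) (auto intro!: Ck_on_diff Ck_on_mult Suc)
qed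

definition bump :: "'a::euclidean_space => real" where
 "bump x = fexp 0 (1 - x \<bullet> x)"

lemma Ck_on_bump: "Ck_on k UNIV (bump :: 'a::euclidean_space => real)"
 unfolding bump_def
 by (rule Ck_on_compose[OF open_UNIV open_UNIV Ck_on_fexp])
  (auto intro!: Ck_on_diff Ck_on_inner)

lemma bump_nonneg: "bump x >= 0"
 by (auto simp: bump_def fexp_def)

lemma bump_pos_iff: "bump x > 0 \<longleftrightarrow> norm x < 1"
proof -
 have "x \<bullet> x < 1 \<longleftrightarrow> norm x < 1"
  by (simp add: norm_eq_sqrt_inner real_sqrt_less_iff)
 thus ?thesis by (auto simp: bump_def fexp_def)
qed

lemma bump_eq_0_iff: "bump x = 0 \<longleftrightarrow> norm x >= 1"
 using bump_pos_iff[of x] bump_nonneg[of x] by linarith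

lemma smooth_onI: "open U ==> (!!k. Ck_on k U f) ==> smooth_on U f"
 unfolding smooth_on_def by blast

lemma smooth_Ck:
 assumes "open U" "smooth_on U f"
 shows "Ck_on k U f"
proof (rule Ck_on_local)
 fix x assume "x : U"
 then obtain V g where V: "open V" "x : V" "ALL k. Ck_on k V g" "ALL y:U Int V. g y = f y"
  using assms(2) unfolding smooth_on_def by blast
 hence "Ck_on k (U Int V) g" using Ck_on_subset by blast
 hence "Ck_on k (U Int V) f"
  using Ck_on_cong[of "U Int V" f g] V assms(1) by auto
 thus "EX V. open V & x : V & Ck_on k V f"
  using \<open>x : U\<close> V assms(1) by (intro exI[of _ "U Int V"]) auto
qed

section \<open>Mollification\<close>

text \<open>Borel functions on the whole space, because convolution and Tonelli are carried out over
  \<open>lborel\<close>; elements of \<open>L2_on S\<close> enter through the representatives of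
  \<open>brep\<close>.\<close>

definition sq_int :: "('a::euclidean_space => real) => bool" where
 "sq_int u \<longleftrightarrow> u : borel_measurable borel & integrable lborel (%x. (u x)^2)"

definition Cc :: "('a::euclidean_space => real) => bool" where
 "Cc f \<longleftrightarrow> continuous_on UNIV f & (EX R. ALL x. norm x >= R --> f x = 0)"

lemma sq_intD:
 assumes "sq_int u"
 shows "u : borel_measurable borel" "u : borel_measurable lborel" "integrable lborel (%x. (u x)^2)"
 using assms by (auto simp: sq_int_def)

lemma sq_int_mult:
 assumes "sq_int u" "sq_int v"
 shows "integrable lborel (%x. u x * v x)"
proof (rule Bochner_Integration.integrable_bound)
 show "integrable lborel (%x. (u x)^2 + (v x)^2)"
  using assms by (auto simp: sq_int_def)
 show "(%x. u x * v x) : borel_measurable lborel"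
  using assms by (auto simp: sq_int_def)
 have "norm (a * b) <= norm (a^2 + b^2)" for a b :: real
 proof -
  have "2 * (abs a * abs b) <= a^2 + b^2" "0 <= abs a * abs b"
   using sum_squares_bound[of "abs a" "abs b"] by auto
  hence "abs a * abs b <= a^2 + b^2" by linarith
  thus ?thesis by (simp add: abs_mult)
 qed
 thus "AE x in lborel. norm (u x * v x) <= norm ((u x)^2 + (v x)^2)" by simp
qed

lemma sq_int_add:
 assumes "sq_int u" "sq_int v"
 shows "sq_int (%x. u x + v x)"
proof -
 have "integrable lborel (%x. (u x)^2 + (v x)^2 + 2 * (u x * v x))"
  using assms sq_int_mult[OF assms]
  by (intro Bochner_Integration.integrable_add integrable_mult_right) (auto simp: sq_int_def)
 moreover have "(u x + v x)^2 = (u x)^2 + (v x)^2 + 2 * (u x * v x)" for x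
  by (simp add: power2_sum)
 moreover have "(%x. u x + v x) : borel_measurable borel"
  using assms by (intro borel_measurable_add) (auto simp: sq_int_def)
 ultimately show ?thesis
  by (simp add: sq_int_def)
qed

lemma sq_int_cmult: "sq_int u ==> sq_int (%x. c * u x)"
 by (auto simp: sq_int_def power_mult_distrib)

lemma sq_int_diff:
 "sq_int u ==> sq_int v ==> sq_int (%x. u x - v x)"
 using sq_int_add[of u "%x. (-1) * v x"] sq_int_cmult[of v "-1"] by simp

lemma Cc_integrable: assumes "Cc f" shows "integrable lborel f"
proof -
 obtain R where R: "!!x. norm x >= R ==> f x = 0"
  using assms by (auto simp: Cc_def)
 have "integrable lborel (%x. indicator (cball 0 R) x *\<^sub>R f x)"
  by (rule borel_integrable_compact) (use assms in \<open>auto simp: Cc_def intro: continuous_on_subset\<close>)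
 also have "(%x. indicator (cball 0 R) x *\<^sub>R f x) = f"
  using R by (auto simp: fun_eq_iff indicator_def)
 finally show ?thesis .
qed

lemma Cc_measurable: "Cc f ==> f : borel_measurable borel"
 by (auto simp: Cc_def intro: borel_measurable_continuous_onI)

lemma Cc_mult: "Cc f ==> continuous_on UNIV g ==> Cc (%x. f x * g x)"
 unfolding Cc_def by (auto intro!: continuous_intros)

lemma Cc_sq_int: assumes "Cc f" shows "sq_int f"
proof -
 have "Cc (%x. f x * f x)"
  using assms by (intro Cc_mult) (auto simp: Cc_def)
 from Cc_integrable[OF this] show ?thesis
  using Cc_measurable[OF assms] by (auto simp: sq_int_def power2_eq_square)
qed

lemma Cc_reflect: assumes "Cc f" shows "Cc (%y. f (x - y))"
proof -
 obtain R where R: "!!x. norm x >= R ==> f x = 0"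
  using assms by (auto simp: Cc_def)
 have "continuous_on UNIV (%y. f (x - y))"
  by (rule continuous_on_compose2[of UNIV f]) (use assms in \<open>auto simp: Cc_def intro!: continuous_intros\<close>)
 moreover have "f (x - y) = 0" if "norm y >= R + norm x" for y
  using that norm_triangle_ineq2[of y x] by (intro R) (simp add: norm_minus_commute)
 ultimately show ?thesis by (auto simp: Cc_def)
qed

lemma Cc_bounded: assumes "Cc f" obtains B where "B > 0" "!!x. abs (f x) <= B"
proof -
 obtain R where R: "!!x. norm x >= R ==> f x = 0"
  using assms by (auto simp: Cc_def)
 have "compact (f ` cball 0 R)"
  by (rule compact_continuous_image) (use assms in \<open>auto simp: Cc_def intro: continuous_on_subset\<close>)
 then obtain B where B: "B > 0" "!!y. y : f ` cball 0 R ==> norm y <= B"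
  using compact_imp_bounded bounded_pos by metis
 have "abs (f x) <= B" for x
  using B R[of x] by (cases "norm x <= R") auto
 thus ?thesis using that B(1) by blast
qed

lemma Cc_uniform:
 assumes "Cc f" "e > 0"
 obtains d where "d > 0" "!!x y. norm (x - y) < d ==> abs (f x - f y) < e"
proof -
 obtain R where R: "!!x. norm x >= R ==> f x = 0"
  using assms by (auto simp: Cc_def)
 have "uniformly_continuous_on (cball 0 (R + 2)) f"
  by (rule compact_uniformly_continuous) (use assms in \<open>auto simp: Cc_def intro: continuous_on_subset\<close>)
 then obtain d where d: "d > 0" "!!x y. x : cball 0 (R+2) ==> y : cball 0 (R+2) ==> dist y x < d ==> dist (f y) (f x) < e"
  using assms(2) unfolding uniformly_continuous_on_def by metis
 have "abs (f x - f y) < e" if "norm (x - y) < min d 1" for x y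
 proof (cases "norm x <= R + 1")
  case True
  hence "norm y <= R + 2"
   using that norm_triangle_ineq2[of y x] by (simp add: norm_minus_commute)
  thus ?thesis
   using True that d(2)[of y x] by (simp add: dist_norm)
 next
  case False
  hence "norm y >= R"
   using that norm_triangle_ineq2[of x y] by simp
  thus ?thesis using False R[of x] R[of y] assms(2) by simp
 qed
 thus ?thesis using that[of "min d 1"] d(1) by auto
qed

lemma lborel_reflect:
 fixes f :: "'a::euclidean_space => real"
 assumes "f : borel_measurable borel"
 shows "(LINT y|lborel. f (x - y)) = (LINT y|lborel. f y)"
  and "(\<integral>\<^sup>+y. f (x - y) \<partial>lborel) = (\<integral>\<^sup>+y. f y \<partial>lborel)"
proof -
 have d: "lborel = density (distr lborel borel (%y. x + (-1) *\<^sub>R y)) (%_. (abs (-1::real))^DIM('a))"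
  by (rule lborel_affine) simp
 hence d: "(lborel :: 'a measure) = distr lborel borel (%y. x - y)"
  by (simp add: density_1)
 show "(LINT y|lborel. f (x - y)) = (LINT y|lborel. f y)"
  by (subst (2) d) (use assms in \<open>simp add: integral_distr\<close>)
 show "(\<integral>\<^sup>+y. f (x - y) \<partial>lborel) = (\<integral>\<^sup>+y. f y \<partial>lborel)"
  by (subst (2) d) (use assms in \<open>simp add: nn_integral_distr\<close>)
qed

text \<open>Two dominated limits: truncation of u in size and support, and then continuous functions
  converging almost everywhere to the truncation, clamped so that a multiple of the indicator of a
  ball dominates them.\<close>

lemma sq_int_dense:
 assumes u: "sq_int (u :: 'a::euclidean_space => real)" and "e > 0"
 obtains c where "Cc c" "(LINT x|lborel. (u x - c x)^2) < e"
proof -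
 note [measurable] = sq_intD(1)[OF u]
 define v where "v k x = (if norm x <= real k & abs (u x) <= real k then u x else 0)" for k x
 have [measurable]: "v k : borel_measurable borel" for k
  unfolding v_def by measurable
 have "(%k. LINT x|lborel. (u x - v k x)^2) \<longlonglongrightarrow> (\<integral>x. 0 \<partial>(lborel :: 'a measure))"
 proof (rule integral_dominated_convergence[where w="%x. (u x)^2"])
  show "AE x in lborel. (%k. (u x - v k x)^2) \<longlonglongrightarrow> 0"
  proof (rule AE_I2)
   fix x
   have "eventually (%k. real k >= max (norm x) \<bar>u x\<bar>) sequentially"
    by (rule eventually_sequentiallyI[of "nat \<lceil>max (norm x) \<bar>u x\<bar>\<rceil>"]) linarith
   hence "eventually (%k. (u x - v k x)^2 = 0) sequentially"
    by eventually_elim (auto simp: v_def)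
   thus "(%k. (u x - v k x)^2) \<longlonglongrightarrow> 0"
    by (rule tendsto_eventually)
  qed
 qed (use u in \<open>auto simp: sq_int_def v_def\<close>)
 hence "(%k. LINT x|lborel. (u x - v k x)^2) \<longlonglongrightarrow> 0" by simp
 then obtain k where k: "(LINT x|lborel. (u x - v k x)^2) < e / 4"
  using \<open>e > 0\<close> by (auto simp: LIMSEQ_iff dest!: spec[of _ "e / 4"])
 have "v k measurable_on UNIV"
  by (rule lebesgue_measurable_imp_measurable_on) (auto intro: measurable_completion)
 then obtain N g where N: "negligible N" and g: "!!n::nat. continuous_on UNIV (g n)"
  and lim: "!!x. x ~: N ==> (%n. g n x) \<longlonglongrightarrow> v k x"
  unfolding measurable_on_def by auto
 define K where "K = real k"
 \<comment> \<open>Clamping to [-K, K] and the radial factor leave the limit \<open>v k\<close>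
   unchanged, as it is bounded by K and vanishes for norm x > K.\<close>
 define c where "c n x = max (- K) (min K (g n x)) * max 0 (min 1 (K + 1 - norm x))" for n x
 have vk: "abs (v k x) <= K" "norm x > K ==> v k x = 0" for x
  by (auto simp: v_def K_def)
 have cc: "continuous_on UNIV (c n)" for n
  unfolding c_def by (intro continuous_intros g)
 have c0: "norm x >= K + 1 ==> c n x = 0" for n x
  by (simp add: c_def)
 have c: "Cc (c n)" for n
  unfolding Cc_def using cc c0 by blast
 have [measurable]: "c n : borel_measurable borel" for n
  using c by (rule Cc_measurable)
 have cK: "abs (c n x) <= K" for n x
 proof -
  have "abs (max (- K) (min K (g n x))) * abs (max 0 (min 1 (K + 1 - norm x))) <= K * 1"
   by (rule mult_mono) (auto simp: K_def)
  thus ?thesis by (simp add: c_def abs_mult)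
 qed
 have "(%n. LINT x|lebesgue. (v k x - c n x)^2) \<longlonglongrightarrow> (\<integral>x. 0 \<partial>(lebesgue :: 'a measure))"
 proof (rule integral_dominated_convergence[where w="%x. (2 * K)^2 * indicator (cball 0 (K + 1)) x"])
  have "AE x in lebesgue. x ~: N"
   using N by (simp add: negligible_iff_null_sets AE_not_in)
  thus "AE x in lebesgue. (%n. (v k x - c n x)^2) \<longlonglongrightarrow> 0"
  proof eventually_elim
   case (elim x)
   have "(%n. c n x) \<longlonglongrightarrow> max (- K) (min K (v k x)) * max 0 (min 1 (K + 1 - norm x))"
    unfolding c_def by (intro tendsto_intros lim elim)
   also have "max (- K) (min K (v k x)) * max 0 (min 1 (K + 1 - norm x)) = v k x"
    using vk[of x] by (cases "norm x > K") (auto simp: min_def max_def abs_le_iff)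
   finally have "(%n. v k x - c n x) \<longlonglongrightarrow> v k x - v k x"
    by (intro tendsto_intros)
   thus ?case
    using tendsto_power[of "%n. v k x - c n x" 0 sequentially 2] by simp
  qed
  show "AE x in lebesgue. norm ((v k x - c n x)^2) <= (2 * K)^2 * indicator (cball 0 (K + 1)) x" for n
  proof (rule AE_I2)
   fix x :: 'a
   have "abs (v k x - c n x) <= abs (2 * K)" using vk(1)[of x] cK[of n x] by linarith
   hence "(v k x - c n x)^2 <= (2 * K)^2" by (simp only: abs_le_square_iff)
   thus "norm ((v k x - c n x)^2) <= (2 * K)^2 * indicator (cball 0 (K + 1)) x"
    using vk(2)[of x] c0[of x n] by (cases "norm x <= K + 1") (auto simp: indicator_def)
  qed
  show "(%x. (v k x - c n x)^2) : borel_measurable lebesgue" for n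
   by (intro measurable_completion) measurable
  have "integrable lebesgue (%x. indicator (cball (0::'a) (K + 1)) x :: real)"
   by (rule integrable_real_indicator)
    (use emeasure_lborel_cball_finite[of "0::'a" "K + 1"] in auto)
  thus "integrable lebesgue (%x. (2 * K)^2 * indicator (cball (0::'a) (K + 1)) x)"
   by simp
 qed simp
 moreover have "(LINT x|lebesgue. (v k x - c n x)^2) = (LINT x|lborel. (v k x - c n x)^2)" for n
  by (rule integral_completion) measurable
 ultimately have "(%n. LINT x|lborel. (v k x - c n x)^2) \<longlonglongrightarrow> 0" by simp
 then obtain n where n: "(LINT x|lborel. (v k x - c n x)^2) < e / 4"
  using \<open>e > 0\<close> by (auto simp: LIMSEQ_iff dest!: spec[of _ "e / 4"])
 have v: "sq_int (v k)"
  unfolding sq_int_def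
  by (intro conjI Bochner_Integration.integrable_bound[OF sq_intD(3)[OF u]]) (auto simp: v_def)
 note d1 = sq_int_diff[OF u v] and d2 = sq_int_diff[OF v Cc_sq_int[OF c]]
 have "(LINT x|lborel. (u x - c n x)^2) <= (LINT x|lborel. 2 * (u x - v k x)^2 + 2 * (v k x - c n x)^2)"
 proof (rule integral_mono)
  show "(u x - c n x)^2 <= 2 * (u x - v k x)^2 + 2 * (v k x - c n x)^2" for x
   using sum_squares_bound[of "u x - v k x" "v k x - c n x"] by (simp add: power2_eq_square algebra_simps)
 qed (use sq_intD(3)[OF d1] sq_intD(3)[OF d2]
    sq_intD(3)[OF sq_int_diff[OF u Cc_sq_int[OF c[of n]]]] in auto)
 also have "... = 2 * (LINT x|lborel. (u x - v k x)^2) + 2 * (LINT x|lborel. (v k x - c n x)^2)"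
  using sq_intD(3)[OF d1] sq_intD(3)[OF d2] by simp
 also have "... < e" using k n by simp
 finally show ?thesis using that[of "c n"] c by blast
qed

definition convol :: "('a::euclidean_space => real) => ('a => real) => 'a => real" where
 "convol kp u x = (LINT y|lborel. kp (x - y) * u y)"

lemma convol_integrable: "Cc kp ==> sq_int u ==> integrable lborel (%y. kp (x - y) * u y)"
 by (intro sq_int_mult[OF Cc_sq_int[OF Cc_reflect]])

lemma convol_measurable:
 assumes "Cc kp" "sq_int u"
 shows "convol kp u : borel_measurable borel"
proof -
 note [measurable] = sq_intD(1)[OF assms(2)] Cc_measurable[OF assms(1)]
 have "(%x. LINT y|lborel. kp (x - y) * u y) : borel_measurable lborel"
  by measurable
 thus ?thesis by (simp add: convol_def[abs_def])
qed

lemma convol_diff: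
 assumes "Cc kp" "sq_int u" "sq_int v"
 shows "convol kp (%x. u x - v x) x = convol kp u x - convol kp v x"
 using convol_integrable[OF assms(1,2), of x] convol_integrable[OF assms(1,3), of x]
 by (simp add: convol_def right_diff_distrib)

text \<open>Jensen for the probability density y -> kp (x - y): the variance of u about its mean
  \<open>convol kp u x\<close> is nonnegative. Tonelli then integrates the kernel out in x.\<close>

lemma convol_L2:
 assumes kp: "Cc kp" "!!x. kp x >= 0" "(LINT x|lborel. kp x) = 1" and u: "sq_int u"
 shows "sq_int (convol kp u)" "(LINT x|lborel. (convol kp u x)^2) <= (LINT x|lborel. (u x)^2)"
proof -
 note [measurable] = sq_intD(1)[OF u] Cc_measurable[OF kp(1)] convol_measurable[OF kp(1) u]
 obtain B where B: "B > 0" "!!x. abs (kp x) <= B" using Cc_bounded[OF kp(1)] by blast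
 have int2: "integrable lborel (%y. kp (x - y) * (u y)^2)" for x
 proof (rule Bochner_Integration.integrable_bound)
  show "integrable lborel (%y. B * (u y)^2)" using sq_intD(3)[OF u] by simp
  show "AE y in lborel. norm (kp (x - y) * (u y)^2) <= norm (B * (u y)^2)"
   using B by (intro AE_I2) (auto simp: abs_mult intro!: mult_right_mono)
 qed measurable
 have int1: "integrable lborel (%y. kp (x - y))" for x
  by (intro Cc_integrable Cc_reflect kp)
 have one: "(LINT y|lborel. kp (x - y)) = 1" for x
  using lborel_reflect(1)[of kp x] kp(3) by simp
 have pw: "(convol kp u x)^2 <= (LINT y|lborel. kp (x - y) * (u y)^2)" for x
 proof -
  define c where "c = convol kp u x"
  have "0 <= (LINT y|lborel. kp (x - y) * (u y - c)^2)"
   using kp(2) by simp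
  also have "(%y. kp (x - y) * (u y - c)^2) =
    (%y. kp (x - y) * (u y)^2 - (2 * c) * (kp (x - y) * u y) + c^2 * kp (x - y))"
   by (auto simp: fun_eq_iff power2_eq_square algebra_simps)
  also have "(LINT y|lborel. ... y) = (LINT y|lborel. kp (x - y) * (u y)^2) - (2 * c) * c + c^2 * 1"
   using int2[of x] int1[of x] convol_integrable[OF kp(1) u, of x] one[of x]
   by (simp add: c_def convol_def)
  finally show ?thesis by (simp add: c_def power2_eq_square)
 qed
 have "(\<integral>\<^sup>+x. ennreal ((convol kp u x)^2) \<partial>lborel) <= (\<integral>\<^sup>+x. (\<integral>\<^sup>+y. ennreal (kp (x - y) * (u y)^2) \<partial>lborel) \<partial>lborel)"
  using pw kp(2) int2 by (intro nn_integral_mono) (simp add: nn_integral_eq_integral ennreal_leI)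
 also have "... = (\<integral>\<^sup>+y. (\<integral>\<^sup>+x. ennreal (kp (x - y) * (u y)^2) \<partial>lborel) \<partial>lborel)"
  by (rule lborel_pair.Fubini'[symmetric]) measurable
 also have "... = (\<integral>\<^sup>+y. ennreal ((u y)^2) \<partial>lborel)"
 proof (rule nn_integral_cong)
  fix y
  have i: "integrable lborel (%x. kp (x - y))"
  proof -
   have "Cc (%x. kp (- x))" using Cc_reflect[OF kp(1), of 0] by simp
   from Cc_reflect[OF this, of y] show ?thesis by (intro Cc_integrable) simp
  qed
  have "(LINT x|lborel. kp (x - y)) = 1"
  proof -
   have "(LINT x|lborel. kp (x - y)) = (LINT x|lborel. (%z. kp (- z)) (y - x))" by simp
   also have "... = (LINT x|lborel. kp (0 - x))" by (subst lborel_reflect(1)) simp_all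
   also have "... = 1" by (subst lborel_reflect(1)) (use kp(3) in simp_all)
   finally show ?thesis .
  qed
  hence "(\<integral>\<^sup>+x. ennreal (kp (x - y)) \<partial>lborel) = 1"
   using i kp(2) by (simp add: nn_integral_eq_integral)
  thus "(\<integral>\<^sup>+x. ennreal (kp (x - y) * (u y)^2) \<partial>lborel) = ennreal ((u y)^2)"
   using kp(2) by (simp add: ennreal_mult nn_integral_multc)
 qed
 also have "... = ennreal (LINT y|lborel. (u y)^2)"
  using sq_intD(3)[OF u] by (simp add: nn_integral_eq_integral)
 finally have le: "(\<integral>\<^sup>+x. ennreal ((convol kp u x)^2) \<partial>lborel) <= ennreal (LINT y|lborel. (u y)^2)" .
 hence i: "integrable lborel (%x. (convol kp u x)^2)"
  by (intro integrableI_nonneg) (auto simp: le_less_trans)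
 thus "sq_int (convol kp u)"
  by (simp add: sq_int_def)
 show "(LINT x|lborel. (convol kp u x)^2) <= (LINT x|lborel. (u x)^2)"
  using le i by (simp add: nn_integral_eq_integral)
qed

text \<open>Continuity and differentiability of a convolution both come down to this: the error in
  the kernel is at most e and is confined to a fixed set S.\<close>

lemma convol_lipschitz:
 fixes kp :: "'b => 'a::euclidean_space => real" and u :: "'a => real"
 assumes kp: "!!x. integrable lborel (%y. kp x y * u y)" and u: "u : borel_measurable borel"
  and b: "!!y. abs (kp x y) <= e" "!!y. y ~: S ==> kp x y = 0" and S: "S : sets borel"
  and i: "integrable lborel (%y. indicator S y * u y)"
 shows "abs (LINT y|lborel. kp x y * u y) <= e * (LINT y|lborel. indicator S y * abs (u y))"
proof -
 have i': "integrable lborel (%y. indicator S y * abs (u y))"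
  using integrable_abs[OF i] by (simp add: abs_mult)
 have e: "e >= 0" using b(1)[of undefined] by linarith
 have "abs (LINT y|lborel. kp x y * u y) <= (LINT y|lborel. abs (kp x y * u y))"
  by (rule integral_abs_bound)
 also have "... <= (LINT y|lborel. e * (indicator S y * abs (u y)))"
 proof (rule integral_mono)
  show "abs (kp x y * u y) <= e * (indicator S y * abs (u y))" for y
   using b[of y] by (cases "y : S") (auto simp: abs_mult intro!: mult_right_mono)
 qed (use kp[of x] i' in auto)
 finally show ?thesis by simp
qed

lemma Cc_ball_integrable:
 assumes "sq_int (u :: 'a::euclidean_space => real)"
 shows "integrable lborel (%y. indicator (cball x r) y * u y)"
proof (rule sq_int_mult[OF _ assms])
 have "emeasure lborel (cball x r) < \<infinity>" by (rule emeasure_lborel_cball_finite)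
 thus "sq_int (indicator (cball x r) :: 'a => real)"
  using integrable_real_indicator[of "cball x r" lborel]
  by (auto simp: sq_int_def power2_eq_square indicator_inter_arith[symmetric]
    intro!: borel_measurable_indicator)
qed

lemma convol_continuous:
 assumes kp: "Cc kp" and u: "sq_int u"
 shows "continuous_on UNIV (convol kp u)"
 unfolding continuous_on_iff
proof safe
 fix x :: 'a and e :: real assume "e > 0"
 obtain R where R: "!!x. norm x >= R ==> kp x = 0" using kp by (auto simp: Cc_def)
 define S where "S = cball x (abs R + 1)"
 define I where "I = (LINT y|lborel. indicator S y * abs (u y))"
 have I: "I >= 0" unfolding I_def by simp
 obtain d where d: "d > 0" "!!x y. norm (x - y) < d ==> abs (kp x - kp y) < e / (I + 1)"
  using Cc_uniform[OF kp, of "e / (I + 1)"] \<open>e > 0\<close> I by auto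
 have "dist (convol kp u x') (convol kp u x) < e" if "dist x' x < min d 1" for x'
 proof -
  have i: "integrable lborel (%y. kp (z - y) * u y)" for z by (rule convol_integrable[OF kp u])
  have "abs (LINT y|lborel. (kp (x' - y) - kp (x - y)) * u y) <= e / (I + 1) * (LINT y|lborel. indicator S y * abs (u y))"
  proof (rule convol_lipschitz[where kp="%_ y. kp (x' - y) - kp (x - y)"])
   show "abs (kp (x' - y) - kp (x - y)) <= e / (I + 1)" for y
    using d(2)[of "x' - y" "x - y"] that by (simp add: dist_norm)
   show "kp (x' - y) - kp (x - y) = 0" if y: "y ~: S" for y
   proof -
    have "norm (x - y) > abs R + 1" using y by (simp add: S_def dist_norm)
    moreover have "norm (x' - y) >= norm (x - y) - norm (x' - x)"
     using norm_triangle_ineq2[of "x - y" "x - x'"] by (simp add: norm_minus_commute)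
    ultimately show ?thesis
     using \<open>dist x' x < min d 1\<close> R[of "x - y"] R[of "x' - y"] by (auto simp: dist_norm)
   qed
  qed (use i sq_intD[OF u] Cc_ball_integrable[OF u] in \<open>auto simp: S_def left_diff_distrib\<close>)
  also have "... = e * (I / (I + 1))" by (simp add: I_def)
  also have "... < e * 1"
   using \<open>e > 0\<close> I by (intro mult_strict_left_mono) auto
  finally show ?thesis
   using i[of x] i[of x'] by (simp add: convol_def dist_norm left_diff_distrib)
 qed
 thus "EX d>0. ALL x':UNIV. dist x' x < d --> dist (convol kp u x') (convol kp u x) < e"
  using d(1) by (intro exI[of _ "min d 1"]) auto
qed

text \<open>Differentiation under the integral. The Taylor remainder of \<open>kp\<close> is small
  relative to h uniformly in the base point, by uniform continuity of the partial derivatives, and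
  vanishes outside a fixed ball around x.\<close>

lemma convol_has_derivative:
 assumes kp: "Cc kp" "Ck_on 1 UNIV kp" and u: "sq_int (u :: 'a::euclidean_space => real)"
 shows "(convol kp u has_derivative (%h. SUM b:Basis. (h \<bullet> b) * convol (%z. Df kp z b) u x)) (at x)"
proof -
 define kp' where "kp' b z = Df kp z b" for b z
 have der: "(kp has_derivative (%h. SUM b:Basis. (h \<bullet> b) * kp' b z)) (at z)" for z
 proof -
  have d: "(kp has_derivative Df kp z) (at z)"
   using kp(2) by (simp add: frechet_derivative_works)
  hence "linear (Df kp z)" by (simp add: has_derivative_linear)
  hence "Df kp z h = (SUM b:Basis. (h \<bullet> b) * kp' b z)" for h
   unfolding kp'_def
   by (subst (1) euclidean_representation[symmetric, of h]) (simp only: linear_sum linear_scale real_scaleR_def)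
  hence "Df kp z = (%h. SUM b:Basis. (h \<bullet> b) * kp' b z)" by (rule ext)
  thus ?thesis using d by simp
 qed
 obtain R where R: "!!x. norm x >= R ==> kp x = 0" using kp(1) by (auto simp: Cc_def)
 have kp'0: "kp' b z = 0" if "norm z > R" for b z
 proof -
  have "(kp has_derivative (%h. 0)) (at z)"
  proof (rule has_derivative_transform_within_open[of "%_. 0"])
   show "open {z. norm z > R}" by (intro open_Collect_less continuous_intros)
  qed (use that R in auto)
  thus ?thesis using frechet_derivative_at[of kp "%h. 0" z] by (metis kp'_def)
 qed
 have Cc': "Cc (kp' b)" for b
  unfolding Cc_def
 proof
  show "continuous_on UNIV (kp' b)" using kp(2) by (simp add: kp'_def[abs_def])
  show "EX R. ALL x. R <= norm x --> kp' b x = 0" by (rule exI[of _ "R + 1"]) (use kp'0 in auto)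
 qed
 show ?thesis
  unfolding has_derivative_at_alt
 proof (intro conjI allI impI)
  show "bounded_linear (%h. SUM b:Basis. (h \<bullet> b) * convol (%z. Df kp z b) u x)"
   by (intro bounded_linear_sum bounded_linear_mult_const bounded_linear_inner_left)
  fix e :: real assume "e > 0"
  define S where "S = cball x (abs R + 1)"
  define I where "I = (LINT y|lborel. indicator S y * abs (u y))"
  have I: "I >= 0" unfolding I_def by simp
  \<comment> \<open>Makes e' times the dimension times I at most e; the summand 1 keeps the
    denominator positive.\<close>
  define e' where "e' = e / ((I + 1) * DIM('a))"
  have "e' > 0" using \<open>e > 0\<close> I by (simp add: e'_def)
  hence "ALL b:Basis. EX d>0. ALL x y. norm (x - y) < d --> abs (kp' b x - kp' b y) < e'"
   using Cc_uniform[OF Cc'] by metis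
  then obtain D where D: "!!b x y. b : Basis ==> D b > (0::real)"
   "!!b x y. b : Basis ==> norm (x - y) < D b ==> abs (kp' b x - kp' b y) < e'"
   by metis
  define d where "d = min 1 (Min (D ` Basis))"
  have d: "d > 0" "d <= 1" "!!b. b : Basis ==> d <= D b"
   using D(1) by (auto simp: d_def min.coboundedI2)
  have main: "abs (kp (z + h) - kp z - (SUM b:Basis. (h \<bullet> b) * kp' b z)) <= (e' * DIM('a)) * norm h"
   if h: "norm h < d" for z h
  proof -
   \<comment> \<open>Mean value inequality for \<open>kp\<close> minus its linearization at
     z.\<close>
   have "norm ((%w. kp w - (SUM b:Basis. (w \<bullet> b) * kp' b z)) (z + h) - (%w. kp w - (SUM b:Basis. (w \<bullet> b) * kp' b z)) z)
    <= (e' * DIM('a)) * norm (z + h - z)"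
   proof (rule differentiable_bound[of "ball z d" _
      "%w k. (SUM b:Basis. (k \<bullet> b) * kp' b w) - (SUM b:Basis. (k \<bullet> b) * kp' b z)"])
    fix w assume w: "w : ball z d"
    show "((%w. kp w - (SUM b:Basis. (w \<bullet> b) * kp' b z)) has_derivative
     (%k. (SUM b:Basis. (k \<bullet> b) * kp' b w) - (SUM b:Basis. (k \<bullet> b) * kp' b z))) (at w within ball z d)"
     by (intro has_derivative_diff has_derivative_at_withinI[OF der])
      (auto intro!: derivative_eq_intros)
    show "onorm (%k. (SUM b:Basis. (k \<bullet> b) * kp' b w) - (SUM b:Basis. (k \<bullet> b) * kp' b z)) <= e' * DIM('a)"
    proof (rule onorm_le)
     fix k :: 'a
     have "norm ((SUM b:Basis. (k \<bullet> b) * kp' b w) - (SUM b:Basis. (k \<bullet> b) * kp' b z))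
      = abs (SUM b:Basis. (k \<bullet> b) * (kp' b w - kp' b z))"
      by (simp add: sum_subtractf right_diff_distrib)
     also have "... <= (SUM b:(Basis :: 'a set). norm k * e')"
     proof (rule order_trans[OF sum_abs], rule sum_mono)
      fix b :: 'a assume b: "b : Basis"
      have "abs (kp' b w - kp' b z) <= e'"
       using D(2)[OF b, of w z] d(3)[OF b] w by (simp add: dist_norm norm_minus_commute)
      thus "abs ((k \<bullet> b) * (kp' b w - kp' b z)) <= norm k * e'"
       using Basis_le_norm[OF b, of k] by (simp add: abs_mult mult_mono)
     qed
     also have "... = e' * DIM('a) * norm k" by simp
     finally show "norm ((SUM b:Basis. (k \<bullet> b) * kp' b w) - (SUM b:Basis. (k \<bullet> b) * kp' b z)) <= e' * DIM('a) * norm k" .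
    qed
   qed (use d h in \<open>auto simp: dist_norm\<close>)
   thus ?thesis
    by (simp add: inner_add_left distrib_right sum.distrib)
  qed
  have "norm (convol kp u y - convol kp u x - (SUM b:Basis. ((y - x) \<bullet> b) * convol (%z. Df kp z b) u x)) <= e * norm (y - x)"
   if y: "norm (y - x) < d" for y
  proof -
   define h where "h = y - x"
   define et where "et w = kp (y - w) - kp (x - w) - (SUM b:Basis. (h \<bullet> b) * kp' b (x - w))" for w
   have i: "integrable lborel (%w. kp (z - w) * u w)" "integrable lborel (%w. kp' b (z - w) * u w)" for z b
    by (rule convol_integrable[OF kp(1) u] convol_integrable[OF Cc' u])+
   have etu: "et w * u w = kp (y - w) * u w - kp (x - w) * u w - (SUM b:Basis. (h \<bullet> b) * (kp' b (x - w) * u w))" for w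
    by (simp add: et_def left_diff_distrib sum_distrib_right mult.assoc)
   have "convol kp u y - convol kp u x - (SUM b:Basis. (h \<bullet> b) * convol (kp' b) u x) = (LINT w|lborel. et w * u w)"
    unfolding etu convol_def using i by simp
   moreover have "abs (LINT w|lborel. et w * u w) <= (e' * DIM('a) * norm h) * (LINT w|lborel. indicator S w * abs (u w))"
   proof (rule convol_lipschitz[where kp="%_. et"])
    show "integrable lborel (%y. et y * u y)" unfolding etu using i by simp
    show "abs (et w) <= e' * DIM('a) * norm h" for w
     using main[of h "x - w"] y by (simp add: h_def et_def)
    show "et w = 0" if w: "w ~: S" for w
    proof -
     have "norm (x - w) > abs R + 1" using w by (simp add: S_def dist_norm)
     moreover have "norm (y - w) >= norm (x - w) - norm h"
      using norm_triangle_ineq2[of "x - w" "x - y"] by (simp add: h_def norm_minus_commute)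
     ultimately show ?thesis
      using y d R[of "x - w"] R[of "y - w"] kp'0[of "x - w"] by (auto simp: et_def h_def)
    qed
   qed (use sq_intD[OF u] Cc_ball_integrable[OF u] in \<open>auto simp: S_def\<close>)
   moreover have "(e' * DIM('a) * norm h) * I <= e * norm h"
   proof -
    have "e' * DIM('a) = e / (I + 1)" by (simp add: e'_def)
    hence "e' * DIM('a) * I = e * (I / (I + 1))" by simp
    also have "... <= e * 1" using \<open>e > 0\<close> I by (intro mult_left_mono) auto
    finally have "(e' * DIM('a) * I) * norm h <= e * norm h" by (intro mult_right_mono) auto
    thus ?thesis by (simp add: mult_ac)
   qed
   ultimately show ?thesis
    by (simp add: I_def h_def kp'_def[abs_def])
  qed
  thus "EX d>0. ALL y. norm (y - x) < d --> norm (convol kp u y - convol kp u x - (SUM b:Basis. ((y - x) \<bullet> b) * convol (%z. Df kp z b) u x)) <= e * norm (y - x)"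
   using d(1) by blast
 qed
qed

definition moll :: "nat => 'a::euclidean_space => real" where
 "moll n x = bump (real (Suc n) *\<^sub>R x) / (LINT y|lborel. bump (real (Suc n) *\<^sub>R (y::'a)))"

lemma Ck_on_bump_scaled: "Ck_on k UNIV (%x::'a::euclidean_space. bump (c *\<^sub>R x))"
 by (rule Ck_on_compose[OF open_UNIV open_UNIV Ck_on_bump]) (auto intro!: Ck_on_scaleR)

lemma Ck_on_moll: "Ck_on k UNIV (moll n :: 'a::euclidean_space => real)"
 unfolding moll_def divide_inverse
 by (intro Ck_on_mult open_UNIV Ck_on_bump_scaled Ck_on_const)

lemma bump_scaled_eq_0_iff:
 "bump (real (Suc n) *\<^sub>R x) = 0 \<longleftrightarrow> norm x >= inverse (real (Suc n))"
 unfolding bump_eq_0_iff norm_scaleR by (simp add: field_simps del: of_nat_Suc)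

lemma moll_eq_0: "norm x >= inverse (real (Suc n)) ==> moll n x = 0"
 unfolding moll_def using bump_scaled_eq_0_iff[of n x] by simp

lemma Cc_bump_scaled: "Cc (%x::'a::euclidean_space. bump (real (Suc n) *\<^sub>R x))"
 unfolding Cc_def
proof (intro conjI exI[of _ "inverse (real (Suc n))"] allI impI)
 show "continuous_on UNIV (%x::'a. bump (real (Suc n) *\<^sub>R x))"
  by (rule Ck_on_cont[OF Ck_on_bump_scaled])
qed (simp add: bump_scaled_eq_0_iff del: of_nat_Suc)

lemma bump_integral_pos: "(LINT y|lborel. bump (real (Suc n) *\<^sub>R (y::'a::euclidean_space))) > 0"
proof -
 let ?f = "%y::'a. bump (real (Suc n) *\<^sub>R y)"
 have "(LINT y|lborel. ?f y) ~= 0"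
 proof
  assume "(LINT y|lborel. ?f y) = 0"
  hence "AE y in lborel. ?f y = 0"
   using integral_nonneg_eq_0_iff_AE[OF Cc_integrable[OF Cc_bump_scaled]] bump_nonneg by auto
  hence "AE y in lborel. y ~: ball (0::'a) (inverse (real (Suc n)))"
   by (rule eventually_mono) (simp add: bump_scaled_eq_0_iff del: of_nat_Suc)
  hence "ball (0::'a) (inverse (real (Suc n))) : null_sets lborel"
   by (subst AE_iff_null_sets) auto
  hence "negligible (ball (0::'a) (inverse (real (Suc n))))"
   by (simp add: negligible_iff_null_sets null_sets_completionI)
  thus False
   using open_not_negligible[of "ball (0::'a) (inverse (real (Suc n)))"] by auto
 qed
 moreover have "(LINT y|lborel. ?f y) >= 0" by (simp add: bump_nonneg)
 ultimately show ?thesis by linarith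
qed

lemma Cc_moll: "Cc (moll n :: 'a::euclidean_space => real)"
 unfolding Cc_def using moll_eq_0 Ck_on_cont[OF Ck_on_moll] by blast

lemma moll_nonneg: "moll n x >= 0"
 by (auto simp: moll_def bump_nonneg)

lemma integral_moll: "(\<integral>x. moll n x \<partial>(lborel :: 'a::euclidean_space measure)) = 1"
 unfolding moll_def using bump_integral_pos[where 'a='a, of n] by simp

lemma moll_uniform:
 assumes "Cc c"
 shows "ALL e>0. EX n0. ALL n>=n0. ALL x. abs (convol (moll n) c x - c x) <= e"
proof safe
 fix e :: real assume "e > 0"
 obtain d where d: "d > 0" "!!x y. norm (x - y) < d ==> abs (c x - c y) < e"
  using Cc_uniform[OF assms \<open>e > 0\<close>] by blast
 obtain n0 where n0: "inverse (real (Suc n0)) < d" using reals_Archimedean d(1) by blast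
 have "abs (convol (moll n) c x - c x) <= e" if "n >= n0" for n x
 proof -
  have n: "inverse (real (Suc n)) < d"
   using n0 that by (smt (verit) Suc_le_mono inverse_le_iff_le of_nat_0_less_iff of_nat_le_iff zero_less_Suc)
  have i: "integrable lborel (%y. moll n (x - y) * c y)" "integrable lborel (%y. moll n (x - y))"
   by (intro convol_integrable Cc_moll Cc_sq_int assms Cc_integrable Cc_reflect)+
  have one: "(LINT y|lborel. moll n (x - y)) = 1"
   using lborel_reflect(1)[OF Cc_measurable[OF Cc_moll], of n x] integral_moll[of n] by simp
  have "convol (moll n) c x - c x = (LINT y|lborel. moll n (x - y) * c y - moll n (x - y) * c x)"
   using i one by (simp add: convol_def)
  also have "abs (...) <= (LINT y|lborel. abs (moll n (x - y) * c y - moll n (x - y) * c x))"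
   by (rule integral_abs_bound)
  also have "... <= (LINT y|lborel. moll n (x - y) * e)"
  proof (rule integral_mono)
   fix y
   show "abs (moll n (x - y) * c y - moll n (x - y) * c x) <= moll n (x - y) * e"
   proof (cases "norm (x - y) < d")
    case True
    hence "abs (c y - c x) <= e" using d(2)[of x y] by (simp add: abs_minus_commute)
    thus ?thesis
     using moll_nonneg[of n "x - y"]
     by (simp add: right_diff_distrib[symmetric] abs_mult mult_left_mono)
   next
    case False
    thus ?thesis using moll_eq_0[of n "x - y"] n by simp
   qed
  qed (use i in auto)
  also have "... = e" using one by simp
  finally show ?thesis .
 qed
 thus "EX n0. ALL n>=n0. ALL x. abs (convol (moll n) c x - c x) <= e" by blast
qed

text \<open>Measurability is not among the assumptions: \<open>lebesgue\<close> is complete, so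
  equality almost everywhere transfers measurability, and both integrals take the default value 0 if
  it fails.\<close>

lemma lebesgue_cong:
 fixes f g :: "'a::euclidean_space => 'b::euclidean_space"
 assumes "AE x in lebesgue. f x = g x"
 shows "integrable lebesgue f \<longleftrightarrow> integrable lebesgue g"
  "(LINT x|lebesgue. f x) = (LINT x|lebesgue. g x)"
proof -
 have m: "f : borel_measurable lebesgue \<longleftrightarrow> g : borel_measurable lebesgue"
 proof -
  have "AE x in lebesgue. g x = f x" using assms by (rule eventually_mono) simp
  thus ?thesis using borel_measurable_AE[of f g] borel_measurable_AE[of g f] assms by blast
 qed
 show i: "integrable lebesgue f \<longleftrightarrow> integrable lebesgue g"
  using m assms integrable_cong_AE[of f lebesgue g] borel_measurable_integrable[of lebesgue f]
   borel_measurable_integrable[of lebesgue g] by blast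
 show "(LINT x|lebesgue. f x) = (LINT x|lebesgue. g x)"
  using m assms i integral_cong_AE[of f lebesgue g]
  by (cases "f : borel_measurable lebesgue")
   (auto simp: not_integrable_integral_eq dest: borel_measurable_integrable)
qed

lemma CS_integral:
 assumes u: "sq_int u" and v: "sq_int v"
 shows "abs (LINT x|lborel. u x * v x) <= sqrt (LINT x|lborel. (u x)^2) * sqrt (LINT x|lborel. (v x)^2)"
proof -
 define A B C where "A = (LINT x|lborel. (u x)^2)" and "B = (LINT x|lborel. u x * v x)"
  and "C = (LINT x|lborel. (v x)^2)"
 have nn: "A >= 0" "C >= 0" by (simp_all add: A_def C_def)
 have q: "0 <= A - 2 * t * B + t^2 * C" for t
 proof -
  have "0 <= (LINT x|lborel. (u x - t * v x)^2)" by simp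
  also have "(%x. (u x - t * v x)^2) = (%x. (u x)^2 - (2 * t) * (u x * v x) + t^2 * (v x)^2)"
   by (auto simp: fun_eq_iff power2_eq_square algebra_simps)
  also have "(LINT x|lborel. ... x) = A - 2 * t * B + t^2 * C"
   using sq_intD(3)[OF u] sq_intD(3)[OF v] sq_int_mult[OF u v]
   by (simp add: A_def B_def C_def)
  finally show ?thesis .
 qed
 have "B^2 <= A * C"
 proof (cases "C = 0")
  case True
  have "B = 0"
  proof (rule ccontr)
   assume "B ~= 0"
   \<comment> \<open>For C = 0 the quadratic takes the value A - (A + 1) = -1 at this t.\<close>
   with q[of "(A + 1) / (2 * B)"] True show False by simp
  qed
  thus ?thesis using True by simp
 next
  case False
  hence "C > 0" using nn by simp
  with q[of "B / C"] have "0 <= A - B^2 / C" by (simp add: power2_eq_square field_simps)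
  thus ?thesis using \<open>C > 0\<close> by (simp add: field_simps)
 qed
 hence "sqrt (B^2) <= sqrt (A * C)" by (rule real_sqrt_le_mono)
 thus ?thesis by (simp add: real_sqrt_mult A_def B_def C_def)
qed

lemma sq_int_bounded_mult:
 assumes "sq_int u" "ze : borel_measurable borel" "!!x. abs (ze x) <= B"
 shows "sq_int (%x. u x * ze x)"
proof -
 note [measurable] = sq_intD(1)[OF assms(1)] assms(2)
 have "integrable lborel (%x. (u x * ze x)^2)"
 proof (rule Bochner_Integration.integrable_bound)
  show "integrable lborel (%x. B^2 * (u x)^2)" using sq_intD(3)[OF assms(1)] by simp
  have "(ze x)^2 <= B^2" for x
   using assms(3)[of x] by (metis abs_ge_zero abs_le_square_iff abs_of_nonneg order_trans)
  thus "AE x in lborel. norm ((u x * ze x)^2) <= norm (B^2 * (u x)^2)"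
   by (auto simp: power_mult_distrib mult.commute[of "B^2"] intro!: mult_left_mono AE_I2)
 qed measurable
 thus ?thesis by (simp add: sq_int_def)
qed

text \<open>Expanding both factors about their limits leaves three error terms, each an inner
  product with at least one factor tending to 0 in L2.\<close>

lemma L2_lim_prod:
 assumes a: "!!n. sq_int (a n)" "sq_int a'"
   "(%n. LINT x|lborel. (a n x - a' x)^2) \<longlonglongrightarrow> 0"
  and b: "!!n. sq_int (b n)" "sq_int b'"
   "(%n. LINT x|lborel. (b n x - b' x)^2) \<longlonglongrightarrow> 0"
  and z: "ze : borel_measurable borel" "!!x. abs (ze x) <= B"
 shows "(%n. LINT x|lborel. a n x * b n x * ze x) \<longlonglongrightarrow> (LINT x|lborel. a' x * b' x * ze x)"
proof -
 define p q where "p n x = a n x - a' x" and "q n x = b n x - b' x" for n x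
 have p: "sq_int (p n)" and q: "sq_int (q n)" for n
  unfolding p_def q_def by (intro sq_int_diff a b)+
 have pl: "(%n. LINT x|lborel. (p n x)^2) \<longlonglongrightarrow> 0" and ql: "(%n. LINT x|lborel. (q n x)^2) \<longlonglongrightarrow> 0"
  unfolding p_def q_def by (rule a b)+
 have zz: "sq_int (%x. u x * ze x)" if "sq_int u" for u
  by (rule sq_int_bounded_mult[OF that z])
 have zero: "(%n. LINT x|lborel. c n x * d n x) \<longlonglongrightarrow> 0"
  if c: "!!n. sq_int (c n)" "(%n. LINT x|lborel. (c n x)^2) \<longlonglongrightarrow> 0"
   and d: "!!n. sq_int (d n)" "(%n. LINT x|lborel. (d n x)^2) \<longlonglongrightarrow> l" for c d l
 proof (rule Lim_null_comparison)
  show "\<forall>\<^sub>F n in sequentially. norm (LINT x|lborel. c n x * d n x) <=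
    sqrt (LINT x|lborel. (c n x)^2) * sqrt (LINT x|lborel. (d n x)^2)"
   using CS_integral[OF c(1) d(1)] by simp
  have "(%n. sqrt (LINT x|lborel. (c n x)^2) * sqrt (LINT x|lborel. (d n x)^2)) \<longlonglongrightarrow> sqrt 0 * sqrt l"
   by (intro tendsto_intros c d)
  thus "(%n. sqrt (LINT x|lborel. (c n x)^2) * sqrt (LINT x|lborel. (d n x)^2)) \<longlonglongrightarrow> 0" by simp
 qed
 have 1: "(%n. LINT x|lborel. p n x * (b' x * ze x)) \<longlonglongrightarrow> 0"
  by (rule zero[OF p pl zz[OF b(2)] tendsto_const])
 have 2: "(%n. LINT x|lborel. q n x * (a' x * ze x)) \<longlonglongrightarrow> 0"
  by (rule zero[OF q ql zz[OF a(2)] tendsto_const])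
 have 3: "(%n. LINT x|lborel. p n x * (q n x * ze x)) \<longlonglongrightarrow> 0"
 proof (rule zero[OF p pl zz[OF q]])
  show "(%n. LINT x|lborel. (q n x * ze x)^2) \<longlonglongrightarrow> 0"
  proof (rule Lim_null_comparison)
   have "norm (LINT x|lborel. (q n x * ze x)^2) <= B^2 * (LINT x|lborel. (q n x)^2)" for n
   proof -
    have "(ze x)^2 <= B^2" for x
     using z(2)[of x] by (metis abs_ge_zero abs_le_square_iff abs_of_nonneg order_trans)
    hence "(LINT x|lborel. (q n x * ze x)^2) <= (LINT x|lborel. B^2 * (q n x)^2)"
     using sq_intD(3)[OF q[of n]] sq_intD(3)[OF zz[OF q[of n]]]
     by (intro integral_mono) (auto simp: power_mult_distrib mult.commute intro!: mult_right_mono)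
    thus ?thesis by simp
   qed
   thus "\<forall>\<^sub>F n in sequentially. norm (LINT x|lborel. (q n x * ze x)^2) <= B^2 * (LINT x|lborel. (q n x)^2)"
    by simp
   show "(%n. B^2 * (LINT x|lborel. (q n x)^2)) \<longlonglongrightarrow> 0"
    using tendsto_mult_left[OF b(3), of "B^2"] by (simp add: q_def)
  qed
 qed
 have i: "integrable lborel (%x. u x * (v x * ze x))" if "sq_int u" "sq_int v" for u v
  using sq_int_mult[OF that(1) zz[OF that(2)]] .
 have "a n x * b n x * ze x = p n x * (b' x * ze x) + q n x * (a' x * ze x) + p n x * (q n x * ze x) + a' x * (b' x * ze x)" for n x
  by (simp add: p_def q_def algebra_simps)
 hence "(LINT x|lborel. a n x * b n x * ze x) =
   (LINT x|lborel. p n x * (b' x * ze x)) + (LINT x|lborel. q n x * (a' x * ze x))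
   + (LINT x|lborel. p n x * (q n x * ze x)) + (LINT x|lborel. a' x * (b' x * ze x))" for n
  using i[OF p b(2)] i[OF q a(2)] i[OF p q] i[OF a(2) b(2)] by simp
 moreover have "(%n. (LINT x|lborel. p n x * (b' x * ze x)) + (LINT x|lborel. q n x * (a' x * ze x))
   + (LINT x|lborel. p n x * (q n x * ze x)) + (LINT x|lborel. a' x * (b' x * ze x))) \<longlonglongrightarrow>
    0 + 0 + 0 + (LINT x|lborel. a' x * (b' x * ze x))"
  by (intro tendsto_add 1 2 3 tendsto_const)
 ultimately show ?thesis by (simp add: mult.assoc)
qed

text \<open>Uniform convergence settles continuous functions of compact support; density and the
  contraction property of convolution on L2 carry it over to u.\<close>

lemma moll_L2:
 assumes u: "sq_int (u :: 'a::euclidean_space => real)"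
 shows "(%n. LINT x|lborel. (convol (moll n) u x - u x)^2) \<longlonglongrightarrow> 0"
proof (rule LIMSEQ_I)
 fix e :: real assume "e > 0"
 \<comment> \<open>The square of a sum of three terms is at most 3 times the sum of the squares,
   hence e / 9 for each of them.\<close>
 obtain c where c: "Cc c" "(LINT x|lborel. (u x - c x)^2) < e / 9"
  using sq_int_dense[OF u, of "e / 9"] \<open>e > 0\<close> by auto
 obtain R where R: "!!x. norm x >= R ==> c x = 0" using c(1) by (auto simp: Cc_def)
 define m where "m = measure lborel (cball (0::'a) (abs R + 1))"
 have "m >= 0" by (simp add: m_def)
 \<comment> \<open>For large n the error for c is at most \<open>et\<close> and lives in the ball of
   volume m, so its squared norm is at most et^2 m < e / 9.\<close>
 define et where "et = sqrt (e / (9 * (m + 1)))"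
 have et: "et > 0" "et^2 = e / (9 * (m + 1))" using \<open>e > 0\<close> \<open>m >= 0\<close> by (auto simp: et_def)
 obtain n0 where n0: "!!n x. n >= n0 ==> abs (convol (moll n) c x - c x) <= et"
  using moll_uniform[OF c(1)] et(1) by blast
 have cs: "sq_int c" by (rule Cc_sq_int[OF c(1)])
 note cL2 = convol_L2[OF Cc_moll moll_nonneg integral_moll]
 have "(LINT x|lborel. (convol (moll n) u x - u x)^2) < e" if "n >= n0" for n
 proof -
  define A where "A x = convol (moll n) (%x. u x - c x) x" for x
  define B where "B x = convol (moll n) c x - c x" for x
  define D where "D x = c x - u x" for x
  have si: "sq_int A" "sq_int B" "sq_int D"
   unfolding A_def B_def D_def using cL2(1) u cs by (auto intro: sq_int_diff)
  have eq: "convol (moll n) u x - u x = A x + B x + D x" for x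
   unfolding A_def B_def D_def by (simp add: convol_diff[OF Cc_moll u cs])
  have IA: "(LINT x|lborel. (A x)^2) < e / 9"
   using cL2(2)[OF sq_int_diff[OF u cs], of n] c(2) by (simp add: A_def)
  have ID: "(LINT x|lborel. (D x)^2) < e / 9"
   using c(2) by (simp add: D_def power2_commute)
  have B0: "B x = 0" if "norm x > abs R + 1" for x
  proof -
   have z: "moll n (x - y) * c y = 0" for y
   proof (cases "norm y >= R")
    case False
    hence "norm (x - y) >= 1"
     using that norm_triangle_ineq2[of x y] by linarith
    moreover have "inverse (real (Suc n)) <= 1" by (simp add: field_simps)
    ultimately show ?thesis using moll_eq_0[of n "x - y"] by simp
   qed (use R in auto)
   have "convol (moll n) c x = 0" unfolding convol_def z by simp
   thus ?thesis using R[of x] that by (simp add: B_def)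
  qed
  have fin: "integrable lborel (indicator (cball (0::'a) (abs R + 1)) :: 'a => real)"
   using emeasure_lborel_cball_finite[of "0::'a" "abs R + 1"] by (intro integrable_real_indicator) auto
  have "(LINT x|lborel. (B x)^2) <= (LINT x|lborel. et^2 * indicator (cball (0::'a) (abs R + 1)) x)"
  proof (rule integral_mono)
   fix x :: 'a
   show "(B x)^2 <= et^2 * indicator (cball (0::'a) (abs R + 1)) x"
   proof (cases "norm x > abs R + 1")
    case False
    have "abs (B x) <= abs et" using n0[OF that, of x] et(1) by (simp add: B_def)
    hence "(B x)^2 <= et^2" by (simp only: abs_le_square_iff)
    thus ?thesis using False by simp
   qed (use B0 in simp)
  qed (use sq_intD(3)[OF si(2)] fin in auto)
  also have "... = et^2 * m" using fin by (simp add: m_def)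
  also have "... < e / 9"
  proof -
   have "m / (m + 1) < 1" using \<open>m >= 0\<close> by simp
   hence "e / 9 * (m / (m + 1)) < e / 9 * 1" using \<open>e > 0\<close> by (intro mult_strict_left_mono) auto
   thus ?thesis unfolding et(2) by simp
  qed
  finally have IB: "(LINT x|lborel. (B x)^2) < e / 9" .
  have "(LINT x|lborel. (convol (moll n) u x - u x)^2) <= (LINT x|lborel. 3 * (A x)^2 + 3 * (B x)^2 + 3 * (D x)^2)"
  proof (rule integral_mono)
   show "(convol (moll n) u x - u x)^2 <= 3 * (A x)^2 + 3 * (B x)^2 + 3 * (D x)^2" for x
   proof -
    have "0 <= (A x - B x)^2 + (A x - D x)^2 + (B x - D x)^2" by simp
    thus ?thesis unfolding eq by (simp add: power2_eq_square algebra_simps)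
   qed
   show "integrable lborel (%x. (convol (moll n) u x - u x)^2)"
    unfolding eq using si by (intro sq_intD(3) sq_int_add) auto
  qed (use si[THEN sq_intD(3)] in auto)
  also have "... = 3 * (LINT x|lborel. (A x)^2) + 3 * (LINT x|lborel. (B x)^2) + 3 * (LINT x|lborel. (D x)^2)"
   using si[THEN sq_intD(3)] by simp
  also have "... < e" using IA IB ID by simp
  finally show ?thesis .
 qed
 thus "EX no. ALL n>=no. norm ((LINT x|lborel. (convol (moll n) u x - u x)^2) - 0) < e"
  by auto
qed

lemma Df_eq_0:
 fixes f :: "'a::real_normed_vector => 'b::real_normed_vector"
 assumes "open U" "x : U" "!!y. y : U ==> f y = 0"
 shows "Df f x v = 0"
proof -
 have "(f has_derivative (%h. 0)) (at x)"
  by (rule has_derivative_transform_within_open[of "%_. 0" _ _ UNIV U]) (use assms in auto)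
 thus ?thesis using frechet_derivative_at[of f "%h. 0" x] by metis
qed

lemma Cc_csupp:
 assumes "continuous_on UNIV f" "compact K" "!!x. x ~: K ==> f x = 0"
 shows "Cc f"
proof -
 obtain R where "!!x. x : K ==> norm x <= R"
  using compact_imp_bounded[OF assms(2)] by (auto simp: bounded_iff)
 hence "ALL x. norm x >= R + 1 --> f x = 0" using assms(3) by force
 thus ?thesis using assms(1) by (auto simp: Cc_def)
qed

lemma Cc_Df:
 assumes "Ck_on 1 UNIV f" "compact K" "!!x. x ~: K ==> f x = 0"
 shows "Cc (%x. Df f x b)" "!!x. x ~: K ==> Df f x b = 0"
proof -
 show *: "Df f x b = 0" if "x ~: K" for x
  by (rule Df_eq_0[of "- K"])
   (use that assms compact_imp_closed in \<open>auto simp: open_Compl\<close>)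
 show "Cc (%x. Df f x b)"
  by (rule Cc_csupp[OF _ assms(2) *]) (use assms(1) in auto)
qed

lemma diff_quotient:
 assumes "(f has_derivative f') (at x)"
 shows "(%n. (f (x + inverse (real (Suc n)) *\<^sub>R b) - f x) / inverse (real (Suc n))) \<longlonglongrightarrow> (f' b :: real)"
proof -
 have "((%t. f (x + t *\<^sub>R b)) has_derivative (%t. f' (t *\<^sub>R b))) (at 0)"
  by (rule has_derivative_compose[of "%t. x + t *\<^sub>R b" "%t. t *\<^sub>R b" 0 UNIV f f'])
   (use assms in \<open>auto intro!: derivative_eq_intros\<close>)
 hence "((%t. f (x + t *\<^sub>R b)) has_real_derivative f' b) (at 0)"
  using linear_scale[OF has_derivative_linear[OF assms]]
  by (simp add: has_field_derivative_def mult.commute[of _ "f' b"])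
 hence "((%h. (f (x + h *\<^sub>R b) - f x) / h) \<longlongrightarrow> f' b) (at 0)"
  by (simp add: DERIV_def)
 moreover have "filterlim (%n. inverse (real (Suc n))) (at 0) sequentially"
  by (intro filterlim_atI LIMSEQ_inverse_real_of_nat) auto
 ultimately show ?thesis by (rule filterlim_compose)
qed

text \<open>The difference quotients have integral 0 by translation invariance; the mean value
  theorem bounds them by a multiple of the indicator of a ball, which justifies the limit.\<close>

lemma integral_deriv_zero:
 fixes f :: "'a::euclidean_space => real"
 assumes "Ck_on 1 UNIV f" "compact K" "!!x. x ~: K ==> f x = 0"
 shows "(LINT x|lborel. Df f x b) = 0"
proof -
 have der: "(f has_derivative Df f x) (at x)" for x
  using assms(1) by (simp add: frechet_derivative_works)
 have cont: "continuous_on UNIV f" using Ck_on_cont[OF assms(1)] .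
 have Ccf: "Cc f" by (rule Cc_csupp[OF cont assms(2,3)])
 note [measurable] = Cc_measurable[OF Ccf]
 note Cd = Cc_Df[OF assms, of b]
 obtain B where B: "B > 0" "!!x. abs (Df f x b) <= B" using Cc_bounded[OF Cd(1)] by blast
 obtain R where R: "!!x. x : K ==> norm x <= R"
  using compact_imp_bounded[OF assms(2)] by (auto simp: bounded_iff)
 define h where "h n = inverse (real (Suc n))" for n
 have h: "0 < h n" "h n <= 1" for n by (auto simp: h_def field_simps)
 define q where "q n x = (f (x + h n *\<^sub>R b) - f x) / h n" for n x
 have qB: "abs (q n x) <= B * indicator (cball 0 (R + norm b)) x" for n x
 proof (cases "x : cball 0 (R + norm b)")
  case True
  have "EX t:{0<..<h n}. f (x + h n *\<^sub>R b) - f (x + 0 *\<^sub>R b) = Df f (x + t *\<^sub>R b) ((h n - 0) *\<^sub>R b)"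
  proof -
   have "((%t. f (x + t *\<^sub>R b)) has_derivative (%s. Df f (x + t *\<^sub>R b) (s *\<^sub>R b))) (at t)" for t
    by (rule has_derivative_compose[of "%t. x + t *\<^sub>R b" "%t. t *\<^sub>R b" t UNIV f])
     (use der in \<open>auto intro!: derivative_eq_intros\<close>)
   thus ?thesis
    using mvt_simple[of 0 "h n" "%t. f (x + t *\<^sub>R b)"
     "%t s. Df f (x + t *\<^sub>R b) (s *\<^sub>R b)"] h(1)[of n]
    by (metis has_derivative_at_withinI)
  qed
  then obtain t where "f (x + h n *\<^sub>R b) - f x = h n * Df f (x + t *\<^sub>R b) b"
   using linear_scale[OF has_derivative_linear[OF der]] by auto
  hence "q n x = Df f (x + t *\<^sub>R b) b" using h(1)[of n] by (simp add: q_def)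
  thus ?thesis using B(2) True by simp
 next
  case False
  hence n: "norm x > R + norm b" by simp
  have "norm (x + h n *\<^sub>R b) >= norm x - norm (h n *\<^sub>R b)"
   using norm_triangle_ineq2[of x "- (h n *\<^sub>R b)"] by simp
  moreover have "norm (h n *\<^sub>R b) <= norm b" using h[of n] by (simp add: mult_left_le_one_le)
  ultimately have "norm (x + h n *\<^sub>R b) > R" using n by linarith
  moreover have "norm x > R" using n norm_ge_zero[of b] by linarith
  ultimately have "x ~: K" "x + h n *\<^sub>R b ~: K" using R by force+
  thus ?thesis using assms(3) False by (simp add: q_def)
 qed
 have "(%n. LINT x|lborel. q n x) \<longlonglongrightarrow> (LINT x|lborel. Df f x b)"
 proof (rule integral_dominated_convergence[where w="%x. B * indicator (cball (0::'a) (R + norm b)) x"])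
  show "(%x. Df f x b) : borel_measurable lborel"
   using Cc_measurable[OF Cd(1)] by simp
  show "q n : borel_measurable lborel" for n unfolding q_def by measurable
  show "integrable lborel (%x. B * indicator (cball (0::'a) (R + norm b)) x)"
   using emeasure_lborel_cball_finite[of "0::'a" "R + norm b"]
   by (intro integrable_mult_right integrable_real_indicator) auto
  show "AE x in lborel. (%n. q n x) \<longlonglongrightarrow> Df f x b"
   unfolding q_def h_def by (intro AE_I2 diff_quotient der)
  show "AE x in lborel. norm (q n x) <= B * indicator (cball (0::'a) (R + norm b)) x" for n
   using qB by simp
 qed
 moreover have "(LINT x|lborel. q n x) = 0" for n
 proof -
  have i: "integrable lborel f" by (rule Cc_integrable[OF Ccf])
  have "(LINT x|lborel. f x) = (\<integral>x. f x \<partial>(distr lborel borel ((+) (h n *\<^sub>R b))))"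
   using lborel_distr_plus[of "h n *\<^sub>R b"] by simp
  also have "... = (LINT x|lborel. f (x + h n *\<^sub>R b))"
   by (subst integral_distr) (auto simp: add.commute)
  finally have e: "(LINT x|lborel. f (x + h n *\<^sub>R b)) = (LINT x|lborel. f x)" ..
  have "integrable lborel (%x. f (h n *\<^sub>R b + x))"
  proof -
   have "integrable (distr lborel borel ((+) (h n *\<^sub>R b))) f"
    using i lborel_distr_plus[of "h n *\<^sub>R b"] by simp
   thus ?thesis by (subst (asm) integrable_distr_eq) auto
  qed
  thus ?thesis using e i by (simp add: q_def add.commute)
 qed
 ultimately have "(%n::nat. 0) \<longlonglongrightarrow> (LINT x|lborel. Df f x b)" by simp
 thus ?thesis by (simp add: LIMSEQ_const_iff)
qed

section \<open>Weak gradients\<close>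

lemma leb_lborel:
 fixes f :: "'a::euclidean_space => 'b::euclidean_space"
 assumes "f : borel_measurable borel"
 shows "integrable lebesgue f \<longleftrightarrow> integrable lborel f" "(LINT x|lebesgue. f x) = (LINT x|lborel. f x)"
 using assms by (simp_all add: integrable_completion integral_completion)

text \<open>The extension by 0 is what gets mollified. The null set is taken in
  \<open>lebesgue\<close>, since u is only Lebesgue measurable.\<close>

definition brep :: "'a::euclidean_space set => ('a => real) => ('a => real) => bool" where
 "brep S u u0 \<longleftrightarrow> sq_int u0 & (AE x in lebesgue. u0 x = indicator S x * u x)"

lemma L2_brep:
 fixes u :: "'a::euclidean_space => real"
 assumes "L2_on S u"
 shows "EX u0. brep S u u0"
proof -
 have m: "(%x. indicator S x * u x) : borel_measurable lebesgue"
  and i: "integrable lebesgue (%x. indicator S x * (u x)^2)"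
  using assms by (auto simp: L2_on_def set_borel_measurable_def set_integrable_def)
 from completion_ex_borel_measurable_real[OF m] obtain u0
  where u0: "u0 : borel_measurable borel" "AE x in lborel. indicator S x * u x = u0 x" by auto
 have ae: "AE x in lebesgue. u0 x = indicator S x * u x"
  using AE_completion[OF u0(2)] by (rule eventually_mono) simp
 hence "AE x in lebesgue. (u0 x)^2 = indicator S x * (u x)^2"
  by (rule eventually_mono) (auto simp: indicator_def)
 from lebesgue_cong(1)[OF this] i have "integrable lebesgue (%x. (u0 x)^2)" by simp
 hence "sq_int u0"
  using u0(1) by (simp add: sq_int_def leb_lborel)
 thus ?thesis using ae by (auto simp: brep_def)
qed

lemma L2_comp:
 fixes g :: "'a::euclidean_space => 'b::euclidean_space"
 assumes "L2_on S g" "b : Basis"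
 shows "L2_on S (%x. g x \<bullet> b)"
proof -
 have m: "(%x. indicator S x *\<^sub>R g x) : borel_measurable lebesgue"
  and i: "integrable lebesgue (%x. indicator S x * (norm (g x))^2)"
  using assms by (auto simp: L2_on_def set_borel_measurable_def set_integrable_def)
 have m': "(%x. indicator S x * (g x \<bullet> b)) : borel_measurable lebesgue"
  using borel_measurable_inner[OF m borel_measurable_const[of b]] by simp
 have "integrable lebesgue (%x. indicator S x * (g x \<bullet> b)^2)"
 proof (rule Bochner_Integration.integrable_bound[OF i])
  have "(%x. (indicator S x * (g x \<bullet> b))^2) : borel_measurable lebesgue"
   using m' by (intro borel_measurable_power)
  also have "(%x. (indicator S x * (g x \<bullet> b))^2) = (%x. indicator S x * (g x \<bullet> b)^2)"
   by (auto simp: fun_eq_iff indicator_def)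
  finally show "(%x. indicator S x * (g x \<bullet> b)^2) : borel_measurable lebesgue" .
  have "(g x \<bullet> b)^2 <= (norm (g x))^2" for x
   using Basis_le_norm[OF assms(2), of "g x"] by (metis abs_ge_zero power2_abs power_mono)
  thus "AE x in lebesgue. norm (indicator S x * (g x \<bullet> b)^2) <= norm (indicator S x * (norm (g x))^2)"
   by (auto simp: indicator_def)
 qed
 thus ?thesis using m' by (simp add: L2_on_def set_borel_measurable_def set_integrable_def)
qed

lemma brep_integral:
 assumes "brep S u u0" "ze : borel_measurable borel"
 shows "(LINT x:S|lebesgue. u x * ze x) = (LINT x|lborel. u0 x * ze x)"
proof -
 have [measurable]: "u0 : borel_measurable borel" using assms by (auto simp: brep_def sq_int_def)
 note assms(2)[measurable]
 have "AE x in lebesgue. indicator S x *\<^sub>R (u x * ze x) = u0 x * ze x"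
  using assms(1) unfolding brep_def by (auto elim!: eventually_mono)
 from lebesgue_cong(2)[OF this] show ?thesis
  unfolding set_lebesgue_integral_def by (simp add: leb_lborel)
qed

lemma brep_integral2:
 assumes "brep S u u0" "brep S v v0" "ze : borel_measurable borel"
 shows "(LINT x:S|lebesgue. u x * v x * ze x) = (LINT x|lborel. u0 x * v0 x * ze x)"
proof -
 have [measurable]: "u0 : borel_measurable borel" "v0 : borel_measurable borel"
  using assms by (auto simp: brep_def sq_int_def)
 note assms(3)[measurable]
 have "AE x in lebesgue. indicator S x *\<^sub>R (u x * v x * ze x) = u0 x * v0 x * ze x"
  using assms(1,2) unfolding brep_def
  by (auto elim!: eventually_elim2 simp: indicator_def)
 from lebesgue_cong(2)[OF this] show ?thesis
  unfolding set_lebesgue_integral_def by (simp add: leb_lborel)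
qed

lemma test_functionI:
 assumes "!!k. Ck_on k UNIV ph" "compact K" "K \<subseteq> S" "!!x. x ~: K ==> ph x = 0"
 shows "test_function S ph"
proof -
 have sub: "closure {x. ph x ~= 0} \<subseteq> K"
  using assms(2,4) by (intro closure_minimal) (auto simp: compact_imp_closed)
 hence "compact (closure {x. ph x ~= 0})"
  using assms(2) by (meson bounded_subset closed_closure compact_eq_bounded_closed)
 thus ?thesis
  using sub assms(1,3) by (auto simp: test_function_def intro: smooth_onI)
qed

text \<open>The weak gradient is tested with y -> moll n (x - y), admissible because its support
  lies in a ball inside S. The sign from the inner derivative cancels the one in the definition of
  the weak gradient.\<close>

lemma convol_weak_gradient:
 assumes w: "has_weak_gradient S u g" and "brep S u u0" "brep S (%x. g x \<bullet> b) gb"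
  and b: "b : Basis" and x: "cball x (inverse (real (Suc n))) \<subseteq> S"
 shows "convol (%z. Df (moll n) z b) u0 x = convol (moll n) gb x"
proof -
 define ph where "ph y = moll n (x - y)" for y
 have ck: "Ck_on k UNIV ph" for k
  unfolding ph_def by (rule Ck_on_compose[OF open_UNIV open_UNIV Ck_on_moll]) (auto intro!: Ck_on_diff)
 have tf: "test_function S ph"
  by (rule test_functionI[OF ck compact_cball x])
   (auto simp: ph_def dist_norm intro!: moll_eq_0)
 have d: "Df ph y b = - Df (moll n) (x - y) b" for y
 proof -
  have "(moll n has_derivative Df (moll n) (x - y)) (at (x - y))"
   using Ck_on_DD[of 0 UNIV "moll n"] Ck_on_moll[where 'a='a, of 1 n] by simp
  hence h: "(ph has_derivative (%h. Df (moll n) (x - y) (- h))) (at y)"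
   unfolding ph_def
   by (intro has_derivative_compose[where f="%y. x - y" and f'="%h. - h" and g="moll n"])
    (auto intro!: derivative_eq_intros)
  have "linear (Df (moll n) (x - y) :: 'a => real)"
   using Ck_on_moll[where 'a='a, of 1 n] by (intro linear_frechet_derivative) simp
  thus ?thesis
   using frechet_derivative_at[OF h, symmetric] by (simp add: linear_neg)
 qed
 have "(%z. Df (moll n) z b) : borel_measurable borel"
  using Ck_on_moll[where 'a='a, of 1 n] by (intro borel_measurable_continuous_onI) auto
 from measurable_compose[OF _ this, of "%y. x - y" borel]
 have m1: "(%y. Df ph y b) : borel_measurable borel"
  unfolding d by (intro borel_measurable_uminus) simp
 have m2: "ph : borel_measurable borel"
  using Ck_on_cont[OF ck] by (intro borel_measurable_continuous_onI)
 have "(LINT y:S|lebesgue. u y * Df ph y b) = - (LINT y:S|lebesgue. (g y \<bullet> b) * ph y)"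
  using w tf b by (simp add: has_weak_gradient_def)
 hence "(LINT y|lborel. u0 y * Df ph y b) = - (LINT y|lborel. gb y * ph y)"
  using brep_integral[OF assms(2) m1] brep_integral[OF assms(3) m2] by simp
 thus ?thesis
  by (simp add: convol_def ph_def d mult.commute)
qed

lemma compact_ball_margin:
 fixes K :: "'a::euclidean_space set"
 assumes "compact K" "open S" "K \<subseteq> S"
 obtains n0 where "!!n x. n >= n0 ==> x : K ==> cball x (inverse (real (Suc n))) \<subseteq> S"
proof -
 obtain e where e: "e > 0" "{y. infdist y K <= e} \<subseteq> S" if "K ~= {}"
  using compact_in_open_separated[OF _ assms(1,2,3)] by metis
 show ?thesis
 proof (cases "K = {}")
  case False
  obtain n0 where n0: "inverse (real (Suc n0)) < e" using reals_Archimedean e(1)[OF False] by blast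
  show ?thesis
  proof (rule that)
   fix n x assume "n >= n0" "x : K"
   have "inverse (real (Suc n)) <= inverse (real (Suc n0))" using \<open>n >= n0\<close> by (simp add: field_simps)
   hence "y : {y. infdist y K <= e}" if "y : cball x (inverse (real (Suc n)))" for y
   proof -
    have "dist y x <= inverse (real (Suc n))"
     using that unfolding mem_cball by (simp only: dist_commute)
    hence "infdist y K <= e"
     using infdist_le[OF \<open>x : K\<close>, of y] \<open>inverse (real (Suc n)) <= inverse (real (Suc n0))\<close> n0
     by linarith
    thus ?thesis by simp
   qed
   thus "cball x (inverse (real (Suc n))) \<subseteq> S" using e(2)[OF False] by blast
  qed
 qed (use that in auto)
qed

text \<open>The sequences \<open>U\<close> and \<open>G\<close> are the mollifications of \<open>u\<close> and of its weak gradient; on a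
 compact subset of \<open>S\<close> the second one is eventually the classical gradient of the first.\<close>

lemma weak_moll:
 assumes S: "open S" and w: "has_weak_gradient S u g" and L2: "L2_on S u" "L2_on S g"
  and u0: "brep S u u0" and g0: "!!b. b : Basis ==> brep S (%x. g x \<bullet> b) (g0 b)"
 obtains U G where
  "!!n. sq_int (U n)" "!!n b. b : Basis ==> sq_int (G n b)"
  "!!n x. (U n has_derivative Df (U n) x) (at x)"
  "!!n b. continuous_on UNIV (%x. Df (U n) x b)"
  "(%n. LINT x|lborel. (U n x - u0 x)^2) \<longlonglongrightarrow> 0"
  "!!b. b : Basis ==> (%n. LINT x|lborel. (G n b x - g0 b x)^2) \<longlonglongrightarrow> 0"
  "!!K. compact K ==> K \<subseteq> S ==>
   EX n0. ALL n>=n0. ALL x:K. ALL b:Basis. Df (U n) x b = G n b x"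
proof -
 have su: "sq_int u0" and sg: "b : Basis ==> sq_int (g0 b)" for b
  using u0 g0 by (auto simp: brep_def)
 define U where "U n = convol (moll n) u0" for n
 define G where "G n b = convol (moll n) (g0 b)" for n b
 define D where "D n b = convol (%z. Df (moll n) z b) u0" for n b
 have Ccd: "Cc (%z::'a. Df (moll n) z b)" for n b
  by (rule Cc_Df(1)[OF Ck_on_moll, where K="cball 0 (inverse (real (Suc n)))"])
   (auto intro: moll_eq_0)
 have der: "(U n has_derivative (%h. SUM b:Basis. (h \<bullet> b) * D n b x)) (at x)" for n x
  unfolding U_def D_def by (rule convol_has_derivative[OF Cc_moll Ck_on_moll su])
 have fd: "Df (U n) x = (%h. SUM b:Basis. (h \<bullet> b) * D n b x)" for n x
  using frechet_derivative_at[OF der] ..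
 have fdb: "Df (U n) x b = D n b x" if "b : Basis" for n x b
  unfolding fd using that by (simp add: inner_Basis if_distrib[where f="%c. c * _"] cong: if_cong)
 show ?thesis
 proof (rule that[of U G])
  show "sq_int (U n)" for n
   unfolding U_def by (rule convol_L2[OF Cc_moll moll_nonneg integral_moll su])
  show "sq_int (G n b)" if "b : Basis" for n b
   unfolding G_def by (rule convol_L2[OF Cc_moll moll_nonneg integral_moll sg[OF that]])
  show "(U n has_derivative Df (U n) x) (at x)" for n x
   unfolding fd by (rule der)
  have "continuous_on UNIV (D n b)" for n b
   unfolding D_def by (rule convol_continuous[OF Ccd su])
  thus "continuous_on UNIV (%x. Df (U n) x b)" for n b
   unfolding fd by (intro continuous_intros)
  show "(%n. LINT x|lborel. (U n x - u0 x)^2) \<longlonglongrightarrow> 0"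
   unfolding U_def by (rule moll_L2[OF su])
  show "(%n. LINT x|lborel. (G n b x - g0 b x)^2) \<longlonglongrightarrow> 0" if "b : Basis" for b
   unfolding G_def by (rule moll_L2[OF sg[OF that]])
  show "EX n0. ALL n>=n0. ALL x:K. ALL b:Basis. Df (U n) x b = G n b x"
   if K: "compact K" "K \<subseteq> S" for K
  proof -
   obtain n0 where "!!n x. n >= n0 ==> x : K ==> cball x (inverse (real (Suc n))) \<subseteq> S"
    using compact_ball_margin[OF K(1) S K(2)] by blast
   hence "ALL n>=n0. ALL x:K. ALL b:Basis. Df (U n) x b = G n b x"
    using convol_weak_gradient[OF w u0 g0] by (simp add: fdb D_def G_def)
   thus ?thesis by blast
  qed
 qed
qed

lemma Ck1_I:
 assumes "!!x. (f has_derivative Df f x) (at x)"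
  "!!b. continuous_on UNIV (%x. Df f x b)"
 shows "Ck_on 1 UNIV f"
 using assms unfolding One_nat_def Ck_on.simps frechet_derivative_works by blast

lemma Df_mult:
 fixes f g :: "'a::real_normed_vector => real"
 assumes "f differentiable (at x)" "g differentiable (at x)"
 shows "Df (%x. f x * g x) x v =
  f x * Df g x v + Df f x v * g x"
 using frechet_derivative_at[OF has_derivative_mult[OF assms[unfolded frechet_derivative_works]], symmetric]
 by simp

text \<open>For the mollifications the integral of the derivative of U^2 ph vanishes, and the
  products converge since all factors converge in L2. The test function is only C^1, which is the
  regularity of the vector fields it is taken from.\<close>

lemma weak_square:
 assumes S: "open S" and w: "has_weak_gradient S u g" and L2: "L2_on S u" "L2_on S g"
  and ph: "Ck_on 1 UNIV ph" "compact K" "K \<subseteq> S" "!!x. x ~: K ==> ph x = 0" and b: "b : Basis"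
 shows "(LINT x:S|lebesgue. u x * u x * Df ph x b)
  = - 2 * (LINT x:S|lebesgue. u x * (g x \<bullet> b) * ph x)"
proof -
 obtain u0 where u0: "brep S u u0" using L2_brep[OF L2(1)] by blast
 have "ALL b:Basis. EX gb. brep S (%x. g x \<bullet> b) gb"
  using L2_brep[OF L2_comp[OF L2(2)]] by blast
 then obtain g0 where g0: "!!b. b : Basis ==> brep S (%x. g x \<bullet> b) (g0 b)" by metis
 obtain U G where U: "!!n. sq_int (U n)" and G: "!!n b. b : Basis ==> sq_int (G n b)"
  and der: "!!n x. (U n has_derivative Df (U n) x) (at x)"
   "!!n b. continuous_on UNIV (%x. Df (U n) x b)"
  and lim: "(%n. LINT x|lborel. (U n x - u0 x)^2) \<longlonglongrightarrow> 0"
   "!!b. b : Basis ==> (%n. LINT x|lborel. (G n b x - g0 b x)^2) \<longlonglongrightarrow> 0"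
  and ev: "!!K. compact K ==> K \<subseteq> S ==>
   EX n0. ALL n>=n0. ALL x:K. ALL b:Basis. Df (U n) x b = G n b x"
  using weak_moll[OF S w L2 u0 g0] by blast
 have su: "sq_int u0" and sg: "sq_int (g0 b)"
  using u0 g0[OF b] by (auto simp: brep_def)
 have ckU: "Ck_on 1 UNIV (U n)" for n by (rule Ck1_I[OF der])
 define dph where "dph x = Df ph x b" for x
 have Cd: "Cc dph" "!!x. x ~: K ==> dph x = 0"
  unfolding dph_def using Cc_Df[OF ph(1,2,4)] by auto
 have Cph: "Cc ph" by (rule Cc_csupp[OF Ck_on_cont[OF ph(1)] ph(2,4)])
 obtain B1 where B1: "!!x. abs (dph x) <= B1" using Cc_bounded[OF Cd(1)] by blast
 obtain B2 where B2: "!!x. abs (ph x) <= B2" using Cc_bounded[OF Cph] by blast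
 note m = Cc_measurable[OF Cd(1)] Cc_measurable[OF Cph]
 obtain n0 where n0: "!!n x. n >= n0 ==> x : K ==> Df (U n) x b = G n b x"
  using ev[OF ph(2,3)] b by blast
 have eq: "(LINT x|lborel. U n x * U n x * dph x) = - 2 * (LINT x|lborel. U n x * G n b x * ph x)" if "n >= n0" for n
 proof -
  have ck: "Ck_on 1 UNIV (%x. U n x * U n x * ph x)"
   by (intro Ck_on_mult ckU ph(1) open_UNIV)
  have df: "U n differentiable (at x)" "ph differentiable (at x)" for x
   using der(1)[of n x] ph(1) by (auto simp: differentiable_def)
  have "Df (%x. U n x * U n x * ph x) x b =
    U n x * U n x * dph x + 2 * (U n x * G n b x * ph x)" for x
  proof (cases "x : K")
   case True
   thus ?thesis
    using n0[OF that True] df[of x]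
    by (simp add: Df_mult dph_def algebra_simps)
  next
   case False
   thus ?thesis
    using df[of x] Cd(2)[of x] ph(4)[of x] by (simp add: Df_mult dph_def)
  qed
  hence "(LINT x|lborel. U n x * U n x * dph x + 2 * (U n x * G n b x * ph x)) = 0"
   using integral_deriv_zero[OF ck ph(2), of b] ph(4) by simp
  moreover have "integrable lborel (%x. U n x * (U n x * dph x))" "integrable lborel (%x. U n x * (G n b x * ph x))"
   using U G[OF b] B1 B2 m by (auto intro!: sq_int_mult sq_int_bounded_mult)
  ultimately show ?thesis by (simp add: mult.assoc)
 qed
 have l1: "(%n. LINT x|lborel. U n x * U n x * dph x) \<longlonglongrightarrow> (LINT x|lborel. u0 x * u0 x * dph x)"
  by (rule L2_lim_prod[OF U su lim(1) U su lim(1) m(1) B1])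
 have l2: "(%n. - 2 * (LINT x|lborel. U n x * G n b x * ph x)) \<longlonglongrightarrow> - 2 * (LINT x|lborel. u0 x * g0 b x * ph x)"
  by (intro tendsto_mult_left L2_lim_prod[OF U su lim(1) G[OF b] sg lim(2)[OF b] m(2) B2])
 have "(%n. LINT x|lborel. U n x * U n x * dph x) \<longlonglongrightarrow> - 2 * (LINT x|lborel. u0 x * g0 b x * ph x)"
  by (rule Lim_transform_eventually[OF l2]) (use eq in \<open>auto simp: eventually_sequentially intro!: exI[of _ n0]\<close>)
 hence "(LINT x|lborel. u0 x * u0 x * dph x) = - 2 * (LINT x|lborel. u0 x * g0 b x * ph x)"
  using l1 LIMSEQ_unique by blast
 thus ?thesis
  using brep_integral2[OF u0 u0 m(1)] brep_integral2[OF u0 g0[OF b] m(2)]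
  by (simp add: dph_def)
qed

lemma Ck_on_prod:
 fixes f :: "'i => 'a::real_normed_vector => real"
 assumes "open U" "!!i. i : I ==> Ck_on k U (f i)"
 shows "Ck_on k U (%x. PROD i:I. f i x)"
 using assms(2)
 by (induction I rule: infinite_finite_induct) (auto intro!: Ck_on_mult assms(1))

text \<open>\<open>th\<close> is smooth and positive exactly on the open box, so th / (th + 1/(n+1))
  tends to its indicator.\<close>

lemma box_indicator_approx:
 fixes c d :: "'a::euclidean_space"
 obtains ph :: "nat => 'a => real" where
  "!!n k. Ck_on k UNIV (ph n)" "!!n x. 0 <= ph n x & ph n x <= indicator (box c d) x"
  "!!x. (%n. ph n x) \<longlonglongrightarrow> indicator (box c d) x"
proof -
 define th where "th x = (PROD i:Basis. fexp 0 (x \<bullet> i - c \<bullet> i) * fexp 0 (d \<bullet> i - x \<bullet> i))" for x :: 'a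
 have fe: "fexp 0 t >= 0" "fexp 0 t > 0 \<longleftrightarrow> t > 0" for t
  by (auto simp: fexp_def)
 have nn: "th x >= 0" for x unfolding th_def by (intro prod_nonneg ballI mult_nonneg_nonneg fe)
 have pos: "th x > 0" if "x : box c d" for x
  unfolding th_def using that by (intro prod_pos ballI mult_pos_pos) (auto simp: fe box_def)
 have zero: "th x = 0" if x: "x ~: box c d" for x
 proof -
  obtain i where i: "i : Basis" "\<not> (c \<bullet> i < x \<bullet> i & x \<bullet> i < d \<bullet> i)" using x by (auto simp: box_def)
  hence "fexp 0 (x \<bullet> i - c \<bullet> i) = 0 \<or> fexp 0 (d \<bullet> i - x \<bullet> i) = 0"
   by (auto simp: fexp_def)
  thus ?thesis unfolding th_def using i(1) by (intro prod_zero) auto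
 qed
 have flat: "Ck_on k UNIV (%x::'a. fexp 0 (g x))" if "Ck_on k UNIV g" for g k
  by (rule Ck_on_compose[OF open_UNIV open_UNIV Ck_on_fexp that]) auto
 have ck: "Ck_on k UNIV th" for k
  unfolding th_def
  by (intro Ck_on_prod Ck_on_mult flat Ck_on_diff Ck_on_inner Ck_on_id Ck_on_const open_UNIV)
 define ph where "ph n x = th x / (th x + inverse (real (Suc n)))" for n x
 have p: "th x + inverse (real (Suc n)) > 0" for n x using nn[of x] by (simp add: add_nonneg_pos)
 show ?thesis
 proof (rule that[of ph])
  show "Ck_on k UNIV (ph n)" for n k
   unfolding ph_def using p[THEN less_imp_neq]
   by (intro Ck_on_divide Ck_on_add ck Ck_on_const open_UNIV) (metis)
  show "0 <= ph n x & ph n x <= indicator (box c d) x" for n x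
   using nn[of x] p[of x n] zero[of x] by (cases "x : box c d") (auto simp: ph_def field_simps)
  show "(%n. ph n x) \<longlonglongrightarrow> indicator (box c d) x" for x
  proof (cases "x : box c d")
   case True
   have "(%n. th x / (th x + inverse (real (Suc n)))) \<longlonglongrightarrow> th x / (th x + 0)"
    using pos[OF True] by (intro tendsto_intros LIMSEQ_inverse_real_of_nat) auto
   thus ?thesis using pos[OF True] True by (simp add: ph_def)
  qed (use zero in \<open>simp add: ph_def\<close>)
 qed
qed

text \<open>Testing with smooth approximations of indicators shows that h has integral 0 over every
  box in S. Lebesgue differentiation along shrinking cubes then gives h = 0 almost everywhere on a
  box, and countably many boxes exhaust S.\<close>

lemma fundamental_lemma:
 fixes h :: "'a::euclidean_space => real"
 assumes S: "open S" and loc: "!!K. compact K ==> K \<subseteq> S ==> set_integrable lebesgue K h"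
  and zero: "!!ph. test_function S ph ==> (LINT x:S|lebesgue. h x * ph x) = 0"
 shows "AE x in lebesgue. x : S --> h x = 0"
proof -
 have cube: "integral (cbox c d) h = 0" if cd: "cbox c d \<subseteq> S" for c d
 proof -
  obtain ph :: "nat => 'a => real" where ph: "!!n k. Ck_on k UNIV (ph n)"
   "!!n x. 0 <= ph n x & ph n x <= indicator (box c d) x"
   "!!x. (%n. ph n x) \<longlonglongrightarrow> indicator (box c d) x"
   using box_indicator_approx[of c d] by blast
  have out: "ph n x = 0" if "x ~: cbox c d" for n x
  proof -
   have "x ~: box c d" using that box_subset_cbox[of c d] by blast
   thus ?thesis using ph(2)[of n x] by simp
  qed
  have tf: "test_function S (ph n)" for n
   by (rule test_functionI[OF ph(1) compact_cbox cd out])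
  have i: "integrable lebesgue (%x. indicator (cbox c d) x * h x)"
   using loc[OF compact_cbox cd] by (simp add: set_integrable_def)
  have eq: "indicator S x *\<^sub>R (h x * ph n x) = (indicator (cbox c d) x * h x) * ph n x" for x n
   using out[of x n] cd by (auto simp: indicator_def)
  have mphi: "ph n : borel_measurable lebesgue" for n
   using Ck_on_cont[OF ph(1)] by (intro measurable_completion) (simp add: borel_measurable_continuous_onI)
  have "(%n. LINT x|lebesgue. (indicator (cbox c d) x * h x) * ph n x) \<longlonglongrightarrow>
    (LINT x|lebesgue. (indicator (cbox c d) x * h x) * indicator (box c d) x)"
  proof (rule integral_dominated_convergence[where w="%x. abs (indicator (cbox c d) x * h x)"])
   show "integrable lebesgue (%x. abs (indicator (cbox c d) x * h x))" using integrable_abs[OF i] by simp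
   show "AE x in lebesgue. norm ((indicator (cbox c d) x * h x) * ph n x) <= abs (indicator (cbox c d) x * h x)" for n
   proof (rule AE_I2)
    fix x
    have "abs (ph n x) <= 1" using ph(2)[of n x] by (cases "x : box c d") auto
    thus "norm ((indicator (cbox c d) x * h x) * ph n x) <= abs (indicator (cbox c d) x * h x)"
     using mult_left_mono[of "abs (ph n x)" 1 "abs (indicator (cbox c d) x * h x)"] by (simp add: abs_mult)
   qed
   show "AE x in lebesgue. (%n. (indicator (cbox c d) x * h x) * ph n x) \<longlonglongrightarrow>
     (indicator (cbox c d) x * h x) * indicator (box c d) x"
    by (intro AE_I2 tendsto_mult tendsto_const ph)
  qed (use borel_measurable_integrable[OF i] mphi in \<open>auto intro!: borel_measurable_times borel_measurable_indicator\<close>)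
  moreover have "(%n. LINT x|lebesgue. (indicator (cbox c d) x * h x) * ph n x) = (%n. 0)"
   using zero[OF tf] unfolding set_lebesgue_integral_def eq by (rule ext)
  ultimately have "(%n::nat. 0) \<longlonglongrightarrow> (LINT x|lebesgue. (indicator (cbox c d) x * h x) * indicator (box c d) x)"
   by (simp only:)
  hence zero_box: "(LINT x|lebesgue. (indicator (cbox c d) x * h x) * indicator (box c d) x) = 0"
   unfolding LIMSEQ_const_iff by (rule sym)
  have "AE x in lebesgue. (indicator (cbox c d) x * h x) * indicator (box c d) x = indicator (cbox c d) x * h x"
  proof -
   have "AE x in lebesgue. x ~: cbox c d - box c d"
    using negligible_frontier_interval[of c d] by (intro AE_not_in) (simp add: negligible_iff_null_sets)
   thus ?thesis by (rule eventually_mono) (auto simp: indicator_def)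
  qed
  from lebesgue_cong(2)[OF this] zero_box have "(LINT x|lebesgue. indicator (cbox c d) x * h x) = 0"
   by (simp only:)
  thus ?thesis
   using set_lebesgue_integral_eq_integral(2)[OF loc[OF compact_cbox cd]]
   by (simp add: set_lebesgue_integral_def)
 qed
 have local: "AE x in lebesgue. x : cbox a b --> h x = 0" if ab: "cbox a b \<subseteq> S" for a b
 proof -
  define f where "f x = (if x : cbox a b then h x else 0)" for x
  have "h absolutely_integrable_on cbox a b" by (rule loc[OF compact_cbox ab])
  hence "f absolutely_integrable_on UNIV"
   unfolding f_def by (simp add: absolutely_integrable_restrict_UNIV)
  hence "f integrable_on cbox c d" for c d
   by (meson absolutely_integrable_on_def integrable_on_subcbox top_greatest)
  then obtain N where N: "negligible N" and
   lim: "!!x e. \<lbrakk>x ~: N; 0 < e\<rbrakk> \<Longrightarrow> EX d>0. ALL t. 0 < t & t < d -->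
             norm (integral (cbox x (x + t *\<^sub>R One)) f /\<^sub>R t ^ DIM('a) - f x) < e"
   using integrable_ccontinuous_explicit[of f] by blast
  have "f x = 0" if x: "x : box a b" "x ~: N" for x
  proof (rule ccontr)
   assume "f x ~= 0"
   then obtain d where d: "d > 0" "!!t. 0 < t ==> t < d ==>
     norm (integral (cbox x (x + t *\<^sub>R One)) f /\<^sub>R t ^ DIM('a) - f x) < norm (f x)"
    using lim[OF x(2), of "norm (f x)"] by auto
   obtain r where r: "r > 0" "ball x r \<subseteq> box a b" using open_contains_ball[of "box a b"] open_box x(1) by blast
   \<comment> \<open>The first bound serves the differentiation estimate; the second keeps the cube
     of side t inside the ball of radius r.\<close>
   define t where "t = min (d / 2) (r / (2 * DIM('a)))"
   have t: "t > 0" "t < d" "t * DIM('a) < r" using d(1) r(1) by (auto simp: t_def min_def field_simps)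
   have sub: "cbox x (x + t *\<^sub>R One) \<subseteq> cbox a b"
   proof
    fix y assume y: "y : cbox x (x + t *\<^sub>R One)"
    have "norm (y - x) <= (SUM i:Basis. abs ((y - x) \<bullet> i))" by (rule norm_le_l1)
    also have "... <= (SUM i:(Basis::'a set). t)"
     by (rule sum_mono) (use y in \<open>auto simp: mem_box inner_diff_left inner_add_left\<close>)
    also have "... < r" using t(3) by (simp add: mult.commute)
    finally show "y : cbox a b" using r(2) box_subset_cbox[of a b] by (auto simp: dist_norm norm_minus_commute)
   qed
   have "integral (cbox x (x + t *\<^sub>R One)) f = integral (cbox x (x + t *\<^sub>R One)) h"
    by (rule integral_cong) (use sub in \<open>auto simp: f_def\<close>)
   also have "... = 0" using cube sub ab by blast
   finally show False using d(2)[OF t(1,2)] by simp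
  qed
  hence hz: "h x = 0" if "x : box a b" "x ~: N" for x
   using that box_subset_cbox[of a b] by (metis f_def subsetD)
  have "AE x in lebesgue. x ~: N" using N by (intro AE_not_in) (simp add: negligible_iff_null_sets)
  moreover have "AE x in lebesgue. x ~: cbox a b - box a b"
   using negligible_frontier_interval[of a b] by (intro AE_not_in) (simp add: negligible_iff_null_sets)
  ultimately show ?thesis by (rule eventually_elim2) (use hz in blast)
 qed
 obtain DD where D: "countable DD" "!!X. X : DD ==> X \<subseteq> S" "!!X. X : DD ==> EX a b. X = cbox a b" "\<Union>DD = S"
  by (rule open_countable_Union_open_cbox[OF S]) blast
 have "AE x in lebesgue. ALL X:DD. x : X --> h x = 0"
  unfolding AE_ball_countable[OF D(1)]
 proof
  fix X assume "X : DD"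
  then obtain a b where "X = cbox a b" using D(3) by blast
  thus "AE x in lebesgue. x : X --> h x = 0" using local[of a b] D(2)[OF \<open>X : DD\<close>] by simp
 qed
 thus ?thesis by (rule eventually_mono) (use D(4) in blast)
qed

lemma set_int_mult:
 fixes h ph :: "'a::euclidean_space => real"
 assumes "set_integrable lebesgue K h" "continuous_on UNIV ph" "!!x. abs (ph x) <= B"
 shows "set_integrable lebesgue K (%x. h x * ph x)"
 unfolding set_integrable_def
proof (rule Bochner_Integration.integrable_bound)
 show "integrable lebesgue (%x. B * (indicator K x *\<^sub>R h x))"
  using assms(1) by (simp add: set_integrable_def)
 have "ph : borel_measurable lebesgue"
  using assms(2) by (intro measurable_completion) (simp add: borel_measurable_continuous_onI)
 from borel_measurable_times[OF borel_measurable_integrable[OF assms(1)[unfolded set_integrable_def]] this]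
 show "(%x. indicator K x *\<^sub>R (h x * ph x)) : borel_measurable lebesgue" by (simp add: mult.assoc)
 show "AE x in lebesgue. norm (indicator K x *\<^sub>R (h x * ph x)) <= norm (B * (indicator K x *\<^sub>R h x))"
 proof (rule AE_I2)
  fix x
  have "abs (h x) * abs (ph x) <= abs (h x) * abs B" using assms(3)[of x] by (intro mult_left_mono) auto
  thus "norm (indicator K x *\<^sub>R (h x * ph x)) <= norm (B * (indicator K x *\<^sub>R h x))"
   by (auto simp: indicator_def abs_mult mult.commute)
 qed
qed

text \<open>This makes \<open>weak_grad\<close>, an arbitrary choice, usable: what is known of one
  weak gradient holds almost everywhere for the chosen one.\<close>

lemma weak_unique:
 assumes S: "open S" and g: "has_weak_gradient S u g" and g': "has_weak_gradient S u g'"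
 shows "AE x in lebesgue. x : S --> g x = g' x"
proof -
 have "AE x in lebesgue. x : S --> (g x - g' x) \<bullet> b = 0" if b: "b : Basis" for b
 proof (rule fundamental_lemma[OF S])
  have comp: "set_integrable lebesgue K (%x. f x \<bullet> b)" if "set_integrable lebesgue K f" for f and K :: "'a set"
  proof -
   have "integrable lebesgue (%x. (indicator K x *\<^sub>R f x) \<bullet> b)"
    using that by (simp only: set_integrable_def integrable_inner_left)
   thus ?thesis by (simp add: set_integrable_def)
  qed
  have loc: "set_integrable lebesgue K (%x. g x \<bullet> b)" "set_integrable lebesgue K (%x. g' x \<bullet> b)"
   if "compact K" "K \<subseteq> S" for K
   using g g' that comp by (auto simp: has_weak_gradient_def)
  show "set_integrable lebesgue K (%x. (g x - g' x) \<bullet> b)" if "compact K" "K \<subseteq> S" for K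
   unfolding inner_diff_left by (intro set_integral_diff loc that)
  show "(LINT x:S|lebesgue. (g x - g' x) \<bullet> b * ph x) = 0" if tf: "test_function S ph" for ph
  proof -
   define K where "K = closure {x. ph x ~= 0}"
   have K: "compact K" "K \<subseteq> S" using tf by (auto simp: test_function_def K_def)
   have out: "ph x = 0" if "x ~: K" for x using that closure_subset[of "{x. ph x ~= 0}"] by (auto simp: K_def)
   have c: "continuous_on UNIV ph"
    using tf smooth_Ck[of UNIV ph 0] by (simp add: test_function_def)
   obtain B where B: "!!x. abs (ph x) <= B" using Cc_bounded[OF Cc_csupp[OF c K(1) out]] by blast
   have eq: "(LINT x:S|lebesgue. f x * ph x) = (LINT x:K|lebesgue. f x * ph x)" for f
    unfolding set_lebesgue_integral_def
    by (intro Bochner_Integration.integral_cong) (use out K(2) in \<open>auto simp: indicator_def\<close>)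
   have "(LINT x:S|lebesgue. (g x \<bullet> b) * ph x) = (LINT x:S|lebesgue. (g' x \<bullet> b) * ph x)"
   proof -
    have "(LINT x:S|lebesgue. u x * Df ph x b) = - (LINT x:S|lebesgue. (g x \<bullet> b) * ph x)"
     "(LINT x:S|lebesgue. u x * Df ph x b) = - (LINT x:S|lebesgue. (g' x \<bullet> b) * ph x)"
     using g g' tf b unfolding has_weak_gradient_def by blast+
    thus ?thesis by linarith
   qed
   hence "(LINT x:K|lebesgue. (g x \<bullet> b) * ph x - (g' x \<bullet> b) * ph x) = 0"
    unfolding eq
    using set_int_mult[OF loc(1)[OF K] c B] set_int_mult[OF loc(2)[OF K] c B]
    by (simp add: set_integral_diff)
   thus ?thesis unfolding eq by (simp add: inner_diff_left left_diff_distrib)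
  qed
 qed
 hence "AE x in lebesgue. ALL b:Basis. x : S --> (g x - g' x) \<bullet> b = 0"
  by (subst AE_finite_all) auto
 thus ?thesis
  by (rule eventually_mono) (auto simp: inner_diff_left intro: euclidean_eqI)
qed

lemma L2_on_AE:
 fixes g g' :: "'a::euclidean_space => 'b::euclidean_space"
 assumes "L2_on S g" "AE x in lebesgue. x : S --> g x = g' x"
 shows "L2_on S g'"
proof -
 have 1: "AE x in lebesgue. indicator S x *\<^sub>R g x = indicator S x *\<^sub>R g' x"
  using assms(2) by (rule eventually_mono) (auto simp: indicator_def)
 have 2: "AE x in lebesgue. indicator S x *\<^sub>R (norm (g x))^2 = indicator S x *\<^sub>R (norm (g' x))^2"
  using assms(2) by (rule eventually_mono) (auto simp: indicator_def)
 show ?thesis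
  using assms(1) borel_measurable_AE[OF _ 1] lebesgue_cong(1)[OF 2]
  by (auto simp: L2_on_def set_borel_measurable_def set_integrable_def)
qed

lemma H1_weak_grad:
 assumes "open S" "u : H1 S"
 shows "L2_on S u" "has_weak_gradient S u (weak_grad S u)" "L2_on S (weak_grad S u)"
proof -
 obtain g where g: "L2_on S u" "has_weak_gradient S u g" "L2_on S g"
  using assms(2) by (auto simp: H1_def)
 show "L2_on S u" by fact
 show w: "has_weak_gradient S u (weak_grad S u)"
  unfolding weak_grad_def by (rule someI[of "has_weak_gradient S u"]) (rule g(2))
 show "L2_on S (weak_grad S u)"
  by (rule L2_on_AE[OF g(3) weak_unique[OF assms(1) g(2) w]])
qed

text \<open>The product rule for div (u^2 F) in integrated form, summed from
  \<open>weak_square\<close> over the components of F.\<close>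

lemma weak_square_field:
 assumes S: "open S" and w: "has_weak_gradient S u g" and L2: "L2_on S u" "L2_on S g"
  and F: "Ck_on 1 UNIV F" "compact K" "K \<subseteq> S" "!!x. x ~: K ==> F x = 0"
 shows "(LINT x:S|lebesgue. (u x)^2 * (SUM b:Basis. Df F x b \<bullet> b))
  = - 2 * (LINT x:S|lebesgue. u x * (g x \<bullet> F x))"
proof -
 obtain u0 where u0: "brep S u u0" using L2_brep[OF L2(1)] by blast
 have "ALL b:Basis. EX gb. brep S (%x. g x \<bullet> b) gb"
  using L2_brep[OF L2_comp[OF L2(2)]] by blast
 then obtain g0 where g0: "!!b. b : Basis ==> brep S (%x. g x \<bullet> b) (g0 b)" by metis
 have su: "sq_int u0" and sg: "b : Basis ==> sq_int (g0 b)" for b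
  using u0 g0 by (auto simp: brep_def)
 define ph where "ph b x = F x \<bullet> b" for b x
 have ck: "Ck_on 1 UNIV (ph b)" for b unfolding ph_def by (intro Ck_on_inner F Ck_on_const open_UNIV)
 have out: "x ~: K ==> ph b x = 0" for b x using F(4) by (simp add: ph_def)
 have dph: "Df F x b \<bullet> b = Df (ph b) x b" for x b
 proof -
  have "(F has_derivative Df F x) (at x)" using F(1) by (simp add: frechet_derivative_works)
  from has_derivative_inner_left[OF this, of b]
  have "(ph b has_derivative (%h. Df F x h \<bullet> b)) (at x)" by (simp add: ph_def[abs_def])
  from frechet_derivative_at[OF this] show ?thesis by metis
 qed
 have Cph: "Cc (ph b)" for b by (rule Cc_csupp[OF Ck_on_cont[OF ck] F(2) out])
 have Cd: "Cc (%x. Df (ph b) x b)" for b by (rule Cc_Df(1)[OF ck F(2) out])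
 have int1: "integrable lborel (%x. u0 x * (u0 x * Df (ph b) x b))" for b
 proof -
  obtain B where "!!x. abs (Df (ph b) x b) <= B" using Cc_bounded[OF Cd[of b]] by blast
  thus ?thesis by (intro sq_int_mult su sq_int_bounded_mult Cc_measurable Cd)
 qed
 have int2: "integrable lborel (%x. u0 x * (g0 b x * ph b x))" if "b : Basis" for b
 proof -
  obtain B where "!!x. abs (ph b x) <= B" using Cc_bounded[OF Cph[of b]] by blast
  thus ?thesis by (intro sq_int_mult su sg that sq_int_bounded_mult Cc_measurable Cph)
 qed
 have meas: "(%x. SUM b:Basis. Df F x b \<bullet> b) : borel_measurable borel"
  unfolding dph by (intro borel_measurable_sum Cc_measurable Cd)
 have "(LINT x:S|lebesgue. (u x)^2 * (SUM b:Basis. Df F x b \<bullet> b))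
  = (LINT x|lborel. u0 x * u0 x * (SUM b:Basis. Df (ph b) x b))"
  using brep_integral2[OF u0 u0 meas] by (simp add: power2_eq_square dph)
 also have "... = (SUM b:Basis. \<integral>x. u0 x * (u0 x * Df (ph b) x b) \<partial>lborel)"
  using int1 by (simp add: sum_distrib_left mult.assoc)
 also have "... = (SUM b:Basis. - 2 * (LINT x|lborel. u0 x * (g0 b x * ph b x)))"
 proof (rule sum.cong[OF refl])
  fix b :: 'a assume b: "b : Basis"
  show "(LINT x|lborel. u0 x * (u0 x * Df (ph b) x b)) = - 2 * (LINT x|lborel. u0 x * (g0 b x * ph b x))"
   using weak_square[OF S w L2 ck F(2,3) out b, of b]
    brep_integral2[OF u0 u0 Cc_measurable[OF Cd[of b]]]
    brep_integral2[OF u0 g0[OF b] Cc_measurable[OF Cph[of b]]] by (simp add: mult.assoc)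
 qed
 also have "... = - 2 * (LINT x|lborel. (SUM b:Basis. u0 x * (g0 b x * ph b x)))"
  using int2 by (simp add: sum_distrib_left)
 also have "(LINT x|lborel. (SUM b:Basis. u0 x * (g0 b x * ph b x))) = (LINT x:S|lebesgue. u x * (g x \<bullet> F x))"
 proof -
  have "AE x in lebesgue. ALL b:Basis. g0 b x = indicator S x * (g x \<bullet> b)"
   using g0 by (subst AE_finite_all) (auto simp: brep_def)
  moreover have "AE x in lebesgue. u0 x = indicator S x * u x" using u0 by (simp add: brep_def)
  ultimately have "AE x in lebesgue. (SUM b:Basis. u0 x * (g0 b x * ph b x)) = indicator S x *\<^sub>R (u x * (g x \<bullet> F x))"
  proof eventually_elim
   case (elim x)
   have "(SUM b:Basis. u0 x * (g0 b x * ph b x)) = (SUM b:Basis. indicator S x * (u x * ((g x \<bullet> b) * (F x \<bullet> b))))"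
    by (rule sum.cong) (use elim in \<open>auto simp: ph_def indicator_def\<close>)
   also have "... = indicator S x *\<^sub>R (u x * (g x \<bullet> F x))"
    by (subst euclidean_inner[of "g x"]) (simp add: sum_distrib_left)
   finally show ?case .
  qed
  note ae = this
  have "(%x. SUM b:Basis. u0 x * (g0 b x * ph b x)) : borel_measurable borel"
   using sq_intD(1)[OF su] sq_intD(1)[OF sg] Cc_measurable[OF Cph]
   by (intro borel_measurable_sum borel_measurable_times) auto
  thus ?thesis
   using lebesgue_cong(2)[OF ae] by (simp add: leb_lborel set_lebesgue_integral_def)
 qed
 finally show ?thesis .
qed

section \<open>Change of variables estimates under local diffeomorphisms\<close>

lemma emeasure_vimage_cube:
 fixes Ph :: "'a::euclidean_space => 'a"
 assumes c: "c > 0" "!!y y'. y : B ==> y' : B ==> c * norm (y - y') <= norm (Ph y - Ph y')"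
  and uv: "!!i. i : Basis ==> v \<bullet> i - u \<bullet> i = s" and s: "s >= 0"
 shows "emeasure lborel (B Int Ph -` cbox u v) <= ennreal ((2 * DIM('a) / c) ^ DIM('a)) * emeasure lborel (cbox u v)"
proof (cases "B Int Ph -` cbox u v = {}")
 case False
 then obtain y0 where y0: "y0 : B" "Ph y0 : cbox u v" by auto
 \<comment> \<open>An expansive map pulls a set of diameter d back to one of diameter at most d / c,
   and a cube of side s has diameter at most s times the dimension.\<close>
 define R where "R = DIM('a) * s / c"
 have R: "R >= 0" using s c(1) by (simp add: R_def)
 have "B Int Ph -` cbox u v \<subseteq> cbox (y0 - R *\<^sub>R One) (y0 + R *\<^sub>R One)"
 proof
  fix y assume y: "y : B Int Ph -` cbox u v"
  have "norm (Ph y - Ph y0) <= (SUM i:Basis. abs ((Ph y - Ph y0) \<bullet> i))" by (rule norm_le_l1)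
  also have "... <= (SUM i:(Basis::'a set). s)"
  proof (rule sum_mono)
   fix i :: 'a assume i: "i : Basis"
   have "u \<bullet> i <= Ph y \<bullet> i" "Ph y \<bullet> i <= v \<bullet> i" "u \<bullet> i <= Ph y0 \<bullet> i" "Ph y0 \<bullet> i <= v \<bullet> i"
    using y y0(2) i by (auto simp: mem_box)
   thus "abs ((Ph y - Ph y0) \<bullet> i) <= s" using uv[OF i] by (simp add: inner_diff_left)
  qed
  finally have "norm (Ph y - Ph y0) <= DIM('a) * s" by simp
  with c(2)[of y y0] y y0 have "c * norm (y - y0) <= DIM('a) * s" by auto
  hence n: "norm (y - y0) <= R" using c(1) by (simp add: R_def field_simps)
  show "y : cbox (y0 - R *\<^sub>R One) (y0 + R *\<^sub>R One)"
   unfolding mem_box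
  proof
   fix i :: 'a assume i: "i : Basis"
   have "abs ((y - y0) \<bullet> i) <= R" using Basis_le_norm[OF i, of "y - y0"] n by linarith
   thus "(y0 - R *\<^sub>R One) \<bullet> i <= y \<bullet> i & y \<bullet> i <= (y0 + R *\<^sub>R One) \<bullet> i"
    using i by (simp add: inner_diff_left inner_add_left abs_le_iff)
  qed
 qed
 hence "emeasure lborel (B Int Ph -` cbox u v) <= emeasure lborel (cbox (y0 - R *\<^sub>R One) (y0 + R *\<^sub>R One))"
  by (intro emeasure_mono) auto
 also have "... = ennreal (PROD i:(Basis::'a set). 2 * R)"
 proof -
  have "(y0 + R *\<^sub>R One - (y0 - R *\<^sub>R One)) \<bullet> i = 2 * R" if "i : Basis" for i
   using that by (simp add: algebra_simps)
  moreover have "ALL i:Basis. (y0 - R *\<^sub>R One) \<bullet> i <= (y0 + R *\<^sub>R One) \<bullet> i"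
   using R by (simp add: algebra_simps)
  ultimately show ?thesis
   by (simp add: emeasure_lborel_cbox_eq)
 qed
 also have "(PROD i:(Basis::'a set). 2 * R) = (2 * DIM('a) / c) ^ DIM('a) * (PROD i:(Basis::'a set). s)"
  by (simp add: R_def power_mult_distrib[symmetric] mult.assoc)
 also have "ennreal ... = ennreal ((2 * DIM('a) / c) ^ DIM('a)) * ennreal (PROD i:(Basis::'a set). s)"
  using c(1) s by (intro ennreal_mult) auto
 also have "ennreal (PROD i:(Basis::'a set). s) = emeasure lborel (cbox u v)"
 proof -
  have "u \<bullet> i <= v \<bullet> i" if "i : Basis" for i using uv[OF that] s by linarith
  thus ?thesis using uv by (simp add: emeasure_lborel_cbox_eq inner_diff_left)
 qed
 finally show ?thesis .
qed simp

text \<open>An upper bound for measures of preimages takes the place of the transformation formula;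
  null sets and L2 bounds of compositions follow from it. Outer regularity puts E into a slightly
  larger open U, the relevant part of E is covered by non-overlapping dyadic cubes inside U, and
  each cube is treated by \<open>emeasure_vimage_cube\<close>.\<close>

lemma emeasure_vimage_exp:
 fixes Ph :: "'a::euclidean_space => 'a"
 assumes B: "compact B" and cont: "continuous_on B Ph" and
  c: "c > 0" "!!y y'. y : B ==> y' : B ==> c * norm (y - y') <= norm (Ph y - Ph y')"
  and E: "E : sets borel"
 shows "emeasure lborel (B Int Ph -` E) <= ennreal ((2 * DIM('a) / c) ^ DIM('a)) * emeasure lborel E"
proof -
 define C where "C = ennreal ((2 * DIM('a) / c) ^ DIM('a))"
 have Cfin: "C < top" by (simp add: C_def)
 define Ps where "Ps y = (if y : B then Ph y else 0)" for y
 have Ps: "Ps : borel_measurable borel"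
  unfolding Ps_def using B cont
  by (intro borel_measurable_continuous_on_if) (auto intro: borel_closed compact_imp_closed)
 have meas: "B Int Ph -` Q : sets borel" if "Q : sets borel" for Q
 proof -
  have "B Int Ph -` Q = B Int (Ps -` Q Int space borel)" by (auto simp: Ps_def)
  thus ?thesis
   using measurable_sets[OF Ps that] borel_closed[OF compact_imp_closed[OF B]] by simp
 qed
 obtain L0 where L0: "!!y. y : B ==> norm (Ph y) <= L0"
  using compact_imp_bounded[OF compact_continuous_image[OF cont B]] by (auto simp: bounded_iff)
 \<comment> \<open>Ph(B) lies in the cube of half-side L about 0, so only the part of E in that cube
   has to be covered.\<close>
 define L where "L = abs L0 + 1"
 have L: "L > 0" "norm (Ph y) <= L" if "y : B" for y using L0[OF that] by (auto simp: L_def)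
 have Lpos: "L > 0" by (simp add: L_def)
 have main: "emeasure lborel (B Int Ph -` E) <= C * (emeasure lborel E + ennreal e)" if "e > 0" for e
 proof -
  obtain U where U: "open U" "E \<subseteq> U" "emeasure lborel (U - E) <= ennreal e"
   using outer_regular_lborel_le[OF E \<open>e > 0\<close>] by blast
  have eU: "emeasure lborel U <= emeasure lborel E + ennreal e"
  proof -
   have "emeasure lborel U = emeasure lborel (E \<union> (U - E))" using U(2) by (simp add: Un_absorb1)
   also have "... <= emeasure lborel E + emeasure lborel (U - E)"
    using E U(1) by (intro emeasure_subadditive) auto
   finally show ?thesis using U(3) by (meson add_left_mono order_trans)
  qed
  define a b :: 'a where "a = - L *\<^sub>R One" and "b = L *\<^sub>R One"
  have ab: "b \<bullet> i - a \<bullet> i = 2 * L" if "i : Basis" for i using that by (simp add: a_def b_def)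
  have "a \<bullet> i < b \<bullet> i" if "i : Basis" for i using ab[OF that] Lpos by linarith
  hence ne: "box a b ~= {}" by (simp add: box_ne_empty)
  \<comment> \<open>This gauge forces every cube tagged by a point of E to lie in U.\<close>
  define g where "g x = (if x : U then U else UNIV)" for x
  have "gauge g" using U(1) by (auto simp: gauge_def g_def)
  then obtain DD where D: "countable DD" "!!Q. Q : DD ==> interior Q ~= {} & (EX c d. Q = cbox c d)"
   "pairwise (%A B. interior A Int interior B = {}) DD"
   "!!Q. Q : DD ==> EX x : (E Int cbox a b) Int Q. Q \<subseteq> g x"
   "!!u v. cbox u v : DD ==> EX n. ALL i : Basis. v \<bullet> i - u \<bullet> i = (b \<bullet> i - a \<bullet> i) / 2^n"
   "E Int cbox a b \<subseteq> \<Union>DD"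
   using covering_lemma[of "E Int cbox a b" a b g] ne by (metis inf_le2)
  have DU: "Q \<subseteq> U" if "Q : DD" for Q
   using D(4)[OF that] U(2) by (auto simp: g_def split: if_splits)
  have cube: "emeasure lborel (B Int Ph -` Q) <= C * emeasure lborel (interior Q)" if Q: "Q : DD" for Q
  proof -
   obtain u v where uv: "Q = cbox u v" using D(2)[OF Q] by blast
   then obtain n :: nat where n: "!!i. i : Basis ==> v \<bullet> i - u \<bullet> i = (b \<bullet> i - a \<bullet> i) / 2^n"
    using D(5) Q by blast
   have "emeasure lborel (B Int Ph -` Q) <= C * emeasure lborel Q"
    unfolding uv C_def
    by (rule emeasure_vimage_cube[OF c, where s="2 * L / 2 ^ n"]) (use n ab Lpos in auto)
   also have "emeasure lborel Q = emeasure lborel (interior Q)"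
    by (simp add: uv emeasure_lborel_cbox_eq emeasure_lborel_box_eq)
   finally show ?thesis .
  qed
  \<comment> \<open>An enumeration padded with empty sets, valid for finite and infinite
    \<open>DD\<close> alike.\<close>
  define F where "F n = (if n : to_nat_on DD ` DD then from_nat_into DD n else {})" for n
  have FD: "F n : DD" if "n : to_nat_on DD ` DD" for n
   using that D(1) by (auto simp: F_def)
  have Fin: "F n = {} \<or> F n : DD" for n using FD[of n] by (auto simp: F_def)
  have FU: "\<Union>DD \<subseteq> (UN n. F n)"
  proof
   fix x assume "x : \<Union>DD"
   then obtain Q where Q: "Q : DD" "x : Q" by blast
   hence "F (to_nat_on DD Q) = Q" using D(1) by (simp add: F_def)
   thus "x : (UN n. F n)" using Q(2) by blast
  qed
  have disj: "disjoint_family (%n. interior (F n))"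
   unfolding disjoint_family_on_def
  proof (intro ballI impI)
   fix m n :: nat assume mn: "m ~= n"
   show "interior (F m) Int interior (F n) = {}"
   proof (cases "m : to_nat_on DD ` DD & n : to_nat_on DD ` DD")
    case True
    hence "F m ~= F n" using mn D(1) by (auto simp: F_def)
    thus ?thesis using D(3) FD True by (auto simp: pairwise_def)
   qed (auto simp: F_def)
  qed
  have Fb: "F n : sets borel" for n using Fin[of n] D(2)[of "F n"] by auto
  have "emeasure lborel (B Int Ph -` E) <= emeasure lborel (UN n. B Int Ph -` F n)"
  proof (rule emeasure_mono)
   show "B Int Ph -` E \<subseteq> (UN n. B Int Ph -` F n)"
   proof
    fix y assume y: "y : B Int Ph -` E"
    have "Ph y : cbox a b"
     unfolding mem_box
    proof
     fix i :: 'a assume i: "i : Basis"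
     have "norm (Ph y) <= L" by (rule L(2)) (use y in simp)
     hence "abs (Ph y \<bullet> i) <= L" using Basis_le_norm[OF i, of "Ph y"] by linarith
     thus "a \<bullet> i <= Ph y \<bullet> i & Ph y \<bullet> i <= b \<bullet> i" using i by (auto simp: a_def b_def abs_le_iff)
    qed
    hence "Ph y : \<Union>DD" using D(6) y by blast
    thus "y : (UN n. B Int Ph -` F n)" using FU y by blast
   qed
   show "(UN n. B Int Ph -` F n) : sets lborel"
    using meas[OF Fb] by (intro sets.countable_UN) auto
  qed
  also have "... <= (\<Sum>n. emeasure lborel (B Int Ph -` F n))"
   using meas[OF Fb] by (intro emeasure_subadditive_countably) auto
  also have "... <= (\<Sum>n. C * emeasure lborel (interior (F n)))"
  proof (rule suminf_le)
   show "emeasure lborel (B Int Ph -` F n) <= C * emeasure lborel (interior (F n))" for n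
    using Fin[of n] cube[of "F n"] by auto
  qed auto
  also have "... = C * (\<Sum>n. emeasure lborel (interior (F n)))" by simp
  also have "(\<Sum>n. emeasure lborel (interior (F n))) = emeasure lborel (UN n. interior (F n))"
   by (rule suminf_emeasure[OF _ disj]) auto
  also have "C * ... <= C * emeasure lborel U"
  proof (intro mult_left_mono emeasure_mono)
   show "(UN n. interior (F n)) \<subseteq> U" using Fin DU interior_subset by fast
  qed (use U(1) in auto)
  also have "... <= C * (emeasure lborel E + ennreal e)" by (intro mult_left_mono eU) auto
  finally show ?thesis .
 qed
 show ?thesis
 proof (cases "emeasure lborel E = top")
  case True
  have "C > 0" unfolding C_def using c(1) by (simp add: ennreal_zero_less_mult_iff)
  thus ?thesis using True c(1) by (simp add: C_def ennreal_mult_top)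
 next
  case False
  show ?thesis unfolding C_def[symmetric]
  proof (rule ennreal_le_epsilon)
   fix e :: real assume "0 < e"
   define k where "k = (2 * DIM('a) / c) ^ DIM('a)"
   have k: "k >= 0" "C = ennreal k" using c(1) by (auto simp: k_def C_def)
   have "emeasure lborel (B Int Ph -` E) <= C * (emeasure lborel E + ennreal (e / (k + 1)))"
    using main[of "e / (k + 1)"] \<open>0 < e\<close> k(1) by simp
   also have "... = C * emeasure lborel E + ennreal (k * (e / (k + 1)))"
    using k \<open>0 < e\<close> ennreal_mult[of k "e / (k + 1)"] by (simp add: distrib_left)
   also have "... <= C * emeasure lborel E + ennreal e"
   proof -
    have "k * (e / (k + 1)) = e * (k / (k + 1))" by simp
    also have "... <= e * 1" using k(1) \<open>0 < e\<close> by (intro mult_left_mono) auto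
    finally have "k * (e / (k + 1)) <= e" by simp
    thus ?thesis by (intro add_left_mono ennreal_leI)
   qed
   finally show "emeasure lborel (B Int Ph -` E) <= C * emeasure lborel E + ennreal e" .
  qed
 qed
qed

text \<open>The estimate for sets is an inequality between the push-forward of Lebesgue measure on B
  and a multiple of Lebesgue measure, and integrals are monotone in the measure.\<close>

lemma nn_int_expansive:
 fixes Ph :: "'a::euclidean_space => 'a"
 assumes B: "compact B" and cont: "continuous_on B Ph" and
  c: "c > 0" "!!y y'. y : B ==> y' : B ==> c * norm (y - y') <= norm (Ph y - Ph y')"
  and f: "f : borel_measurable borel"
 shows "(\<integral>\<^sup>+y. indicator B y * f (Ph y) \<partial>lborel)
  <= ennreal ((2 * DIM('a) / c) ^ DIM('a)) * (\<integral>\<^sup>+x. f x \<partial>lborel)"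
proof -
 define Ps where "Ps y = (if y : B then Ph y else 0)" for y
 have Ps[measurable]: "Ps : borel_measurable borel"
  unfolding Ps_def using B cont
  by (intro borel_measurable_continuous_on_if) (auto intro: borel_closed compact_imp_closed)
 have [measurable]: "B : sets borel" using B by (auto intro: borel_closed compact_imp_closed)
 note f[measurable]
 define M where "M = distr (density lborel (indicator B)) borel Ps"
 define N where "N = density (lborel :: 'a measure) (%_. ennreal ((2 * DIM('a) / c) ^ DIM('a)))"
 have "M <= N"
 proof -
  have "emeasure M E <= emeasure N E" for E
  proof (cases "E : sets borel")
   case True
   note True[measurable]
   have "emeasure M E = emeasure lborel (B Int Ph -` E)"
   proof -
    have "emeasure M E = (\<integral>\<^sup>+y. indicator B y * indicator (Ps -` E) y \<partial>lborel)"
     using measurable_sets[OF Ps True] by (simp add: M_def emeasure_distr emeasure_density)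
    also have "... = (\<integral>\<^sup>+y. indicator (B Int Ps -` E) y \<partial>lborel)"
     by (simp add: indicator_inter_arith)
    also have "... = emeasure lborel (B Int Ps -` E)"
     using measurable_sets[OF Ps True] by (intro nn_integral_indicator) auto
    also have "B Int Ps -` E = B Int Ph -` E" by (auto simp: Ps_def)
    finally show ?thesis .
   qed
   also have "... <= emeasure N E"
    using emeasure_vimage_exp[OF B cont c True] True
    by (simp add: N_def emeasure_density nn_integral_cmult)
   finally show ?thesis .
  next
   case False
   thus ?thesis by (simp add: emeasure_notin_sets M_def N_def)
  qed
  thus ?thesis by (auto simp: le_measure_iff M_def N_def le_fun_def)
 qed
 hence "nn_integral M f <= nn_integral N f"
  by (intro nn_integral_mono_measure) (auto simp: M_def N_def)
 moreover have "nn_integral M f = (\<integral>\<^sup>+y. indicator B y * f (Ph y) \<partial>lborel)"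
 proof -
  have "nn_integral M f = (\<integral>\<^sup>+y. indicator B y * f (Ps y) \<partial>lborel)"
   unfolding M_def by (subst nn_integral_distr) (simp_all add: nn_integral_density)
  also have "... = (\<integral>\<^sup>+y. indicator B y * f (Ph y) \<partial>lborel)"
   by (intro nn_integral_cong) (auto simp: Ps_def indicator_def)
  finally show ?thesis .
 qed
 moreover have "nn_integral N f = ennreal ((2 * DIM('a) / c) ^ DIM('a)) * (\<integral>\<^sup>+x. f x \<partial>lborel)"
  unfolding N_def by (simp add: nn_integral_density nn_integral_cmult)
 ultimately show ?thesis by simp
qed

text \<open>The quantitative half of the inverse function theorem: near y0, the map Ph minus its
  derivative at y0 is Lipschitz with constant c / 2, where c bounds that derivative from
  below.\<close>

lemma local_expansion:
 fixes Ph :: "'a::euclidean_space => 'a"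
 assumes W: "open W" and ck: "Ck_on 1 W Ph" and y0: "y0 : W" and inj: "inj (Df Ph y0)"
 shows "EX r>0. EX c>0. cball y0 r \<subseteq> W &
  (ALL y:cball y0 r. ALL y':cball y0 r. c * norm (y - y') <= norm (Ph y - Ph y'))"
proof -
 define A where "A y = Df Ph y" for y
 have der: "(Ph has_derivative A y) (at y)" if "y : W" for y
  using ck that by (simp add: A_def frechet_derivative_works)
 have lin: "linear (A y)" if "y : W" for y using der[OF that] by (simp add: has_derivative_linear)
 obtain c where c: "c > 0" "!!h. c * norm h <= norm (A y0 h)"
  using linear_inj_bounded_below_pos[OF lin[OF y0]] inj by (auto simp: A_def)
 \<comment> \<open>Perturbing each column by at most e changes the operator norm by at most c /
   2.\<close>
 define e where "e = c / (2 * DIM('a))"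
 have e: "e > 0" using c(1) by (simp add: e_def)
 have contb: "continuous_on W (%y. A y b)" for b using ck by (simp add: A_def)
 have "ALL b:Basis. EX d>0. ALL y. dist y y0 < d --> y : W --> dist (A y b) (A y0 b) < e"
  using contb y0 e unfolding continuous_on_iff by meson
 then obtain D where D: "!!b. b : Basis ==> D b > (0::real)"
  "!!b y. b : Basis ==> dist y y0 < D b ==> y : W ==> dist (A y b) (A y0 b) < e" by metis
 obtain r0 where r0: "r0 > 0" "cball y0 r0 \<subseteq> W" using open_contains_cball W y0 by blast
 define r where "r = min r0 (Min (D ` Basis) / 2)"
 have "Min (D ` Basis) > 0" using D(1) by simp
 hence r: "r > 0" "r <= r0" using r0(1) by (auto simp: r_def)
 have rD: "r < D b" if "b : Basis" for b
 proof -
  have "Min (D ` Basis) <= D b" using that by simp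
  thus ?thesis using \<open>Min (D ` Basis) > 0\<close> min.cobounded2[of r0 "Min (D ` Basis) / 2"] unfolding r_def by linarith
 qed
 have sub: "cball y0 r \<subseteq> W" using r0(2) r(2) by (meson order_trans subset_cball)
 have est: "c / 2 * norm (y - y') <= norm (Ph y - Ph y')" if y: "y : cball y0 r" "y' : cball y0 r" for y y'
 proof -
  have "norm ((%z. Ph z - A y0 z) y - (%z. Ph z - A y0 z) y') <= c / 2 * norm (y - y')"
  proof (rule differentiable_bound[of "cball y0 r" _ "%z h. A z h - A y0 h"])
   fix z assume z: "z : cball y0 r"
   hence zW: "z : W" using sub by blast
   show "((%z. Ph z - A y0 z) has_derivative (%h. A z h - A y0 h)) (at z within cball y0 r)"
    by (rule has_derivative_at_withinI[OF has_derivative_diff[OF der[OF zW]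
       linear_imp_has_derivative[OF lin[OF y0]]]])
   show "onorm (%h. A z h - A y0 h) <= c / 2"
   proof (rule onorm_le)
    fix h :: 'a
    have "A z h - A y0 h = (SUM b:Basis. (h \<bullet> b) *\<^sub>R (A z b - A y0 b))"
    proof -
     have "A z h = (SUM b:Basis. (h \<bullet> b) *\<^sub>R A z b)" if "z : W" for z
      by (subst (1) euclidean_representation[symmetric, of h])
       (simp only: linear_sum[OF lin[OF that]] linear_scale[OF lin[OF that]])
     from this[OF zW] this[OF y0] show ?thesis by (simp add: scaleR_diff_right sum_subtractf)
    qed
    also have "norm ... <= (SUM b:(Basis::'a set). norm h * e)"
    proof (rule order_trans[OF norm_sum], rule sum_mono)
     fix b :: 'a assume b: "b : Basis"
     have "norm (A z b - A y0 b) <= e"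
      using D(2)[OF b _ zW] rD[OF b] z by (auto simp: dist_norm norm_minus_commute)
     thus "norm ((h \<bullet> b) *\<^sub>R (A z b - A y0 b)) <= norm h * e"
      using Basis_le_norm[OF b, of h] by (simp add: mult_mono)
    qed
    also have "... = c / 2 * norm h" by (simp add: e_def)
    finally show "norm (A z h - A y0 h) <= c / 2 * norm h" .
   qed
  qed (use y in auto)
  hence "norm ((Ph y - Ph y') - A y0 (y - y')) <= c / 2 * norm (y - y')"
   by (simp add: linear_diff[OF lin[OF y0]] algebra_simps)
  moreover have "norm (A y0 (y - y')) - norm (Ph y - Ph y') <= norm ((Ph y - Ph y') - A y0 (y - y'))"
   using norm_triangle_ineq2[of "A y0 (y - y')" "Ph y - Ph y'"] by (simp add: norm_minus_commute)
  ultimately show ?thesis using c(2)[of "y - y'"] by linarith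
 qed
 show ?thesis
  by (intro exI[of _ r] exI[of _ "c / 2"] conjI r(1) sub ballI est) (use c(1) in auto)
qed

text \<open>Finitely many balls on which Ph is expansive cover K; overlaps only enlarge the
  right-hand side, and the constants add up.\<close>

lemma nn_int_diffeo:
 fixes Ph :: "'a::euclidean_space => 'a"
 assumes W: "open W" and ck: "Ck_on 1 W Ph" and inj: "!!y. y : W ==> inj (Df Ph y)"
  and K: "compact K" "K \<subseteq> W"
 obtains C :: real where "C >= 0" "!!f. f : borel_measurable borel ==>
  (\<integral>\<^sup>+y. indicator K y * f (Ph y) \<partial>lborel) <= ennreal C * (\<integral>\<^sup>+x. f x \<partial>lborel)"
proof -
 have cont: "continuous_on W Ph" by (rule Ck_on_cont[OF ck])
 have "ALL y:K. EX r>0. EX c>0. cball y r \<subseteq> W &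
  (ALL z:cball y r. ALL z':cball y r. c * norm (z - z') <= norm (Ph z - Ph z'))"
  using local_expansion[OF W ck] inj K(2) by blast
 then obtain r c where rc: "!!y. y : K ==> r y > (0::real)" "!!y. y : K ==> c y > (0::real)"
  "!!y. y : K ==> cball y (r y) \<subseteq> W"
  "!!y z z'. y : K ==> z : cball y (r y) ==> z' : cball y (r y) ==> c y * norm (z - z') <= norm (Ph z - Ph z')"
  by metis
 have "\<exists>T\<subseteq>K. finite T & K \<subseteq> (UN y:T. ball y (r y))"
  by (rule compactE_image[OF K(1), of K "%y. ball y (r y)"]) (use rc(1) in auto)
 then obtain T where T: "T \<subseteq> K" "finite T" "K \<subseteq> (UN y:T. ball y (r y))" by blast
 define k where "k y = (2 * DIM('a) / c y) ^ DIM('a)" for y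
 show ?thesis
 proof (rule that[of "SUM y:T. k y"])
  show "(SUM y:T. k y) >= 0" using rc(2) T(1) by (intro sum_nonneg) (auto simp: k_def less_imp_le subset_iff)
  fix f :: "'a => ennreal" assume f: "f : borel_measurable borel"
  have meas: "(%z. indicator (cball y (r y)) z * f (Ph z)) : borel_measurable borel" if "y : T" for y
  proof -
   have "(%z. if z : cball y (r y) then Ph z else 0) : borel_measurable borel"
    using rc(3) T(1) that cont
    by (intro borel_measurable_continuous_on_if) (auto intro: continuous_on_subset)
   from measurable_compose[OF this f]
   have "(%z. indicator (cball y (r y)) z * f (if z : cball y (r y) then Ph z else 0)) : borel_measurable borel"
    by (intro borel_measurable_times_ennreal borel_measurable_indicator) auto
   also have "(%z. indicator (cball y (r y)) z * f (if z : cball y (r y) then Ph z else 0)) =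
     (%z. indicator (cball y (r y)) z * f (Ph z))" by (auto simp: fun_eq_iff indicator_def)
   finally show ?thesis .
  qed
  have "(\<integral>\<^sup>+y. indicator K y * f (Ph y) \<partial>lborel) <= (\<integral>\<^sup>+z. (SUM y:T. indicator (cball y (r y)) z * f (Ph z)) \<partial>lborel)"
  proof (rule nn_integral_mono)
   fix z :: 'a
   show "indicator K z * f (Ph z) <= (SUM y:T. indicator (cball y (r y)) z * f (Ph z))"
   proof (cases "z : K")
    case True
    then obtain y where y: "y : T" "z : ball y (r y)" using T(3) by blast
    have "indicator K z * f (Ph z) = indicator (cball y (r y)) z * f (Ph z)" using True y(2) by simp
    also have "... <= (SUM y:T. indicator (cball y (r y)) z * f (Ph z))"
     by (rule member_le_sum) (use y T(2) in auto)
    finally show ?thesis .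
   qed simp
  qed
  also have "... = (SUM y:T. \<integral>\<^sup>+z. indicator (cball y (r y)) z * f (Ph z) \<partial>lborel)"
   using meas by (intro nn_integral_sum) auto
  also have "... <= (SUM y:T. ennreal (k y) * (\<integral>\<^sup>+x. f x \<partial>lborel))"
  proof (rule sum_mono)
   fix y assume "y : T"
   hence y: "y : K" using T(1) by blast
   show "(\<integral>\<^sup>+z. indicator (cball y (r y)) z * f (Ph z) \<partial>lborel) <= ennreal (k y) * (\<integral>\<^sup>+x. f x \<partial>lborel)"
    unfolding k_def
    by (rule nn_int_expansive[OF compact_cball continuous_on_subset[OF cont rc(3)[OF y]] rc(2)[OF y] rc(4)[OF y] f])
  qed
  also have "... = ennreal (SUM y:T. k y) * (\<integral>\<^sup>+x. f x \<partial>lborel)"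
  proof -
   have "k y >= 0" if "y : T" for y
    using rc(2)[of y] T(1) that by (auto simp: k_def less_imp_le)
   hence "ennreal (SUM y:T. k y) = (SUM y:T. ennreal (k y))" by (intro sum_ennreal[symmetric])
   thus ?thesis by (simp add: sum_distrib_right)
  qed
  finally show "(\<integral>\<^sup>+y. indicator K y * f (Ph y) \<partial>lborel) <= ennreal (SUM y:T. k y) * (\<integral>\<^sup>+x. f x \<partial>lborel)" .
 qed
qed

lemma nn_integral_square:
 assumes "sq_int u"
 shows "(\<integral>\<^sup>+x. ennreal ((u x)^2) \<partial>lborel) = ennreal (LINT x|lborel. (u x)^2)"
 using sq_intD(3)[OF assms] by (simp add: nn_integral_eq_integral)

text \<open>The extension by 0 turns composition with Ph into a bounded operator on L2 of the whole
  space.\<close>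

definition cutc :: "'a set => ('a::euclidean_space => 'a) => ('a => real) => 'a => real" where
 "cutc K Ph u y = (if y : K then u (Ph y) else 0)"

lemma cutc_L2:
 assumes K: "compact K" and cont: "continuous_on K Ph"
  and C: "!!f. f : borel_measurable borel ==>
   (\<integral>\<^sup>+y. indicator K y * f (Ph y) \<partial>lborel) <= ennreal C * (\<integral>\<^sup>+x. f x \<partial>lborel)" "C >= 0"
  and u: "sq_int u"
 shows "sq_int (cutc K Ph u)"
  "(LINT y|lborel. (cutc K Ph u y)^2) <= C * (LINT x|lborel. (u x)^2)"
proof -
 have Kb: "K : sets borel" using K by (auto intro: borel_closed compact_imp_closed)
 note [measurable] = sq_intD(1)[OF u] Kb
 have "(%y. if y : K then Ph y else 0) : borel_measurable borel"
  using Kb cont by (intro borel_measurable_continuous_on_if) auto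
 note [measurable] = this
 have "(%y. if y : K then u (if y : K then Ph y else 0) else 0) : borel_measurable borel"
  by measurable
 also have "(%y. if y : K then u (if y : K then Ph y else 0) else 0) = cutc K Ph u"
  by (auto simp: cutc_def fun_eq_iff)
 finally have m[measurable]: "cutc K Ph u : borel_measurable borel" .
 have "(\<integral>\<^sup>+y. ennreal ((cutc K Ph u y)^2) \<partial>lborel) = (\<integral>\<^sup>+y. indicator K y * ennreal ((u (Ph y))^2) \<partial>lborel)"
  by (intro nn_integral_cong) (auto simp: cutc_def)
 also have "... <= ennreal C * (\<integral>\<^sup>+x. ennreal ((u x)^2) \<partial>lborel)"
  by (rule C(1)) measurable
 also have "... = ennreal (C * (LINT x|lborel. (u x)^2))"
  using C(2) by (simp add: nn_integral_square[OF u] ennreal_mult)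
 finally have le: "(\<integral>\<^sup>+y. ennreal ((cutc K Ph u y)^2) \<partial>lborel) <= ennreal (C * (LINT x|lborel. (u x)^2))" .
 have "integrable lborel (%y. (cutc K Ph u y)^2)"
  by (rule integrableI_nonneg) (use le in \<open>auto simp: le_less_trans\<close>)
 thus si: "sq_int (cutc K Ph u)" by (simp add: sq_int_def)
 show "(LINT y|lborel. (cutc K Ph u y)^2) <= C * (LINT x|lborel. (u x)^2)"
  using le C(2) by (simp add: nn_integral_square[OF si])
qed

text \<open>Applied to the indicator of a Borel null set, the integral bound says that its preimage
  in K is null.\<close>

lemma local_diffeo_AE:
 fixes Ph :: "'a::euclidean_space => 'a"
 assumes C: "!!f. f : borel_measurable borel ==>
   (\<integral>\<^sup>+y. indicator K y * f (Ph y) \<partial>lborel) <= ennreal C * (\<integral>\<^sup>+x. f x \<partial>lborel)"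
  and K: "compact K" and cont: "continuous_on K Ph" and P: "AE x in lebesgue. P x"
 shows "AE y in lebesgue. y : K --> P (Ph y)"
proof -
 have "AE x in lborel. P x" using P by (simp add: AE_completion_iff)
 then obtain N where N: "N : null_sets lborel" "{x. \<not> P x} \<subseteq> N" by (auto simp: eventually_ae_filter)
 have Nb[measurable]: "N : sets borel" using N(1) by auto
 have Kb[measurable]: "K : sets borel" using K by (auto intro: borel_closed compact_imp_closed)
 have [measurable]: "(%y. if y : K then Ph y else 0) : borel_measurable borel"
  using Kb cont by (intro borel_measurable_continuous_on_if) auto
 have "(\<integral>\<^sup>+y. indicator K y * indicator N (Ph y) \<partial>lborel) <= ennreal C * (\<integral>\<^sup>+x. indicator N x \<partial>lborel)"
  by (rule C) measurable
 also have "... = 0" using N(1) by (simp add: null_setsD1)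
 finally have "(\<integral>\<^sup>+y. indicator K y * indicator N (Ph y) \<partial>lborel) = 0" by simp
 also have "(%y. indicator K y * indicator N (Ph y) :: ennreal) =
   (%y. indicator K y * indicator N (if y : K then Ph y else 0))"
  by (auto simp: fun_eq_iff indicator_def)
 finally have "AE y in lborel. indicator K y * indicator N (if y : K then Ph y else 0) = (0::ennreal)"
  by (subst (asm) nn_integral_0_iff_AE) auto
 hence "AE y in lborel. y : K --> P (Ph y)"
  by (rule eventually_mono) (use N(2) in \<open>auto simp: indicator_def split: if_splits\<close>)
 thus ?thesis by (rule AE_completion)
qed

lemma set_integrable_cut:
 fixes h :: "'a::euclidean_space => real"
 assumes K: "compact K" and si: "sq_int v" and out: "!!y. y ~: K ==> v y = 0"
  and ze: "continuous_on K ze" and ae: "AE y in lebesgue. y : K --> v y = h y"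
 shows "set_integrable lebesgue K (%y. h y * ze y)"
proof -
 have Kb[measurable]: "K : sets borel" using K by (auto intro: borel_closed compact_imp_closed)
 define z where "z y = (if y : K then ze y else 0)" for y
 have zm: "z : borel_measurable borel"
  unfolding z_def using Kb ze by (intro borel_measurable_continuous_on_if) auto
 obtain B where B: "!!y. y : K ==> norm (ze y) <= B"
  using compact_imp_bounded[OF compact_continuous_image[OF ze K]] by (auto simp: bounded_iff)
 hence zB: "abs (z y) <= abs B" for y by (force simp: z_def)
 have si1: "sq_int (indicator K :: 'a => real)"
  using K emeasure_compact_finite[OF K] by (auto simp: sq_int_def power2_eq_square indicator_inter_arith[symmetric])
 have i: "integrable lborel (%y. indicator K y * (v y * z y))"
  by (intro sq_int_mult si1 sq_int_bounded_mult[OF si zm zB])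
 hence i: "integrable lebesgue (%y. indicator K y * (v y * z y))"
  using leb_lborel(1)[OF borel_measurable_integrable[OF i, simplified]] by simp
 have "AE y in lebesgue. indicator K y * (v y * z y) = indicator K y *\<^sub>R (h y * ze y)"
  using ae by (rule eventually_mono) (auto simp: z_def indicator_def)
 from lebesgue_cong(1)[OF this] i show ?thesis by (simp add: set_integrable_def)
qed

text \<open>Classical chain rule for the mollifications of u, then passage to the limit. Composition
  with Ph is bounded on L2 over the compact support of the test function, so the L2 convergence of
  the mollifications and of their gradients survives it.\<close>

lemma weak_compose:
 fixes Ph :: "'a::euclidean_space => 'a"
 assumes S: "open S" and w: "has_weak_gradient S u g" and L2: "L2_on S u" "L2_on S g"
  and W: "open W" and ck: "Ck_on 1 W Ph" and inj: "!!y. y : W ==> inj (Df Ph y)"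
  and WS: "Ph ` W \<subseteq> S"
 shows "has_weak_gradient W (%y. u (Ph y)) (%y. SUM b:Basis. (g (Ph y) \<bullet> Df Ph y b) *\<^sub>R b)"
proof -
 obtain u0 where u0: "brep S u u0" using L2_brep[OF L2(1)] by blast
 have "ALL b:Basis. EX gb. brep S (%x. g x \<bullet> b) gb"
  using L2_brep[OF L2_comp[OF L2(2)]] by blast
 then obtain g0 where g0: "!!b. b : Basis ==> brep S (%x. g x \<bullet> b) (g0 b)" by metis
 have su: "sq_int u0" and sg: "b : Basis ==> sq_int (g0 b)" for b
  using u0 g0 by (auto simp: brep_def)
 have cont: "continuous_on W Ph" by (rule Ck_on_cont[OF ck])
 have contd: "continuous_on W (%y. Df Ph y b)" for b using ck by simp
 define T where "T K = cutc K Ph" for K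
 have T_out: "y ~: K ==> T K v y = 0" for y K v by (simp add: T_def cutc_def)
 have T_props: "!!v. sq_int v ==> sq_int (T K v)"
   "EX C>=0. ALL v. sq_int v --> (LINT y|lborel. (T K v y)^2) <= C * (LINT x|lborel. (v x)^2)"
   "!!h h0. brep S h h0 ==> AE y in lebesgue. y : K --> T K h0 y = h (Ph y)"
  if K: "compact K" "K \<subseteq> W" for K
 proof -
  obtain C where C: "C >= 0" "!!f. f : borel_measurable borel ==>
    (\<integral>\<^sup>+y. indicator K y * f (Ph y) \<partial>lborel) <= ennreal C * (\<integral>\<^sup>+x. f x \<partial>lborel)"
   using nn_int_diffeo[OF W ck inj K] by blast
  have cK: "continuous_on K Ph" using cont K(2) continuous_on_subset by blast
  note cc = cutc_L2[OF K(1) cK C(2) C(1)]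
  show "sq_int v ==> sq_int (T K v)" for v
   unfolding T_def by (rule cc)
  show "EX C>=0. ALL v. sq_int v --> (LINT y|lborel. (T K v y)^2) <= C * (LINT x|lborel. (v x)^2)"
   unfolding T_def using cc(2) C(1) by blast
  show "AE y in lebesgue. y : K --> T K h0 y = h (Ph y)" if "brep S h h0" for h h0
  proof -
   have "AE x in lebesgue. h0 x = indicator S x * h x" using that by (simp add: brep_def)
   from local_diffeo_AE[OF C(2) K(1) cK this] show ?thesis
    by (rule eventually_mono) (use WS K(2) in \<open>auto simp: T_def cutc_def indicator_def\<close>)
  qed
 qed
 have intu: "set_integrable lebesgue K (%y. h (Ph y) * ze y)"
  if K: "compact K" "K \<subseteq> W" and h: "brep S h h0" and z: "continuous_on K ze" for K h h0 ze
  by (rule set_integrable_cut[OF K(1) T_props(1)[OF K] T_out z T_props(3)[OF K h]])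
   (use h in \<open>simp add: brep_def\<close>)
 show ?thesis
  unfolding has_weak_gradient_def
 proof (intro conjI allI impI)
  fix K assume "compact K & K \<subseteq> W"
  hence K: "compact K" "K \<subseteq> W" by auto
  show "set_integrable lebesgue K (%y. u (Ph y))"
   using intu[OF K u0, of "%_. 1"] by simp
  have e: "(g (Ph y) \<bullet> Df Ph y b) *\<^sub>R b
   = (SUM j:Basis. ((g (Ph y) \<bullet> j) * (Df Ph y b \<bullet> j)) *\<^sub>R b)" for y b
   by (subst euclidean_inner) (simp add: scaleR_sum_left)
  show "set_integrable lebesgue K (%y. SUM b:Basis. (g (Ph y) \<bullet> Df Ph y b) *\<^sub>R b)"
   unfolding e set_integrable_def scaleR_sum_right
  proof (intro Bochner_Integration.integrable_sum)
   fix b j :: 'a assume j: "j : Basis"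
   have "set_integrable lebesgue K (%y. (g (Ph y) \<bullet> j) * (Df Ph y b \<bullet> j))"
    by (rule intu[OF K g0[OF j]])
     (intro continuous_on_inner continuous_on_const continuous_on_subset[OF contd K(2)])
   thus "integrable lebesgue (%y. indicator K y *\<^sub>R ((g (Ph y) \<bullet> j) * (Df Ph y b \<bullet> j)) *\<^sub>R b)"
    unfolding set_integrable_def
    using integrable_scaleR_left[of b lebesgue "%y. indicator K y *\<^sub>R ((g (Ph y) \<bullet> j) * (Df Ph y b \<bullet> j))"]
    by simp
  qed
 next
  fix ph :: "'a => real" and b :: 'a assume "test_function W ph & b : Basis"
  hence tf: "test_function W ph" and b: "b : Basis" by auto
  define K where "K = closure {x. ph x ~= 0}"
  have K: "compact K" "K \<subseteq> W" using tf by (auto simp: test_function_def K_def)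
  have out: "ph x = 0" if "x ~: K" for x using that closure_subset[of "{x. ph x ~= 0}"] by (auto simp: K_def)
  have ckph: "Ck_on 1 UNIV ph"
   using tf smooth_Ck[of UNIV ph 1] by (simp add: test_function_def)
  obtain U G where U: "!!n. sq_int (U n)" and G: "!!n b. b : Basis ==> sq_int (G n b)"
   and der: "!!n x. (U n has_derivative Df (U n) x) (at x)"
    "!!n b. continuous_on UNIV (%x. Df (U n) x b)"
   and lim: "(%n. LINT x|lborel. (U n x - u0 x)^2) \<longlonglongrightarrow> 0"
    "!!b. b : Basis ==> (%n. LINT x|lborel. (G n b x - g0 b x)^2) \<longlonglongrightarrow> 0"
   and ev: "!!K. compact K ==> K \<subseteq> S ==>
    EX n0. ALL n>=n0. ALL x:K. ALL b:Basis. Df (U n) x b = G n b x"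
   using weak_moll[OF S w L2 u0 g0] by blast
  have ckU: "Ck_on 1 UNIV (U n)" for n by (rule Ck1_I[OF der])
  have cK: "continuous_on K Ph" using cont K(2) continuous_on_subset by blast
  obtain n0 where n0: "!!n x j. n >= n0 ==> x : Ph ` K ==> j : Basis ==> Df (U n) x j = G n j x"
   using ev[OF compact_continuous_image[OF cK K(1)]] WS K(2) by blast
  define dph where "dph y = Df ph y b" for y
  have Cd: "Cc dph" "!!x. x ~: K ==> dph x = 0"
   unfolding dph_def using Cc_Df[OF ckph K(1) out] by auto
  \<comment> \<open>The weight of the j-th gradient component in the limit identity. It is
    continuous on the whole space because it vanishes on the open complement of K, which together
    with W covers everything.\<close>
  define z where "z j y = (if y : W then (Df Ph y b \<bullet> j) * ph y else 0)" for j y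
  have z_out: "y ~: K ==> z j y = 0" for j y by (simp add: z_def out)
  have zc: "continuous_on UNIV (z j)" for j
  proof -
   have "continuous_on (W \<union> - K) (z j)"
   proof (rule continuous_on_open_Un[OF W])
    show "open (- K)" using K(1) by (simp add: compact_imp_closed open_Compl)
    have "continuous_on W (%y. (Df Ph y b \<bullet> j) * ph y)"
     using continuous_on_subset[OF Ck_on_cont[OF ckph]]
     by (intro continuous_intros contd) auto
    thus "continuous_on W (z j)" by (rule continuous_on_eq) (simp add: z_def)
    show "continuous_on (- K) (z j)"
     by (rule continuous_on_eq[OF continuous_on_const[of _ 0]]) (simp add: z_out)
   qed
   also have "W \<union> - K = UNIV" using K(2) by blast
   finally show ?thesis .
  qed
  have Cz: "Cc (z j)" for j by (rule Cc_csupp[OF zc K(1) z_out])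
  \<comment> \<open>Second L2 factor in \<open>L2_lim_prod\<close>; it equals 1 on K, outside of
    which \<open>T K v\<close> vanishes.\<close>
  have one: "sq_int (indicator K :: 'a => real)"
   using borel_closed[OF compact_imp_closed[OF K(1)]] emeasure_compact_finite[OF K(1)]
   by (auto simp: sq_int_def power2_eq_square indicator_inter_arith[symmetric])
  have Tlim: "(%n. LINT y|lborel. T K (v n) y * ze y) \<longlonglongrightarrow> (LINT y|lborel. T K v0 y * ze y)"
   if v: "!!n. sq_int (v n)" "sq_int v0"
    "(%n. LINT x|lborel. (v n x - v0 x)^2) \<longlonglongrightarrow> 0" and ze: "Cc ze" for v v0 ze
  proof -
   obtain C where C: "C >= 0" "!!v. sq_int v ==> (LINT y|lborel. (T K v y)^2) <= C * (LINT x|lborel. (v x)^2)"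
    using T_props(2)[OF K] by blast
   have "(%n. LINT y|lborel. (T K (v n) y - T K v0 y)^2) \<longlonglongrightarrow> 0"
   proof (rule Lim_null_comparison)
    have "T K (v n) y - T K v0 y = T K (%x. v n x - v0 x) y" for n y
     by (simp add: T_def cutc_def)
    thus "\<forall>\<^sub>F n in sequentially. norm (LINT y|lborel. (T K (v n) y - T K v0 y)^2)
      <= C * (LINT x|lborel. (v n x - v0 x)^2)"
     using C(2)[OF sq_int_diff[OF v(1,2)]] by simp
    show "(%n. C * (LINT x|lborel. (v n x - v0 x)^2)) \<longlonglongrightarrow> 0"
     using tendsto_mult_left[OF v(3), of C] by simp
   qed
   note tl = this
   obtain B where B: "!!x. abs (ze x) <= B" using Cc_bounded[OF ze] by blast
   have "(%n. LINT y|lborel. T K (v n) y * indicator K y * ze y) \<longlonglongrightarrow> (LINT y|lborel. T K v0 y * indicator K y * ze y)"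
    by (rule L2_lim_prod[OF T_props(1)[OF K v(1)] T_props(1)[OF K v(2)] tl one one _ Cc_measurable[OF ze] B]) simp
   moreover have "T K v y * indicator K y = T K v y" for v y
    by (simp add: T_def cutc_def)
   ultimately show ?thesis by simp
  qed
  have Tint: "integrable lborel (%y. T K v y * ze y)" if "sq_int v" "Cc ze" for v ze
   by (intro sq_int_mult T_props(1)[OF K] that Cc_sq_int)
  have eq: "(LINT y|lborel. T K (U n) y * dph y) = - (SUM j:Basis. \<integral>y. T K (G n j) y * z j y \<partial>lborel)" if "n >= n0" for n
  proof -
   define p where "p y = (if y : W then U n (Ph y) * ph y else 0)" for y
   have p_out: "y ~: K ==> p y = 0" for y by (simp add: p_def out)
   have ckp: "Ck_on 1 W (%y. U n (Ph y) * ph y)"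
    by (intro Ck_on_mult W Ck_on_compose[OF W open_UNIV ckU ck] Ck_on_subset[OF ckph]) auto
   have ckpU: "Ck_on 1 UNIV p"
   proof (rule Ck_on_local)
    fix y :: 'a
    show "EX V. open V & y : V & Ck_on 1 V p"
    proof (cases "y : W")
     case True
     have "Ck_on 1 W p" using ckp Ck_on_cong[OF W, of p "%y. U n (Ph y) * ph y" 1] by (simp add: p_def)
     thus ?thesis using True W by blast
    next
     case False
     have o: "open (- K)" using K(1) by (simp add: compact_imp_closed open_Compl)
     have "Ck_on 1 (- K) p" using Ck_on_cong[OF o, of p "%_. 0" 1] p_out by simp
     thus ?thesis using o False K(2) by blast
    qed
   qed
   have "Df p y b = T K (U n) y * dph y + (SUM j:Basis. T K (G n j) y * z j y)" for y
   proof (cases "y : K")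
    case True
    hence y: "y : W" using K(2) by blast
    have dPh: "(Ph has_derivative Df Ph y) (at y)"
     using ck y by (simp add: frechet_derivative_works)
    have dU: "((%y. U n (Ph y)) has_derivative (%h. Df (U n) (Ph y) (Df Ph y h))) (at y)"
     by (rule has_derivative_compose[OF dPh der(1)])
    have dph': "(ph has_derivative Df ph y) (at y)"
     using ckph by (simp add: frechet_derivative_works)
    have "(p has_derivative (%h. U n (Ph y) * Df ph y h +
      Df (U n) (Ph y) (Df Ph y h) * ph y)) (at y)"
     by (rule has_derivative_transform_within_open[OF has_derivative_mult[OF dU dph'] W y]) (simp add: p_def)
    from frechet_derivative_at[OF this]
    have "Df p y b = U n (Ph y) * dph y +
      Df (U n) (Ph y) (Df Ph y b) * ph y"
     unfolding dph_def by metis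
    also have "Df (U n) (Ph y) (Df Ph y b) =
      (SUM j:Basis. (Df Ph y b \<bullet> j) * G n j (Ph y))"
    proof -
     have lin: "linear (Df (U n) (Ph y))" using der(1) by (rule has_derivative_linear)
     have "Df (U n) (Ph y) (Df Ph y b) =
       (SUM j:Basis. (Df Ph y b \<bullet> j) * Df (U n) (Ph y) j)"
      by (subst (1) euclidean_representation[symmetric, of "Df Ph y b"])
       (simp only: linear_sum[OF lin] linear_scale[OF lin] real_scaleR_def)
     thus ?thesis using n0[OF that] True by simp
    qed
    finally show ?thesis
     using True y by (simp add: T_def cutc_def z_def sum_distrib_right sum_distrib_left mult_ac)
   next
    case False
    hence "Df p y b = 0"
     using Cc_Df(2)[OF ckpU K(1) p_out] by blast
    thus ?thesis using False by (simp add: T_out)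
   qed
   hence "(LINT y|lborel. T K (U n) y * dph y + (SUM j:Basis. T K (G n j) y * z j y)) = 0"
    using integral_deriv_zero[OF ckpU K(1) p_out, of b] by simp
   thus ?thesis
    using Tint[OF U Cd(1)] Tint[OF G Cz] by (simp add: add_eq_0_iff2)
  qed
  have l1: "(%n. LINT y|lborel. T K (U n) y * dph y) \<longlonglongrightarrow> (LINT y|lborel. T K u0 y * dph y)"
   by (rule Tlim[OF U su lim(1) Cd(1)])
  have l2: "(%n. - (SUM j:Basis. \<integral>y. T K (G n j) y * z j y \<partial>lborel)) \<longlonglongrightarrow> - (SUM j:Basis. \<integral>y. T K (g0 j) y * z j y \<partial>lborel)"
   by (intro tendsto_minus tendsto_sum Tlim G sg lim(2) Cz)
  have "(%n. LINT y|lborel. T K (U n) y * dph y) \<longlonglongrightarrow> - (SUM j:Basis. \<integral>y. T K (g0 j) y * z j y \<partial>lborel)"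
   by (rule Lim_transform_eventually[OF l2]) (use eq in \<open>auto simp: eventually_sequentially intro!: exI[of _ n0]\<close>)
  hence fin: "(LINT y|lborel. T K u0 y * dph y) = - (SUM j:Basis. \<integral>y. T K (g0 j) y * z j y \<partial>lborel)"
   using l1 LIMSEQ_unique by blast
  have "AE y in lebesgue. indicator W y *\<^sub>R (u (Ph y) * Df ph y b) = T K u0 y * dph y"
   using T_props(3)[OF K u0] by (rule eventually_mono) (use K(2) Cd(2) in \<open>auto simp: dph_def indicator_def\<close>)
  from lebesgue_cong(2)[OF this]
  have A: "(LINT y:W|lebesgue. u (Ph y) * Df ph y b) = (LINT y|lborel. T K u0 y * dph y)"
   using borel_measurable_integrable[OF Tint[OF su Cd(1)]] by (simp add: set_lebesgue_integral_def leb_lborel)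
  have "AE y in lebesgue. ALL j:Basis. y : K --> T K (g0 j) y = g (Ph y) \<bullet> j"
   using T_props(3)[OF K g0] by (subst AE_finite_all) auto
  hence "AE y in lebesgue. indicator W y *\<^sub>R (((SUM b:Basis. (g (Ph y) \<bullet> Df Ph y b) *\<^sub>R b) \<bullet> b) * ph y)
    = (SUM j:Basis. T K (g0 j) y * z j y)"
  proof (rule eventually_mono)
   fix y assume y: "ALL j:Basis. y : K --> T K (g0 j) y = g (Ph y) \<bullet> j"
   show "indicator W y *\<^sub>R (((SUM b:Basis. (g (Ph y) \<bullet> Df Ph y b) *\<^sub>R b) \<bullet> b) * ph y)
    = (SUM j:Basis. T K (g0 j) y * z j y)"
   proof (cases "y : K")
    case True
    hence "y : W" using K(2) by blast
    moreover have "(SUM j:Basis. T K (g0 j) y * z j y) = (g (Ph y) \<bullet> Df Ph y b) * ph y"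
     using True y \<open>y : W\<close>
     by (subst euclidean_inner) (simp add: z_def sum_distrib_right mult.assoc)
    ultimately show ?thesis using b by (simp add: inner_sum_left_Basis)
   qed (simp add: out T_out)
  qed
  from lebesgue_cong(2)[OF this]
  have B: "(LINT y:W|lebesgue. ((SUM b:Basis. (g (Ph y) \<bullet> Df Ph y b) *\<^sub>R b) \<bullet> b) * ph y)
    = (SUM j:Basis. \<integral>y. T K (g0 j) y * z j y \<partial>lborel)"
   using Tint[OF sg Cz] borel_measurable_integrable[OF Tint[OF sg Cz]]
   by (simp add: set_lebesgue_integral_def leb_lborel)
  show "(LINT y:W|lebesgue. u (Ph y) * Df ph y b) =
    - (LINT y:W|lebesgue. ((SUM b:Basis. (g (Ph y) \<bullet> Df Ph y b) *\<^sub>R b) \<bullet> b) * ph y)"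
   unfolding A B by (rule fin)
 qed
qed

section \<open>The corner profile\<close>

lemma has_weak_gradient_AE:
 fixes u v :: "'a::euclidean_space => real"
 assumes w: "has_weak_gradient S u g" and uv: "AE x in lebesgue. x : S --> u x = v x"
  and gh: "AE x in lebesgue. x : S --> g x = h x"
 shows "has_weak_gradient S v h"
 unfolding has_weak_gradient_def
proof (intro conjI allI impI)
 fix K assume K: "compact K & K \<subseteq> S"
 have 1: "AE x in lebesgue. indicator K x *\<^sub>R u x = indicator K x *\<^sub>R v x"
  using uv by (rule eventually_mono) (use K in \<open>auto simp: indicator_def\<close>)
 have 2: "AE x in lebesgue. indicator K x *\<^sub>R g x = indicator K x *\<^sub>R h x"
  using gh by (rule eventually_mono) (use K in \<open>auto simp: indicator_def\<close>)
 show "set_integrable lebesgue K v" "set_integrable lebesgue K h"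
  using w K lebesgue_cong(1)[OF 1] lebesgue_cong(1)[OF 2]
  by (auto simp: has_weak_gradient_def set_integrable_def)
next
 fix ph and b :: 'a assume tb: "test_function S ph & b : Basis"
 have 1: "AE x in lebesgue. indicator S x *\<^sub>R (u x * Df ph x b)
   = indicator S x *\<^sub>R (v x * Df ph x b)"
  using uv by (rule eventually_mono) (auto simp: indicator_def)
 have 2: "AE x in lebesgue. indicator S x *\<^sub>R ((g x \<bullet> b) * ph x) = indicator S x *\<^sub>R ((h x \<bullet> b) * ph x)"
  using gh by (rule eventually_mono) (auto simp: indicator_def)
 show "(LINT x:S|lebesgue. v x * Df ph x b) = - (LINT x:S|lebesgue. (h x \<bullet> b) * ph x)"
  using w tb lebesgue_cong(2)[OF 1] lebesgue_cong(2)[OF 2]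
  by (simp add: has_weak_gradient_def set_lebesgue_integral_def)
qed

lemma H1_AE:
 assumes "u : H1 S" "AE x in lebesgue. x : S --> u x = v x"
 shows "v : H1 S"
proof -
 obtain g where g: "has_weak_gradient S u g" "L2_on S g" "L2_on S u"
  using assms(1) by (auto simp: H1_def)
 have "has_weak_gradient S v g" by (rule has_weak_gradient_AE[OF g(1) assms(2)]) simp
 thus ?thesis using g(2) L2_on_AE[OF g(3) assms(2)] by (auto simp: H1_def)
qed

lemma test_int:
 fixes h :: "'a::euclidean_space => real"
 assumes "!!K. compact K ==> K \<subseteq> S ==> set_integrable lebesgue K h"
  and "continuous_on UNIV ze" "compact K" "K \<subseteq> S" "!!x. x ~: K ==> ze x = 0"
 shows "set_integrable lebesgue S (%x. h x * ze x)"
proof -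
 obtain B where B: "!!x. abs (ze x) <= B" using Cc_bounded[OF Cc_csupp[OF assms(2,3,5)]] by blast
 have "set_integrable lebesgue K (%x. h x * ze x)"
  by (rule set_int_mult[OF assms(1)[OF assms(3,4)] assms(2) B])
 moreover have "(%x. indicator K x *\<^sub>R (h x * ze x)) = (%x. indicator S x *\<^sub>R (h x * ze x))"
  using assms(4,5) by (auto simp: indicator_def fun_eq_iff)
 ultimately show ?thesis by (simp only: set_integrable_def)
qed

lemma weak_add_scaled:
 fixes u v :: "'a::euclidean_space => real"
 assumes u: "has_weak_gradient S u g" and v: "has_weak_gradient S v h"
 shows "has_weak_gradient S (%x. u x + c * v x) (%x. g x + c *\<^sub>R h x)"
 unfolding has_weak_gradient_def
proof (intro conjI allI impI)
 fix K assume K: "compact K & K \<subseteq> S"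
 show "set_integrable lebesgue K (%x. u x + c * v x)" "set_integrable lebesgue K (%x. g x + c *\<^sub>R h x)"
  using u v K by (auto simp: has_weak_gradient_def intro!: set_integral_add)
next
 fix ph and b :: 'a assume tb: "test_function S ph & b : Basis"
 define K where "K = closure {x. ph x ~= 0}"
 have K: "compact K" "K \<subseteq> S" using tb by (auto simp: test_function_def K_def)
 have out: "ph x = 0" if "x ~: K" for x using that closure_subset[of "{x. ph x ~= 0}"] by (auto simp: K_def)
 have ckph: "Ck_on 1 UNIV ph"
  using tb smooth_Ck[of UNIV ph 1] by (simp add: test_function_def)
 note d = Cc_Df[OF ckph K(1) out]
 have dc: "continuous_on UNIV (%x. Df ph x b)" using d(1)[of b] by (simp add: Cc_def)
 have comp: "set_integrable lebesgue L (%x. f x \<bullet> b)" if "set_integrable lebesgue L f" for f and L :: "'a set"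
 proof -
  have "integrable lebesgue (%x. (indicator L x *\<^sub>R f x) \<bullet> b)"
   using that by (simp only: set_integrable_def integrable_inner_left)
  thus ?thesis by (simp add: set_integrable_def)
 qed
 have i1: "set_integrable lebesgue S (%x. w x * Df ph x b)"
  and i2: "set_integrable lebesgue S (%x. (k x \<bullet> b) * ph x)" if "has_weak_gradient S w k" for w k
  using that comp
  by (auto simp: has_weak_gradient_def
    intro!: test_int[OF _ dc K d(2)]
    test_int[OF _ Ck_on_cont[OF ckph] K out])
 have "(LINT x:S|lebesgue. (u x + c * v x) * Df ph x b)
  = (LINT x:S|lebesgue. u x * Df ph x b + c * (v x * Df ph x b))"
  by (simp add: distrib_right mult.assoc)
 also have "... = (LINT x:S|lebesgue. u x * Df ph x b)
   + c * (LINT x:S|lebesgue. v x * Df ph x b)"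
  using i1[OF u] i1[OF v] by (subst set_integral_add) auto
 also have "... = - ((LINT x:S|lebesgue. (g x \<bullet> b) * ph x) + c * (LINT x:S|lebesgue. (h x \<bullet> b) * ph x))"
  using u v tb by (simp add: has_weak_gradient_def)
 also have "(LINT x:S|lebesgue. (g x \<bullet> b) * ph x) + c * (LINT x:S|lebesgue. (h x \<bullet> b) * ph x)
   = (LINT x:S|lebesgue. (g x \<bullet> b) * ph x + c * ((h x \<bullet> b) * ph x))"
  using i2[OF u] i2[OF v] by (subst set_integral_add) auto
 also have "... = (LINT x:S|lebesgue. ((g x + c *\<^sub>R h x) \<bullet> b) * ph x)"
  by (simp add: inner_add_left distrib_right mult.assoc)
 finally show "(LINT x:S|lebesgue. (u x + c * v x) * Df ph x b) =
   - (LINT x:S|lebesgue. ((g x + c *\<^sub>R h x) \<bullet> b) * ph x)" .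
qed

lemma L2_on_add_scaled:
 fixes u v :: "'a::euclidean_space => 'b::euclidean_space"
 assumes "L2_on S u" "L2_on S v"
 shows "L2_on S (%x. u x + c *\<^sub>R v x)"
proof -
 have m: "(%x. indicator S x *\<^sub>R u x) : borel_measurable lebesgue" "(%x. indicator S x *\<^sub>R v x) : borel_measurable lebesgue"
  and i: "integrable lebesgue (%x. indicator S x * (norm (u x))^2)" "integrable lebesgue (%x. indicator S x * (norm (v x))^2)"
  using assms by (auto simp: L2_on_def set_borel_measurable_def set_integrable_def)
 have "(%x. indicator S x *\<^sub>R u x + c *\<^sub>R (indicator S x *\<^sub>R v x)) : borel_measurable lebesgue"
  by (intro borel_measurable_add[OF m(1) borel_measurable_scaleR[OF borel_measurable_const m(2)]])
 also have "(%x. indicator S x *\<^sub>R u x + c *\<^sub>R (indicator S x *\<^sub>R v x)) = (%x. indicator S x *\<^sub>R (u x + c *\<^sub>R v x))"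
  by (simp add: scaleR_add_right mult.commute)
 finally have m': "(%x. indicator S x *\<^sub>R (u x + c *\<^sub>R v x)) : borel_measurable lebesgue" .
 have "integrable lebesgue (%x. indicator S x * (norm (u x + c *\<^sub>R v x))^2)"
 proof (rule Bochner_Integration.integrable_bound)
  show "integrable lebesgue (%x. 2 * (indicator S x * (norm (u x))^2) + 2 * c^2 * (indicator S x * (norm (v x))^2))"
   using i by (intro Bochner_Integration.integrable_add integrable_mult_right)
  have "(%x. (norm (indicator S x *\<^sub>R (u x + c *\<^sub>R v x)))^2) : borel_measurable lebesgue"
   using m' by measurable
  also have "(%x. (norm (indicator S x *\<^sub>R (u x + c *\<^sub>R v x)))^2) = (%x. indicator S x * (norm (u x + c *\<^sub>R v x))^2)"
   by (auto simp: fun_eq_iff indicator_def)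
  finally show "(%x. indicator S x * (norm (u x + c *\<^sub>R v x))^2) : borel_measurable lebesgue" .
  have "(norm (a + c *\<^sub>R b))^2 <= 2 * (norm a)^2 + 2 * c^2 * (norm b)^2" for a b :: 'b
  proof -
   have "(norm (a + c *\<^sub>R b))^2 <= (norm a + abs c * norm b)^2"
    using norm_triangle_ineq[of a "c *\<^sub>R b"] by (intro power_mono) auto
   also have "... <= 2 * (norm a)^2 + 2 * (abs c * norm b)^2"
    using sum_squares_bound[of "norm a" "abs c * norm b"] by (simp add: power2_sum)
   finally show ?thesis by (simp add: power_mult_distrib)
  qed
  thus "AE x in lebesgue. norm (indicator S x * (norm (u x + c *\<^sub>R v x))^2) <=
    norm (2 * (indicator S x * (norm (u x))^2) + 2 * c^2 * (indicator S x * (norm (v x))^2))"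
   by (intro AE_I2) (auto simp: indicator_def)
 qed
 thus ?thesis using m' by (simp add: L2_on_def set_borel_measurable_def set_integrable_def)
qed

lemma H1_add_scaled:
 assumes "u : H1 S" "v : H1 S"
 shows "(%x. u x + c * v x) : H1 S"
proof -
 obtain g h where g: "has_weak_gradient S u g" "L2_on S g" "L2_on S u"
  and h: "has_weak_gradient S v h" "L2_on S h" "L2_on S v"
  using assms by (auto simp: H1_def)
 have "L2_on S (%x. u x + c * v x)" using L2_on_add_scaled[OF g(3) h(3), of c] by simp
 thus ?thesis
  using weak_add_scaled[OF g(1) h(1), of c] L2_on_add_scaled[OF g(2) h(2), of c]
  unfolding H1_def by blast
qed

text \<open>\<open>H2\<close> refers to the chosen \<open>weak_grad\<close>, which is linear only
  almost everywhere; \<open>H1_AE\<close> removes the discrepancy.\<close>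

lemma H2_add_scaled:
 assumes S: "open S" and "u : H2 S" "v : H2 S"
 shows "(%x. u x + c * v x) : H2 S"
proof -
 have u: "u : H1 S" "!!b. b : Basis ==> (%x. weak_grad S u x \<bullet> b) : H1 S"
  and v: "v : H1 S" "!!b. b : Basis ==> (%x. weak_grad S v x \<bullet> b) : H1 S"
  using assms(2,3) by (auto simp: H2_def)
 have 1: "(%x. u x + c * v x) : H1 S" by (rule H1_add_scaled[OF u(1) v(1)])
 have "AE x in lebesgue. x : S --> weak_grad S u x + c *\<^sub>R weak_grad S v x = weak_grad S (%x. u x + c * v x) x"
  by (rule weak_unique[OF S weak_add_scaled[OF H1_weak_grad(2)[OF S u(1)] H1_weak_grad(2)[OF S v(1)]]
     H1_weak_grad(2)[OF S 1]])
 hence ae: "AE x in lebesgue. x : S -->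
   weak_grad S u x \<bullet> b + c * (weak_grad S v x \<bullet> b) = weak_grad S (%x. u x + c * v x) x \<bullet> b" for b
  by (rule eventually_mono) (metis inner_add_left inner_scaleR_left)
 have "(%x. weak_grad S (%x. u x + c * v x) x \<bullet> b) : H1 S" if "b : Basis" for b
  by (rule H1_AE[OF H1_add_scaled[OF u(2)[OF that] v(2)[OF that], of c] ae])
 with 1 show ?thesis by (simp add: H2_def)
qed

lemma H2w_add_scaled:
 assumes "u : H2w gm" "v : H2w gm"
 shows "(%p. u p + c * v p) : H2w gm"
proof -
 have "open half_plane"
  unfolding half_plane_def by (intro open_Collect_less continuous_intros)
 from H2_add_scaled[OF this, of "%p. exp (gm * snd p) * u p" "%p. exp (gm * snd p) * v p" c] assms
 show ?thesis by (simp add: H2w_def algebra_simps)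
qed

section \<open>Smoothed Heaviside functions and their tensor products\<close>

definition step :: "nat => real => real" where
 "step n t = integral {-2..t} (moll n)"

lemma moll_real_integrable: "(moll n :: real => real) integrable_on {a..b}"
 by (rule integrable_continuous_interval)
  (rule continuous_on_subset[OF Ck_on_cont[OF Ck_on_moll] subset_UNIV])

lemma step_eq_0: assumes "t <= - inverse (real (Suc n))" shows "step n t = 0"
proof -
 have "step n t = integral {-2..t} (%_. 0)"
  unfolding step_def by (rule integral_cong) (use assms in \<open>auto intro!: moll_eq_0\<close>)
 thus ?thesis by simp
qed

lemma step_DERIV: "(step n has_real_derivative moll n t) (at t)"
proof (cases "t > -2")
 case True
 have c: "continuous_on {-2..t+1} (moll n :: real => real)"
  using Ck_on_cont[OF Ck_on_moll] by (rule continuous_on_subset) auto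
 have "((%u. integral {-2..u} (moll n)) has_vector_derivative moll n t) (at t within {-2..t+1})"
  using True by (intro integral_has_vector_derivative[OF c]) auto
 moreover have "at t within {-2..t+1} = at t"
  using True by (intro at_within_Icc_at) auto
 ultimately show ?thesis
  by (simp add: step_def[abs_def] has_real_derivative_iff_has_vector_derivative)
next
 case False
 have n: "inverse (real (Suc n)) <= 1" by (simp add: field_simps)
 have z: "moll n t = 0" using False n by (intro moll_eq_0) auto
 have "((%_. 0) has_real_derivative 0) (at t)" by simp
 hence "(step n has_real_derivative 0) (at t)"
  by (rule has_field_derivative_transform_within_open[of _ _ _ "{..<-1}"])
   (use False n step_eq_0[of _ n] in auto)
 thus ?thesis using z by simp
qed

lemma Ck_on_step: "Ck_on k UNIV (step n)"
proof (cases k)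
 case 0
 thus ?thesis
  using DERIV_isCont[OF step_DERIV] by (simp add: continuous_at_imp_continuous_on)
next
 case (Suc j)
 thus ?thesis
  using Ck_on_SucI_real[OF open_UNIV step_DERIV Ck_on_moll] by simp
qed

lemma step_bounds: "0 <= step n t" "step n t <= 1"
proof -
 show "0 <= step n t"
  unfolding step_def by (intro integral_nonneg moll_real_integrable moll_nonneg)
 have i: "integrable lborel (moll n :: real => real)" by (rule Cc_integrable[OF Cc_moll])
 hence h: "(moll n has_integral 1) (UNIV :: real set)"
  using has_integral_integral_lborel[OF i] integral_moll[where 'a=real, of n] by simp
 show "step n t <= 1"
  unfolding step_def
  by (rule has_integral_subset_le[OF subset_UNIV integrable_integral[OF moll_real_integrable] h])
   (simp add: moll_nonneg)
qed

lemma step_eq_1: assumes "t >= 1" shows "step n t = 1"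
proof -
 have i: "integrable lborel (moll n :: real => real)" by (rule Cc_integrable[OF Cc_moll])
 hence h: "(moll n has_integral 1) (UNIV :: real set)"
  using has_integral_integral_lborel[OF i] integral_moll[where 'a=real, of n] by simp
 have n: "inverse (real (Suc n)) <= 1" by (simp add: field_simps)
 have "(%x. if x : {-2..t} then moll n x else 0) = (moll n :: real => real)"
 proof (rule ext)
  fix x :: real
  show "(if x : {-2..t} then moll n x else 0) = moll n x"
   using assms n moll_eq_0[of n x] by (cases "x : {-2..t}") auto
 qed
 hence "(moll n has_integral 1) {-2..t}"
  using h has_integral_restrict_UNIV[of "{-2..t}" "moll n" 1] by simp
 thus ?thesis by (simp add: step_def integral_unique)
qed

text \<open>A smoothed Heaviside function, cut off between 1 and 3. Its derivative is
  \<open>moll n\<close> plus a term bounded uniformly in n, so the approximate delta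
  \<open>moll n\<close> is the derivative of a bounded function up to a bounded error.\<close>

definition ramp :: "nat => real => real" where
 "ramp n t = step 0 (2 - t) * step n t"

definition ramp_cut :: "nat => real => real" where
 "ramp_cut n t = - moll 0 (2 - t) * step n t"

lemma ramp_DERIV: "(ramp n has_real_derivative (moll n t + ramp_cut n t)) (at t)"
proof -
 have d: "((%t. step 0 (2 - t)) has_real_derivative (moll 0 (2 - t) * (-1))) (at t)"
  by (rule DERIV_chain2[OF step_DERIV]) (auto intro!: derivative_eq_intros)
 \<comment> \<open>The outer cut-off equals 1 on the support of \<open>moll n\<close>.\<close>
 have "step 0 (2 - t) * moll n t = moll n t"
 proof (cases "t <= 1")
  case True
  thus ?thesis using step_eq_1[of "2 - t" 0] by simp
 next
  case False
  moreover have "inverse (real (Suc n)) <= 1" by (simp add: field_simps)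
  ultimately have "inverse (real (Suc n)) <= norm t" unfolding real_norm_def by linarith
  thus ?thesis using moll_eq_0[of n t] by simp
 qed
 thus ?thesis
  unfolding ramp_def[abs_def] by (intro DERIV_cong[OF DERIV_mult[OF d step_DERIV[of n t]]])
   (simp add: ramp_cut_def)
qed

lemma Ck_on_comp_real:
 fixes f :: "real => real"
 shows "Ck_on k UNIV f ==> Ck_on k UNIV g ==> Ck_on k UNIV (%x. f (g x))"
 by (rule Ck_on_compose[OF open_UNIV open_UNIV]) auto

lemma Ck_on_ramp: "Ck_on k UNIV (ramp n)" and Ck_on_ramp_cut: "Ck_on k UNIV (ramp_cut n)"
 unfolding ramp_def[abs_def] ramp_cut_def[abs_def]
 by (intro Ck_on_mult Ck_on_uminus Ck_on_comp_real[OF Ck_on_step] Ck_on_comp_real[OF Ck_on_moll]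
   Ck_on_step Ck_on_diff Ck_on_const Ck_on_id open_UNIV)+

text \<open>The support reaches only 1/(n+1) to the left: test functions centred at p stay in the
  half-plane as soon as 1/(n+1) < snd p, and nothing has to be extended across its boundary.\<close>

definition rsupp :: "nat => (real => real) => bool" where
 "rsupp n f \<longleftrightarrow> (ALL k. Ck_on k UNIV f) & (ALL t. t <= - inverse (real (Suc n)) \<or> t >= 3 --> f t = 0)"

lemma rsupp_ramp: "rsupp n (ramp n)" "rsupp n (ramp_cut n)"
 "rsupp n (moll n)"
proof -
 have *: "step 0 (2 - t) = 0" "moll 0 (2 - t) = 0" if "t >= 3" for t :: real
  using that step_eq_0[of "2 - t" 0] moll_eq_0[of 0 "2 - t"] by auto
 show "rsupp n (ramp n)" "rsupp n (ramp_cut n)"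
  by (auto simp: rsupp_def Ck_on_ramp Ck_on_ramp_cut ramp_def ramp_cut_def * step_eq_0)
 have "inverse (real (Suc n)) <= 3" by (simp add: field_simps)
 thus "rsupp n (moll n)"
  by (auto simp: rsupp_def Ck_on_moll intro!: moll_eq_0 simp del: of_nat_Suc)
qed

lemma rsupp_add: "rsupp n f ==> rsupp n g ==> rsupp n (%t. f t + g t)"
 unfolding rsupp_def by (auto intro!: Ck_on_add)

definition tens :: "(real => real) => (real => real) => real \<times> real => real \<times> real => real" where
 "tens f g p z = f (fst z - fst p) * g (snd z - snd p)"

lemma Ck_on_tens:
 assumes "Ck_on k UNIV f" "Ck_on k UNIV g"
 shows "Ck_on k UNIV (tens f g p)"
 unfolding tens_def[abs_def]
 by (intro Ck_on_mult Ck_on_comp_real[OF assms(1)] Ck_on_comp_real[OF assms(2)] Ck_on_diff Ck_on_const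
   Ck_on_fst Ck_on_snd Ck_on_id open_UNIV)

lemma tens_derivative:
 assumes "!!t. (f has_real_derivative f' t) (at t)" "!!t. (g has_real_derivative g' t) (at t)"
 shows "Df (tens f g p) z (1, 0) = tens f' g p z"
  "Df (tens f g p) z (0, 1) = tens f g' p z"
proof -
 have f: "((%z::real \<times> real. f (fst z - fst p)) has_derivative (%h. f' (fst z - fst p) * fst h)) (at z)"
  by (rule has_derivative_compose[where g=f and f="%z. fst z - fst p" and f'=fst])
   (use assms(1) in \<open>auto simp: has_field_derivative_def intro!: derivative_eq_intros\<close>)
 have g: "((%z::real \<times> real. g (snd z - snd p)) has_derivative (%h. g' (snd z - snd p) * snd h)) (at z)"
  by (rule has_derivative_compose[where g=g and f="%z. snd z - snd p" and f'=snd])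
   (use assms(2) in \<open>auto simp: has_field_derivative_def intro!: derivative_eq_intros\<close>)
 have "(tens f g p has_derivative (%h. f (fst z - fst p) * (g' (snd z - snd p) * snd h) +
   f' (fst z - fst p) * fst h * g (snd z - snd p))) (at z)"
  unfolding tens_def[abs_def] by (rule has_derivative_mult[OF f g])
 from frechet_derivative_at[OF this, symmetric]
 show "Df (tens f g p) z (1, 0) = tens f' g p z"
  "Df (tens f g p) z (0, 1) = tens f g' p z"
  by (simp_all add: tens_def)
qed

abbreviation tens_box :: "real \<times> real => nat => (real \<times> real) set" where
 "tens_box p n \<equiv> cbox (fst p - inverse (real (Suc n)), snd p - inverse (real (Suc n))) (fst p + 3, snd p + 3)"

lemma tens_eq_0:
 assumes "rsupp n f" "rsupp n g" "z ~: tens_box p n"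
 shows "tens f g p z = 0"
proof -
 have "fst z - fst p <= - inverse (real (Suc n)) \<or> fst z - fst p >= 3 \<or>
  snd z - snd p <= - inverse (real (Suc n)) \<or> snd z - snd p >= 3"
  using assms(3) by (cases z) (auto simp: cbox_Pair_eq mem_Times_iff)
 thus ?thesis using assms(1,2) by (auto simp: rsupp_def tens_def)
qed

lemma tens_box_half_plane: "inverse (real (Suc n)) < snd p ==> tens_box p n \<subseteq> half_plane"
 by (auto simp: half_plane_def cbox_Pair_eq simp del: of_nat_Suc)

lemma test_function_tens:
 assumes "rsupp n f" "rsupp n g" "inverse (real (Suc n)) < snd p"
 shows "test_function half_plane (tens f g p)"
 by (rule test_functionI[OF Ck_on_tens compact_cbox tens_box_half_plane[OF assms(3)] tens_eq_0[OF assms(1,2)]])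
  (use assms in \<open>auto simp: rsupp_def\<close>)

lemma L2_norm_brep:
 assumes "brep S h h0"
 shows "L2_norm S h = sqrt (LINT x|lborel. (h0 x)^2)"
proof -
 have "AE x in lebesgue. indicator S x *\<^sub>R (norm (h x))^2 = (h0 x)^2"
  using assms unfolding brep_def by (auto elim!: eventually_mono simp: indicator_def)
 note 1 = lebesgue_cong(2)[OF this]
 have m: "(%x. (h0 x)^2) : borel_measurable borel"
  using assms by (auto simp: brep_def sq_int_def)
 show ?thesis
  unfolding L2_norm_def set_lebesgue_integral_def 1 leb_lborel(2)[OF m] ..
qed

text \<open>Cauchy-Schwarz on a box with sides 3 + 1/(n+1) <= 4; the area bound 16 gives the factor
  4 B^2, independent of n and p.\<close>

lemma tens_integral_bound:
 assumes h: "L2_on S h" and fg: "rsupp n f" "rsupp n g"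
  and B: "!!t. abs (f t) <= B" "!!t. abs (g t) <= B"
 shows "abs (LINT z:S|lebesgue. h z * tens f g p z) <= L2_norm S h * (4 * B^2)"
proof -
 obtain h0 where h0: "brep S h h0" using L2_brep[OF h] by blast
 have c: "continuous_on UNIV (tens f g p)"
  using fg by (intro Ck_on_cont[OF Ck_on_tens]) (auto simp: rsupp_def)
 have Cc: "Cc (tens f g p)" by (rule Cc_csupp[OF c compact_cbox tens_eq_0[OF fg]])
 have B0: "0 <= B" using B(1)[of 0] by linarith
 have tb: "(tens f g p z)^2 <= B ^ 4 * indicator (tens_box p n) z" for z
 proof (cases "z : tens_box p n")
  case True
  have "abs (tens f g p z) <= B * B" unfolding tens_def abs_mult by (intro mult_mono B B0) auto
  hence "\<bar>tens f g p z\<bar>\<^sup>2 <= (B * B)^2" by (rule power_mono) simp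
  thus ?thesis using True by (simp add: power_mult_distrib power2_eq_square power4_eq_xxxx mult.assoc)
 qed (simp add: tens_eq_0[OF fg])
 have inv: "inverse (real (Suc n)) <= 1" by (simp add: field_simps)
 define m where "m = measure lborel (tens_box p n)"
 have m: "m <= 16"
 proof -
  define i where "i = inverse (real (Suc n))"
  have i: "0 <= i" "i <= 1" using inv by (simp_all add: i_def)
  have "m = (3 + i) * (3 + i)"
   unfolding m_def content_Pair i_def[symmetric] using i by simp
  also have "... <= 4 * 4" by (rule mult_mono) (use i in auto)
  finally show ?thesis by simp
 qed
 have "(LINT z|lborel. (tens f g p z)^2) <= (LINT z|lborel. B ^ 4 * indicator (tens_box p n) z)"
  using tb sq_intD(3)[OF Cc_sq_int[OF Cc]]
  by (intro integral_mono integrable_mult_right integrable_real_indicator emeasure_lborel_cbox_finite) auto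
 also have "... = B ^ 4 * m" by (simp add: m_def)
 also have "... <= B ^ 4 * 16" using m by (intro mult_left_mono) auto
 also have "B ^ 4 * 16 = (4 * B^2)^2" by (simp add: power2_eq_square power4_eq_xxxx)
 finally have "sqrt (LINT z|lborel. (tens f g p z)^2) <= sqrt ((4 * B^2)^2)" by (rule real_sqrt_le_mono)
 hence s: "sqrt (LINT z|lborel. (tens f g p z)^2) <= 4 * B^2" by (simp only: real_sqrt_abs) simp
 have "abs (LINT z:S|lebesgue. h z * tens f g p z) = abs (LINT z|lborel. h0 z * tens f g p z)"
  using brep_integral[OF h0 Cc_measurable[OF Cc]] by simp
 also have "... <= sqrt (LINT z|lborel. (h0 z)^2) * sqrt (LINT z|lborel. (tens f g p z)^2)"
  using h0 by (intro CS_integral Cc_sq_int[OF Cc]) (simp add: brep_def)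
 also have "... <= sqrt (LINT z|lborel. (h0 z)^2) * (4 * B^2)" by (intro mult_left_mono s) auto
 finally show ?thesis by (simp add: L2_norm_brep[OF h0])
qed

lemma tens_int:
 assumes "L2_on S h" "rsupp n f" "rsupp n g"
 shows "set_integrable lebesgue S (%z. h z * tens f g p z)"
proof -
 obtain h0 where h0: "brep S h h0" using L2_brep[OF assms(1)] by blast
 have c: "continuous_on UNIV (tens f g p)"
  using assms(2,3) by (intro Ck_on_cont[OF Ck_on_tens]) (auto simp: rsupp_def)
 have Cc: "Cc (tens f g p)" by (rule Cc_csupp[OF c compact_cbox tens_eq_0[OF assms(2,3)]])
 have i: "integrable lborel (%z. h0 z * tens f g p z)"
  using h0 by (intro sq_int_mult Cc_sq_int[OF Cc]) (simp add: brep_def)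
 have "AE z in lebesgue. h0 z * tens f g p z = indicator S z *\<^sub>R (h z * tens f g p z)"
  using h0 unfolding brep_def by (auto elim!: eventually_mono)
 from lebesgue_cong(1)[OF this] show ?thesis
  using i leb_lborel(1)[OF borel_measurable_integrable[OF i, simplified]]
  by (simp add: set_integrable_def)
qed

section \<open>Sobolev bounds and continuity through local averages\<close>

definition pavg :: "nat => real \<times> real => (real \<times> real => real) => real" where
 "pavg n p w = (LINT z:half_plane|lebesgue. w z * tens (moll n) (moll n) p z)"

lemma open_half_plane: "open half_plane"
 unfolding half_plane_def by (intro open_Collect_less continuous_intros)

lemma L2_comp_le:
 fixes g :: "'a::euclidean_space => 'b::euclidean_space"
 assumes "L2_on S g" "b : Basis"
 shows "L2_norm S (%x. g x \<bullet> b) <= L2_norm S g"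
proof -
 have "(g x \<bullet> b)^2 <= (norm (g x))^2" for x
  using Basis_le_norm[OF assms(2), of "g x"] by (metis abs_ge_zero power2_abs power_mono)
 thus ?thesis
  using assms(1) L2_comp[OF assms] unfolding L2_norm_def L2_on_def
  by (intro real_sqrt_le_mono set_integral_mono) auto
qed

text \<open>The embedding of H2 into the bounded functions in two dimensions rests on the mixed
  derivative, since a delta is the mixed derivative of a product of Heaviside functions. Writing
  \<open>moll n\<close> as the derivative of \<open>ramp n\<close> minus \<open>ramp_cut n\<close>
  in both variables and integrating by parts pairs w, its first derivatives and one mixed second
  derivative with functions bounded uniformly in n.\<close>

lemma pavg_bound:
 obtains C where "C >= 0" "!!n p w. w : H2 half_plane ==> inverse (real (Suc n)) < snd p ==>
  abs (pavg n p w) <= C * H2_norm half_plane w"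
proof -
 obtain B0 where B0: "!!t. abs (moll 0 (t::real)) <= B0" using Cc_bounded[OF Cc_moll] by blast
 define B where "B = max 1 B0"
 have B1: "B >= 1" "B0 <= B" by (auto simp: B_def)
 have bt: "abs (ramp n t) <= B" for n t
 proof -
  have "abs (step 0 (2 - t)) * abs (step n t) <= 1 * 1" by (intro mult_mono) (use step_bounds in auto)
  thus ?thesis using B1(1) by (simp add: ramp_def abs_mult)
 qed
 have bc: "abs (ramp_cut n t) <= B" for n t
 proof -
  have "abs (moll 0 (2 - t)) * abs (step n t) <= B * 1"
   using order_trans[OF B0 B1(2)] by (intro mult_mono) (use step_bounds B1 in auto)
  thus ?thesis by (simp add: ramp_cut_def abs_mult)
 qed
 let ?S = half_plane
 have "abs (pavg n p w) <= 16 * B^2 * H2_norm ?S w" if w: "w : H2 ?S" and p: "inverse (real (Suc n)) < snd p" for n p w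
 proof -
  define g where "g = weak_grad ?S w"
  define e1 e2 :: "real \<times> real" where "e1 = (1, 0)" and "e2 = (0, 1)"
  have e: "e1 : Basis" "e2 : Basis" by (auto simp: e1_def e2_def Basis_prod_def)
  define g1 where "g1 z = g z \<bullet> e1" for z
  define g12 where "g12 z = weak_grad ?S g1 z" for z
  have wH: "w : H1 ?S" and g1H: "g1 : H1 ?S"
   using w e(1) by (auto simp: H2_def g_def g1_def[abs_def])
  note W = H1_weak_grad[OF open_half_plane wH] and G1 = H1_weak_grad[OF open_half_plane g1H]
  have L: "L2_on ?S w" "L2_on ?S g" "L2_on ?S g1" "L2_on ?S (%z. g z \<bullet> e2)" "L2_on ?S g12" "L2_on ?S (%z. g12 z \<bullet> e2)"
   using W G1 L2_comp[OF W(3)] L2_comp[OF G1(3)] e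
   by (auto simp: g_def g1_def[abs_def] g12_def[abs_def])
  have ibp1: "(LINT z:?S|lebesgue. w z * Df ph z e1) = - (LINT z:?S|lebesgue. g1 z * ph z)"
   and ibp2: "(LINT z:?S|lebesgue. w z * Df ph z e2) = - (LINT z:?S|lebesgue. (g z \<bullet> e2) * ph z)"
   and ibp12: "(LINT z:?S|lebesgue. g1 z * Df ph z e2) = - (LINT z:?S|lebesgue. (g12 z \<bullet> e2) * ph z)"
   if "test_function ?S ph" for ph
   using W(2) G1(2) that e unfolding has_weak_gradient_def g_def g1_def g12_def by blast+
  define sig where "sig t = moll n t + ramp_cut n t" for t
  define a ta where "a = ramp_cut n" and "ta = ramp n"
  have rs: "rsupp n sig" "rsupp n a" "rsupp n ta" "rsupp n (moll n)"
   unfolding sig_def a_def ta_def by (intro rsupp_add rsupp_ramp)+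
  have dta: "(ta has_real_derivative sig t) (at t)" for t unfolding ta_def sig_def by (rule ramp_DERIV)
  have diff: "(f has_real_derivative deriv f t) (at t)" if "rsupp n f" for f t
   using that Ck_on_real_deriv(1)[of 0 UNIV f t] by (auto simp: rsupp_def simp del: Ck_on.simps)
  have t1: "Df (tens ta f p) z e1 = tens sig f p z" if "rsupp n f" for f z
   unfolding e1_def by (rule tens_derivative(1)[OF dta diff[OF that]])
  have t2: "Df (tens f ta p) z e2 = tens f sig p z" if "rsupp n f" for f z
   unfolding e2_def by (rule tens_derivative(2)[OF diff[OF that] dta])
  note tf = test_function_tens[OF _ _ p]
  have I1: "(LINT z:?S|lebesgue. w z * tens sig sig p z) = (LINT z:?S|lebesgue. (g12 z \<bullet> e2) * tens ta ta p z)"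
   using ibp1[OF tf[OF rs(3,1)]] ibp12[OF tf[OF rs(3,3)]] by (simp add: t1[OF rs(1)] t2[OF rs(3)])
  have I2: "(LINT z:?S|lebesgue. w z * tens sig a p z) = - (LINT z:?S|lebesgue. g1 z * tens ta a p z)"
   using ibp1[OF tf[OF rs(3,2)]] by (simp add: t1[OF rs(2)])
  have I3: "(LINT z:?S|lebesgue. w z * tens a sig p z) = - (LINT z:?S|lebesgue. (g z \<bullet> e2) * tens a ta p z)"
   using ibp2[OF tf[OF rs(2,3)]] by (simp add: t2[OF rs(2)])
  \<comment> \<open>Here \<open>moll n\<close> is sig - a in each variable; every factor
    \<open>sig\<close> is a derivative and is moved over by parts.\<close>
  have "w z * tens (moll n) (moll n) p z =
    w z * tens sig sig p z - w z * tens sig a p z - w z * tens a sig p z + w z * tens a a p z" for z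
   by (simp add: tens_def sig_def a_def algebra_simps)
  hence eq: "pavg n p w = (LINT z:?S|lebesgue. w z * tens sig sig p z) - (LINT z:?S|lebesgue. w z * tens sig a p z)
    - (LINT z:?S|lebesgue. w z * tens a sig p z) + (LINT z:?S|lebesgue. w z * tens a a p z)"
   using tens_int[OF L(1) rs(1) rs(1)] tens_int[OF L(1) rs(1) rs(2)]
    tens_int[OF L(1) rs(2) rs(1)] tens_int[OF L(1) rs(2) rs(2)]
   by (simp add: pavg_def set_integral_add set_integral_diff)
  have "abs (pavg n p w) <= L2_norm ?S (%z. g12 z \<bullet> e2) * (4 * B^2) + L2_norm ?S g1 * (4 * B^2)
    + L2_norm ?S (%z. g z \<bullet> e2) * (4 * B^2) + L2_norm ?S w * (4 * B^2)"
  proof -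
   have ab: "abs (a - (- b) - (- c) + d) <= x + y + z + u" if "abs a <= x" "abs b <= y" "abs c <= z" "abs d <= u"
    for a b c d x y z u :: real using that by linarith
   have B: "abs (ta t) <= B" "abs (a t) <= B" for t unfolding a_def ta_def by (rule bt bc)+
   show ?thesis
    unfolding eq I1 I2 I3
    by (rule ab[OF tens_integral_bound[OF L(6) rs(3) rs(3) B(1) B(1)] tens_integral_bound[OF L(3) rs(3) rs(2) B(1) B(2)]
     tens_integral_bound[OF L(4) rs(2) rs(3) B(2) B(1)] tens_integral_bound[OF L(1) rs(2) rs(2) B(2) B(2)]])
  qed
  also have "... <= H2_norm ?S w * (4 * B^2) + H2_norm ?S w * (4 * B^2) + H2_norm ?S w * (4 * B^2) + H2_norm ?S w * (4 * B^2)"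
  proof -
   define R where "R = (SUM b:Basis. (L2_norm ?S (weak_grad ?S (%x. g x \<bullet> b)))^2)"
   have H: "H2_norm ?S w = sqrt ((L2_norm ?S w)^2 + (L2_norm ?S g)^2 + R)"
    unfolding R_def g_def H2_norm_def by (rule refl)
   have s: "x <= H2_norm ?S w" if x: "x^2 <= (L2_norm ?S w)^2 + (L2_norm ?S g)^2 + R" for x
    unfolding H by (rule real_le_rsqrt[OF x])
   have sn: "0 <= R" unfolding R_def by (intro sum_nonneg) auto
   have a1: "L2_norm ?S w <= H2_norm ?S w" using sn by (intro s) simp
   have a2: "L2_norm ?S g <= H2_norm ?S w" using sn by (intro s) simp
   have "(L2_norm ?S g12)^2 <= R"
    unfolding R_def g12_def[abs_def] g1_def[abs_def]
    by (rule member_le_sum[of e1 Basis "%b. (L2_norm ?S (weak_grad ?S (%x. g x \<bullet> b)))^2"]) (use e in auto)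
   hence a3: "L2_norm ?S g12 <= H2_norm ?S w" by (intro s) (simp add: add_increasing)
   show ?thesis
    using L2_comp_le[OF L(5) e(2)] L2_comp_le[OF L(2) e(1)] L2_comp_le[OF L(2) e(2)] a1 a2 a3
    by (intro add_mono mult_right_mono) (auto simp: g1_def[abs_def])
  qed
  finally show ?thesis by (simp add: algebra_simps)
 qed
 moreover have "16 * B^2 >= 0" by simp
 ultimately show ?thesis using that by blast
qed

lemma tens_moll_integral:
 "(LINT z|lborel. tens (moll n) (moll n) p z) = 1"
proof -
 have rs: "rsupp n (moll n)" by (rule rsupp_ramp)
 have c: "continuous_on UNIV (tens (moll n) (moll n) p)"
  by (rule Ck_on_cont[OF Ck_on_tens[OF Ck_on_moll Ck_on_moll]])
 have "integrable lborel (tens (moll n) (moll n) p)"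
  by (rule Cc_integrable[OF Cc_csupp[OF c compact_cbox tens_eq_0[OF rs rs]]])
 hence i: "integrable (lborel \<Otimes>\<^sub>M lborel) (tens (moll n) (moll n) p)"
  by (simp add: lborel_prod)
 have shift: "(LINT y|lborel. moll n (y - a)) = 1" for a :: real
 proof -
  have "(LINT y|lborel. moll n (y - a)) = (LINT y|lborel. (%z. moll n (- z)) (a - y))" by simp
  also have "... = (LINT y|lborel. moll n (0 - y :: real))"
  proof -
   have [measurable]: "(moll n :: real => real) : borel_measurable borel" by (rule Cc_measurable[OF Cc_moll])
   have "(%z::real. moll n (- z)) : borel_measurable borel" by measurable
   from lborel_reflect(1)[OF this, of a] show ?thesis by simp
  qed
  also have "... = 1"
   using integral_moll[of n, where 'a=real] by (subst lborel_reflect(1)[OF Cc_measurable[OF Cc_moll]])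
  finally show ?thesis .
 qed
 have "(LINT z|lborel. tens (moll n) (moll n) p z) =
   (LINT x|lborel. \<integral>y. moll n (x - fst p) * moll n (y - snd p) \<partial>lborel)"
  using lborel_pair.integral_fst'[OF i] unfolding lborel_prod tens_def fst_conv snd_conv by (rule sym)
 thus ?thesis by (simp add: shift)
qed

lemma pavg_tendsto:
 assumes c: "continuous_on half_plane w" and L2: "L2_on half_plane w" and p: "p : half_plane"
 shows "(%n. pavg n p w) \<longlonglongrightarrow> w p"
proof (rule LIMSEQ_I)
 fix e :: real assume "e > 0"
 obtain d where d: "d > 0" "!!z. z : half_plane ==> dist z p < d ==> dist (w z) (w p) < e / 2"
  using c p \<open>e > 0\<close> unfolding continuous_on_iff by (meson half_gt_zero)
 have p2: "snd p > 0" using p by (simp add: half_plane_def)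
 obtain n0 where n0: "inverse (real (Suc n0)) < min (snd p) (d / 2)"
  using reals_Archimedean[of "min (snd p) (d / 2)"] p2 d(1) by auto
 have "norm (pavg n p w - w p) < e" if "n >= n0" for n
 proof -
  define i where "i = inverse (real (Suc n))"
  have "i <= inverse (real (Suc n0))" using that by (simp add: i_def field_simps)
  moreover have "i > 0" by (simp add: i_def)
  ultimately have i: "i < snd p" "2 * i < d" "i > 0" using n0 unfolding min_less_iff_conj by linarith+
  let ?K = "tens (moll n) (moll n) p"
  have rs: "rsupp n (moll n)" by (rule rsupp_ramp)
  have c': "continuous_on UNIV ?K"
   by (rule Ck_on_cont[OF Ck_on_tens[OF Ck_on_moll Ck_on_moll]])
  have Cc: "Cc ?K" by (rule Cc_csupp[OF c' compact_cbox tens_eq_0[OF rs rs]])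
  have K0: "?K z >= 0" for z by (simp add: tens_def moll_nonneg)
  have supp: "z : half_plane & dist z p < d" if "?K z ~= 0" for z
  proof -
   have nz: "moll n (fst z - fst p) ~= 0" "moll n (snd z - snd p) ~= 0" using that by (auto simp: tens_def)
   have a: "abs (fst z - fst p) < i" "abs (snd z - snd p) < i"
    using nz moll_eq_0[of n "fst z - fst p"] moll_eq_0[of n "snd z - snd p"]
    unfolding i_def real_norm_def by (meson not_le)+
   have "dist z p <= abs (fst z - fst p) + abs (snd z - snd p)"
    using sqrt_sum_squares_le_sum_abs[of "fst z - fst p" "snd z - snd p"]
    by (simp add: dist_prod_def dist_real_def)
   thus ?thesis using a i by (simp add: half_plane_def)
  qed
  have int: "set_integrable lebesgue half_plane (%z. w z * ?K z)" by (rule tens_int[OF L2 rs rs])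
  have KI: "integrable lebesgue ?K" "(LINT z|lebesgue. ?K z) = 1"
   using Cc_integrable[OF Cc] leb_lborel[OF Cc_measurable[OF Cc]] tens_moll_integral[of n p] by auto
  have "pavg n p w - w p = (LINT z|lebesgue. indicator half_plane z *\<^sub>R (w z * ?K z) - w p * ?K z)"
   using int KI by (simp add: pavg_def set_lebesgue_integral_def set_integrable_def)
  hence "norm (pavg n p w - w p) <= (LINT z|lebesgue. e / 2 * ?K z)"
  proof (simp only: real_norm_def, intro order_trans[OF integral_abs_bound] integral_mono)
   fix z
   show "abs (indicator half_plane z *\<^sub>R (w z * ?K z) - w p * ?K z) <= e / 2 * ?K z"
   proof (cases "?K z = 0")
    case False
    hence "z : half_plane" "abs (w z - w p) <= e / 2" using supp[of z] d(2)[of z] by (auto simp: dist_real_def)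
    hence "abs (w z - w p) * ?K z <= e / 2 * ?K z" using K0 by (intro mult_right_mono) auto
    thus ?thesis using \<open>z : half_plane\<close> K0[of z] by (simp add: left_diff_distrib[symmetric] abs_mult)
   qed simp
  qed (use int KI in \<open>auto simp: set_integrable_def\<close>)
  also have "... < e" using KI \<open>e > 0\<close> by simp
  finally show ?thesis .
 qed
 thus "EX no. ALL n>=no. norm (pavg n p w - w p) < e" by blast
qed

text \<open>Only partial derivatives are available, so the coordinates are moved one at a time, with
  the mean value inequality on each segment.\<close>

lemma partials_lipschitz:
 fixes f :: "'a::euclidean_space => real"
 assumes part: "!!x b. (!!j. j : Basis ==> abs ((x - x0) \<bullet> j) <= r) ==> b : Basis ==>
   ((%k. (f (x + k *\<^sub>R b) - f x) / k) \<longlongrightarrow> d b x) (at 0) & abs (d b x) <= M"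
  and x: "!!j. j : Basis ==> abs ((x - x0) \<bullet> j) <= r" and r: "r >= 0"
 shows "abs (f x - f x0) <= M * (SUM j:Basis. abs ((x - x0) \<bullet> j))"
proof -
 \<comment> \<open>The coordinates in A already have their final value; all points in between stay
   in the box around x0.\<close>
 define y where "y A = x0 + (SUM j:A. ((x - x0) \<bullet> j) *\<^sub>R j)" for A
 have "abs (f (y A) - f x0) <= M * (SUM j:A. abs ((x - x0) \<bullet> j))" if "A \<subseteq> Basis" for A
  using finite_subset[OF that finite_Basis] that
 proof (induction A rule: finite_induct)
  case empty
  thus ?case by (simp add: y_def)
 next
  case (insert b A)
  hence b: "b : Basis" and A: "A \<subseteq> Basis" by auto
  define s where "s = (x - x0) \<bullet> b"
  define h where "h k = f (y A + k *\<^sub>R b)" for k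
  have yA: "(y A - x0) \<bullet> j = (if j : A then (x - x0) \<bullet> j else 0)" if "j : Basis" for j
  proof -
   have "(y A - x0) \<bullet> j = (SUM i:A. ((x - x0) \<bullet> i) * (i \<bullet> j))" by (simp add: y_def inner_sum_left)
   also have "... = (SUM i:A. if i = j then (x - x0) \<bullet> i else 0)"
    by (rule sum.cong) (use A that in \<open>auto simp: inner_Basis subset_iff\<close>)
   finally show ?thesis using insert.hyps(1) by simp
  qed
  have inbox: "abs ((y A + k *\<^sub>R b - x0) \<bullet> j) <= r" if k: "abs k <= abs s" and j: "j : Basis" for k j
  proof -
   have "(y A + k *\<^sub>R b - x0) \<bullet> j = (y A - x0) \<bullet> j + k * (b \<bullet> j)" by (simp add: algebra_simps)
   also have "... = (if j : A then (x - x0) \<bullet> j else if j = b then k else 0)"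
    using yA[OF j] insert.hyps(2) b j by (auto simp: inner_Basis)
   finally show ?thesis using x[OF j] x[OF b] k r by (auto simp: s_def)
  qed
  have der: "(h has_real_derivative d b (y A + k *\<^sub>R b)) (at k)" and dM: "abs (d b (y A + k *\<^sub>R b)) <= M"
   if "abs k <= abs s" for k
   using part[OF inbox[OF that] b] by (auto simp: DERIV_def h_def scaleR_add_left algebra_simps)
  have "norm (h s - h 0) <= M * norm (s - 0)"
  proof (rule field_differentiable_bound[of "closed_segment 0 s" h "%k. d b (y A + k *\<^sub>R b)"])
   fix k assume "k : closed_segment 0 s"
   hence k: "abs k <= abs s" by (auto simp: closed_segment_eq_real_ivl split: if_splits)
   show "(h has_field_derivative d b (y A + k *\<^sub>R b)) (at k within closed_segment 0 s)"
    by (rule has_field_derivative_at_within[OF der[OF k]])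
   show "norm (d b (y A + k *\<^sub>R b)) <= M" using dM[OF k] by simp
  qed auto
  moreover have "h s = f (y (insert b A))" "h 0 = f (y A)"
   using insert.hyps by (simp_all add: h_def y_def s_def add_ac)
  ultimately have "abs (f (y (insert b A)) - f (y A)) <= M * abs ((x - x0) \<bullet> b)" by (simp add: s_def)
  thus ?case using insert.IH[OF A] insert.hyps by (simp add: distrib_left)
 qed
 from this[OF order_refl] show ?thesis
  by (simp add: y_def euclidean_representation)
qed

text \<open>These functionals stand in for evaluation at p: they are linear on
  \<open>H2w gm\<close>, bounded uniformly in n and p once 1/(n+1) < snd p, and tend to the weighted
  value exp (gm snd p) v(p) for continuous v.\<close>

definition wavg :: "real => nat => real \<times> real => (real \<times> real => real) => real" where
 "wavg gm n p v = pavg n p (%z. exp (gm * snd z) * v z)"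

lemma H2w_L2: "v : H2w gm ==> L2_on half_plane (%z. exp (gm * snd z) * v z)"
 by (auto simp: H2w_def H2_def H1_def)

lemma wavg_linear:
 assumes "u : H2w gm" "v : H2w gm"
 shows "wavg gm n p (%z. u z + c * v z) = wavg gm n p u + c * wavg gm n p v"
proof -
 have rs: "rsupp n (moll n)" by (rule rsupp_ramp)
 note i = tens_int[OF H2w_L2[OF assms(1)] rs rs, of p] tens_int[OF H2w_L2[OF assms(2)] rs rs, of p]
 have "wavg gm n p (%z. u z + c * v z) =
  (LINT z:half_plane|lebesgue. exp (gm * snd z) * u z * tens (moll n) (moll n) p z
    + c * (exp (gm * snd z) * v z * tens (moll n) (moll n) p z))"
  by (simp add: wavg_def pavg_def algebra_simps)
 also have "... = wavg gm n p u + c * wavg gm n p v"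
  using i by (subst set_integral_add) (auto simp: wavg_def pavg_def)
 finally show ?thesis .
qed

lemma wavg_bound:
 obtains C where "C > 0" "!!gm n p v. v : H2w gm ==> inverse (real (Suc n)) < snd p ==>
  abs (wavg gm n p v) <= C * H2w_norm gm v"
proof -
 obtain C where C: "C >= 0" "!!n p w. w : H2 half_plane ==> inverse (real (Suc n)) < snd p ==>
  abs (pavg n p w) <= C * H2_norm half_plane w" using pavg_bound by blast
 have "0 <= H2w_norm gm v" for gm v
  by (simp add: H2w_norm_def H2_norm_def sum_nonneg)
 hence "abs (wavg gm n p v) <= (C + 1) * H2w_norm gm v"
  if "v : H2w gm" "inverse (real (Suc n)) < snd p" for gm n p v
  using C(2)[OF _ that(2), of "%z. exp (gm * snd z) * v z"] that(1)
  by (simp add: wavg_def H2w_def H2w_norm_def distrib_right add_increasing2)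
 thus ?thesis using that[of "C + 1"] C(1) by simp
qed

text \<open>A bounded functional takes derivatives in norm to scalar derivatives; the work lies in
  seeing that the difference quotients belong to \<open>H2w gm\<close>, so that the bound applies to
  them.\<close>

lemma wavg_partial:
 assumes C: "!!v. v : H2w gm ==> abs (wavg gm n p v) <= C * H2w_norm gm v"
  and U: "open U" "x : U" and F: "!!y. y : U ==> F y : H2w gm"
  and part: "has_partial_in (H2w gm) (H2w_norm gm) F x b D"
 shows "((%k. (wavg gm n p (F (x + k *\<^sub>R b)) - wavg gm n p (F x)) / k)
   \<longlongrightarrow> wavg gm n p D) (at 0)"
proof -
 have D: "D : H2w gm" and lim: "((%k. H2w_norm gm (%z. (F (x + k *\<^sub>R b) z - F x z) / k - D z)) \<longlongrightarrow> 0) (at 0)"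
  using part by (auto simp: has_partial_in_def)
 have "isCont (%k. x + k *\<^sub>R b) 0" by (intro continuous_intros)
 hence "((%k. x + k *\<^sub>R b) \<longlongrightarrow> x) (at 0)" by (simp add: isCont_def)
 hence "eventually (%k. x + k *\<^sub>R b : U) (at 0)"
  using U topological_tendstoD by blast
 hence "eventually (%k. norm ((wavg gm n p (F (x + k *\<^sub>R b)) - wavg gm n p (F x)) / k
   - wavg gm n p D) <= C * H2w_norm gm (%z. (F (x + k *\<^sub>R b) z - F x z) / k - D z)) (at 0)"
 proof (rule eventually_mono)
  fix k assume "x + k *\<^sub>R b : U"
  hence Fk: "F (x + k *\<^sub>R b) : H2w gm" and Fx: "F x : H2w gm" using F U(2) by auto
  have zero: "(%z. 0) : H2w gm" using H2w_add_scaled[OF D D, of "-1"] by simp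
  have d: "(%z. F (x + k *\<^sub>R b) z + (-1) * F x z) : H2w gm" by (rule H2w_add_scaled[OF Fk Fx])
  have q: "(%z. 0 + inverse k * (F (x + k *\<^sub>R b) z + (-1) * F x z)) : H2w gm" by (rule H2w_add_scaled[OF zero d])
  have e: "(%z. (0 + inverse k * (F (x + k *\<^sub>R b) z + (-1) * F x z)) + (-1) * D z) : H2w gm"
   by (rule H2w_add_scaled[OF q D])
  have fe: "(%z. (0 + inverse k * (F (x + k *\<^sub>R b) z + (-1) * F x z)) + (-1) * D z) =
   (%z. (F (x + k *\<^sub>R b) z - F x z) / k - D z)" by (simp add: field_simps)
  have w0: "wavg gm n p (%z. 0) = 0"
   by (simp add: wavg_def pavg_def)
  have "wavg gm n p (%z. (0 + inverse k * (F (x + k *\<^sub>R b) z + (-1) * F x z)) + (-1) * D z) =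
   inverse k * (wavg gm n p (F (x + k *\<^sub>R b)) + (-1) * wavg gm n p (F x))
    + (-1) * wavg gm n p D"
   unfolding wavg_linear[OF q D] wavg_linear[OF zero d]
    wavg_linear[OF Fk Fx] w0 by simp
  hence "(wavg gm n p (F (x + k *\<^sub>R b)) - wavg gm n p (F x)) / k - wavg gm n p D
   = wavg gm n p (%z. (F (x + k *\<^sub>R b) z - F x z) / k - D z)"
   unfolding fe by (simp add: divide_inverse mult.commute)
  thus "norm ((wavg gm n p (F (x + k *\<^sub>R b)) - wavg gm n p (F x)) / k
   - wavg gm n p D) <= C * H2w_norm gm (%z. (F (x + k *\<^sub>R b) z - F x z) / k - D z)"
   using C[OF e] unfolding fe by simp
 qed
 moreover have "((%k. C * H2w_norm gm (%z. (F (x + k *\<^sub>R b) z - F x z) / k - D z)) \<longlongrightarrow> 0) (at 0)"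
  using tendsto_mult_left[OF lim, of C] by simp
 ultimately have "((%k. (wavg gm n p (F (x + k *\<^sub>R b)) - wavg gm n p (F x)) / k
   - wavg gm n p D) \<longlongrightarrow> 0) (at 0)"
  by (rule Lim_null_comparison)
 thus ?thesis by (rule LIM_zero_cancel)
qed

lemma wavg_tendsto:
 assumes "v : H2w gm" "continuous_on half_plane v" "p : half_plane"
 shows "(%n. wavg gm n p v) \<longlonglongrightarrow> exp (gm * snd p) * v p"
 unfolding wavg_def
 by (rule pavg_tendsto[where w="%z. exp (gm * snd z) * v z", OF _ H2w_L2[OF assms(1)] assms(3)])
  (intro continuous_intros assms(2))

lemma ev_inverse_less: "s > 0 ==> eventually (%n. inverse (real (Suc n)) < s) sequentially"
 using order_tendstoD(2)[OF LIMSEQ_inverse_real_of_nat] by blast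

text \<open>The uniform bound on the averages passes to the limit because u is the continuous
  representative. The summand 1 in the constant makes it positive.\<close>

lemma corner_bound:
 assumes cp: "corner_profile G gm u"
 obtains C where "C > 0" "!!sig t p. sig : surf_boundary (gSigma G) ==> t : {0..gT G} ==> p : half_plane ==>
  abs (u p sig t) <= C * exp (- gm * snd p)"
proof -
 obtain C0 where C0: "C0 > 0" "!!gm n p v. v : H2w gm ==> inverse (real (Suc n)) < snd p ==>
  abs (wavg gm n p v) <= C0 * H2w_norm gm v" using wavg_bound by blast
 let ?B = "surf_boundary (gSigma G)"
 have cont: "!!sig t. sig : ?B ==> t : {0..gT G} ==> continuous_on half_plane (%p. u p sig t)"
  using cp by (simp add: corner_profile_def Let_def)
 obtain C1 where C1: "!!t. t : {0..gT G} ==> EX U F D1 D2.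
    open U & ?B \<subseteq> U & C2_into (H2w gm) (H2w_norm gm) U F D1 D2 &
    (ALL sig:?B. F sig = (%p. u p sig t) & H2w_norm gm (F sig) <= C1)"
  using cp unfolding corner_profile_def Let_def by meson
 have "abs (u p sig t) <= (C0 * abs C1 + 1) * exp (- gm * snd p)"
  if s: "sig : ?B" and t: "t : {0..gT G}" and p: "p : half_plane" for sig t p
 proof -
  have v: "(%p. u p sig t) : H2w gm" "H2w_norm gm (%p. u p sig t) <= C1"
   using C1[OF t] s unfolding C2_into_def by (metis subsetD)+
  have "abs (exp (gm * snd p) * u p sig t) <= C0 * abs C1"
  proof (rule LIMSEQ_le_const2[OF tendsto_rabs[OF wavg_tendsto[OF v(1) cont[OF s t] p]]])
   have "eventually (%n. inverse (real (Suc n)) < snd p) sequentially"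
    using p by (intro ev_inverse_less) (simp add: half_plane_def)
   hence "eventually (%n. abs (wavg gm n p (%p. u p sig t)) <= C0 * abs C1) sequentially"
   proof (rule eventually_mono)
    fix n assume "inverse (real (Suc n)) < snd p"
    hence "abs (wavg gm n p (%p. u p sig t)) <= C0 * H2w_norm gm (%p. u p sig t)"
     by (rule C0(2)[OF v(1)])
    also have "... <= C0 * abs C1" using v(2) C0(1) by (intro mult_left_mono) auto
    finally show "abs (wavg gm n p (%p. u p sig t)) <= C0 * abs C1" .
   qed
   thus "EX N. ALL n>=N. abs (wavg gm n p (%p. u p sig t)) <= C0 * abs C1"
    by (simp add: eventually_sequentially)
  qed
  hence "exp (gm * snd p) * abs (u p sig t) <= C0 * abs C1 + 1" by (simp add: abs_mult)
  thus ?thesis by (simp add: exp_minus field_simps)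
 qed
 moreover have "C0 * abs C1 + 1 > 0" using C0(1) by (simp add: add_nonneg_pos)
 ultimately show ?thesis using that by blast
qed

text \<open>Joint continuity is what makes the corner term measurable in x. Continuity of the second
  derivatives at \<open>sig0\<close> bounds them in a box, hence also the first derivatives, hence
  the averages are Lipschitz at \<open>sig0\<close> uniformly in p. For gm > 0 the weight is at
  least 1, so the same holds for u itself.\<close>

lemma corner_cont:
 assumes cp: "corner_profile G gm u" and gm: "gm > 0" and t: "t : {0..gT G}"
 shows "continuous_on (half_plane \<times> surf_boundary (gSigma G)) (%(p, sig). u p sig t)"
proof -
 let ?B = "surf_boundary (gSigma G)"
 obtain C0 where C0: "C0 > 0" "!!gm n p v. v : H2w gm ==> inverse (real (Suc n)) < snd p ==>
  abs (wavg gm n p v) <= C0 * H2w_norm gm v" using wavg_bound by blast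
 have cont: "!!sig. sig : ?B ==> continuous_on half_plane (%p. u p sig t)"
  using cp t by (simp add: corner_profile_def Let_def)
 obtain U F D1 D2 where U: "open U" "?B \<subseteq> U" and c2: "C2_into (H2w gm) (H2w_norm gm) U F D1 D2"
  and F: "!!sig. sig : ?B ==> F sig = (%p. u p sig t)"
  using cp t unfolding corner_profile_def Let_def by meson
 have FU: "!!y. y : U ==> F y : H2w gm"
  and p1: "!!y b. y : U ==> b : Basis ==> has_partial_in (H2w gm) (H2w_norm gm) F y b (D1 b y)"
  and p2: "!!y b c. y : U ==> b : Basis ==> c : Basis ==> has_partial_in (H2w gm) (H2w_norm gm) (D1 b) y c (D2 b c y)"
  and c3: "!!x b c. x : U ==> b : Basis ==> c : Basis ==>
    ((%y. H2w_norm gm (%p. D2 b c y p - D2 b c x p)) \<longlongrightarrow> 0) (at x)"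
  using c2 by (auto simp: C2_into_def)
 have D1U: "!!y b. y : U ==> b : Basis ==> D1 b y : H2w gm"
  and D2U: "!!y b c. y : U ==> b : Basis ==> c : Basis ==> D2 b c y : H2w gm"
  using p1 p2 by (auto simp: has_partial_in_def)
 have lip: "EX L r. r > 0 & L >= 0 & (ALL sig:?B. dist sig sig0 < r --> (ALL p:half_plane. abs (u p sig t - u p sig0 t) <= L * dist sig sig0))"
  if s0: "sig0 : ?B" for sig0
 proof -
  have s0U: "sig0 : U" using s0 U(2) by blast
  have "eventually (%y. ALL b:Basis. ALL c:Basis. H2w_norm gm (%p. D2 b c y p - D2 b c sig0 p) < 1) (at sig0)"
   using order_tendstoD(2)[OF c3[OF s0U], of _ _ 1] by (intro eventually_ball_finite finite_Basis ballI) auto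
  then obtain r1 where r1: "r1 > 0" "!!y b c. y ~= sig0 ==> dist y sig0 < r1 ==> b : Basis ==> c : Basis ==>
    H2w_norm gm (%p. D2 b c y p - D2 b c sig0 p) < 1"
   unfolding eventually_at by blast
  obtain r2 where r2: "r2 > 0" "ball sig0 r2 \<subseteq> U" using U(1) s0U open_contains_ball by blast
  \<comment> \<open>A point of the box with half-side r has distance at most min r1 r2 / 2 from
    \<open>sig0\<close>.\<close>
  define r where "r = min r1 r2 / (2 * DIM('a))"
  have r: "r > 0" using r1(1) r2(1) by (simp add: r_def)
  have box: "dist y sig0 < r1" "y : U" if "!!j. j : Basis ==> abs ((y - sig0) \<bullet> j) <= r" for y
  proof -
   have "norm (y - sig0) <= (SUM j:Basis. abs ((y - sig0) \<bullet> j))" by (rule norm_le_l1)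
   also have "... <= (SUM j:(Basis::'a set). r)" by (rule sum_mono) (use that in auto)
   also have "... = min r1 r2 / 2" by (simp add: r_def)
   finally have "norm (y - sig0) <= min r1 r2 / 2" .
   thus "dist y sig0 < r1" "y : U" using r1(1) r2 by (auto simp: dist_norm norm_minus_commute subset_iff)
  qed
  have nn: "0 <= H2w_norm gm v" for v
   by (simp add: H2w_norm_def H2_norm_def sum_nonneg)
  \<comment> \<open>Bound for the averaged second derivatives in the box: their size at
    \<open>sig0\<close>, plus 1 for their variation. \<open>M1\<close> adds the resulting growth of
    the first derivatives.\<close>
  define M2 where "M2 = C0 * ((SUM b:Basis. SUM c:Basis. H2w_norm gm (D2 b c sig0)) + 1)"
  define M1 where "M1 = C0 * (SUM b:Basis. H2w_norm gm (D1 b sig0)) + M2 * (SUM j:(Basis::'a set). r)"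
  have M2: "M2 >= 0" unfolding M2_def using C0(1) nn by (intro mult_nonneg_nonneg add_nonneg_nonneg sum_nonneg) auto
  have M1: "M1 >= 0" unfolding M1_def using C0(1) nn M2 r
   by (intro mult_nonneg_nonneg add_nonneg_nonneg sum_nonneg) auto
  have key: "abs (wavg gm n p (F y) - wavg gm n p (F sig0)) <= M1 * (SUM j:Basis. abs ((y - sig0) \<bullet> j))"
   if y: "!!j. j : Basis ==> abs ((y - sig0) \<bullet> j) <= r" and n: "inverse (real (Suc n)) < snd p" for y n p
  proof -
   define A where "A = wavg gm n p"
   have CA: "!!v. v : H2w gm ==> abs (A v) <= C0 * H2w_norm gm v" unfolding A_def by (rule C0(2)[OF _ n])
   have A2: "abs (A (D2 b c z)) <= M2" if z: "!!j. j : Basis ==> abs ((z - sig0) \<bullet> j) <= r" and bc: "b : Basis" "c : Basis" for z b c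
   proof -
    have "H2w_norm gm (D2 b c sig0) <= (SUM c:Basis. H2w_norm gm (D2 b c sig0))"
     using bc nn by (intro member_le_sum) auto
    also have "... <= (SUM b:Basis. SUM c:Basis. H2w_norm gm (D2 b c sig0))"
     using bc nn by (intro member_le_sum[of b Basis "%b. SUM c:Basis. H2w_norm gm (D2 b c sig0)"] sum_nonneg) auto
    finally have le: "C0 * H2w_norm gm (D2 b c sig0) <= C0 * (SUM b:Basis. SUM c:Basis. H2w_norm gm (D2 b c sig0))"
     using C0(1) by (intro mult_left_mono) auto
    show ?thesis
    proof (cases "z = sig0")
     case True
     thus ?thesis
      unfolding M2_def distrib_left using CA[OF D2U[OF s0U bc]] le C0(1) by (simp only:)
    next
     case False
     note zz = box[OF z]
     have d: "(%p. D2 b c z p + (-1) * D2 b c sig0 p) : H2w gm"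
      by (rule H2w_add_scaled[OF D2U[OF zz(2) bc] D2U[OF s0U bc]])
     have "abs (A (%p. D2 b c z p + (-1) * D2 b c sig0 p)) <= C0 * 1"
      using CA[OF d] r1(2)[OF False zz(1) bc] C0(1)
      by (intro order_trans[OF CA[OF d]] mult_left_mono) auto
     moreover have "A (%p. D2 b c z p + (-1) * D2 b c sig0 p) = A (D2 b c z) + (-1) * A (D2 b c sig0)"
      unfolding A_def by (rule wavg_linear[OF D2U[OF zz(2) bc] D2U[OF s0U bc]])
     ultimately show ?thesis using CA[OF D2U[OF s0U bc]] le by (simp add: M2_def distrib_left)
    qed
   qed
   have A1: "abs (A (D1 b z)) <= M1" if z: "!!j. j : Basis ==> abs ((z - sig0) \<bullet> j) <= r" and b: "b : Basis" for z b
   proof -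
    have "abs (A (D1 b z) - A (D1 b sig0)) <= M2 * (SUM j:Basis. abs ((z - sig0) \<bullet> j))"
    proof (rule partials_lipschitz[of sig0 r "%z. A (D1 b z)" "%c z. A (D2 b c z)"])
     fix x c :: 'a assume x: "!!j. j : Basis ==> abs ((x - sig0) \<bullet> j) <= r" and c: "c : Basis"
     show "((%k. (A (D1 b (x + k *\<^sub>R c)) - A (D1 b x)) / k) \<longlongrightarrow> A (D2 b c x)) (at 0) & abs (A (D2 b c x)) <= M2"
      unfolding A_def
      using wavg_partial[OF C0(2)[OF _ n] U(1) box(2)[OF x] D1U[OF _ b] p2[OF box(2)[OF x] b c]] A2[OF x b c]
      by (simp add: A_def)
    qed (use z r in auto)
    also have "... <= M2 * (SUM j:(Basis::'a set). r)" by (intro mult_left_mono sum_mono M2 z)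
    finally have 1: "abs (A (D1 b z) - A (D1 b sig0)) <= M2 * (SUM j:(Basis::'a set). r)" .
    have "H2w_norm gm (D1 b sig0) <= (SUM b:Basis. H2w_norm gm (D1 b sig0))"
     using b nn by (intro member_le_sum) auto
    hence "C0 * H2w_norm gm (D1 b sig0) <= C0 * (SUM b:Basis. H2w_norm gm (D1 b sig0))"
     using C0(1) by (intro mult_left_mono) auto
    with 1 CA[OF D1U[OF s0U b]] show ?thesis unfolding M1_def by linarith
   qed
   show ?thesis
   proof (rule partials_lipschitz[of sig0 r "%z. wavg gm n p (F z)" "%b z. A (D1 b z)"])
    fix x b :: 'a assume x: "!!j. j : Basis ==> abs ((x - sig0) \<bullet> j) <= r" and b: "b : Basis"
    show "((%k. (wavg gm n p (F (x + k *\<^sub>R b)) - wavg gm n p (F x)) / k) \<longlongrightarrow> A (D1 b x)) (at 0) & abs (A (D1 b x)) <= M1"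
     using wavg_partial[OF C0(2)[OF _ n] U(1) box(2)[OF x] FU p1[OF box(2)[OF x] b]] A1[OF x b]
     by (simp add: A_def)
   qed (use y r in auto)
  qed
  have "abs (u p sig t - u p sig0 t) <= M1 * DIM('a) * dist sig sig0"
   if s: "sig : ?B" "dist sig sig0 < r" and p: "p : half_plane" for sig p
  proof -
   have bd: "abs ((sig - sig0) \<bullet> j) <= dist sig sig0" if "j : Basis" for j
    using Basis_le_norm[OF that, of "sig - sig0"] by (simp add: dist_norm)
   have sb: "!!j. j : Basis ==> abs ((sig - sig0) \<bullet> j) <= r" using bd s(2) by (meson less_imp_le order_trans)
   have sU: "sig : U" using s(1) U(2) by blast
   have v: "(%p. u p sig t) : H2w gm" "(%p. u p sig0 t) : H2w gm"
    using FU[OF sU] FU[OF s0U] F[OF s(1)] F[OF s0] by simp_all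
   have lim: "(%n. abs (wavg gm n p (F sig) - wavg gm n p (F sig0))) \<longlonglongrightarrow>
     \<bar>exp (gm * snd p) * u p sig t - exp (gm * snd p) * u p sig0 t\<bar>"
    unfolding F[OF s(1)] F[OF s0]
    by (intro tendsto_rabs tendsto_diff wavg_tendsto v cont s s0 p)
   have ev: "eventually (%n. inverse (real (Suc n)) < snd p) sequentially"
    using p by (intro ev_inverse_less) (simp add: half_plane_def)
   have "abs (exp (gm * snd p) * u p sig t - exp (gm * snd p) * u p sig0 t) <= M1 * (SUM j:Basis. abs ((sig - sig0) \<bullet> j))"
    by (rule tendsto_upperbound[OF lim eventually_mono[OF ev key[OF sb]]]) auto
   also have "... <= M1 * (SUM j:(Basis::'a set). dist sig sig0)" by (intro mult_left_mono sum_mono M1 bd)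
   also have "... = M1 * DIM('a) * dist sig sig0" by simp
   finally have 1: "exp (gm * snd p) * abs (u p sig t - u p sig0 t) <= M1 * DIM('a) * dist sig sig0"
    by (simp add: right_diff_distrib[symmetric] abs_mult)
   have "1 <= exp (gm * snd p)" using gm p by (simp add: half_plane_def)
   from mult_right_mono[OF this, of "abs (u p sig t - u p sig0 t)"] 1 show ?thesis by simp
  qed
  thus ?thesis using r M1 by (intro exI[of _ "M1 * DIM('a)"] exI[of _ r]) auto
 qed
 show ?thesis
  unfolding continuous_on_iff
 proof safe
  fix p0 sig0 and e :: real assume p0: "p0 : half_plane" and s0: "sig0 : ?B" and e: "0 < e"
  obtain L r where L: "r > 0" "L >= 0" "!!sig p. sig : ?B ==> dist sig sig0 < r ==> p : half_plane ==>
   abs (u p sig t - u p sig0 t) <= L * dist sig sig0" using lip[OF s0] by blast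
  obtain d where d: "d > 0" "!!p. p : half_plane ==> dist p p0 < d ==> dist (u p sig0 t) (u p0 sig0 t) < e / 2"
   using cont[OF s0] p0 e unfolding continuous_on_iff by (meson half_gt_zero)
  define et where "et = min (min d r) (e / (2 * (L + 1)))"
  have eta: "et > 0" using d(1) L(1,2) e by (simp add: et_def)
  have "dist (u p sig t) (u p0 sig0 t) < e"
   if p: "p : half_plane" and s: "sig : ?B" and dd: "dist (p, sig) (p0, sig0) < et" for p sig
  proof -
   have a: "dist p p0 < et" "dist sig sig0 < et"
    using dd dist_fst_le[of "(p, sig)" "(p0, sig0)"] dist_snd_le[of "(p, sig)" "(p0, sig0)"] by auto
   have "L * dist sig sig0 <= (L + 1) * (e / (2 * (L + 1)))"
    using a(2) L(2) by (intro mult_mono) (auto simp: et_def)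
   also have "... = e / 2"
    using L(2) nonzero_mult_divide_mult_cancel_left[of "L + 1" e 2] by (simp add: mult.commute)
   finally have "abs (u p sig t - u p sig0 t) <= e / 2" using L(3)[OF s _ p] a(2) by (auto simp: et_def intro: order_trans)
   moreover have "dist (u p sig0 t) (u p0 sig0 t) < e / 2" using d(2)[OF p] a(1) by (simp add: et_def)
   ultimately show ?thesis unfolding dist_real_def by linarith
  qed
  thus "EX d>0. ALL x':half_plane \<times> ?B. dist x' (p0, sig0) < d -->
    dist (case x' of (p, sig) => u p sig t) (u p0 sig0 t) < e"
   using eta by (intro exI[of _ et]) auto
 qed
qed

section \<open>The optimal profile\<close>

lemma well_derivs:
 assumes "double_well f"
 shows "(f has_real_derivative deriv f x) (at x)"
  "(deriv f has_real_derivative deriv (deriv f) x) (at x)"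
  "(deriv (deriv f) has_real_derivative deriv (deriv (deriv f)) x) (at x)"
  "continuous_on UNIV (deriv (deriv f))" "continuous_on UNIV (deriv (deriv (deriv f)))"
proof -
 have f: "Ck_on k UNIV f" for k
  using assms by (simp add: double_well_def smooth_Ck)
 have f1: "Ck_on k UNIV (deriv f)" for k using Ck_on_real_deriv(2)[OF f] by blast
 have f2: "Ck_on k UNIV (deriv (deriv f))" for k using Ck_on_real_deriv(2)[OF f1] by blast
 have f3: "Ck_on k UNIV (deriv (deriv (deriv f)))" for k using Ck_on_real_deriv(2)[OF f2] by blast
 show "(f has_real_derivative deriv f x) (at x)" by (rule Ck_on_real_deriv(1)[OF f]) simp
 show "(deriv f has_real_derivative deriv (deriv f) x) (at x)" by (rule Ck_on_real_deriv(1)[OF f1]) simp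
 show "(deriv (deriv f) has_real_derivative deriv (deriv (deriv f)) x) (at x)"
  by (rule Ck_on_real_deriv(1)[OF f2]) simp
 show "continuous_on UNIV (deriv (deriv f))" "continuous_on UNIV (deriv (deriv (deriv f)))"
  by (rule Ck_on_cont[OF f2] Ck_on_cont[OF f3])+
qed

lemma compact_bound:
 assumes "compact S" "continuous_on S h"
 shows "EX B. ALL x:S. norm (h x) <= B"
 using compact_imp_bounded[OF compact_continuous_image[OF assms(2,1)]] by (auto simp: bounded_iff)

text \<open>Two mean value estimates: first |f'| <= B |x - a| between a and x because f' a = 0, then
  the increment of f.\<close>

lemma quadratic_contact:
 fixes f f' f'' :: "real => real"
 assumes d: "!!x. (f has_real_derivative f' x) (at x)" "!!x. (f' has_real_derivative f'' x) (at x)"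
  and B: "!!x. abs x <= M ==> abs (f'' x) <= B" and a: "f' a = 0" "abs a <= M" and x: "abs x <= M"
 shows "abs (f x - f a) <= B * (x - a)^2"
proof -
 have seg: "closed_segment a x \<subseteq> {-M..M}"
  using a(2) x by (auto simp: closed_segment_eq_real_ivl split: if_splits)
 have f1: "abs (f' y) <= B * abs (x - a)" if y: "y : closed_segment a x" for y
 proof -
  have "norm (f' y - f' a) <= B * norm (y - a)"
   by (rule field_differentiable_bound[of "{-M..M}" f' f''])
    (use d(2) B a(2) y seg in \<open>auto intro: has_field_derivative_at_within\<close>)
  moreover have "B >= 0" using B[OF x] by linarith
  moreover have "abs (y - a) <= abs (x - a)"
   using y by (auto simp: closed_segment_eq_real_ivl split: if_splits)
  ultimately show ?thesis using a(1) mult_left_mono[of "abs (y - a)" "abs (x - a)" B] by simp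
 qed
 have "norm (f x - f a) <= (B * abs (x - a)) * norm (x - a)"
  by (rule field_differentiable_bound[of "closed_segment a x" f f'])
   (use d(1) f1 in \<open>auto intro: has_field_derivative_at_within\<close>)
 thus ?thesis by (simp add: power2_eq_square mult.assoc)
qed

text \<open>Gronwall in both directions of time: y exp (- C z) is nonincreasing and y exp (C z) is
  nondecreasing.\<close>

lemma gronwall_zero:
 fixes y y' :: "real => real"
 assumes d: "!!z. (y has_real_derivative y' z) (at z)" and b: "!!z. abs (y' z) <= C * y z"
  and z0: "y z0 = 0" and nn: "!!z. y z >= 0"
 shows "y z = 0"
proof (cases "z0 <= z")
 case True
 have "y z * exp (- C * z) <= y z0 * exp (- C * z0)"
 proof (rule DERIV_nonpos_imp_nonincreasing[OF True, of "%z. y z * exp (- C * z)"])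
  fix x
  have "((%z. y z * exp (- C * z)) has_real_derivative (y' x - C * y x) * exp (- C * x)) (at x)"
   by (auto intro!: derivative_eq_intros d simp: algebra_simps)
  moreover have "(y' x - C * y x) * exp (- C * x) <= 0"
   using b[of x] by (intro mult_nonpos_nonneg) auto
  ultimately show "EX l. ((%z. y z * exp (- C * z)) has_real_derivative l) (at x) & l <= 0" by blast
 qed
 hence "y z * exp (- C * z) <= 0" using z0 by simp
 thus ?thesis using nn[of z] by (simp add: mult_le_0_iff)
next
 case False
 have "y z * exp (C * z) <= y z0 * exp (C * z0)"
 proof (rule DERIV_nonneg_imp_nondecreasing[of z z0 "%z. y z * exp (C * z)"])
  fix x
  have "((%z. y z * exp (C * z)) has_real_derivative (y' x + C * y x) * exp (C * x)) (at x)"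
   by (auto intro!: derivative_eq_intros d simp: algebra_simps)
  moreover have "(y' x + C * y x) * exp (C * x) >= 0"
   using b[of x] by (intro mult_nonneg_nonneg) auto
  ultimately show "EX l. ((%z. y z * exp (C * z)) has_real_derivative l) (at x) & 0 <= l" by blast
 qed (use False in auto)
 hence "y z * exp (C * z) <= 0" using z0 by simp
 thus ?thesis using nn[of z] by (simp add: mult_le_0_iff)
qed

text \<open>Ground state substitution: \<open>g = th'' / th'\<close> solves the Riccati equation \<open>g' + g^2 = f''(th)\<close>.\<close>

lemma profile_riccati:
 assumes f: "double_well f" and th: "optimal_profile f th"
 obtains g where "!!z. (g has_real_derivative (deriv (deriv f) (th z) - (g z)^2)) (at z)"
  "!!z. abs (th z) < 1" "continuous_on UNIV th"
proof -
 note fd = well_derivs[OF f]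
 have C2: "Ck_on (Suc (Suc 0)) UNIV th" using th by (simp add: optimal_profile_def numeral_2_eq_2)
 have d1: "(th has_real_derivative deriv th z) (at z)" for z by (rule Ck_on_real_deriv(1)[OF C2]) simp
 have C1: "Ck_on (Suc 0) UNIV (deriv th)" using Ck_on_real_deriv(2)[OF C2] by blast
 have "(deriv th has_real_derivative deriv (deriv th) z) (at z)" for z by (rule Ck_on_real_deriv(1)[OF C1]) simp
 moreover have "deriv (deriv th) z = deriv f (th z)" for z
  using th by (auto simp: optimal_profile_def dest!: spec[of _ z])
 ultimately have d2: "(deriv th has_real_derivative deriv f (th z)) (at z)" for z by simp
 have t0: "th 0 = 0" and top: "(th \<longlongrightarrow> 1) at_top" and bot: "(th \<longlongrightarrow> -1) at_bot"
  using th by (auto simp: optimal_profile_def)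
 have fp: "deriv f 1 = 0" "deriv f (-1) = 0" "f (-1) = f 1" "!!x. -1 < x ==> x < 1 ==> f x > f 1"
  using f by (auto simp: double_well_def)
 have cont: "isCont th z" "isCont (deriv th) z" for z using DERIV_isCont d1 d2 by blast+
 \<comment> \<open>The first integral of the equation; it is constant, and its value is found at
   infinity.\<close>
 define E where "E z = (deriv th z)^2 - 2 * (f (th z) - f 1)" for z
 have "(E has_real_derivative 0) (at z)" for z
  unfolding E_def
  by (auto intro!: derivative_eq_intros d1 d2 DERIV_chain2[OF fd(1) d1] simp: power2_eq_square)
 hence Ec: "E z = E 0" for z using DERIV_isconst_all by metis
 have "E 0 = 0"
 proof -
  \<comment> \<open>Since th (n+1) - th n tends to 0, the derivative of th tends to 0 along mean
    value points that run off to infinity.\<close>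
  have "EX xv. real n < xv & th (real n + 1) - th (real n) = deriv th xv" for n
   using MVT2[of "real n" "real n + 1" th "deriv th"] d1 by force
  then obtain xv where xi: "!!n. real n < xv n" "!!n. th (real n + 1) - th (real n) = deriv th (xv n)" by metis
  have xt: "filterlim xv at_top sequentially"
   by (rule filterlim_at_top_mono[OF filterlim_real_sequentially]) (use xi(1) in \<open>auto intro!: always_eventually less_imp_le\<close>)
  have n1: "filterlim (%n. real n + 1) at_top sequentially"
   by (rule filterlim_at_top_mono[OF filterlim_real_sequentially]) auto
  have "(%n. th (real n + 1) - th (real n)) \<longlonglongrightarrow> 1 - 1"
   by (intro tendsto_diff filterlim_compose[OF top] n1 filterlim_real_sequentially)
  hence "(%n. deriv th (xv n)) \<longlonglongrightarrow> 0" using xi(2) by simp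
  moreover have "(%n. f (th (xv n))) \<longlonglongrightarrow> f 1"
   by (rule isCont_tendsto_compose[OF DERIV_isCont[OF fd(1)] filterlim_compose[OF top xt]])
  ultimately have "(%n. E (xv n)) \<longlonglongrightarrow> 0\<^sup>2 - 2 * (f 1 - f 1)"
   unfolding E_def by (intro tendsto_intros)
  moreover have "(%n. E (xv n)) = (%n. E 0)" using Ec by (rule ext)
  ultimately have "(%n::nat. E 0) \<longlonglongrightarrow> 0" by simp
  thus ?thesis by (simp add: LIMSEQ_const_iff)
 qed
 hence en: "(deriv th z)^2 = 2 * (f (th z) - f 1)" for z using Ec[of z] by (simp add: E_def)
 obtain M where M: "M >= 1" "!!z. abs (th z) <= M"
 proof -
  have "eventually (%z. abs (th z) < 2) at_top"
   using order_tendstoD(2)[OF tendsto_rabs[OF top], of 2] by simp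
  then obtain z1 where z1: "!!z. z >= z1 ==> abs (th z) < 2" by (auto simp: eventually_at_top_linorder)
  have "eventually (%z. abs (th z) < 2) at_bot"
   using order_tendstoD(2)[OF tendsto_rabs[OF bot], of 2] by simp
  then obtain z2 where z2: "!!z. z <= z2 ==> abs (th z) < 2" by (auto simp: eventually_at_bot_linorder)
  obtain K where "ALL z:{z2..z1}. norm (th z) <= K"
   using compact_bound[OF compact_Icc continuous_at_imp_continuous_on, of z2 z1 th] cont(1) by blast
  hence K: "!!z. z : {z2..z1} ==> abs (th z) <= K" by simp
  have "abs (th z) <= max 2 K" for z
   using z1[of z] z2[of z] K[of z] by (cases "z >= z1"; cases "z <= z2") auto
  thus ?thesis using that[of "max 2 K"] by auto
 qed
 obtain B where "ALL x:{-M..M}. norm (deriv (deriv f) x) <= B"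
  using compact_bound[OF compact_Icc continuous_on_subset[OF fd(4) subset_UNIV]] by blast
 hence B: "!!x. abs x <= M ==> abs (deriv (deriv f) x) <= B" by (simp add: abs_le_iff)
 have B0: "B >= 0" using B[of 0] M(1) by auto
 \<comment> \<open>If th met a = 1 or a = -1, the quadratic contact of f with the value f 1 there
   would turn the first integral into |th'| <= C |th - a|, and Gronwall would force th = a
   everywhere, against th 0 = 0.\<close>
 have ne: "th z ~= a" if a: "deriv f a = 0" "f a = f 1" "abs a = 1" for a z
 proof
  assume z: "th z = a"
  have "(th 0 - a)^2 = 0"
  proof (rule gronwall_zero[of "%z. (th z - a)^2" "%z. 2 * (th z - a) * deriv th z" "2 * sqrt (2 * B)" z])
   fix x
   show "((%z. (th z - a)^2) has_real_derivative 2 * (th x - a) * deriv th x) (at x)"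
    by (auto intro!: derivative_eq_intros d1)
   have "(deriv th x)^2 <= 2 * B * (th x - a)^2"
    using quadratic_contact[OF fd(1,2) B a(1) _ M(2)[of x]] a M(1) en[of x] by auto
   hence "abs (deriv th x) <= sqrt (2 * B * (th x - a)^2)"
    by (metis real_sqrt_abs real_sqrt_le_iff)
   also have "... = sqrt (2 * B) * abs (th x - a)" by (simp add: real_sqrt_mult)
   finally have "2 * abs (th x - a) * abs (deriv th x) <= 2 * abs (th x - a) * (sqrt (2 * B) * abs (th x - a))"
    by (intro mult_left_mono) auto
   also have "... = 2 * sqrt (2 * B) * (th x - a)^2"
    unfolding power2_abs[of "th x - a", symmetric] by (simp add: power2_eq_square)
   finally show "abs (2 * (th x - a) * deriv th x) <= 2 * sqrt (2 * B) * (th x - a)^2"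
    unfolding abs_mult by simp
  qed (use z in auto)
  thus False using t0 a(3) by simp
 qed
 have bd: "abs (th z) < 1" for z
 proof (rule ccontr)
  assume "\<not> \<bar>th z\<bar> < 1"
  hence "th z >= 1 \<or> th z <= -1" by linarith
  moreover have c: "continuous_on UNIV th" by (simp add: continuous_at_imp_continuous_on cont)
  have im: "connected (range th)" by (rule connected_continuous_image[OF c connected_UNIV])
  have z0: "0 : range th" "th z : range th" by (metis rangeI t0) (rule rangeI)
  ultimately have "1 : range th \<or> -1 : range th"
   using connectedD_interval[OF im z0(1) z0(2), of 1] connectedD_interval[OF im z0(2) z0(1), of "-1"] by auto
  then obtain y where "th y = 1 \<or> th y = -1" by (metis rangeE)
  thus False using ne[of 1 y] ne[of "-1" y] fp(1-3) by auto
 qed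
 \<comment> \<open>By the first integral, since f > f 1 strictly between -1 and 1.\<close>
 have nz: "deriv th z ~= 0" for z
 proof -
  have "f (th z) > f 1" using bd[of z] by (intro fp(4)) auto
  hence "(deriv th z)^2 > 0" using en[of z] by simp
  thus ?thesis by auto
 qed
 define g where "g z = deriv f (th z) / deriv th z" for z
 have "(g has_real_derivative (deriv (deriv f) (th z) - (g z)^2)) (at z)" for z
 proof -
  have n: "((%z. deriv f (th z)) has_real_derivative deriv (deriv f) (th z) * deriv th z) (at z)"
   by (rule DERIV_chain2[OF fd(2) d1])
  show ?thesis
   unfolding g_def[abs_def]
   by (rule DERIV_cong[OF DERIV_divide[OF n d2 nz]])
    (use nz[of z] in \<open>simp add: power2_eq_square diff_divide_distrib\<close>)
 qed
 moreover have "continuous_on UNIV th" by (simp add: continuous_at_imp_continuous_on cont)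
 ultimately show ?thesis using that bd by blast
qed

lemma profile_coercive:
 assumes f: "double_well f" and th: "optimal_profile f th"
 obtains R c where "R > 0" "c > 0" "!!z. abs z >= R ==> deriv (deriv f) (th z) >= c"
proof -
 note fd = well_derivs[OF f]
 have pos: "deriv (deriv f) 1 > 0" "deriv (deriv f) (-1) > 0" using f by (auto simp: double_well_def)
 define c where "c = min (deriv (deriv f) 1) (deriv (deriv f) (-1)) / 2"
 have c: "c > 0" "c < deriv (deriv f) 1" "c < deriv (deriv f) (-1)" using pos by (auto simp: c_def)
 have ic: "isCont (deriv (deriv f)) x" for x using DERIV_isCont[OF fd(3)] .
 have top: "(th \<longlongrightarrow> 1) at_top" and bot: "(th \<longlongrightarrow> -1) at_bot"
  using th by (auto simp: optimal_profile_def)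
 have "eventually (%z. deriv (deriv f) (th z) > c) at_top"
  using order_tendstoD(1)[OF isCont_tendsto_compose[OF ic top] c(2)] .
 then obtain z1 where z1: "!!z. z >= z1 ==> deriv (deriv f) (th z) > c" by (auto simp: eventually_at_top_linorder)
 have "eventually (%z. deriv (deriv f) (th z) > c) at_bot"
  using order_tendstoD(1)[OF isCont_tendsto_compose[OF ic bot] c(3)] .
 then obtain z2 where z2: "!!z. z <= z2 ==> deriv (deriv f) (th z) > c" by (auto simp: eventually_at_bot_linorder)
 have "deriv (deriv f) (th z) >= c" if "abs z >= abs z1 + abs z2 + 1" for z
  using z1[of z] z2[of z] that by (cases "z >= 0") force+
 thus ?thesis using that[of "abs z1 + abs z2 + 1" c] c(1) by auto
qed

lemma well_lipschitz:
 assumes f: "double_well f"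
 obtains L where "L > 0" "!!x y. abs x <= M ==> abs y <= M ==>
  abs (deriv (deriv f) x - deriv (deriv f) y) <= L * abs (x - y)" "!!x. abs x <= M ==> abs (deriv (deriv f) x) <= L"
proof -
 note fd = well_derivs[OF f]
 have cb: "EX B. ALL x. abs x <= M --> abs (h x) <= B" if h: "continuous_on UNIV h" for h :: "real => real"
 proof -
  obtain B where "ALL x:{-M..M}. norm (h x) <= B"
   using compact_bound[OF compact_Icc continuous_on_subset[OF h subset_UNIV]] by blast
  hence "abs x <= M --> abs (h x) <= B" for x by (auto simp: abs_le_iff)
  thus ?thesis by blast
 qed
 obtain B1 B2 where B: "!!x. abs x <= M ==> abs (deriv (deriv f) x) <= B1"
  "!!x. abs x <= M ==> abs (deriv (deriv (deriv f)) x) <= B2"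
  using cb[OF fd(4)] cb[OF fd(5)] by blast
 define L where "L = max 1 (max B1 B2)"
 have "abs (deriv (deriv f) x - deriv (deriv f) y) <= L * abs (x - y)" if "abs x <= M" "abs y <= M" for x y
 proof -
  have "norm (deriv (deriv f) x - deriv (deriv f) y) <= L * norm (x - y)"
  proof (rule field_differentiable_bound[of "{-M..M}" "deriv (deriv f)" "deriv (deriv (deriv f))"])
   fix z assume "z : {-M..M}"
   hence "abs z <= M" by auto
   from B(2)[OF this] show "norm (deriv (deriv (deriv f)) z) <= L" by (simp add: L_def)
  qed (use that fd(3) in \<open>auto intro: has_field_derivative_at_within\<close>)
  thus ?thesis by simp
 qed
 moreover have "abs (deriv (deriv f) x) <= L" if "abs x <= M" for x
  using B(1)[OF that] by (simp add: L_def)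
 moreover have "L > 0" by (simp add: L_def)
 ultimately show ?thesis using that by blast
qed

section \<open>Curvilinear coordinates\<close>

locale contact_geometry =
 fixes G :: "'a::euclidean_space interface_geometry"
 assumes geom: "contact_angle_geometry G"
begin

abbreviation (input) "Omg \<equiv> gOmega G"
abbreviation (input) "T \<equiv> gT G"
abbreviation (input) "S \<equiv> gSigma G"
abbreviation (input) "bd \<equiv> surf_boundary (gSigma G)"
abbreviation (input) "dl \<equiv> gdelta G"
abbreviation (input) "rco \<equiv> r_coord G"
abbreviation (input) "sco \<equiv> s_coord G"

lemma geo: "evolving_hypersurface G" "tubular_coordinates G" "curvilinear_coordinates G" "bulk_regions G"
 using geom unfolding contact_angle_geometry_def by - (elim conjE, assumption)+

lemma smooth_domain: "smooth_bounded_domain Omg"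
 and T_pos: "0 < T" and S_facts: "hypersurface S" "compact S" "connected S" "S ~= {}"
 and X0_ball: "ALL t:{0..T}. (ALL s:surf_interior S. gX0 G (s, t) : Omg) & (ALL sig:bd. gX0 G (sig, t) : frontier Omg)"
 using geo(1) unfolding evolving_hypersurface_def Let_def by - (elim conjE, assumption)+

lemma domain: "open Omg" "bounded Omg" "ALL p:frontier Omg. EX U g. domain_chart Omg p U g"
 using smooth_domain unfolding smooth_bounded_domain_def by - (elim conjE, assumption)+

lemma interior_X0: "t : {0..T} ==> s : surf_interior S ==> gX0 G (s, t) : Omg"
 and boundary_X0: "t : {0..T} ==> s : bd ==> gX0 G (s, t) : frontier Omg"
 by (use X0_ball in \<open>simp_all only: Ball_def\<close>)

lemma mu1: "0 < gmu1 G" and Y_range: "gY G ` (bd \<times> {0..2 * gmu1 G}) \<subseteq> S"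
 and Y_smooth: "smooth_on (bd \<times> {0..2 * gmu1 G}) (gY G)"
 and Y_homeo: "EX Yi. homeomorphism (bd \<times> {0..2 * gmu1 G}) (gY G ` (bd \<times> {0..2 * gmu1 G})) (gY G) Yi &
   smooth_on (gY G ` (bd \<times> {0..2 * gmu1 G})) Yi"
 and Y_open: "ALL mu:{0<..2 * gmu1 G}. openin (top_of_set S) (gY G ` (bd \<times> {0..<mu}))"
 using geo(2) unfolding tubular_coordinates_def Let_def by - (elim conjE, assumption)+

lemma Y_0: "sig : bd ==> gY G (sig, 0) = sig"
 using geo(2) unfolding tubular_coordinates_def Let_def by - (elim conjE, drule (1) bspec, elim conjE, assumption)

lemma dpos: "0 < dl" and mu0: "0 < gmu0 G" "gmu0 G <= gmu1 G"
 and X_smooth: "smooth_on (coord_dom G) (gX G)" and X_range: "gX G ` coord_dom G \<subseteq> closure Omg"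
 and Xbar_homeo: "EX Xi. homeomorphism (coord_dom G) (Xbar G ` coord_dom G) (Xbar G) Xi"
 and Z_ex: "EX W Z Zi. openin (top_of_set (UNIV \<times> gSigma_ext G \<times> UNIV)) W & coord_dom G \<subseteq> W &
    (ALL p:coord_dom G. Z p = Xbar G p) & open (Z ` W) &
    homeomorphism W (Z ` W) Z Zi & smooth_on W Z & smooth_on (Z ` W) Zi"
 and tube_ball: "ALL et:{0<..2 * dl}. openin (top_of_set (closure Omg \<times> {0..T})) (tube G et) & interface G \<subseteq> tube G et"
 and X_X0_ball: "ALL s:S. ALL t:{0..T}. gX G (0, s, t) = gX0 G (s, t)"
 and X_frontier_ball: "\<forall>(r, s, t)\<in>coord_dom G. gX G (r, s, t) : frontier Omg \<longleftrightarrow> s : bd"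
 and tangent_ball: "ALL p:tube G (2 * dl). span (Dx_s G p ` Basis) = tangent_space S (sco p)"
 using geo(3) unfolding curvilinear_coordinates_def Let_def by - (elim conjE, assumption)+

lemma tube_open: "et : {0<..2 * dl} ==> openin (top_of_set (closure Omg \<times> {0..T})) (tube G et)"
 and interface_tube: "et : {0<..2 * dl} ==> interface G \<subseteq> tube G et"
 and X_X0: "s : S ==> t : {0..T} ==> gX G (0, s, t) = gX0 G (s, t)"
 and X_frontier: "(r, s, t) : coord_dom G ==> gX G (r, s, t) : frontier Omg \<longleftrightarrow> s : bd"
 and tangent_span: "p : tube G (2 * dl) ==> span (Dx_s G p ` Basis) = tangent_space S (sco p)"
 subgoal by (drule bspec[OF tube_ball]) (elim conjE)
 subgoal by (drule bspec[OF tube_ball]) (elim conjE)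
 subgoal by (rule bspec[OF bspec[OF X_X0_ball]])
 subgoal by (drule bspec[OF X_frontier_ball]) (simp only: prod.case)
 subgoal by (rule bspec[OF tangent_ball])
 done

lemma normal_relations:
 assumes "s : S" "t : {0..T}"
 shows "(norm (grad_r G (gX0 G (s, t), t)))^2 = 1"
  "((%r. (norm (grad_r G (Xbar G (r, s, t))))^2) has_real_derivative 0) (at 0)"
  "Dx_s G (gX0 G (s, t), t) (grad_r G (gX0 G (s, t), t)) = 0"
proof -
 have *: "ALL s:S. ALL t:{0..T}.
    (norm (grad_r G (gX0 G (s, t), t)))^2 = 1 &
    ((%r. (norm (grad_r G (Xbar G (r, s, t))))^2) has_real_derivative 0) (at 0) &
    Dx_s G (gX0 G (s, t), t) (grad_r G (gX0 G (s, t), t)) = 0 &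
    grad_r G (gX0 G (s, t), t) = gnormal G (s, t) &
    gnormal G (s, t) \<bullet> vector_derivative (%t'. gX0 G (s, t')) (at t within {0..T})
     = - dt_r G (gX0 G (s, t), t) &
    mean_curvature S (%s'. gX0 G (s', t)) (%s'. gnormal G (s', t)) s = - laplace_r G (gX0 G (s, t), t)"
  using geo(3) unfolding curvilinear_coordinates_def Let_def by - (elim conjE, assumption)
 show "(norm (grad_r G (gX0 G (s, t), t)))^2 = 1"
  "((%r. (norm (grad_r G (Xbar G (r, s, t))))^2) has_real_derivative 0) (at 0)"
  "Dx_s G (gX0 G (s, t), t) (grad_r G (gX0 G (s, t), t)) = 0"
  using bspec[OF bspec[OF * assms(1)] assms(2)] by - (elim conjE, assumption)+
qed

lemma cdom_iff: "(r, s, t) : coord_dom G \<longleftrightarrow> - 2 * dl <= r & r <= 2 * dl & s : S & 0 <= t & t <= T"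
 by (auto simp: coord_dom_def)

lemma Xbar_eq: "Xbar G (r, s, t) = (gX G (r, s, t), t)"
 by (simp add: Xbar_def)

lemma coords:
 assumes "(r, s, t) : coord_dom G"
 shows "rco (gX G (r, s, t), t) = r" "sco (gX G (r, s, t), t) = s"
proof -
 obtain Xi where "homeomorphism (coord_dom G) (Xbar G ` coord_dom G) (Xbar G) Xi" using Xbar_homeo ..
 hence "inj_on (Xbar G) (coord_dom G)" by (intro inj_on_inverseI[of _ Xi]) (rule homeomorphism_apply1)
 from inv_into_f_f[OF this assms]
 show "rco (gX G (r, s, t), t) = r" "sco (gX G (r, s, t), t) = s"
  by (simp_all add: r_coord_def s_coord_def Xbar_eq)
qed

lemma int_or_bd: "s : S ==> s ~: bd ==> s : surf_interior S"
 and boundary_subset: "bd \<subseteq> S" and surf_interior_subset: "surf_interior S \<subseteq> S"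
 using S_facts(1) unfolding hypersurface_def by blast+

lemma X_interior: "(r, s, t) : coord_dom G ==> s ~: bd ==> gX G (r, s, t) : Omg"
 using X_frontier[of r s t] X_range domain(1) by (force simp: frontier_def interior_open)

text \<open>Read off from the images at time 0, inside \<Omega> for interior points and on its
  frontier for boundary points, rather than from the local charts.\<close>

lemma int_not_bd: assumes "s : surf_interior S" shows "s ~: bd"
proof
 assume "s : bd"
 hence "gX0 G (s, 0) : frontier Omg" "gX0 G (s, 0) : Omg"
  using boundary_X0[of 0 s] interior_X0[of 0 s] assms T_pos by auto
 thus False using domain(1) by (simp add: frontier_def interior_open)
qed

text \<open>Points over the frontier of \<Omega> are left out, so that time slices are open and
  derivatives are ordinary ones; uniformity up to the boundary comes from the compact set
  \<open>cpt\<close>.\<close>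

definition reg :: "('a \<times> real) set" where
 "reg = {q. q : tube G dl & fst q : Omg}"

definition slice :: "real => 'a set" where
 "slice t = {x. (x, t) : reg}"

definition cpt :: "('a \<times> real) set" where
 "cpt = Xbar G ` ({-dl..dl} \<times> S \<times> {0..T})"

lemma reg_cases:
 assumes "q : reg"
 obtains r s t where "q = (gX G (r, s, t), t)" "-dl < r" "r < dl" "s : S" "s ~: bd" "t : {0..T}"
  "(r, s, t) : coord_dom G" "rco q = r" "sco q = s" "snd q = t"
proof -
 obtain r s t where q: "q = (gX G (r, s, t), t)" "-dl < r" "r < dl" "s : S" "t : {0..T}"
  using assms by (auto simp: reg_def tube_def Xbar_eq)
 hence c: "(r, s, t) : coord_dom G" using dpos by (auto simp: cdom_iff)
 have "s ~: bd" using X_frontier[OF c] assms q(1) domain(1) by (auto simp: reg_def frontier_def interior_open)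
 thus ?thesis using that q c coords[OF c] by simp
qed

lemma regI: "-dl < r ==> r < dl ==> s : S ==> s ~: bd ==> t : {0..T} ==> (gX G (r, s, t), t) : reg"
 using X_interior[of r s t] dpos by (auto simp: reg_def tube_def cdom_iff Xbar_eq image_iff)

lemma reg_cpt: "reg \<subseteq> cpt"
proof
 fix q assume "q : reg"
 thus "q : cpt" by (rule reg_cases) (auto simp: cpt_def Xbar_eq image_iff)
qed

lemma compact_cpt: "compact cpt"
proof -
 have "compact ({-dl..dl} \<times> S \<times> {0..T})" by (intro compact_Times compact_Icc S_facts(2))
 moreover have "continuous_on ({-dl..dl} \<times> S \<times> {0..T}) (Xbar G)"
  using Xbar_homeo dpos
  by (auto simp: homeomorphism_def coord_dom_def intro: continuous_on_subset)
 ultimately show ?thesis unfolding cpt_def by (rule compact_continuous_image[rotated])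
qed

lemma open_slice: "open (slice t)"
proof -
 have "openin (top_of_set (closure Omg \<times> {0..T})) (tube G dl)" using tube_open[of dl] dpos by auto
 then obtain V where V: "open V" "tube G dl = (closure Omg \<times> {0..T}) Int V" by (auto simp: openin_open)
 show ?thesis
 proof (cases "t : {0..T}")
  case True
  hence "slice t = Omg Int (%x. (x, t)) -` V"
   using closure_subset[of Omg] by (auto simp: slice_def reg_def V(2))
  moreover have "open ((%x. (x, t)) -` V)" by (intro open_vimage V(1) continuous_intros)
  ultimately show ?thesis using domain(1) by auto
 next
  case False
  hence "slice t = {}" by (auto simp: slice_def reg_def V(2))
  thus ?thesis by simp
 qed
qed

text \<open>The finite subcover is one of \<open>cpt\<close> while the estimate is asked for only on
  \<open>reg\<close>: this is how local extensions across the boundary produce global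
  constants.\<close>

lemma compact_principle:
 assumes loc: "!!p. p : cpt ==> EX V C. open V & p : V & (ALL q:V Int reg. P q C)"
  and mono: "!!q (c::real) d. P q c ==> c <= d ==> P q d"
 shows "EX C>0. ALL q:reg. P q C"
proof -
 obtain V C where V: "!!p. p : cpt ==> open (V p) & p : V p & (ALL q:V p Int reg. P q (C p :: real))"
  using loc by metis
 have "\<exists>F\<subseteq>cpt. finite F & cpt \<subseteq> (UN p:F. V p)"
  by (rule compactE_image[OF compact_cpt, of cpt V]) (use V in blast)+
 then obtain F where F: "F \<subseteq> cpt" "finite F" "cpt \<subseteq> (UN p:F. V p)" by blast
 define M where "M = (SUM p:F. abs (C p)) + 1"
 have "P q M" if qr: "q : reg" for q
 proof -
  obtain p where p: "p : F" "q : V p" using qr F(3) reg_cpt by blast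
  have "abs (C p) <= (SUM p:F. abs (C p))" by (rule member_le_sum) (use p F(2) in auto)
  hence "C p <= M" by (simp add: M_def)
  moreover have "P q (C p)" using V[of p] p F(1) qr by blast
  ultimately show ?thesis by (rule mono[rotated])
 qed
 moreover have "M > 0" by (simp add: M_def add_nonneg_pos sum_nonneg)
 ultimately show ?thesis by blast
qed

text \<open>\<open>C\<^sup>k\<close> up to the boundary of the region, which yields bounds uniform in time.\<close>

definition nice :: "nat => ('a \<times> real => 'b::real_normed_vector) => bool" where
 "nice k a \<longleftrightarrow> (ALL p:cpt. EX V f. open V & p : V & Ck_on k V f & (ALL q:V Int reg. f q = a q))"

lemma niceE:
 assumes "nice k a" "p : cpt"
 obtains V f where "open V" "p : V" "Ck_on k V f" "ALL q:V Int reg. f q = a q"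
proof -
 obtain V f where *: "open V & p : V & Ck_on k V f & (ALL q:V Int reg. f q = a q)"
  using bspec[OF assms(1)[unfolded nice_def] assms(2)] by (elim exE)
 show thesis by (rule that[of V f]) (use * in auto)
qed

lemma niceI:
 assumes "!!p. p : cpt ==> EX V f. open V & p : V & Ck_on k V f & (ALL q:V Int reg. f q = a q)"
 shows "nice k a"
 unfolding nice_def by (rule ballI) (rule assms)

lemma nice_mono: assumes "nice k a" "j <= k" shows "nice j a"
proof (rule niceI)
 fix p assume "p : cpt"
 then obtain V f where V: "open V" "p : V" "Ck_on k V f" "ALL q:V Int reg. f q = a q"
  by (rule niceE[OF assms(1)])
 show "EX V f. open V & p : V & Ck_on j V f & (ALL q:V Int reg. f q = a q)"
  by (intro exI[of _ V] exI[of _ f] conjI V Ck_on_mono[OF V(3) assms(2)])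
qed

lemma nice_const: "nice k (%q. c)"
 by (rule niceI, intro exI[of _ UNIV] exI[of _ "%q. c"]) simp

lemma nice_cong: assumes "nice k a" "!!q. q : reg ==> a q = b q" shows "nice k b"
proof (rule niceI)
 fix p assume "p : cpt"
 then obtain V f where V: "open V" "p : V" "Ck_on k V f" "ALL q:V Int reg. f q = a q"
  by (rule niceE[OF assms(1)])
 show "EX V f. open V & p : V & Ck_on k V f & (ALL q:V Int reg. f q = b q)"
  by (intro exI[of _ V] exI[of _ f] conjI V) (use V(4) assms(2) in auto)
qed

lemma nice_bilinear:
 assumes B: "bounded_bilinear B" and a: "nice k a" and b: "nice k b"
 shows "nice k (%q. B (a q) (b q))"
 unfolding nice_def
proof
 fix p assume p: "p : cpt"
 obtain V f where V: "open V" "p : V" "Ck_on k V f" "ALL q:V Int reg. f q = a q" by (rule niceE[OF a p])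
 obtain V' f' where V': "open V'" "p : V'" "Ck_on k V' f'" "ALL q:V' Int reg. f' q = b q" by (rule niceE[OF b p])
 have "Ck_on k (V Int V') (%q. B (f q) (f' q))"
  by (intro Ck_on_bilinear[OF _ B] Ck_on_subset[OF V(3)] Ck_on_subset[OF V'(3)]) (use V(1) V'(1) in auto)
 thus "EX W h. open W & p : W & Ck_on k W h & (ALL q:W Int reg. h q = B (a q) (b q))"
  using V V' by (intro exI[of _ "V Int V'"] exI[of _ "%q. B (f q) (f' q)"]) auto
qed

lemmas nice_mult = nice_bilinear[OF bounded_bilinear_mult]
lemmas nice_scaleR = nice_bilinear[OF bounded_bilinear_scaleR]
lemmas nice_inner = nice_bilinear[OF bounded_bilinear_inner]

lemma nice_add:
 assumes a: "nice k a" and b: "nice k b"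
 shows "nice k (%q. a q + b q)"
 unfolding nice_def
proof
 fix p assume p: "p : cpt"
 obtain V f where V: "open V" "p : V" "Ck_on k V f" "ALL q:V Int reg. f q = a q" by (rule niceE[OF a p])
 obtain V' f' where V': "open V'" "p : V'" "Ck_on k V' f'" "ALL q:V' Int reg. f' q = b q" by (rule niceE[OF b p])
 have "Ck_on k (V Int V') (%q. f q + f' q)"
  by (intro Ck_on_add Ck_on_subset[OF V(3)] Ck_on_subset[OF V'(3)]) (use V(1) V'(1) in auto)
 thus "EX W h. open W & p : W & Ck_on k W h & (ALL q:W Int reg. h q = a q + b q)"
  using V V' by (intro exI[of _ "V Int V'"] exI[of _ "%q. f q + f' q"]) auto
qed

lemma nice_diff: "nice k a ==> nice k (b :: _ => 'b::real_normed_vector) ==> nice k (%q. a q - b q)"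
 using nice_add[of k a "%q. (-1) *\<^sub>R b q"] nice_scaleR[OF nice_const, of k b "-1"] by simp

lemma nice_sum: "(!!i. i : I ==> nice k (a i)) ==> nice k (%q. SUM i:I. a i q)"
 by (induction I rule: infinite_finite_induct) (auto intro: nice_add nice_const)

lemma nice_compose:
 fixes h :: "'b::euclidean_space => 'c::real_normed_vector"
 assumes a: "nice k a" and h: "Ck_on k UNIV h"
 shows "nice k (%q. h (a q))"
 unfolding nice_def
proof
 fix p assume p: "p : cpt"
 obtain V f where V: "open V" "p : V" "Ck_on k V f" "ALL q:V Int reg. f q = a q" by (rule niceE[OF a p])
 have "Ck_on k V (%q. h (f q))" by (rule Ck_on_compose[OF V(1) open_UNIV h V(3)]) simp
 thus "EX W g. open W & p : W & Ck_on k W g & (ALL q:W Int reg. g q = h (a q))"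
  using V by (intro exI[of _ V] exI[of _ "%q. h (f q)"]) auto
qed

lemma nice_bounded:
 assumes "nice 0 a"
 shows "EX C>0. ALL q:reg. norm (a q) <= C"
proof (rule compact_principle)
 fix p assume p: "p : cpt"
 obtain V f where V: "open V" "p : V" "Ck_on 0 V f" "ALL q:V Int reg. f q = a q" by (rule niceE[OF assms p])
 have "isCont f p" using V by (simp add: continuous_on_eq_continuous_at)
 hence "eventually (%q. dist (f q) (f p) < 1) (at p)" by (simp add: isCont_def tendstoD)
 then obtain W where W: "open W" "p : W" "!!q. q : W ==> q ~= p ==> dist (f q) (f p) < 1"
  by (auto simp: eventually_at_topological)
 have "norm (a q) <= norm (f p) + 1" if "q : (V Int W) Int reg" for q
 proof -
  have "dist (f q) (f p) < 1" using W(3)[of q] that by (cases "q = p") auto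
  hence "norm (f q) <= norm (f p) + 1" using norm_triangle_ineq2[of "f q" "f p"] by (simp add: dist_norm)
  thus ?thesis using bspec[OF V(4), of q] that by simp
 qed
 thus "EX V C. open V & p : V & (ALL q:V Int reg. norm (a q) <= C)"
  using V(1,2) W(1,2) by (intro exI[of _ "V Int W"] exI[of _ "norm (f p) + 1"]) auto
qed auto

section \<open>Spatial derivatives at fixed time\<close>

definition Dx :: "('a \<times> real => 'b::real_normed_vector) => 'a \<times> real => 'a => 'b" where
 "Dx a q = Df (%y. a (y, snd q)) (fst q)"

text \<open>Near a point of a time slice, which is open, a coincides with its space-time extension
  f, so the spatial derivative of a is that of f in the directions (v, 0).\<close>

lemma nice_Dx_local:
 assumes "nice (Suc k) a" "p : cpt"
 obtains V f where "open V" "p : V" "Ck_on (Suc k) V f"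
  "ALL q:V Int reg. f q = a q &
   ((%y. a (y, snd q)) has_derivative (%v. Df f q (v, 0))) (at (fst q))"
proof -
 obtain V f where V: "open V" "p : V" "Ck_on (Suc k) V f" "ALL q:V Int reg. f q = a q"
  by (rule niceE[OF assms])
 have "((%y. a (y, snd q)) has_derivative (%v. Df f q (v, 0))) (at (fst q))"
  if q: "q : V" "q : reg" for q
 proof -
  have df: "(f has_derivative Df f q) (at (fst q, snd q))"
   using Ck_on_DD[OF V(3) q(1)] by simp
  have "((%y. f (y, snd q)) has_derivative (%v. Df f q (v, 0))) (at (fst q))"
   by (rule has_derivative_compose[where f="%y. (y, snd q)" and f'="%v. (v, 0)" and g=f])
    (use df in \<open>auto intro!: derivative_eq_intros\<close>)
  moreover have "open ((%y. (y, snd q)) -` V Int slice (snd q))"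
   by (intro open_Int open_vimage V(1) open_slice continuous_intros)
  ultimately show ?thesis
   by (rule has_derivative_transform_within_open) (use q V(4) in \<open>auto simp: slice_def\<close>)
 qed
 thus ?thesis using that V by blast
qed

lemma nice_hd:
 assumes "nice (Suc k) a" "(x, t) : reg"
 shows "((%y. a (y, t)) has_derivative Dx a (x, t)) (at x)"
proof -
 obtain V f where "open V" "(x, t) : V" "Ck_on (Suc k) V f"
  "ALL q:V Int reg. f q = a q &
   ((%y. a (y, snd q)) has_derivative (%v. Df f q (v, 0))) (at (fst q))"
  using nice_Dx_local[OF assms(1), of "(x, t)"] assms(2) reg_cpt by blast
 hence "((%y. a (y, snd (x, t))) has_derivative (%v. Df f (x, t) (v, 0))) (at (fst (x, t)))"
  using assms(2) by blast
 hence "(%y. a (y, t)) differentiable (at x)" unfolding fst_conv snd_conv by (rule differentiableI)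
 thus ?thesis unfolding Dx_def fst_conv snd_conv by (simp only: frechet_derivative_works)
qed

lemma nice_Dx: assumes "nice (Suc k) a" shows "nice k (%q. Dx a q v)"
 unfolding nice_def
proof
 fix p assume p: "p : cpt"
 obtain V f where V: "open V" "p : V" "Ck_on (Suc k) V f"
  "ALL q:V Int reg. f q = a q &
   ((%y. a (y, snd q)) has_derivative (%v. Df f q (v, 0))) (at (fst q))"
  by (rule nice_Dx_local[OF assms p])
 have "Df f q (v, 0) = Dx a q v" if "q : V Int reg" for q
  using frechet_derivative_at[of "%y. a (y, snd q)"] bspec[OF V(4) that] unfolding Dx_def by metis
 thus "EX W g. open W & p : W & Ck_on k W g & (ALL q:W Int reg. g q = Dx a q v)"
  using V by (intro exI[of _ V] exI[of _ "%q. Df f q (v, 0)"]) auto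
qed

lemma Dx_linear: "nice (Suc k) a ==> q : reg ==> linear (Dx a q)"
 using nice_hd[of k a "fst q" "snd q"] by (simp add: has_derivative_linear)

lemma Dx_expand:
 assumes "nice (Suc k) a" "q : reg"
 shows "Dx a q v = (SUM b:Basis. (v \<bullet> b) *\<^sub>R Dx a q b)"
 using Dx_linear[OF assms]
 by (subst (1) euclidean_representation[symmetric, of v]) (simp only: linear_sum linear_scale)

lemma nice_Dx_field:
 assumes a: "nice (Suc k) a" and w: "nice k w"
 shows "nice k (%q. Dx a q (w q))"
proof -
 have "nice k (%q. SUM b:Basis. (w q \<bullet> b) *\<^sub>R Dx a q b)"
  by (intro nice_sum nice_scaleR nice_inner nice_const nice_Dx a w)
 thus ?thesis by (rule nice_cong) (use Dx_expand[OF a] in simp)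
qed

definition gradx :: "('a \<times> real => real) => 'a \<times> real => 'a" where
 "gradx a q = (SUM b:Basis. Dx a q b *\<^sub>R b)"

definition divx :: "('a \<times> real => 'a) => 'a \<times> real => real" where
 "divx w q = (SUM b:Basis. Dx w q b \<bullet> b)"

lemma nice_gradx: "nice (Suc k) a ==> nice k (gradx a)"
 unfolding gradx_def[abs_def] by (intro nice_sum nice_scaleR nice_const nice_Dx)

lemma nice_divx: "nice (Suc k) w ==> nice k (divx w)"
 unfolding divx_def[abs_def] by (intro nice_sum nice_inner nice_const nice_Dx)

lemma gradx_inner:
 assumes "nice (Suc k) a" "q : reg"
 shows "gradx a q \<bullet> v = Dx a q v"
 unfolding gradx_def inner_sum_left inner_scaleR_left Dx_expand[OF assms, of v] real_scaleR_def
 by (intro sum.cong refl) (simp add: inner_commute)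

end

section \<open>Local charts, the normal coordinate field and the splitting of gradients\<close>

context contact_geometry
begin

text \<open>X is smooth on a set with boundary, and the coordinates are values of
  \<open>inv_into\<close>. A chart at p provides genuine smooth maps on open sets: z extends (r, s,
  t) and g extends X.\<close>

definition chart :: "'a \<times> real => ('a \<times> real) set => ('a \<times> real => real \<times> 'a \<times> real) =>
  (real \<times> 'a \<times> real) set => (real \<times> 'a \<times> real => 'a) => bool" where
 "chart p V z U g \<longleftrightarrow> open V & p : V & (ALL k. Ck_on k V z) & open U & (ALL k. Ck_on k U g) & z ` V \<subseteq> U &
  (ALL q:V Int cpt. z q = (rco q, sco q, snd q)) & (ALL P:U Int coord_dom G. g P = gX G P)"

lemma chartD:
 assumes "chart p V z U g"
 shows "open V" "p : V" "ALL k. Ck_on k V z" "open U" "ALL k. Ck_on k U g" "z ` V \<subseteq> U"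
  "ALL q:V Int cpt. z q = (rco q, sco q, snd q)" "ALL P:U Int coord_dom G. g P = gX G P"
 using assms unfolding chart_def by - (elim conjE, assumption)+

lemma chart_exists:
 assumes p: "p : cpt"
 shows "EX V z U g. chart p V z U g"
proof -
 have "cpt \<subseteq> Xbar G ` coord_dom G" using dpos by (auto simp: cpt_def coord_dom_def)
 then obtain P0 where P0: "P0 : coord_dom G" "p = Xbar G P0" using p by blast
 obtain W Z Zi where W: "coord_dom G \<subseteq> W" "ALL P:coord_dom G. Z P = Xbar G P" "open (Z ` W)"
   and hZ: "homeomorphism W (Z ` W) Z Zi" and sZ: "smooth_on (Z ` W) Zi"
  using Z_ex by (elim exE conjE)
 have Ck: "Ck_on k (Z ` W) Zi" for k using smooth_Ck[OF W(3) sZ] .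
 have inv: "Zi (Xbar G P) = P" if "P : coord_dom G" for P
  using homeomorphism_apply1[OF hZ, of P] that W(1,2) by auto
 obtain U g where U: "open U" "P0 : U" "ALL k. Ck_on k U g" "ALL y:coord_dom G Int U. g y = gX G y"
  using bspec[OF X_smooth[unfolded smooth_on_def] P0(1)] by (elim exE conjE)
 define V where "V = Z ` W Int Zi -` U"
 have oV: "open V" unfolding V_def
  by (intro continuous_open_preimage W(3) U(1) Ck_on_cont[OF Ck[of 0]])
 have "p : Z ` W" using P0 W(1,2) by (metis imageI subsetD)
 hence pV: "p : V" using inv[OF P0(1)] U(2) P0(2) by (simp add: V_def)
 have zc: "Zi q = (rco q, sco q, snd q)" if q: "q : V Int cpt" for q
 proof -
  obtain P where P: "P : coord_dom G" "q = Xbar G P" using q \<open>cpt \<subseteq> Xbar G ` coord_dom G\<close> by blast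
  obtain r s t where Prst: "P = (r, s, t)" using prod_cases3 by blast
  show ?thesis using inv[OF P(1)] coords[of r s t] P unfolding Prst by (simp add: Xbar_eq)
 qed
 have "ALL k. Ck_on k V Zi" using Ck_on_subset[OF Ck] by (simp add: V_def)
 hence "chart p V Zi U g" using oV pV U zc unfolding chart_def by (auto simp: V_def)
 thus ?thesis by (intro exI)
qed

lemma nice_coords: "nice k (%q. (rco q, sco q, snd q))"
proof (rule niceI)
 fix p assume p: "p : cpt"
 obtain V z U g where "chart p V z U g" using chart_exists[OF p] by (elim exE)
 note V = chartD[OF this]
 show "EX V f. open V & p : V & Ck_on k V f & (ALL q:V Int reg. f q = (rco q, sco q, snd q))"
  using V reg_cpt by (intro exI[of _ V] exI[of _ z]) auto
qed

lemma nice_r: "nice k (rco)"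
 using nice_compose[OF nice_coords Ck_on_fst[OF open_UNIV Ck_on_id]] by simp

lemma nice_s: "nice k (sco)"
 using nice_compose[OF nice_coords Ck_on_fst[OF open_UNIV Ck_on_snd[OF open_UNIV Ck_on_id]]] by simp

text \<open>The coordinate field \<partial>_r X: r grows at unit rate along it and s is constant. It
  pairs to 1 with \<open>mfield\<close>, the gradient of r, and agrees with it on the interface
  (\<open>v_eq_m\<close>).\<close>

definition vfield :: "'a \<times> real => 'a" where
 "vfield q = vector_derivative (%rh. gX G (rh, sco q, snd q)) (at (rco q))"

definition mfield :: "'a \<times> real => 'a" where
 "mfield = gradx (rco)"

abbreviation "Ds \<equiv> Dx (sco)"

lemma mfield_inner: "q : reg ==> mfield q \<bullet> k = Dx (rco) q k"
 unfolding mfield_def by (rule gradx_inner[OF nice_r])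

lemma reg_facts:
 assumes "q : reg"
 shows "abs (rco q) < dl" "sco q : S" "sco q ~: bd" "snd q : {0..T}"
  "(rco q, sco q, snd q) : coord_dom G" "(gX G (rco q, sco q, snd q), snd q) = q"
 using assms by (rule reg_cases, simp)+

lemma chart_derivative:
 assumes q: "q : reg" and U: "open U" "ALL k. Ck_on k U g" "(rco q, sco q, snd q) : U"
  and g: "ALL P:U Int coord_dom G. g P = gX G P"
 shows "((%rh. gX G (rh, sco q, snd q)) has_vector_derivative
   Df g (rco q, sco q, snd q) (1, 0, 0)) (at (rco q))"
proof -
 define r s t where rst: "r = rco q" "s = sco q" "t = snd q"
 have c: "(r, s, t) : coord_dom G" "abs r < 2 * dl"
  using reg_facts[OF q] dpos unfolding rst by auto
 have "(g has_derivative Df g (r, s, t)) (at (r, s, t))"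
  using Ck_on_DD[of 0 U g] U rst by auto
 hence "((%rh. g (rh, s, t)) has_derivative (%h. Df g (r, s, t) (h, 0, 0))) (at r)"
  by (rule has_derivative_compose[rotated])
   (intro has_derivative_Pair has_derivative_ident has_derivative_const)
 moreover have "open ({-2*dl<..<2*dl} Int (%rh. (rh, s, t)) -` U)"
  by (intro open_Int open_vimage U(1) continuous_intros open_greaterThanLessThan)
 ultimately have *: "((%rh. gX G (rh, s, t)) has_derivative (%h. Df g (r, s, t) (h, 0, 0))) (at r)"
  by (rule has_derivative_transform_within_open) (use c U(3) g in \<open>auto simp: rst[symmetric] cdom_iff\<close>)
 define L where "L = (%h. Df g (r, s, t) (h, 0, 0))"
 have "linear L" unfolding L_def by (rule has_derivative_linear[OF *])
 hence "L h = h *\<^sub>R L 1" for h using linear_scale[of L h 1] by simp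
 hence L: "(%h. h *\<^sub>R L 1) = L" by (intro ext) (rule sym)
 have L1: "Df g (r, s, t) (1, 0, 0) = L 1" by (simp only: L_def)
 have "((%rh. gX G (rh, s, t)) has_derivative L) (at r)" unfolding L_def by (rule *)
 thus ?thesis unfolding has_vector_derivative_def rst[symmetric] L1 L .
qed

lemma vfield_chart:
 assumes q: "q : reg" and U: "open U" "ALL k. Ck_on k U g" "(rco q, sco q, snd q) : U"
  and g: "ALL P:U Int coord_dom G. g P = gX G P"
 shows "vfield q = Df g (rco q, sco q, snd q) (1, 0, 0)"
  "((%rh. gX G (rh, sco q, snd q)) has_vector_derivative vfield q) (at (rco q))"
 using chart_derivative[OF assms] vector_derivative_at[OF chart_derivative[OF assms]] by (auto simp: vfield_def)

lemma nice_v: "nice k vfield"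
proof (rule niceI)
 fix p assume p: "p : cpt"
 obtain V z U g where "chart p V z U g" using chart_exists[OF p] by (elim exE)
 note V = chartD[OF this]
 have "Ck_on k V (%q. Df g (z q) (1, 0, 0))"
  by (rule Ck_on_compose[OF V(1,4) _ _ V(6), where f="%P. Df g P (1, 0, 0)"])
   (use V(3) Ck_on_SucD[of k U g] V(5) in auto)
 moreover have "Df g (z q) (1, 0, 0) = vfield q" if "q : V Int reg" for q
 proof -
  have z: "z q = (rco q, sco q, snd q)" using V(7) that reg_cpt by auto
  hence "(rco q, sco q, snd q) : U" using V(6) that by (metis IntD1 image_subset_iff)
  thus ?thesis using vfield_chart(1)[OF _ V(4,5) _ V(8), of q] that z by simp
 qed
 ultimately show "EX V f. open V & p : V & Ck_on k V f & (ALL q:V Int reg. f q = vfield q)"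
  using V by (intro exI[of _ V] exI[of _ "%q. Df g (z q) (1, 0, 0)"]) auto
qed

lemma X_vd:
 assumes "q : reg"
 shows "((%rh. gX G (rh, sco q, snd q)) has_vector_derivative vfield q) (at (rco q))"
proof -
 have p: "q : cpt" using assms reg_cpt by blast
 obtain V z U g where "chart q V z U g" using chart_exists[OF p] by (elim exE)
 note V = chartD[OF this]
 have "(rco q, sco q, snd q) : U" using V(2,6,7) p by (metis IntI image_subset_iff)
 thus ?thesis by (rule vfield_chart(2)[OF assms V(4,5) _ V(8)])
qed

lemma deriv_v:
 assumes a: "nice (Suc k) a" and q: "q : reg"
 shows "((%rh. a (gX G (rh, sco q, snd q), snd q)) has_vector_derivative Dx a q (vfield q)) (at (rco q))"
proof -
 have "((%y. a (y, snd q)) has_derivative Dx a q) (at (gX G (rco q, sco q, snd q)))"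
  using nice_hd[OF a, of "fst q" "snd q"] reg_facts(6)[OF q] q by (metis fst_conv prod.collapse)
 from has_derivative_compose[OF X_vd[OF q, unfolded has_vector_derivative_def] this]
 show ?thesis using linear_scale[OF Dx_linear[OF a q]] by (simp add: has_vector_derivative_def)
qed

lemma reg_line:
 assumes q: "q : reg" and "abs rh < dl"
 shows "(gX G (rh, sco q, snd q), snd q) : reg"
 using assms(2) reg_facts[OF q] by (intro regI) auto

lemma line_coords:
 assumes q: "q : reg" and "abs rh < dl"
 shows "rco (gX G (rh, sco q, snd q), snd q) = rh"
  "sco (gX G (rh, sco q, snd q), snd q) = sco q"
 using assms(2) reg_facts[OF q] dpos by (auto intro!: coords simp: cdom_iff)

lemma Dr_v: "q : reg ==> mfield q \<bullet> vfield q = 1"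
 and Ds_v: "q : reg ==> Ds q (vfield q) = 0"
proof -
 assume q: "q : reg"
 have r: "abs (rco q) < dl" by (rule reg_facts(1)[OF q])
 have I: "open {-dl<..<dl}" "rco q : {-dl<..<dl}" using r by auto
 have "((%rh. rh) has_vector_derivative Dx (rco) q (vfield q)) (at (rco q))"
  by (rule has_vector_derivative_transform_within_open[OF deriv_v[OF nice_r[of "Suc 0"] q] I])
   (use line_coords(1)[OF q] in auto)
 hence "Dx (rco) q (vfield q) = 1"
  by (rule vector_derivative_unique_at) (rule has_vector_derivative_id)
 thus "mfield q \<bullet> vfield q = 1" by (simp only: mfield_inner[OF q])
 have "((%rh. sco q) has_vector_derivative Ds q (vfield q)) (at (rco q))"
  by (rule has_vector_derivative_transform_within_open[OF deriv_v[OF nice_s[of "Suc 0"] q] I])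
   (use line_coords(2)[OF q] in auto)
 thus "Ds q (vfield q) = 0"
  by (rule vector_derivative_unique_at) (rule has_vector_derivative_const)
qed

text \<open>Differentiating X (r(y,t), s(y,t), t) = y in y exhibits a left inverse of k -> (dr k, ds
  k).\<close>

lemma coords_immersion:
 assumes q: "q : reg" and "mfield q \<bullet> k = 0" "Ds q k = 0"
 shows "k = 0"
proof -
 have p: "q : cpt" using q reg_cpt by blast
 obtain V z U g where "chart q V z U g" using chart_exists[OF p] by (elim exE)
 note V = chartD[OF this]
 let ?z = "%y. (rco (y, snd q), sco (y, snd q), snd q)"
 have zq: "?z (fst q) = z q" using V(2,7) p by simp
 have dr: "((%y. rco (y, snd q)) has_derivative Dx (rco) q) (at (fst q))"
  using nice_hd[OF nice_r, of "fst q" "snd q"] q by simp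
 have ds: "((%y. sco (y, snd q)) has_derivative Ds q) (at (fst q))"
  using nice_hd[OF nice_s, of "fst q" "snd q"] q by simp
 have dz: "(?z has_derivative (%k. (Dx (rco) q k, Ds q k, 0))) (at (fst q))"
  by (intro has_derivative_Pair dr ds has_derivative_const)
 have "(g has_derivative Df g (z q)) (at (?z (fst q)))"
  unfolding zq by (rule Ck_on_DD[of 0 U]) (use V in auto)
 from has_derivative_compose[OF dz this]
 have "((%y. g (?z y)) has_derivative (%k. Df g (z q) (Dx (rco) q k, Ds q k, 0))) (at (fst q))" .
 moreover have "open ((%y. (y, snd q)) -` V Int slice (snd q))"
  by (intro open_Int open_vimage V(1) open_slice continuous_intros)
 ultimately have *: "((%y. y) has_derivative (%k. Df g (z q) (Dx (rco) q k, Ds q k, 0))) (at (fst q))"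
 proof (rule has_derivative_transform_within_open)
  fix y assume y: "y : (%y. (y, snd q)) -` V Int slice (snd q)"
  hence r: "(y, snd q) : reg" "(y, snd q) : V" by (auto simp: slice_def)
  hence "?z y = z (y, snd q)" using V(7) reg_cpt by auto
  hence "?z y : U" using V(6) r(2) by auto
  moreover have "?z y : coord_dom G" using reg_facts(5)[OF r(1)] by simp
  ultimately show "g (?z y) = y" using V(8) reg_facts(6)[OF r(1)] by auto
 qed (use q V(2) in \<open>auto simp: slice_def\<close>)
 have "Dx (rco) q k = 0" using assms(2) by (simp only: mfield_inner[OF q])
 have "(%k. Df g (z q) (Dx (rco) q k, Ds q k, 0)) = (%k. k)"
  by (rule has_derivative_unique[OF *]) (rule has_derivative_ident)
 from fun_cong[OF this, of k] have "k = Df g (z q) 0"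
  unfolding \<open>Dx (rco) q k = 0\<close> assms(3) by (simp add: zero_prod_def)
 also have "... = 0"
  by (rule linear_0, rule has_derivative_linear, rule Ck_on_DD[of 0 U]) (use V in auto)
 finally show ?thesis .
qed

lemma at_within_closure: "x : Omg ==> at x within closure Omg = at x"
 by (rule at_within_open_subset[OF _ domain(1) closure_subset])

lemma grad_r_eq: "q : reg ==> grad_r G q = mfield q"
 and Dx_s_eq: "q : reg ==> Dx_s G q = Ds q"
 by (simp_all add: reg_def at_within_closure grad_r_def grad_within_def mfield_def gradx_def Dx_def Dx_s_def)

text \<open>Both fields satisfy dr = 1 and ds = 0 on the interface, so
  \<open>coords_immersion\<close> identifies them. The last claim transfers the vanishing normal
  derivative of |\<nabla>r|^2 to \<open>Dx\<close>.\<close>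

lemma v_eq_m:
 assumes q: "q : reg" and r: "rco q = 0"
 shows "vfield q = mfield q" "mfield q \<bullet> mfield q = 1" "Dx (%q. mfield q \<bullet> mfield q) q (vfield q) = 0"
proof -
 let ?s = "sco q" and ?t = "snd q"
 have st: "?s : S" "?t : {0..T}" and q0: "q = (gX0 G (?s, ?t), ?t)"
  using reg_facts[OF q] r X_X0 by auto
 have mm: "mfield q \<bullet> mfield q = 1"
  using normal_relations(1)[OF st] grad_r_eq[OF q] q0 by (simp add: power2_norm_eq_inner)
 have "Ds q (mfield q) = 0"
  using normal_relations(3)[OF st] grad_r_eq[OF q] Dx_s_eq[OF q] q0 by metis
 hence "Ds q (mfield q - vfield q) = 0"
  using Ds_v[OF q] linear_diff[OF Dx_linear[OF nice_s[of "Suc 0"] q]] by simp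
 moreover have "mfield q \<bullet> (mfield q - vfield q) = 0" using mm Dr_v[OF q] by (simp add: inner_diff_right)
 ultimately have "mfield q - vfield q = 0" by (rule coords_immersion[OF q, rotated])
 thus "vfield q = mfield q" by simp
 show "mfield q \<bullet> mfield q = 1" by (rule mm)
 have "nice (Suc 0) (%q. mfield q \<bullet> mfield q)"
  unfolding mfield_def by (intro nice_inner nice_gradx nice_r)
 from deriv_v[OF this q]
 have d: "((%rh. mfield (gX G (rh, ?s, ?t), ?t) \<bullet> mfield (gX G (rh, ?s, ?t), ?t)) has_vector_derivative
   Dx (%q. mfield q \<bullet> mfield q) q (vfield q)) (at 0)" using r by simp
 have "((%rh. (norm (grad_r G (Xbar G (rh, ?s, ?t))))^2) has_vector_derivative
   Dx (%q. mfield q \<bullet> mfield q) q (vfield q)) (at 0)"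
 proof (rule has_vector_derivative_transform_within_open[OF d])
  show "open {-dl<..<dl}" "0 : {-dl<..<dl}" using dpos by simp_all
  fix rh assume "rh : {-dl<..<dl}"
  hence "(gX G (rh, ?s, ?t), ?t) : reg" by (intro reg_line q) auto
  thus "mfield (gX G (rh, ?s, ?t), ?t) \<bullet> mfield (gX G (rh, ?s, ?t), ?t) = (norm (grad_r G (Xbar G (rh, ?s, ?t))))^2"
   by (simp only: Xbar_eq grad_r_eq power2_norm_eq_inner)
 qed
 thus "Dx (%q. mfield q \<bullet> mfield q) q (vfield q) = 0"
  using normal_relations(2)[OF st] unfolding has_real_derivative_iff_has_vector_derivative
  by (rule vector_derivative_unique_at)
qed

text \<open>Mean value inequality along the r-line through q, starting on the interface.\<close>

lemma line_bound:
 assumes a: "nice (Suc k) a" and q: "q : reg"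
  and B: "!!q'. q' : reg ==> abs (rco q') <= abs (rco q) ==> norm (Dx a q' (vfield q')) <= B"
  and z: "!!q'. q' : reg ==> rco q' = 0 ==> a q' = 0"
 shows "norm (a q) <= B * abs (rco q)"
proof -
 let ?r = "rco q"
 define L where "L rh = (gX G (rh, sco q, snd q), snd q)" for rh
 define I where "I = {-abs (?r)..abs (?r)}"
 have I: "convex I" "0 : I" "?r : I" by (auto simp: I_def)
 have L: "L rh : reg" "rco (L rh) = rh" "sco (L rh) = sco q" "snd (L rh) = snd q" if "rh : I" for rh
 proof -
  have "abs rh < dl" using that reg_facts(1)[OF q] by (auto simp: I_def)
  thus "L rh : reg" "rco (L rh) = rh" "sco (L rh) = sco q" "snd (L rh) = snd q"
   unfolding L_def by (simp_all only: reg_line[OF q] line_coords[OF q] snd_conv)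
 qed
 have d: "((%rh. a (L rh)) has_derivative (%h. h *\<^sub>R Dx a (L rh) (vfield (L rh)))) (at rh within I)" if "rh : I" for rh
  using deriv_v[OF a L(1)[OF that]] unfolding L(2-4)[OF that] L_def[symmetric] has_vector_derivative_def
  by (rule has_derivative_at_withinI)
 have "norm (a (L ?r) - a (L 0)) <= B * norm (?r - 0)"
 proof (rule differentiable_bound[OF I(1) d _ I(3) I(2)])
  fix rh assume rh: "rh : I"
  have "norm (Dx a (L rh) (vfield (L rh))) <= B" using B[OF L(1)[OF rh]] L(2)[OF rh] rh by (auto simp: I_def)
  thus "onorm (%h. h *\<^sub>R Dx a (L rh) (vfield (L rh))) <= B"
   by (intro onorm_bound) (auto simp: mult.commute[of B] intro: mult_left_mono order_trans[OF norm_ge_zero])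
 qed
 moreover have "a (L 0) = 0" using z L(1,2) I(2) by blast
 moreover have "L ?r = q" unfolding L_def by (rule reg_facts(6)[OF q])
 ultimately show ?thesis by simp
qed

lemma first_order_bound:
 assumes a: "nice (Suc k) a" and z: "!!q. q : reg ==> rco q = 0 ==> a q = 0"
 shows "EX C>0. ALL q:reg. norm (a q) <= C * abs (rco q)"
proof -
 have "nice 0 (%q. Dx a q (vfield q))" by (rule nice_mono[of k, OF nice_Dx_field[OF a nice_v]]) simp
 from nice_bounded[OF this] obtain C where C: "C > 0" "ALL q:reg. norm (Dx a q (vfield q)) <= C" by blast
 have "norm (a q) <= C * abs (rco q)" if "q : reg" for q
  by (rule line_bound[OF a that]) (use C(2) z in auto)
 with C(1) show ?thesis by blast
qed

text \<open>\<open>first_order_bound\<close> controls the normal derivative by |r|; integrating once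
  more along the r-line gives the square.\<close>

lemma second_order_bound:
 assumes a: "nice (Suc (Suc k)) a" and z: "!!q. q : reg ==> rco q = 0 ==> a q = 0"
  and z': "!!q. q : reg ==> rco q = 0 ==> Dx a q (vfield q) = 0"
 shows "EX C>0. ALL q:reg. norm (a q) <= C * (rco q)^2"
proof -
 obtain C where C: "C > 0" "ALL q:reg. norm (Dx a q (vfield q)) <= C * abs (rco q)"
  using first_order_bound[OF nice_Dx_field[OF a nice_v] z'] by blast
 have "norm (a q) <= C * abs (rco q) * abs (rco q)" if "q : reg" for q
  by (rule line_bound[OF a that]) (use C z in \<open>auto intro: order_trans mult_left_mono\<close>)
 with C(1) show ?thesis by (auto simp: power2_eq_square mult.assoc)
qed

text \<open>Not the orthogonal projection: the coefficient of \<open>mfield\<close> is the normal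
  derivative, that is the product with \<open>vfield\<close>, so that \<nabla>\<psi> =
  \<partial>_n\<psi> \<nabla>r + \<nabla>_\<tau>\<psi> exactly.\<close>

definition tang :: "'a => 'a \<times> real => 'a" where
 "tang xv q = xv - (vfield q \<bullet> xv) *\<^sub>R mfield q"

text \<open>Write m for \<open>mfield\<close>, v for \<open>vfield\<close> and ta for the tangential
  part. Then |m|^2 - 1 = O(r^2), m - v = O(r), and v is orthogonal to ta, so the product of m and ta
  is O(r) |ta|. The cross term is absorbed by half of |ta|^2 at the price of O(r^2) times the square
  of the normal part.\<close>

lemma gradient_splitting:
 "EX C>0. ALL q:reg. ALL xv. (1 - C * (rco q)^2) * (vfield q \<bullet> xv)^2 + (norm (tang xv q))^2 / 2 <= (norm xv)^2 &
   (norm (tang xv q))^2 <= C * (norm xv)^2"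
proof -
 have nm: "nice k mfield" for k unfolding mfield_def by (rule nice_gradx[OF nice_r])
 have n1: "nice (Suc (Suc 0)) (%q. mfield q \<bullet> mfield q - 1)"
  by (intro nice_diff nice_inner nm nice_const)
 have z: "Dx (%q. mfield q \<bullet> mfield q - 1) q (vfield q) = 0" if "q : reg" "rco q = 0" for q
 proof -
  have "((%y. mfield (y, snd q) \<bullet> mfield (y, snd q)) has_derivative Dx (%q. mfield q \<bullet> mfield q) q) (at (fst q))"
   using nice_hd[OF nice_inner[OF nm nm], of "fst q" "snd q"] that by simp
  from has_derivative_diff[OF this has_derivative_const[of 1]]
  have "((%y. mfield (y, snd q) \<bullet> mfield (y, snd q) - 1) has_derivative Dx (%q. mfield q \<bullet> mfield q) q) (at (fst q))" by simp
  hence "Dx (%q. mfield q \<bullet> mfield q - 1) q = Dx (%q. mfield q \<bullet> mfield q) q"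
   unfolding Dx_def by (rule frechet_derivative_at[symmetric])
  thus ?thesis using v_eq_m(3)[OF that] by simp
 qed
 have "EX C>0. ALL q:reg. norm (mfield q \<bullet> mfield q - 1) <= C * (rco q)^2"
  by (rule second_order_bound[OF n1]) (use z v_eq_m(2) in auto)
 then obtain C1 where C1: "C1 > 0" "ALL q:reg. abs (mfield q \<bullet> mfield q - 1) <= C1 * (rco q)^2"
  unfolding real_norm_def by (elim exE conjE)
 have n2: "nice (Suc 0) (%q. mfield q - vfield q)" by (intro nice_diff nm nice_v)
 have "EX C>0. ALL q:reg. norm (mfield q - vfield q) <= C * abs (rco q)"
  by (rule first_order_bound[OF n2]) (simp add: v_eq_m(1))
 then obtain C2 where C2: "C2 > 0" "ALL q:reg. norm (mfield q - vfield q) <= C2 * abs (rco q)"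
  by (elim exE conjE)
 obtain C3 where C3: "C3 > 0" "ALL q:reg. norm (vfield q) <= C3" using nice_bounded[OF nice_v] by (elim exE conjE)
 obtain C4 where C4: "C4 > 0" "ALL q:reg. norm (mfield q) <= C4" using nice_bounded[OF nm] by (elim exE conjE)
 \<comment> \<open>The summands pay for |m|^2 - 1, for the absorbed cross term and for the second
   claim.\<close>
 define C where "C = C1 + 2 * C2^2 + (1 + C3 * C4)^2"
 have Cpos: "C > 0" using C1(1) by (simp add: C_def add_pos_nonneg)
 show ?thesis
 proof (intro exI[of _ C] conjI ballI allI Cpos)
  fix q xv assume q: "q : reg"
  define p where "p = vfield q \<bullet> xv"
  define ta where "ta = tang xv q"
  define m where "m = mfield q"
  have xv: "xv = ta + p *\<^sub>R m" by (simp add: ta_def tang_def p_def m_def)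
  have vta: "vfield q \<bullet> ta = 0"
   using Dr_v[OF q] by (simp add: ta_def tang_def inner_diff_right inner_commute)
  have "abs (m \<bullet> ta) = abs ((m - vfield q) \<bullet> ta)" by (simp add: inner_diff_left vta)
  also have "... <= norm (m - vfield q) * norm ta" by (rule Cauchy_Schwarz_ineq2)
  also have "... <= (C2 * abs (rco q)) * norm ta" by (intro mult_right_mono) (use C2 q in \<open>auto simp: m_def\<close>)
  finally have mta: "abs (m \<bullet> ta) <= C2 * abs (rco q) * norm ta" .
  have sq: "(norm xv)^2 = (norm ta)^2 + 2 * p * (m \<bullet> ta) + p^2 * (m \<bullet> m)"
   unfolding xv power2_norm_eq_inner
   by (simp add: inner_add_left inner_add_right inner_commute power2_eq_square algebra_simps)
  have "(norm ta / 2 - 2 * (C2 * abs (rco q) * abs p) / 2 * 1)^2 >= 0" by simp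
  hence y: "2 * (C2 * abs (rco q) * norm ta) * abs p <= (norm ta)^2 / 2 + 2 * C2^2 * (rco q)^2 * p^2"
   by (simp add: power2_eq_square field_simps abs_mult_self_eq)
  have "abs (2 * p * (m \<bullet> ta)) <= 2 * (C2 * abs (rco q) * norm ta) * abs p"
   using mult_right_mono[OF mta, of "2 * abs p"] by (simp add: abs_mult algebra_simps)
  hence 1: "2 * p * (m \<bullet> ta) >= - ((norm ta)^2 / 2) - 2 * C2^2 * (rco q)^2 * p^2" using y by linarith
  have "1 - C1 * (rco q)^2 <= m \<bullet> m" using bspec[OF C1(2) q] by (simp add: m_def abs_le_iff)
  hence 2: "p^2 * (1 - C1 * (rco q)^2) <= p^2 * (m \<bullet> m)" by (intro mult_left_mono) auto
  have "0 <= (1 + C3 * C4)^2 * (rco q)^2 * p^2" by simp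
  moreover have "(1 - C * (rco q)^2) * p^2 = p^2 * (1 - C1 * (rco q)^2)
    - 2 * C2^2 * (rco q)^2 * p^2 - (1 + C3 * C4)^2 * (rco q)^2 * p^2"
   unfolding C_def by (simp only: algebra_simps)
  ultimately have "(1 - C * (rco q)^2) * p^2 + (norm ta)^2 / 2 <= (norm xv)^2" using sq 1 2 by linarith
  thus "(1 - C * (rco q)^2) * (vfield q \<bullet> xv)^2 + (norm (tang xv q))^2 / 2 <= (norm xv)^2"
   by (simp only: p_def ta_def)
  have "norm ta <= norm xv + abs p * norm m" unfolding ta_def tang_def p_def m_def
   by (rule order_trans[OF norm_triangle_ineq4]) simp
  also have "abs p * norm m <= (C3 * norm xv) * C4" unfolding p_def m_def
   by (intro mult_mono order_trans[OF Cauchy_Schwarz_ineq2] mult_right_mono) (use C3 C4 q in \<open>auto intro: less_imp_le\<close>)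
  finally have "norm ta <= (1 + C3 * C4) * norm xv" by (simp add: algebra_simps)
  hence "(norm ta)^2 <= ((1 + C3 * C4) * norm xv)^2" by (intro power_mono) auto
  also have "... <= C * (norm xv)^2"
   unfolding power_mult_distrib C_def using C1(1) by (intro mult_right_mono) auto
  finally show "(norm (tang xv q))^2 <= C * (norm xv)^2" by (simp add: ta_def)
 qed
qed

end

section \<open>The tangential gradient as a weak surface gradient\<close>

lemma has_weak_gradient_subset:
 fixes u :: "'b::euclidean_space => real"
 assumes w: "has_weak_gradient A u g" and BA: "B \<subseteq> A"
 shows "has_weak_gradient B u g"
 unfolding has_weak_gradient_def
proof (intro conjI allI impI)
 fix K assume "compact K & K \<subseteq> B"
 thus "set_integrable lebesgue K u" "set_integrable lebesgue K g"
  using w BA unfolding has_weak_gradient_def by (meson order_trans)+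
next
 fix ph :: "'b => real" and b :: 'b assume ph: "test_function B ph & b : Basis"
 hence "test_function A ph & b : Basis" using BA unfolding test_function_def by (meson order_trans)
 hence *: "(LINT x:A|lebesgue. u x * Df ph x b) = - (LINT x:A|lebesgue. (g x \<bullet> b) * ph x)"
  by (rule conjunct2[OF w[unfolded has_weak_gradient_def], THEN spec, THEN spec, THEN mp])
 have out: "ph x = 0" "Df ph x b = 0" if "x ~: B" for x
 proof -
  let ?U = "- closure {x. ph x ~= 0}"
  have U: "open ?U" "x : ?U" using ph that by (auto simp: test_function_def)
  have z: "ph y = 0" if "y : ?U" for y using that closure_subset[of "{x. ph x ~= 0}"] by auto
  show "ph x = 0" using U(2) by (rule z)
  show "Df ph x b = 0" using U z by (rule Df_eq_0)
 qed
 have ind: "(LINT x:A|lebesgue. h x) = (LINT x:B|lebesgue. h x)" if "!!x. x ~: B ==> h x = 0" for h :: "'b => real"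
  unfolding set_lebesgue_integral_def
  by (rule Bochner_Integration.integral_cong) (use that BA in \<open>auto simp: indicator_def\<close>)
 show "(LINT x:B|lebesgue. u x * Df ph x b) = - (LINT x:B|lebesgue. (g x \<bullet> b) * ph x)"
  using * by (subst (asm) (1 2) ind) (simp_all add: out)
qed

context contact_geometry
begin

text \<open>On the kernel of dr the map ds has the left inverse A0, so there the functional
  \<open>gm\<close> is represented by \<open>adjoint A0 gm\<close> on values of ds. Projecting onto
  the span of the range of ds, which is the tangent space, does not change these values.\<close>

lemma tangent_representation:
 assumes q: "q : reg"
 shows "EX w:tangent_space S (sco q). ALL xv. mfield q \<bullet> xv = 0 --> w \<bullet> Ds q xv = gm \<bullet> xv"
proof -
 have lin: "linear (Ds q)" by (rule Dx_linear[OF nice_s q])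
 define L where "L xv = (mfield q \<bullet> xv, Ds q xv)" for xv
 have linL: "linear L" unfolding L_def
  by (intro linearI) (simp_all add: inner_add_right linear_add[OF lin] linear_scale[OF lin])
 have "inj L" unfolding linear_injective_0[OF linL]
  using coords_immersion[OF q] by (simp add: L_def zero_prod_def)
 then obtain A where A: "linear A" "A \<circ> L = id" using linear_injective_left_inverse[OF linL] by blast
 define A0 where "A0 et = A (0, et)" for et
 have linA: "linear A0" unfolding A0_def
  by (intro linearI) (simp_all add: linear_add[OF A(1), symmetric] linear_scale[OF A(1), symmetric])
 have A0: "A0 (Ds q xv) = xv" if "mfield q \<bullet> xv = 0" for xv
  using fun_cong[OF A(2), of xv] that by (simp add: L_def A0_def)
 obtain y z where yz: "y : span (Ds q ` Basis)" "!!w. w : span (Ds q ` Basis) ==> orthogonal z w"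
  "adjoint A0 gm = y + z" using orthogonal_subspace_decomp_exists[of "Ds q ` Basis" "adjoint A0 gm"] by blast
 have "q : tube G (2 * dl)" using q dpos by (auto simp: reg_def tube_def)
 from tangent_span[OF this] have "y : tangent_space S (sco q)" using yz(1) Dx_s_eq[OF q] by simp
 moreover have "y \<bullet> Ds q xv = gm \<bullet> xv" if xv: "mfield q \<bullet> xv = 0" for xv
 proof -
  have "Ds q xv : span (Ds q ` Basis)"
   unfolding Dx_expand[OF nice_s[of "Suc 0"] q, of xv] by (intro span_sum span_scale span_base imageI)
  hence "z \<bullet> Ds q xv = 0" using yz(2) by (simp add: orthogonal_def)
  hence "y \<bullet> Ds q xv = adjoint A0 gm \<bullet> Ds q xv" by (simp add: yz(3) inner_add_left)
  also have "... = gm \<bullet> xv" by (simp add: adjoint_clauses(2)[OF linA] A0[OF xv])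
  finally show ?thesis .
 qed
 ultimately show ?thesis by blast
qed

text \<open>Every k differs by a multiple of \<open>vfield\<close> from an element of the kernel of
  dr, and ds does not see that multiple.\<close>

lemma tang_unique:
 assumes q: "q : reg" and w: "!!xv. mfield q \<bullet> xv = 0 ==> w \<bullet> Ds q xv = gm \<bullet> xv"
 shows "adjoint (Ds q) w = tang gm q"
proof (rule vector_eq_rdot[THEN iffD1], intro allI)
 fix k
 define k' where "k' = k - (mfield q \<bullet> k) *\<^sub>R vfield q"
 have lin: "linear (Ds q)" by (rule Dx_linear[OF nice_s q])
 have "mfield q \<bullet> k' = 0" using Dr_v[OF q] by (simp add: k'_def inner_diff_right)
 hence "w \<bullet> Ds q k' = gm \<bullet> k'" by (rule w)
 moreover have "Ds q k' = Ds q k" using Ds_v[OF q] by (simp add: k'_def linear_diff[OF lin] linear_scale[OF lin])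
 ultimately have "adjoint (Ds q) w \<bullet> k = gm \<bullet> k'" by (simp only: adjoint_clauses(2)[OF lin])
 thus "adjoint (Ds q) w \<bullet> k = tang gm q \<bullet> k"
  by (simp add: k'_def tang_def inner_diff_left inner_diff_right inner_commute mult.commute)
qed

lemma nice_Ck_slice:
 assumes a: "nice k a"
 shows "Ck_on k (slice t) (%x. a (x, t))"
proof (rule Ck_on_local)
 fix x assume x: "x : slice t"
 hence "(x, t) : cpt" using reg_cpt by (auto simp: slice_def)
 then obtain V f where V: "open V" "(x, t) : V" "Ck_on k V f" "ALL q:V Int reg. f q = a q" by (rule niceE[OF a])
 have W: "open ((%y. (y, t)) -` V Int slice t)" (is "open ?W")
  by (intro open_Int open_vimage V(1) open_slice continuous_intros)
 have "Ck_on k ?W (%y. f (y, t))"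
  by (rule Ck_on_compose[OF W V(1,3)]) (use W in \<open>auto intro!: Ck_on_Pair\<close>)
 hence "Ck_on k ?W (%y. a (y, t))"
  by (rule Ck_on_cong[OF W, THEN iffD1, rotated]) (use V(4) in \<open>auto simp: slice_def\<close>)
 thus "EX W. open W & x : W & Ck_on k W (%x. a (x, t))"
  using W x V(2) by (intro exI[of _ ?W]) auto
qed

lemma Ck_slice_X:
 assumes t: "t : {0..T}" and W: "open W" "Ck_on k W F" and F: "F ` W \<subseteq> {-dl<..<dl} \<times> S"
 shows "Ck_on k W (%y. gX G (fst (F y), snd (F y), t))"
proof (rule Ck_on_local)
 fix y0 assume y0: "y0 : W"
 have c: "(fst (F y), snd (F y), t) : coord_dom G" if "y : W" for y
  using F that t dpos by (auto simp: coord_dom_def image_subset_iff mem_Times_iff dest!: bspec)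
 obtain U g where U: "open U" "(fst (F y0), snd (F y0), t) : U" "ALL k. Ck_on k U g" "ALL P:coord_dom G Int U. g P = gX G P"
  using bspec[OF X_smooth[unfolded smooth_on_def] c[OF y0]] by (elim exE conjE)
 let ?P = "%y. (fst (F y), snd (F y), t)"
 have ckP: "Ck_on k W ?P" by (intro Ck_on_Pair W Ck_on_fst Ck_on_snd Ck_on_const)
 define W' where "W' = W Int ?P -` U"
 have W': "open W'" unfolding W'_def by (intro continuous_open_preimage W(1) U(1) Ck_on_cont[OF ckP])
 have "Ck_on k W' (%y. g (?P y))"
  by (rule Ck_on_compose[OF W' U(1) _ Ck_on_subset[OF ckP]]) (use U(3) in \<open>auto simp: W'_def\<close>)
 hence "Ck_on k W' (%y. gX G (?P y))"
  by (rule Ck_on_cong[OF W', THEN iffD1, rotated]) (use U(4) c in \<open>auto simp: W'_def\<close>)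
 thus "EX W. open W & y0 : W & Ck_on k W (%y. gX G (?P y))"
  using W' y0 U(2) by (intro exI[of _ W']) (auto simp: W'_def)
qed

text \<open>\<open>has_weak_surface_gradient\<close> prescribes tangent values over boundary points
  too, which no product chart reaches; 0 serves there.\<close>

lemma boundary_tangent: assumes "s : bd" shows "0 : tangent_space S s"
 using assms unfolding surf_boundary_def tangent_space_def mem_Collect_eq
 by (elim exE) (intro exI conjI disjI2, assumption, rule inner_zero_right)

text \<open>Existence is what gives \<open>weak_surface_grad\<close> a meaning. A product chart
  followed by X is a local diffeomorphism into \<Omega>, so \<open>weak_compose\<close> provides the
  weak gradient in the chart, and \<open>tangent_representation\<close> provides a compatible
  tangent vector at every interior point.\<close>

lemma surface_gradient_exists:
 assumes t: "t : {0..T}" and w: "has_weak_gradient Omg ps g" and L2: "L2_on Omg ps" "L2_on Omg g"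
 shows "EX w. has_weak_surface_gradient {-dl<..<dl} S (%(r, s). ps (gX G (r, s, t))) w"
proof -
 have "EX w. w : tangent_space S s & (s ~: bd --> (ALL xv. mfield (gX G (r, s, t), t) \<bullet> xv = 0 -->
   w \<bullet> Ds (gX G (r, s, t), t) xv = g (gX G (r, s, t)) \<bullet> xv))" if "r : {-dl<..<dl}" "s : S" for r s
 proof (cases "s : bd")
  case True
  thus ?thesis using boundary_tangent by blast
 next
  case False
  have "(gX G (r, s, t), t) : reg" by (rule regI) (use that False t in auto)
  moreover have "sco (gX G (r, s, t), t) = s" by (rule coords) (use that t dpos in \<open>auto simp: cdom_iff\<close>)
  ultimately show ?thesis using tangent_representation[of "(gX G (r, s, t), t)" "g (gX G (r, s, t))"] by auto
 qed
 then obtain w where w': "!!r s. r : {-dl<..<dl} ==> s : S ==> w (r, s) : tangent_space S s &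
   (s ~: bd --> (ALL xv. mfield (gX G (r, s, t), t) \<bullet> xv = 0 -->
   w (r, s) \<bullet> Ds (gX G (r, s, t), t) xv = g (gX G (r, s, t)) \<bullet> xv))"
  by (atomize_elim, intro exI[of _ "%(r, s). SOME w. w : tangent_space S s & (s ~: bd -->
   (ALL xv. mfield (gX G (r, s, t), t) \<bullet> xv = 0 --> w \<bullet> Ds (gX G (r, s, t), t) xv = g (gX G (r, s, t)) \<bullet> xv))"] allI impI)
   (simp only: prod.case, rule someI_ex, assumption | blast)
 show ?thesis
 proof (intro exI[of _ w], unfold has_weak_surface_gradient_def, intro conjI allI impI ballI)
  fix W F assume pc: "product_chart {-dl<..<dl} S W F"
  note pc = pc[unfolded product_chart_def]
  have W: "open W" using pc by (rule conjunct1)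
  have F: "Ck_on k W F" for k by (rule smooth_Ck[OF W]) (use pc in \<open>elim conjE\<close>)
  have FW: "F ` W \<subseteq> {-dl<..<dl} \<times> surf_interior S" using pc by (elim conjE)
  have injW: "ALL w:W. inj (Df F w)" using pc by (elim conjE)
  have inj: "inj (Df F y)" if "y : W" for y using bspec[OF injW that] .
  have FS: "F ` W \<subseteq> {-dl<..<dl} \<times> S"
   by (rule order_trans[OF FW]) (intro Sigma_mono order_refl surf_interior_subset)
  define Ph where "Ph y = gX G (fst (F y), snd (F y), t)" for y
  have ck: "Ck_on k W Ph" for k unfolding Ph_def by (rule Ck_slice_X[OF t W F FS])
  have Fy: "fst (F y) : {-dl<..<dl}" "snd (F y) : S" "snd (F y) ~: bd" if "y : W" for y
   using FW that surf_interior_subset int_not_bd by (auto simp: image_subset_iff mem_Times_iff)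
  have reg: "(Ph y, t) : reg" if "y : W" for y
   unfolding Ph_def by (rule regI) (use Fy[OF that] t in auto)
  have co: "rco (Ph y, t) = fst (F y)" "sco (Ph y, t) = snd (F y)" if "y : W" for y
   unfolding Ph_def by (rule coords; use Fy[OF that] t dpos in \<open>auto simp: cdom_iff\<close>)+
  \<comment> \<open>F is (r, s) after Ph. Hence injectivity of DF passes to DPh, and the vectors k
    with vanishing r-component are those that DPh maps into the kernel of dr.\<close>
  have DF: "Df F y k = (mfield (Ph y, t) \<bullet> Df Ph y k,
    Ds (Ph y, t) (Df Ph y k))" if y: "y : W" for y k
  proof -
   have dPh: "(Ph has_derivative Df Ph y) (at y)" by (rule Ck_on_DD[OF ck y])
   have 1: "((%y. (rco (Ph y, t), sco (Ph y, t))) has_derivative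
     (%k. (Dx (rco) (Ph y, t) (Df Ph y k), Ds (Ph y, t) (Df Ph y k)))) (at y)"
    by (intro has_derivative_Pair)
     (rule has_derivative_compose[OF dPh nice_hd[OF nice_r reg[OF y]]],
      rule has_derivative_compose[OF dPh nice_hd[OF nice_s reg[OF y]]])
   have "(F has_derivative
     (%k. (Dx (rco) (Ph y, t) (Df Ph y k), Ds (Ph y, t) (Df Ph y k)))) (at y)"
    by (rule has_derivative_transform_within_open[OF 1 W y]) (simp add: co)
   from frechet_derivative_at[OF this] show ?thesis by (metis mfield_inner[OF reg[OF y]])
  qed
  have injPh: "inj (Df Ph y)" if "y : W" for y
   by (rule injI, rule injD[OF inj[OF that]]) (simp add: DF[OF that])
  have PhOmg: "Ph ` W \<subseteq> Omg" using reg by (auto simp: reg_def)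
  define h where "h = (%y. SUM b:Basis. (g (Ph y) \<bullet> Df Ph y b) *\<^sub>R b)"
  have hw: "has_weak_gradient W (%y. ps (Ph y)) h" unfolding h_def
   by (rule weak_compose[OF domain(1) w L2 W ck injPh PhOmg])
  have h: "h y \<bullet> k = g (Ph y) \<bullet> Df Ph y k" if y: "y : W" for y k
  proof -
   have lin: "linear (Df Ph y)" by (rule has_derivative_linear[OF Ck_on_DD[OF ck y]])
   have "Df Ph y k = (SUM b:Basis. (k \<bullet> b) *\<^sub>R Df Ph y b)"
    by (subst (1) euclidean_representation[symmetric, of k]) (simp only: linear_sum[OF lin] linear_scale[OF lin])
   thus ?thesis by (simp add: h_def inner_sum_left inner_sum_right inner_commute mult.commute)
  qed
  have comp: "(%(r, s). ps (gX G (r, s, t))) \<circ> F = (%y. ps (Ph y))"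
   by (auto simp: Ph_def case_prod_beta)
  have "w (F y) \<bullet> snd (Df F y k) = h y \<bullet> k"
   if y: "y : W" and k: "fst (Df F y k) = 0" for y k
  proof -
   have "mfield (Ph y, t) \<bullet> Df Ph y k = 0" using k DF[OF y] by simp
   hence "w (fst (F y), snd (F y)) \<bullet> Ds (Ph y, t) (Df Ph y k) = g (Ph y) \<bullet> Df Ph y k"
    using w'[OF Fy(1,2)[OF y]] Fy(3)[OF y] unfolding Ph_def by blast
   thus ?thesis using h[OF y] DF[OF y] by simp
  qed
  with hw show "EX g. has_weak_gradient W ((%(r, s). ps (gX G (r, s, t))) \<circ> F) g &
    (AE y in lebesgue. y : W --> (ALL k. fst (Df F y k) = 0 -->
     w (F y) \<bullet> snd (Df F y k) = g y \<bullet> k))"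
   unfolding comp by (intro exI[of _ h] conjI AE_I2) auto
 qed (use w' in blast)
qed

text \<open>The coordinates (r, s) at time t are themselves a product chart on the slice, in which
  \<psi> after X is \<psi> again. Uniqueness identifies the gradient in this chart with
  \<open>weak_grad\<close>, and \<open>tang_unique\<close> does the algebra.\<close>

lemma tangential_grad_eq:
 assumes t: "t : {0..T}" and ps: "ps : H1 Omg"
 shows "AE x in lebesgue. x : slice t --> tangential_grad G t ps x = tang (weak_grad Omg ps x) (x, t)"
proof -
 let ?g = "weak_grad Omg ps" and ?ph = "%(r, s). ps (gX G (r, s, t))"
 note wg = H1_weak_grad[OF domain(1) ps]
 define w where "w = weak_surface_grad {-dl<..<dl} S ?ph"
 have w: "has_weak_surface_gradient {-dl<..<dl} S ?ph w"
  unfolding w_def weak_surface_grad_def by (rule someI_ex[OF surface_gradient_exists[OF t wg(2,1,3)]])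
 define F where "F x = (rco (x, t), sco (x, t))" for x
 have dF: "(F has_derivative (%k. (mfield (x, t) \<bullet> k, Ds (x, t) k))) (at x)" if "x : slice t" for x
 proof -
  have r: "(x, t) : reg" using that by (simp add: slice_def)
  show ?thesis unfolding F_def mfield_inner[OF r]
   by (intro has_derivative_Pair nice_hd[OF nice_r r] nice_hd[OF nice_s r])
 qed
 have DF: "Df F x = (%k. (mfield (x, t) \<bullet> k, Ds (x, t) k))" if "x : slice t" for x
  by (rule frechet_derivative_at[symmetric, OF dF[OF that]])
 have "product_chart {-dl<..<dl} S (slice t) F"
  unfolding product_chart_def
 proof (intro conjI ballI)
  show "open (slice t)" by (rule open_slice)
  show "smooth_on (slice t) F" unfolding F_def
   by (intro smooth_onI open_slice Ck_on_Pair nice_Ck_slice nice_r nice_s)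
  show "F ` slice t \<subseteq> {-dl<..<dl} \<times> surf_interior S"
  proof
   fix P assume "P : F ` slice t"
   then obtain x where x: "(x, t) : reg" "P = F x" by (auto simp: slice_def)
   show "P : {-dl<..<dl} \<times> surf_interior S"
    using reg_facts(1-3)[OF x(1)] int_or_bd by (auto simp: x(2) F_def)
  qed
  fix x assume x: "x : slice t"
  hence r: "(x, t) : reg" by (simp add: slice_def)
  have lin: "linear (Df F x)" unfolding DF[OF x] by (rule has_derivative_linear[OF dF[OF x]])
  show "inj (Df F x)"
   unfolding linear_injective_0[OF lin] unfolding DF[OF x]
   using coords_immersion[OF r] by (simp add: zero_prod_def)
 qed
 then obtain g' where g': "has_weak_gradient (slice t) (?ph \<circ> F) g'"
  "AE y in lebesgue. y : slice t --> (ALL k. fst (Df F y k) = 0 -->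
     w (F y) \<bullet> snd (Df F y k) = g' y \<bullet> k)"
  using w unfolding has_weak_surface_gradient_def by blast
 have sub: "slice t \<subseteq> Omg" by (auto simp: slice_def reg_def)
 have "(?ph \<circ> F) x = ps x" if "x : slice t" for x
  using reg_facts(6)[of "(x, t)"] that by (simp add: F_def slice_def)
 hence "has_weak_gradient (slice t) ps g'"
  by (intro has_weak_gradient_AE[OF g'(1)] AE_I2) auto
 moreover have "has_weak_gradient (slice t) ps ?g" by (rule has_weak_gradient_subset[OF wg(2) sub])
 ultimately have "AE x in lebesgue. x : slice t --> g' x = ?g x" by (rule weak_unique[OF open_slice])
 with g'(2) show ?thesis
 proof eventually_elim
  case (elim x)
  show ?case
  proof
   assume x: "x : slice t"
   hence r: "(x, t) : reg" by (simp add: slice_def)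
   have "w (F x) \<bullet> Ds (x, t) xv = ?g x \<bullet> xv" if "mfield (x, t) \<bullet> xv = 0" for xv
    using elim x that by (auto simp: DF[OF x])
   from tang_unique[OF r this]
   show "tangential_grad G t ps x = tang (?g x) (x, t)"
    unfolding tangential_grad_def Dx_s_eq[OF r] w_def F_def .
  qed
 qed
qed

end

section \<open>A regularized distance to the boundary\<close>

lemma max_power_DERIV:
 "((%x::real. (max 0 x) ^ Suc (Suc n)) has_real_derivative real (Suc (Suc n)) * (max 0 x) ^ Suc n) (at x)"
proof -
 consider "x > 0" | "x < 0" | "x = 0" by linarith
 thus ?thesis
 proof cases
  case 1
  have "((%x::real. x ^ Suc (Suc n)) has_real_derivative real (Suc (Suc n)) * x ^ Suc n) (at x)"
   by (rule DERIV_cong[OF DERIV_pow]) simp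
  hence "((%x::real. (max 0 x) ^ Suc (Suc n)) has_real_derivative real (Suc (Suc n)) * x ^ Suc n) (at x)"
   by (rule has_field_derivative_transform_within_open[of _ _ _ "{0<..}"]) (use 1 in auto)
  thus ?thesis using 1 by simp
 next
  case 2
  have "((%x::real. (max 0 x) ^ Suc (Suc n)) has_real_derivative 0) (at x)"
   by (rule has_field_derivative_transform_within_open[of "%x. 0" 0 x "{..<0}"]) (use 2 in auto)
  thus ?thesis using 2 by simp
 next
  case 3
  have "((%h::real. (max 0 (0 + h)) ^ Suc (Suc n) / h) \<longlongrightarrow> 0) (at 0)"
  proof (rule Lim_null_comparison)
   show "\<forall>\<^sub>F h in at 0. norm ((max 0 (0 + h)) ^ Suc (Suc n) / h) <= abs (h::real) ^ Suc n"
   proof (rule always_eventually, rule allI)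
    fix h :: real
    show "norm ((max 0 (0 + h)) ^ Suc (Suc n) / h) <= abs h ^ Suc n"
    proof (cases "h > 0")
     case False
     hence "max 0 (0 + h) = 0" by simp
     thus ?thesis unfolding \<open>max 0 (0 + h) = 0\<close> by simp
    qed simp
   qed
   have "((%h::real. abs h ^ Suc n) \<longlongrightarrow> \<bar>0\<bar> ^ Suc n) (at 0)" by (intro tendsto_intros)
   thus "((%h::real. abs h ^ Suc n) \<longlongrightarrow> 0) (at 0)" by simp
  qed
  thus ?thesis using 3 by (simp add: DERIV_def)
 qed
qed

lemma Ck_on_max_power: "Ck_on n UNIV (%x::real. (max 0 x) ^ Suc n)"
proof (induction n)
 case 0
 thus ?case by (simp add: continuous_intros)
next
 case (Suc n)
 show ?case
  by (rule Ck_on_SucI_real[OF open_UNIV max_power_DERIV]) (intro Ck_on_mult open_UNIV Ck_on_const Suc.IH)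
qed

context contact_geometry
begin

text \<open>The boundary is S minus the union of all interior chart domains, which is open.\<close>

lemma compact_bd: "compact bd"
proof -
 define V where "V = \<Union>{U. EX p g. interior_chart S p U g}"
 have "open V" unfolding V_def by (auto simp: interior_chart_def)
 have "x : surf_interior S" if "x : S" "x : V" for x
 proof -
  obtain U p g where U: "x : U" "interior_chart S p U g" using \<open>x : V\<close> unfolding V_def by blast
  hence "interior_chart S x U g" using \<open>x : S\<close> unfolding interior_chart_def by blast
  thus ?thesis unfolding surf_interior_def by blast
 qed
 moreover have "surf_interior S \<subseteq> V" unfolding V_def surf_interior_def interior_chart_def by blast
 ultimately have "bd = S Int - V"
  using int_or_bd int_not_bd boundary_subset by blast
 thus ?thesis using compact_Int_closed[OF S_facts(2), of "- V"] \<open>open V\<close> by (simp add: closed_Compl)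
qed

abbreviation (input) "mu0 \<equiv> gmu0 G"
abbreviation (input) "mu1 \<equiv> gmu1 G"

lemma Y_inv_Y:
 assumes "sig : bd" "b : {0..2 * mu1}"
 shows "Y_inv G (gY G (sig, b)) = (sig, b)"
proof -
 obtain Yi where "homeomorphism (bd \<times> {0..2 * mu1}) (gY G ` (bd \<times> {0..2 * mu1})) (gY G) Yi"
  using Y_homeo by (elim exE conjE)
 hence "inj_on (gY G) (bd \<times> {0..2 * mu1})" by (intro inj_on_inverseI[of _ Yi]) (rule homeomorphism_apply1)
 thus ?thesis unfolding Y_inv_def by (rule inv_into_f_f) (use assms in simp)
qed

lemma Y_inv_smooth: "smooth_on (gY G ` (bd \<times> {0..2 * mu1})) (Y_inv G)"
proof -
 obtain Yi where Yi: "homeomorphism (bd \<times> {0..2 * mu1}) (gY G ` (bd \<times> {0..2 * mu1})) (gY G) Yi"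
  and sm: "smooth_on (gY G ` (bd \<times> {0..2 * mu1})) Yi"
  using Y_homeo by (elim exE conjE)
 have "Y_inv G s = Yi s" if "s : gY G ` (bd \<times> {0..2 * mu1})" for s
  using that homeomorphism_apply1[OF Yi] Y_inv_Y by auto
 with sm show ?thesis unfolding smooth_on_def by simp
qed

lemma compact_Y: assumes "c <= 2 * mu1" shows "compact (gY G ` (bd \<times> {0..c}))"
proof -
 obtain Yi where Yi: "homeomorphism (bd \<times> {0..2 * mu1}) (gY G ` (bd \<times> {0..2 * mu1})) (gY G) Yi"
  using Y_homeo by (elim exE conjE)
 have "continuous_on (bd \<times> {0..c}) (gY G)"
  by (rule continuous_on_subset[OF homeomorphism_cont1[OF Yi]]) (use assms in auto)
 thus ?thesis by (intro compact_continuous_image compact_Times compact_bd compact_Icc)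
qed

text \<open>Replaces the distance b, which exists only near the boundary, by a function that is 1
  from \<open>mu0\<close> on and so can be continued by 1. The exponent 3 makes it C^2; it is
  positive for b > 0, at most 3 b / mu0, and has slope at least 3 / (4 mu0) for b <= mu0 /
  2.\<close>

definition kap :: "real => real" where "kap b = 1 - (max 0 (1 - b / mu0)) ^ 3"

definition btil :: "'a => real" where
 "btil s = (if s : gY G ` (bd \<times> {0..2 * mu1}) then kap (snd (Y_inv G s)) else 1)"

definition beta :: "'a \<times> real => real" where "beta q = btil (sco q)"

lemma Ck_kap: "Ck_on 2 UNIV kap"
proof -
 have "Ck_on 2 UNIV (%b. (%x::real. (max 0 x) ^ Suc 2) (1 - b * (1 / mu0)))"
  by (rule Ck_on_compose[OF open_UNIV open_UNIV Ck_on_max_power])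
   (intro Ck_on_diff Ck_on_mult Ck_on_const Ck_on_id open_UNIV, simp)
 from Ck_on_diff[OF open_UNIV Ck_on_const[of 2 UNIV 1] this] show ?thesis by (simp add: kap_def[abs_def])
qed

lemma kap_deriv: "0 <= b ==> b < mu0 ==> (kap has_real_derivative 3 * (1 - b / mu0)^2 / mu0) (at b)"
proof -
 assume b: "0 <= b" "b < mu0"
 have "((%b. 1 - (1 - b / mu0) ^ 3) has_real_derivative 3 * (1 - b / mu0)^2 / mu0) (at b)"
  using mu0(1) by (auto intro!: derivative_eq_intros)
 thus ?thesis
  by (rule has_field_derivative_transform_within_open[of _ _ _ "{..<mu0}"]) (use mu0(1) b in \<open>auto simp: kap_def max_def\<close>)
qed

lemma kap_facts:
 assumes "b >= 0" shows "kap b <= 1" "b > 0 ==> kap b > 0" "b >= mu0 ==> kap b = 1" "kap b <= 3 * b / mu0"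
proof -
 let ?x = "b / mu0"
 have x: "?x >= 0" "b > 0 ==> ?x > 0" "b >= mu0 ==> ?x >= 1" using assms mu0(1) by auto
 show "kap b <= 1" by (simp add: kap_def)
 show "kap b = 1" if "b >= mu0" using x(3)[OF that] by (simp add: kap_def max_def)
 show "kap b > 0" if "b > 0"
 proof -
  have "max 0 (1 - ?x) < 1" "max 0 (1 - ?x) >= 0" using x(2)[OF that] by auto
  hence "(max 0 (1 - ?x)) ^ 3 < 1 ^ 3" by (intro power_strict_mono) auto
  thus ?thesis by (simp add: kap_def)
 qed
 \<comment> \<open>Bernoulli gives the linear upper bound, which fixes the decay rate in
   \<open>tangential_field\<close>.\<close>
 have "1 + real 3 * (max 0 (1 - ?x) - 1) <= (1 + (max 0 (1 - ?x) - 1)) ^ 3" by (rule Bernoulli_inequality) simp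
 hence "1 - (max 0 (1 - ?x)) ^ 3 <= 3 * (1 - max 0 (1 - ?x))" by simp
 also have "... <= 3 * ?x" by (intro mult_left_mono) auto
 finally show "kap b <= 3 * b / mu0" by (simp add: kap_def)
qed

lemma btil_Y: "sig : bd ==> b : {0..2 * mu1} ==> btil (gY G (sig, b)) = kap b"
 by (simp add: btil_def Y_inv_Y)

lemma btil_bd: "s : bd ==> btil s = 0"
 using btil_Y[of s 0] Y_0[of s] mu1 by (simp add: kap_def)

lemma btil_pos: assumes "s : S" "s ~: bd" shows "btil s > 0"
proof (cases "s : gY G ` (bd \<times> {0..2 * mu1})")
 case True
 then obtain sig b where b: "s = gY G (sig, b)" "sig : bd" "b : {0..2 * mu1}" by auto
 moreover have "b ~= 0" using b Y_0 assms(2) by auto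
 ultimately show ?thesis using btil_Y[OF b(2,3)] kap_facts(2)[of b] by auto
qed (simp add: btil_def)

text \<open>Two overlapping descriptions: for b < 2 mu1 the smooth inverse of Y is available, and
  off the compact set where b <= mu1 the function is constantly 1 because mu0 <= mu1.\<close>

lemma btil_local:
 assumes s0: "s0 : S"
 shows "EX U g. open U & s0 : U & Ck_on 2 U g & (ALL s:U Int S. g s = btil s)"
proof (cases "s0 : gY G ` (bd \<times> {0..<2 * mu1})")
 case True
 have "openin (top_of_set S) (gY G ` (bd \<times> {0..<2 * mu1}))" using bspec[OF Y_open, of "2 * mu1"] mu1 by simp
 then obtain W where W: "open W" "gY G ` (bd \<times> {0..<2 * mu1}) = S Int W" by (auto simp: openin_open)
 have sub: "S Int W \<subseteq> gY G ` (bd \<times> {0..2 * mu1})" unfolding W(2)[symmetric] by (intro image_mono Sigma_mono) auto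
 have sW: "s0 : S Int W" using True W(2) by simp
 obtain U h where U: "open U" "s0 : U" "ALL k. Ck_on k U h" "ALL s:gY G ` (bd \<times> {0..2 * mu1}) Int U. h s = Y_inv G s"
  using bspec[OF Y_inv_smooth[unfolded smooth_on_def], of s0] sW sub by blast
 have o: "open (U Int W)" using U(1) W(1) by blast
 have "Ck_on 2 (U Int W) (%s. kap (snd (h s)))"
  by (rule Ck_on_compose[OF o open_UNIV Ck_kap]) (use o U(3) in \<open>auto intro!: Ck_on_snd intro: Ck_on_subset\<close>)
 moreover have "kap (snd (h s)) = btil s" if "s : (U Int W) Int S" for s
  using that sub U(4) by (auto simp: btil_def)
 ultimately show ?thesis using o U(2) sW by (intro exI[of _ "U Int W"] exI[of _ "%s. kap (snd (h s))"]) auto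
next
 case False
 let ?U = "- (gY G ` (bd \<times> {0..mu1}))"
 have o: "open ?U" using compact_Y[of mu1] mu1 by (intro open_Compl compact_imp_closed) auto
 have "btil s = 1" if s: "s : ?U" for s
 proof (cases "s : gY G ` (bd \<times> {0..2 * mu1})")
  case True
  then obtain sig b where b: "s = gY G (sig, b)" "sig : bd" "b : {0..2 * mu1}" by auto
  hence "b > mu1" using s by (force simp: image_iff)
  thus ?thesis using btil_Y[OF b(2,3)] kap_facts(3)[of b] mu0 mu1 b by simp
 qed (simp add: btil_def)
 moreover have "s0 : ?U" using False mu1 by auto
 ultimately show ?thesis using o by (intro exI[of _ ?U] exI[of _ "%s. 1"]) auto
qed

lemma continuous_btil: "continuous_on S btil"
 unfolding continuous_on_eq_continuous_within
proof
 fix s0 assume s0: "s0 : S"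
 obtain U g where U: "open U" "s0 : U" "Ck_on 2 U g" "ALL s:U Int S. g s = btil s"
  using btil_local[OF s0] by (elim exE conjE)
 obtain e where e: "e > 0" "ball s0 e \<subseteq> U" using U(1,2) openE by blast
 have "isCont g s0" using Ck_on_cont[OF U(3)] U(1,2) by (simp add: continuous_on_eq_continuous_at)
 hence "continuous (at s0 within S) g" by (rule continuous_at_imp_continuous_at_within)
 thus "continuous (at s0 within S) btil"
  by (rule continuous_transform_within[OF _ e(1) s0]) (use e(2) U(4) in \<open>auto simp: dist_commute subset_iff\<close>)
qed

lemma cpt_coords: "p : cpt ==> (rco p, sco p, snd p) : coord_dom G"
 using dpos by (auto simp: cpt_def Xbar_eq cdom_iff coords)

lemma nice_beta: "nice 2 beta"
proof (rule niceI)
 fix p assume p: "p : cpt"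
 obtain V z U' g' where "chart p V z U' g'" using chart_exists[OF p] by (elim exE)
 note V = chartD[OF this]
 have zp: "fst (snd (z p)) = sco p" "sco p : S" using V(2,7) p cpt_coords[OF p] by (auto simp: cdom_iff)
 obtain U g where U: "open U" "sco p : U" "Ck_on 2 U g" "ALL s:U Int S. g s = btil s"
  using btil_local[OF zp(2)] by (elim exE conjE)
 have cks: "Ck_on k V (%q. fst (snd (z q)))" for k by (intro Ck_on_fst Ck_on_snd V(1) V(3)[rule_format])
 define W where "W = V Int (%q. fst (snd (z q))) -` U"
 have oW: "open W" unfolding W_def by (intro continuous_open_preimage V(1) U(1) Ck_on_cont[OF cks])
 have "Ck_on 2 W (%q. g (fst (snd (z q))))"
  by (rule Ck_on_compose[OF oW U(1,3) Ck_on_subset[OF cks]]) (auto simp: W_def)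
 moreover have "g (fst (snd (z q))) = beta q" if q: "q : W Int reg" for q
 proof -
  have "z q = (rco q, sco q, snd q)" using V(7) q reg_cpt by (auto simp: W_def)
  thus ?thesis using q U(4) reg_facts(2)[of q] by (auto simp: W_def beta_def)
 qed
 ultimately show "EX V f. open V & p : V & Ck_on 2 V f & (ALL q:V Int reg. f q = beta q)"
  using oW V(2) zp U(2) by (intro exI[of _ W] exI[of _ "%q. g (fst (snd (z q)))"]) (auto simp: W_def)
qed

lemma nice_beta1: "nice (Suc 0) beta"
 by (rule nice_mono[OF nice_beta]) simp

lemma beta_pos: "q : reg ==> beta q > 0"
 unfolding beta_def by (rule btil_pos[OF reg_facts(2,3)])

lemma Dbeta_v: assumes q: "q : reg" shows "Dx beta q (vfield q) = 0"
proof -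
 have I: "open {-dl<..<dl}" "rco q : {-dl<..<dl}" using reg_facts(1)[OF q] by auto
 have "((%rh. beta q) has_vector_derivative Dx beta q (vfield q)) (at (rco q))"
  by (rule has_vector_derivative_transform_within_open[OF deriv_v[OF nice_beta1 q] I])
   (use line_coords(2)[OF q] in \<open>auto simp: beta_def\<close>)
 thus ?thesis by (rule vector_derivative_unique_at) (rule has_vector_derivative_const)
qed

text \<open>A lower bound for |\<nabla>\<beta>| up to the boundary: the vector \<open>ze\<close>,
  the image of \<partial>_b Y under the derivative of X, is bounded near p, and \<beta> has
  derivative kap'(b) along it. If s(p) lies off the compact corner piece, the claim is void near
  p.\<close>

lemma beta_gradient_local:
 assumes p: "p : cpt"
 shows "EX V C. open V & p : V &
  (ALL q:V Int reg. sco q : gY G ` (bd \<times> {0..mu0 / 2}) --> 1 <= C * norm (gradx beta q))"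
proof -
 let ?K = "gY G ` (bd \<times> {0..mu0 / 2})"
 have K: "compact ?K" by (rule compact_Y) (use mu0 in auto)
 obtain V z U g where "chart p V z U g" using chart_exists[OF p] by (elim exE)
 note V = chartD[OF this]
 have zp: "fst (snd (z p)) = sco p" using V(2,7) p by auto
 let ?s = "%q. fst (snd (z q))"
 have cks: "Ck_on k V ?s" for k by (intro Ck_on_fst Ck_on_snd V(1) V(3)[rule_format])
 have sq: "?s q = sco q" if "q : V" "q : reg" for q using V(7) that reg_cpt by auto
 show ?thesis
 proof (cases "sco p : ?K")
  case False
  define W where "W = V Int ?s -` (- ?K)"
  have "open W" unfolding W_def
   by (intro continuous_open_preimage V(1) open_Compl compact_imp_closed[OF K] Ck_on_cont[OF cks])
  moreover have "p : W" using False V(2) zp by (simp add: W_def)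
  ultimately show ?thesis using sq by (intro exI[of _ W] exI[of _ 1]) (auto simp: W_def)
 next
  case True
  then obtain sig0 b0 where s0: "sco p = gY G (sig0, b0)" "sig0 : bd" "b0 : {0..2 * mu1}"
   using mu0 mu1 by auto
  obtain UY Y' where UY: "open UY" "(sig0, b0) : UY" "ALL k. Ck_on k UY Y'" "ALL P:(bd \<times> {0..2 * mu1}) Int UY. Y' P = gY G P"
   using bspec[OF Y_smooth[unfolded smooth_on_def], of "(sig0, b0)"] s0(2,3) by auto
  obtain Uk k where Uk: "open Uk" "sco p : Uk" "ALL j. Ck_on j Uk k" "ALL s:gY G ` (bd \<times> {0..2 * mu1}) Int Uk. k s = Y_inv G s"
   using bspec[OF Y_inv_smooth[unfolded smooth_on_def], of "sco p"] s0 by auto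
  define V1 where "V1 = V Int ?s -` Uk"
  have V1: "open V1" unfolding V1_def by (intro continuous_open_preimage V(1) Uk(1) Ck_on_cont[OF cks])
  have cky: "Ck_on j V1 (%q. k (?s q))" for j
   by (rule Ck_on_compose[OF V1 Uk(1) Uk(3)[rule_format] Ck_on_subset[OF cks]]) (auto simp: V1_def)
  define V2 where "V2 = V1 Int (%q. k (?s q)) -` UY"
  have V2: "open V2" unfolding V2_def by (intro continuous_open_preimage V1 UY(1) Ck_on_cont[OF cky])
  have pV2: "p : V2" using V(2) Uk(2,4) zp s0 Y_inv_Y[OF s0(2,3)] UY(2) by (auto simp: V2_def V1_def)
  define w where "w q = Df Y' (k (?s q)) (0, 1)" for q
  have ckw: "Ck_on 0 V2 w" unfolding w_def
   by (rule Ck_on_compose[OF V2 UY(1) Ck_on_SucD[OF UY(3)[rule_format]] Ck_on_subset[OF cky]]) (auto simp: V2_def)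
  \<comment> \<open>Written out in the basis, so that continuity in q follows from that of the
    partial derivatives of g.\<close>
  define ze where "ze q = (SUM b:Basis. (w q \<bullet> b) *\<^sub>R Df g (z q) (0, b, 0))" for q
  have "Ck_on 0 V2 (%q. Df g (z q) (0, b, 0))" for b
   by (rule Ck_on_compose[OF V2 V(4) Ck_on_SucD[OF V(5)[rule_format]] Ck_on_subset[OF V(3)[rule_format]]])
    (use V(6) in \<open>auto simp: V2_def V1_def\<close>)
  hence "Ck_on 0 V2 ze" unfolding ze_def by (intro Ck_on_sum Ck_on_scaleR Ck_on_inner ckw Ck_on_const V2)
  hence "isCont ze p" using V2 pV2 by (simp add: continuous_on_eq_continuous_at)
  hence "eventually (%q. dist (ze q) (ze p) < 1) (at p)" by (simp add: isCont_def tendstoD)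
  then obtain W where W: "open W" "p : W" "!!q. q : W ==> q ~= p ==> dist (ze q) (ze p) < 1"
   by (auto simp: eventually_at_topological)
  define C where "C = norm (ze p) + 1"
  have C: "norm (ze q) <= C" if "q : W" for q
  proof -
   have "norm (ze q - ze p) < 1" using W(3)[of q] that by (cases "q = p") (auto simp: dist_norm)
   thus ?thesis using norm_triangle_ineq2[of "ze q" "ze p"] unfolding C_def by linarith
  qed
  have "1 <= 4 * mu0 / 3 * C * norm (gradx beta q)"
   if q: "q : V2" "q : W" "q : reg" and sK: "sco q : ?K" for q
  proof -
   obtain sig b where b: "sco q = gY G (sig, b)" "sig : bd" "0 <= b" "b <= mu0 / 2" using sK by auto
   have "b ~= 0" using b(1,2) Y_0[of sig] reg_facts(3)[OF q(3)] by auto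
   hence b0: "b > 0" "b : {0..2 * mu1}" using b mu0 by auto
   let ?r = "rco q" and ?t = "snd q"
   have qV: "q : V" "q : cpt" using q reg_cpt by (auto simp: V2_def V1_def)
   have kq: "k (?s q) = (sig, b)" "(sig, b) : UY"
   proof -
    have "?s q = gY G (sig, b)" "?s q : Uk" using sq[OF qV(1) q(3)] b(1) q(1) by (auto simp: V2_def V1_def)
    thus "k (?s q) = (sig, b)" using Uk(4) Y_inv_Y[OF b(2) b0(2)] b(2) b0(2) by auto
    thus "(sig, b) : UY" using q(1) by (simp add: V2_def)
   qed
   have zq: "z q = (?r, gY G (sig, b), ?t)" using V(7) qV b(1) by auto
   hence zU: "(?r, gY G (sig, b), ?t) : U" using V(6) qV(1) by (metis image_subset_iff)
   have dY: "((%ta. Y' (sig, ta)) has_derivative (%h. Df Y' (sig, b) (0, h))) (at b)"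
    by (rule has_derivative_compose[OF has_derivative_Pair[OF has_derivative_const has_derivative_ident]])
     (rule Ck_on_DD[OF UY(3)[rule_format] kq(2)])
   have Yb: "Y' (sig, b) = gY G (sig, b)" using UY(4) kq(2) b(2) b0(2) by blast
   have dg: "(g has_derivative Df g (z q)) (at (?r, Y' (sig, b), ?t))"
    unfolding Yb zq by (rule Ck_on_DD[OF V(5)[rule_format] zU])
   \<comment> \<open>The curve through q on which only the distance coordinate varies; along it
     \<beta> is \<open>kap ta\<close>.\<close>
   define c where "c ta = g (?r, Y' (sig, ta), ?t)" for ta
   have dc: "(c has_derivative (%h. Df g (z q) (0, Df Y' (sig, b) (0, h), 0))) (at b)"
    unfolding c_def
    by (rule has_derivative_compose[OF has_derivative_Pair[OF has_derivative_const has_derivative_Pair[OF dY has_derivative_const]] dg])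
   define J where "J = {0<..<mu0} Int ((%ta. (sig, ta)) -` UY Int (%ta. (?r, Y' (sig, ta), ?t)) -` U)"
   have oJ0: "open ((%ta. (sig, ta)) -` UY)" by (intro open_vimage UY(1) continuous_intros)
   have cY: "continuous_on ((%ta. (sig, ta)) -` UY) (%ta. (?r, Y' (sig, ta), ?t))"
    by (intro continuous_on_Pair continuous_on_const continuous_on_compose2[OF Ck_on_cont[OF UY(3)[rule_format]]]
      continuous_on_id) auto
   have oJ: "open J" unfolding J_def
    by (intro open_Int[OF open_greaterThanLessThan] continuous_open_preimage[OF cY oJ0 V(4)])
   have bJ: "b : J" using b0(1) b(4) mu0 kq(2) zU Yb by (auto simp: J_def)
   have cX: "c ta = gX G (?r, gY G (sig, ta), ?t)" "(c ta, ?t) : reg" "beta (c ta, ?t) = kap ta" if "ta : J" for ta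
   proof -
    have ta: "0 < ta" "ta < mu0" "(sig, ta) : UY" "(?r, Y' (sig, ta), ?t) : U" "ta : {0..2 * mu1}"
     using that mu0 by (auto simp: J_def)
    have Y': "Y' (sig, ta) = gY G (sig, ta)" using UY(4) ta(3,5) b(2) by blast
    have YS: "gY G (sig, ta) : S" using Y_range b(2) ta(5) by blast
    have Yn: "gY G (sig, ta) ~: bd"
     using btil_bd[of "gY G (sig, ta)"] btil_Y[OF b(2) ta(5)] kap_facts(2)[of ta] ta(1) by auto
    have cd: "(?r, gY G (sig, ta), ?t) : coord_dom G"
     using YS reg_facts(1,4)[OF q(3)] dpos by (auto simp: cdom_iff)
    show c1: "c ta = gX G (?r, gY G (sig, ta), ?t)" using V(8) ta(4) cd by (simp add: c_def Y')
    show "(c ta, ?t) : reg" unfolding c1 by (rule regI) (use reg_facts(1,4)[OF q(3)] YS Yn in auto)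
    show "beta (c ta, ?t) = kap ta" unfolding c1 beta_def coords(2)[OF cd] by (rule btil_Y[OF b(2) ta(5)])
   qed
   have cb: "c b = fst q" using cX(1)[OF bJ] reg_facts(6)[OF q(3)] b(1) by (metis fst_conv)
   have "((%ta. beta (c ta, ?t)) has_derivative (%h. Dx beta q (Df g (z q) (0, Df Y' (sig, b) (0, h), 0)))) (at b)"
    by (rule has_derivative_compose[OF dc]) (use nice_hd[OF nice_beta1, of "fst q" ?t] q(3) cb in simp)
   hence "(kap has_derivative (%h. Dx beta q (Df g (z q) (0, Df Y' (sig, b) (0, h), 0)))) (at b)"
    by (rule has_derivative_transform_within_open[OF _ oJ bJ]) (rule cX(3))
   moreover have "(kap has_derivative (%h. 3 * (1 - b / mu0)^2 / mu0 * h)) (at b)"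
    by (rule kap_deriv[OF b(3), unfolded has_field_derivative_def]) (use b(4) mu0(1) in simp)
   ultimately have "(%h. Dx beta q (Df g (z q) (0, Df Y' (sig, b) (0, h), 0)))
    = (%h. 3 * (1 - b / mu0)^2 / mu0 * h)" by (rule has_derivative_unique)
   from fun_cong[OF this, of 1]
   have 1: "Dx beta q (Df g (z q) (0, w q, 0)) = 3 * (1 - b / mu0)^2 / mu0"
    by (simp add: w_def kq(1))
   have lin: "linear (Df g (z q))" using dg by (rule has_derivative_linear)
   have "(0, w q, 0) = (SUM b:Basis. (w q \<bullet> b) *\<^sub>R (0::real, b, 0::real))"
    by (simp add: sum_prod[symmetric] euclidean_representation fst_sum snd_sum prod_eq_iff)
   hence "Df g (z q) (0, w q, 0) = ze q"
    by (simp only: ze_def linear_sum[OF lin] linear_scale[OF lin])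
   with 1 have 2: "gradx beta q \<bullet> ze q = 3 * (1 - b / mu0)^2 / mu0" by (simp add: gradx_inner[OF nice_beta1 q(3)])
   have "(1 / 2)^2 <= (1 - b / mu0)^2" using b mu0(1) by (intro power_mono) (auto simp: field_simps)
   hence "3 / (4 * mu0) <= 3 * (1 - b / mu0)^2 / mu0" using mu0(1) by (simp add: field_simps power2_eq_square)
   also have "... <= norm (gradx beta q) * norm (ze q)" unfolding 2[symmetric] by (rule norm_cauchy_schwarz)
   also have "... <= norm (gradx beta q) * C" by (intro mult_left_mono C q) simp
   finally show ?thesis using mu0(1) by (simp add: field_simps)
  qed
  thus ?thesis using V2 pV2 W(1,2) by (intro exI[of _ "V2 Int W"] exI[of _ "4 * mu0 / 3 * C"]) auto
 qed
qed

lemma beta_gradient: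
 "EX c>0. ALL q:reg. sco q : gY G ` (bd \<times> {0..mu0 / 2}) --> c <= norm (gradx beta q)"
proof -
 have "EX C>0. ALL q:reg. sco q : gY G ` (bd \<times> {0..mu0 / 2}) --> 1 <= C * norm (gradx beta q)"
 proof (rule compact_principle[OF beta_gradient_local])
  fix q :: "'a \<times> real" and c d :: real
  assume *: "sco q : gY G ` (bd \<times> {0..mu0 / 2}) --> 1 <= c * norm (gradx beta q)" and "c <= d"
  have "c * norm (gradx beta q) <= d * norm (gradx beta q)" by (rule mult_right_mono) (use \<open>c <= d\<close> in auto)
  with * show "sco q : gY G ` (bd \<times> {0..mu0 / 2}) --> 1 <= d * norm (gradx beta q)"
   using order_trans by blast
 qed
 then obtain C where C: "C > 0" "ALL q:reg. sco q : gY G ` (bd \<times> {0..mu0 / 2}) --> 1 <= C * norm (gradx beta q)"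
  by (elim exE conjE)
 have "1 / C <= norm (gradx beta q)" if "q : reg" "sco q : gY G ` (bd \<times> {0..mu0 / 2})" for q
  using C that by (simp add: divide_le_eq mult.commute)
 with C(1) show ?thesis by (intro exI[of _ "1 / C"]) simp
qed

text \<open>Compactness inside the open slice comes from \<open>btil\<close>, continuous on S and
  zero on its boundary; these sets carry the cut-off fields of \<open>flux_identity\<close>.\<close>

lemma compact_slab:
 assumes t: "t : {0..T}" and rh: "rh < dl" and c: "c > 0"
 defines "K \<equiv> (%P. gX G (fst P, snd P, t)) ` ({-rh..rh} \<times> {s : S. btil s >= c})"
 shows "compact K" "K \<subseteq> slice t" "!!x. x : slice t ==> abs (rco (x, t)) <= rh ==> beta (x, t) >= c ==> x : K"
proof -
 have "{s : S. btil s >= c} = S Int btil -` {c..}" by auto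
 moreover have "closed (S Int btil -` {c..})"
  by (rule continuous_closed_preimage[OF continuous_btil compact_imp_closed[OF S_facts(2)] closed_atLeast])
 ultimately have "compact {s : S. btil s >= c}" using compact_Int_closed[OF S_facts(2)] by (metis Int_assoc Int_absorb)
 moreover have "continuous_on ({-rh..rh} \<times> {s : S. btil s >= c}) (%P. gX G (fst P, snd P, t))"
 proof -
  obtain Xi where "homeomorphism (coord_dom G) (Xbar G ` coord_dom G) (Xbar G) Xi" using Xbar_homeo ..
  hence "continuous_on (coord_dom G) (%P. fst (Xbar G P))" by (intro continuous_on_fst homeomorphism_cont1)
  hence "continuous_on (coord_dom G) (gX G)" by (simp add: Xbar_def)
  thus ?thesis
   by (rule continuous_on_compose2[where s="{-rh..rh} \<times> {s : S. btil s >= c}"])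
    (use t rh dpos in \<open>auto simp: cdom_iff intro!: continuous_intros\<close>)
 qed
 ultimately show "compact K" unfolding K_def by (intro compact_continuous_image compact_Times compact_Icc)
 show "K \<subseteq> slice t"
 proof
  fix x assume "x : K"
  then obtain r s where x: "x = gX G (r, s, t)" "-rh <= r" "r <= rh" "s : S" "btil s >= c" by (auto simp: K_def)
  hence "s ~: bd" using btil_bd c by force
  thus "x : slice t" unfolding slice_def mem_Collect_eq x(1) by (intro regI) (use x rh t in auto)
 qed
 fix x assume x: "x : slice t" "abs (rco (x, t)) <= rh" "beta (x, t) >= c"
 hence r: "(x, t) : reg" by (simp add: slice_def)
 show "x : K" unfolding K_def
  by (rule image_eqI[of _ _ "(rco (x, t), sco (x, t))"])
   (use x reg_facts(2,6)[OF r] in \<open>auto simp: beta_def\<close>)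
qed

end

section \<open>The bulk regions\<close>

text \<open>Near a frontier point p the frontier lies in the zero set of g. Seen from p -
  \<nabla>g(p), every ray meets that set at most once near p, since g increases in directions close
  to \<nabla>g(p); a closed set with this property is negligible.\<close>

lemma negligible_frontier:
 fixes D :: "'a::euclidean_space set"
 assumes ch: "ALL p:frontier D. EX U g. domain_chart D p U g"
 shows "negligible (frontier D)"
 unfolding locally_negligible_alt[of "frontier D"]
proof
 fix p assume "p : frontier D"
 then obtain U g where c: "domain_chart D p U g" using ch by blast
 hence U: "open U" "p : U" "smooth_on U g" "grad g p ~= 0" "D Int U = {x : U. g x < 0}"
  unfolding domain_chart_def by blast+
 have ck: "Ck_on k U g" for k by (rule smooth_Ck[OF U(1,3)])
 have dg: "(g has_derivative Df g y) (at y)" if "y : U" for y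
  by (rule Ck_on_DD[OF ck[of "Suc 0"] that])
 have ex: "Df g y x = (SUM b:Basis. (x \<bullet> b) * Df g y b)" if "y : U" for y x
  by (subst (1) euclidean_representation[symmetric, of x])
   (simp only: linear_sum[OF has_derivative_linear[OF dg[OF that]]] linear_scale[OF has_derivative_linear[OF dg[OF that]]] real_scaleR_def)
 define e0 where "e0 = grad g p"
 have "Df g p b = e0 \<bullet> b" if "b : Basis" for b
  using that by (simp add: e0_def grad_within_def)
 hence "Df g p e0 = e0 \<bullet> e0"
  unfolding ex[OF U(2), of e0] euclidean_inner[of e0 e0] by (intro sum.cong refl) simp
 hence pos: "Df g p e0 > 0" using U(4) by (simp add: e0_def)
 have o: "open (U \<times> (UNIV :: 'a set))" using U(1) by (simp add: open_Times)
 define N where "N = (U \<times> UNIV) Int (%P. SUM b:Basis. (snd P \<bullet> b) * Df g (fst P) b) -` {0<..}"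
 have cb: "continuous_on U (%y. Df g y b)" for b
  using Ck_on_SucD[OF ck[of "Suc 0"], of b] by simp
 have "open N" unfolding N_def
  by (intro continuous_open_preimage o open_greaterThan continuous_intros continuous_on_compose2[OF cb]) auto
 moreover have "(p, e0) : N" using pos U(2) unfolding ex[OF U(2), of e0] by (simp add: N_def)
 ultimately obtain A B where AB: "open A" "open B" "(p, e0) : A \<times> B" "A \<times> B \<subseteq> N" by (rule open_prod_elim)
 have "open (A Int (%y. y - p + e0) -` B)" by (intro open_Int AB open_vimage continuous_intros)
 moreover have "p : A Int (%y. y - p + e0) -` B" using AB(3) by simp
 \<comment> \<open>For y in this ball, the vector from p - e0 to y lies in B, close to e0.\<close>
 ultimately obtain r where r: "r > 0" "cball p r \<subseteq> A Int (%y. y - p + e0) -` B"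
  using open_contains_cball by blast
 have rU: "cball p r \<subseteq> U" using r(2) AB(3,4) by (force simp: N_def)
 define Z where "Z = cball p r Int g -` {0}"
 have cl: "closed Z" unfolding Z_def
  by (intro continuous_closed_preimage continuous_on_subset[OF Ck_on_cont[OF ck] rU]) auto
 have "negligible Z"
 proof (rule starlike_negligible[OF cl, of "p - e0"])
  fix c x assume cx: "(p - e0) + c *\<^sub>R x : Z" "(p - e0) + x : Z"
  define ph where "ph ta = g ((p - e0) + ta *\<^sub>R x)" for ta
  have xB: "x : B" using cx(2) r(2) by (force simp: Z_def)
  have d: "EX y. (ph has_real_derivative y) (at ta) & y > 0" if ta: "ta : closed_segment 1 c" for ta
  proof -
   obtain u where u: "0 <= u" "u <= 1" "ta = (1 - u) * 1 + u * c" using ta by (auto simp: closed_segment_def)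
   have "(p - e0) + ta *\<^sub>R x = (1 - u) *\<^sub>R ((p - e0) + x) + u *\<^sub>R ((p - e0) + c *\<^sub>R x)"
    by (simp add: u(3) algebra_simps)
   hence y: "(p - e0) + ta *\<^sub>R x : cball p r"
    using convexD_alt[OF convex_cball, of "p - e0 + x" p r "p - e0 + c *\<^sub>R x" u] cx u by (auto simp: Z_def)
   have "((%ta. (p - e0) + ta *\<^sub>R x) has_derivative (%h. h *\<^sub>R x)) (at ta)" by (auto intro!: derivative_eq_intros)
   from has_derivative_compose[OF this dg[OF subsetD[OF rU y]]]
   have "(ph has_derivative (%h. Df g ((p - e0) + ta *\<^sub>R x) (h *\<^sub>R x))) (at ta)"
    unfolding ph_def[abs_def] .
   hence "(ph has_real_derivative Df g ((p - e0) + ta *\<^sub>R x) x) (at ta)"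
    unfolding has_field_derivative_def
    using linear_scale[OF has_derivative_linear[OF dg[OF subsetD[OF rU y]]]] by (simp add: mult_commute_abs)
   moreover have "((p - e0) + ta *\<^sub>R x, x) : N" using AB(4) y r(2) xB by blast
   hence "Df g ((p - e0) + ta *\<^sub>R x) x > 0" using ex[OF subsetD[OF rU y], of x] by (simp add: N_def)
   ultimately show ?thesis by blast
  qed
  have eq: "ph 1 = ph c" using cx by (simp add: ph_def Z_def)
  show "c = 1"
  proof (rule ccontr)
   assume "c ~= 1"
   then consider "1 < c" | "c < 1" by linarith
   thus False
   proof cases
    case 1
    thus ?thesis using DERIV_pos_imp_increasing[OF 1, of ph] d eq by (simp add: closed_segment_eq_real_ivl)
   next
    case 2
    thus ?thesis using DERIV_pos_imp_increasing[OF 2, of ph] d eq by (simp add: closed_segment_eq_real_ivl)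
   qed
  qed
 qed
 moreover have "frontier D Int ball p r \<subseteq> Z"
 proof
  fix y assume y: "y : frontier D Int ball p r"
  hence yU: "y : U" using rU by auto
  have cg: "continuous_on U g" by (rule Ck_on_cont[OF ck])
  have "\<not> g y > 0"
  proof
   assume "g y > 0"
   have "open (U Int g -` {0<..})" by (intro continuous_open_preimage cg U(1) open_greaterThan)
   moreover have "(U Int g -` {0<..}) Int D = {}" using U(5) by force
   ultimately have "(U Int g -` {0<..}) Int closure D = {}" by (simp add: open_Int_closure_eq_empty)
   thus False using y yU \<open>g y > 0\<close> by (auto simp: frontier_def)
  qed
  moreover have "\<not> g y < 0"
  proof
   assume "g y < 0"
   have "open (U Int g -` {..<0})" by (intro continuous_open_preimage cg U(1) open_lessThan)
   moreover have "U Int g -` {..<0} \<subseteq> D" using U(5) by force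
   ultimately have "y : interior D" using yU \<open>g y < 0\<close> by (intro interiorI) auto
   thus False using y by (simp add: frontier_def)
  qed
  ultimately show "y : Z" using y by (auto simp: Z_def)
 qed
 ultimately show "EX U. openin (top_of_set (frontier D)) U & p : U & negligible U"
  using \<open>p : frontier D\<close> r(1) by (intro exI[of _ "frontier D Int ball p r"]) (auto intro: negligible_subset openin_open_Int)
qed

text \<open>Removing a component of the complement of \<open>P'\<close> from a connected set leaves a connected set;
 with uniqueness this identifies the two parts, and maximality of components separates them.\<close>

lemma uniq_part_closure:
 fixes E :: "'b::metric_space set"
 assumes E: "connected E" "E = A \<union> B" "A Int B = {}" and con: "connected A" "connected P" "connected P'"
  and sub: "P \<subseteq> A" "P' \<subseteq> B" "P ~= {}" and op: "openin (top_of_set E) P'"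
  and uniq: "!!A' B'. connected A' ==> connected B' ==> E = A' \<union> B' ==> A' Int B' = {} ==> P \<subseteq> A' ==> P' \<subseteq> B' ==> A' = A"
 shows "B Int closure A = {}"
proof -
 obtain p where p: "p : P" using sub(3) by blast
 have PE: "P \<subseteq> E - P'" "P' \<subseteq> E" using sub E by auto
 define C where "C = connected_component_set (E - P') p"
 have "C : components (E - P')" unfolding C_def by (rule componentsI) (use p PE in blast)
 hence co: "connected (E - C)" by (rule component_diff_connected[OF con(3) E(1) PE(2)])
 have CE: "C \<subseteq> E - P'" unfolding C_def by (rule connected_component_subset)
 have "P \<subseteq> C" unfolding C_def by (rule connected_component_maximal[OF p con(2) PE(1)])
 hence AC: "C = A" using CE PE(2) by (intro uniq[of C "E - C"] co) (auto simp: C_def)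
 show ?thesis
 proof (rule ccontr)
  assume "B Int closure A ~= {}"
  then obtain x where x: "x : B" "x : closure A" by blast
  obtain W where W: "open W" "P' = E Int W" using op by (auto simp: openin_open)
  have "x ~: P'"
  proof
   assume "x : P'"
   hence "W Int A ~= {}" using open_Int_closure_eq_empty[OF W(1), of A] x(2) W(2) by blast
   thus False using W(2) E sub(2) by blast
  qed
  moreover have "connected (insert x A)"
   by (rule connected_intermediate_closure[OF con(1)]) (use x closure_subset in auto)
  ultimately have "insert x A \<subseteq> C" unfolding C_def
   by (intro connected_component_maximal) (use p sub(1) x(1) E CE AC in auto)
  thus False using AC x(1) E(3) by blast
 qed
qed

text \<open>If E were connected, the previous lemma applied both ways would make A and B disjoint
  from each other's closure, which splits E. So E is disconnected, and each of the connected sets A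
  and B fills one side of a splitting.\<close>

lemma uniq_part_openin:
 fixes E :: "'b::metric_space set"
 assumes E: "E = A \<union> B" "A Int B = {}" and con: "connected A" "connected B" "connected P" "connected P'"
  and sub: "P \<subseteq> A" "P' \<subseteq> B" "P ~= {}" "P' ~= {}"
  and op: "openin (top_of_set E) P" "openin (top_of_set E) P'"
  and uniq: "!!A' B'. connected A' ==> connected B' ==> E = A' \<union> B' ==> A' Int B' = {} ==> P \<subseteq> A' ==> P' \<subseteq> B' ==> A' = A"
 shows "openin (top_of_set E) A" "openin (top_of_set E) B"
proof -
 have "\<not> connected E"
 proof
  assume c: "connected E"
  have 1: "B Int closure A = {}" by (rule uniq_part_closure[OF c E con(1,3,4) sub(1-3) op(2) uniq])
  have 2: "A Int closure B = {}"
  proof (rule uniq_part_closure[OF c _ _ con(2,4,3) sub(2,1,4) op(1)])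
   fix A' B' assume *: "connected A'" "connected B'" "E = A' \<union> B'" "A' Int B' = {}" "P' \<subseteq> A'" "P \<subseteq> B'"
   have "B' = A" by (rule uniq) (use * in auto)
   thus "A' = B" using * E by blast
  qed (use E in auto)
  have "- closure B Int E = {} \<or> - closure A Int E = {}"
   by (rule connectedD[OF c]) (use 1 2 E closure_subset[of A] closure_subset[of B] in auto)
  thus False using 1 2 E sub by blast
 qed
 then obtain U V where U: "open U" "open V" "E \<subseteq> U \<union> V" "U Int V Int E = {}" "U Int E ~= {}" "V Int E ~= {}"
  unfolding connected_def by auto
 have "U Int A = {} \<or> V Int A = {}" "U Int B = {} \<or> V Int B = {}"
  by (rule connectedD[OF con(1) U(1,2)]; use U E in blast) (rule connectedD[OF con(2) U(1,2)]; use U E in blast)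
 hence "(A = E Int U & B = E Int V) \<or> (A = E Int V & B = E Int U)" using U E by blast
 thus "openin (top_of_set E) A" "openin (top_of_set E) B" using U(1,2) by (auto simp: openin_open)
qed

context contact_geometry
begin

text \<open>J is the closed complementary half of the coordinate range, so its image K is compact
  and the half tube is an open trace of the tube minus K. As 0 belongs to J, the interface lies in
  K.\<close>

lemma half_tube:
 assumes I: "I = {0<..<dl} & J = {-2 * dl..0} \<or> I = {-dl<..<0} & J = {0..2 * dl}"
 defines "P \<equiv> Xbar G ` (I \<times> S \<times> {0..T})" and "E \<equiv> closure Omg \<times> {0..T} - interface G"
 shows "connected P" "P ~= {}" "openin (top_of_set E) P" "P = {q : tube G dl. rco q : I}"
proof -
 obtain Xi where Xi: "homeomorphism (coord_dom G) (Xbar G ` coord_dom G) (Xbar G) Xi" using Xbar_homeo ..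
 have cX: "continuous_on A (Xbar G)" if "A \<subseteq> coord_dom G" for A
  by (rule continuous_on_subset[OF homeomorphism_cont1[OF Xi] that])
 have Ic: "I \<times> S \<times> {0..T} \<subseteq> coord_dom G" "J \<times> S \<times> {0..T} \<subseteq> coord_dom G" using I dpos by (auto simp: coord_dom_def)
 have "connected (I \<times> S \<times> {0..T})" using I by (intro connected_Times S_facts(3) connected_Icc) auto
 thus "connected P" unfolding P_def by (rule connected_continuous_image[OF cX[OF Ic(1)]])
 show "P ~= {}" using I S_facts(4) T_pos dpos unfolding P_def by (auto simp: less_imp_le)
 have rc: "rco (Xbar G (r, s, t)) = r" if "(r, s, t) : coord_dom G" for r s t
  using coords(1)[OF that] by (simp add: Xbar_eq)
 show eq: "P = {q : tube G dl. rco q : I}"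
 proof (intro equalityI subsetI)
  fix q assume "q : P"
  then obtain r s t where q: "q = Xbar G (r, s, t)" "r : I" "s : S" "t : {0..T}" by (auto simp: P_def)
  have "-dl < r" "r < dl" using q(2) I dpos by auto
  hence "q : tube G dl" unfolding tube_def q(1) using q(3,4) by (intro imageI) simp
  moreover have "rco q = r" unfolding q(1) by (rule rc) (use q Ic(1) in blast)
  ultimately show "q : {q : tube G dl. rco q : I}" using q(2) by simp
 next
  fix q assume q: "q : {q : tube G dl. rco q : I}"
  then obtain r s t where "q = Xbar G (r, s, t)" "-dl < r" "r < dl" "s : S" "t : {0..T}" by (auto simp: tube_def)
  thus "q : P" using rc[of r s t] q dpos by (auto simp: P_def cdom_iff)
 qed
 define K where "K = Xbar G ` (J \<times> S \<times> {0..T})"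
 have "compact (J \<times> S \<times> {0..T})" using I by (intro compact_Times S_facts(2) compact_Icc) auto
 hence "compact K" unfolding K_def by (rule compact_continuous_image[OF cX[OF Ic(2)]])
 have KI: "K Int P = {}" "interface G Int P = {}"
 proof -
  have inj: "inj_on (Xbar G) (coord_dom G)"
   by (intro inj_on_inverseI[of _ Xi]) (rule homeomorphism_apply1[OF Xi])
  have "(J \<times> S \<times> {0..T}) Int (I \<times> S \<times> {0..T}) = {}" using I by auto
  thus "K Int P = {}" unfolding K_def P_def using inj_on_image_Int[OF inj Ic(2,1)] by auto
  have "interface G \<subseteq> K"
  proof
   fix q assume "q : interface G"
   then obtain s t where q: "q = (gX0 G (s, t), t)" "s : S" "t : {0..T}" by (auto simp: interface_def)
   hence "q = Xbar G (0, s, t)" using X_X0[OF q(2,3)] by (simp add: Xbar_eq)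
   thus "q : K" unfolding K_def using q(2,3) I dpos by (intro image_eqI[of _ _ "(0, s, t)"]) auto
  qed
  thus "interface G Int P = {}" using \<open>K Int P = {}\<close> by blast
 qed
 obtain W where W: "open W" "tube G dl = (closure Omg \<times> {0..T}) Int W"
  using tube_open[of dl] dpos by (auto simp: openin_open)
 have "P = E Int (W - K)"
 proof (intro equalityI subsetI)
  fix q assume "q : P"
  thus "q : E Int (W - K)" using KI eq W(2) by (auto simp: E_def)
 next
  fix q assume q: "q : E Int (W - K)"
  hence "q : tube G dl" using W(2) by (auto simp: E_def)
  then obtain r s t where rst: "q = Xbar G (r, s, t)" "-dl < r" "r < dl" "s : S" "t : {0..T}" by (auto simp: tube_def)
  hence "r ~: J" using q by (auto simp: K_def)
  hence "r : I" using I rst(2,3) dpos by auto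
  thus "q : P" using rst by (auto simp: P_def)
 qed
 moreover have "open (W - K)" using W(1) \<open>compact K\<close> by (intro open_Diff compact_imp_closed)
 ultimately show "openin (top_of_set E) P" by (auto simp: openin_open)
qed

text \<open>Outside the tube the approximate solution is prescribed separately on the two bulk
  regions, so these have to be measurable. The sign conditions on r amount to containing the half
  tubes, which brings the uniqueness in \<open>bulk_regions\<close> into the form of
  \<open>uniq_part_openin\<close>.\<close>

lemma bulk_slices_open:
 "EX Op Om. open Op & open Om & (let E = closure Omg \<times> {0..T} - interface G in gQp G = E Int Op & gQm G = E Int Om & E = gQp G \<union> gQm G)"
proof -
 define E where "E = closure Omg \<times> {0..T} - interface G"
 define Pp where "Pp = Xbar G ` ({0<..<dl} \<times> S \<times> {0..T})"
 define Pm where "Pm = Xbar G ` ({-dl<..<0} \<times> S \<times> {0..T})"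
 note hp = half_tube[of "{0<..<dl}" "{-2 * dl..0}", folded E_def Pp_def, simplified]
 note hm = half_tube[of "{-dl<..<0}" "{0..2 * dl}", folded E_def Pm_def, simplified]
 have M: "closure (Omg \<times> {0<..<T}) = closure Omg \<times> {0..T}" using T_pos by (simp add: closure_Times)
 have iM: "interface G \<subseteq> closure Omg \<times> {0..T}"
  using interface_tube[of dl] openin_imp_subset[OF tube_open[of dl]] dpos by auto
 have bp: "bulk_partition G A B \<longleftrightarrow> connected A & connected B & E = A \<union> B & A Int B = {} & Pm \<subseteq> A & Pp \<subseteq> B" for A B
 proof -
  have r0: "rco q ~= 0" if q': "q : tube G dl" "q ~: interface G" for q
  proof
   assume 0: "rco q = 0"
   obtain r s t where q: "q = (gX G (r, s, t), t)" "-dl < r" "r < dl" "s : S" "t : {0..T}"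
    using q'(1) by (auto simp: tube_def Xbar_eq)
   hence "r = 0" using 0 coords(1)[of r s t] dpos by (auto simp: cdom_iff)
   hence "q = (gX0 G (s, t), t)" using X_X0[OF q(4,5)] q(1) by simp
   thus False using q'(2) q(4,5) unfolding interface_def by blast
  qed
  have rI: "rco q : {-dl<..<dl}" if "q : tube G dl" for q
   using that dpos coords(1) by (auto simp: tube_def Xbar_eq cdom_iff)
  have PE: "Pp \<subseteq> E" "Pm \<subseteq> E" using hp(3) hm(3) openin_imp_subset by blast+
  have sg: "Pm \<subseteq> A & Pp \<subseteq> B \<longleftrightarrow> (ALL p:A Int tube G dl. sgn (rco p) = -1) & (ALL p:B Int tube G dl. sgn (rco p) = 1)"
   if AB: "E = A \<union> B" "A Int B = {}"
  proof
   assume P: "Pm \<subseteq> A & Pp \<subseteq> B"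
   have "rco p < 0" if "p : A" "p : tube G dl" for p
    using that P AB r0[of p] rI[of p] hp(4) by (force simp: E_def)
   moreover have "rco p > 0" if "p : B" "p : tube G dl" for p
    using that P AB r0[of p] rI[of p] hm(4) by (force simp: E_def)
   ultimately show "(ALL p:A Int tube G dl. sgn (rco p) = -1) & (ALL p:B Int tube G dl. sgn (rco p) = 1)" by simp
  next
   assume P: "(ALL p:A Int tube G dl. sgn (rco p) = -1) & (ALL p:B Int tube G dl. sgn (rco p) = 1)"
   have "p : A" if "p : Pm" for p
    using that P PE AB hm(4) by (force dest!: bspec[of _ _ p])
   moreover have "p : B" if "p : Pp" for p
    using that P PE AB hp(4) by (force dest!: bspec[of _ _ p])
   ultimately show "Pm \<subseteq> A & Pp \<subseteq> B" by blast
  qed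
  have "closure Omg \<times> {0..T} = A \<union> B \<union> interface G & A Int B = {} & A Int interface G = {} & B Int interface G = {}
    \<longleftrightarrow> E = A \<union> B & A Int B = {}"
   using iM unfolding E_def by blast
  thus ?thesis unfolding bulk_partition_def M using sg by blast
 qed
 have b1: "connected (gQm G) & connected (gQp G) & E = gQm G \<union> gQp G & gQm G Int gQp G = {} & Pm \<subseteq> gQm G & Pp \<subseteq> gQp G"
  unfolding bp[symmetric] using geo(4) unfolding bulk_regions_def by (rule conjunct1)
 have b2: "ALL A B. bulk_partition G A B --> A = gQm G & B = gQp G"
  using geo(4) unfolding bulk_regions_def by (rule conjunct2)
 have u: "A = gQm G" if "connected A" "connected B" "E = A \<union> B" "A Int B = {}" "Pm \<subseteq> A" "Pp \<subseteq> B" for A B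
 proof -
  have "bulk_partition G A B" unfolding bp by (intro conjI that)
  with b2 show ?thesis by (elim allE impE conjE)
 qed
 have "openin (top_of_set E) (gQm G) & openin (top_of_set E) (gQp G)"
 proof (intro conjI)
  note c = b1[THEN conjunct1] b1[THEN conjunct2, THEN conjunct1] and r = b1[THEN conjunct2, THEN conjunct2]
  note op = uniq_part_openin[OF r[THEN conjunct1] r[THEN conjunct2, THEN conjunct1] c hm(1) hp(1)
    r[THEN conjunct2, THEN conjunct2, THEN conjunct1] r[THEN conjunct2, THEN conjunct2, THEN conjunct2] hm(2) hp(2) hm(3) hp(3) u]
  show "openin (top_of_set E) (gQm G)" by (rule op(1))
  show "openin (top_of_set E) (gQp G)" by (rule op(2))
 qed
 hence o: "EX U. open U & gQm G = E Int U" "EX V. open V & gQp G = E Int V" unfolding openin_open by simp_all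
 obtain U where U: "open U & gQm G = E Int U" using o(1) ..
 obtain V where V: "open V & gQp G = E Int V" using o(2) ..
 have e: "E = gQp G \<union> gQm G" using b1 by (metis Un_commute)
 show ?thesis unfolding Let_def E_def[symmetric]
  by (rule exI[of _ V], rule exI[of _ U], intro conjI) (rule conjunct1[OF V] conjunct1[OF U] conjunct2[OF V] conjunct2[OF U] e)+
qed

lemma tube_slice_AE:
 assumes t: "t : {0..T}"
 shows "AE x in lebesgue. x : time_slice (tube G dl) t \<longleftrightarrow> x : slice t"
proof (rule AE_I')
 show "frontier Omg : null_sets lebesgue"
  using negligible_frontier[OF domain(3)] by (simp add: negligible_iff_null_sets)
 show "{x : space lebesgue. \<not> (x : time_slice (tube G dl) t \<longleftrightarrow> x : slice t)} \<subseteq> frontier Omg"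
  using openin_imp_subset[OF tube_open[of dl]] dpos domain(1)
  by (auto simp: time_slice_def slice_def reg_def frontier_def interior_open)
qed

end

section \<open>Vector fields\<close>

context contact_geometry
begin

lemma nice_deriv: "nice (Suc k) a ==> q : reg ==> ((%y. a (y, snd q)) has_derivative Dx a q) (at (fst q))"
 using nice_hd[of k a "fst q" "snd q"] by simp

lemma Dx_eqI: "((%y. a (y, snd q)) has_derivative D) (at (fst q)) ==> Dx a q = D"
 unfolding Dx_def by (rule frechet_derivative_at[symmetric])

lemma Dx_scaleR:
 assumes "nice (Suc k) a" "nice (Suc j) w" "q : reg"
 shows "Dx (%q. a q *\<^sub>R w q) q = (%h. a q *\<^sub>R Dx w q h + Dx a q h *\<^sub>R w q)"
 by (rule Dx_eqI) (use has_derivative_scaleR[OF nice_deriv[OF assms(1,3)] nice_deriv[OF assms(2,3)]] in simp)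

lemma divx_scaleR:
 assumes a: "nice (Suc k) a" and w: "nice (Suc j) w" and q: "q : reg"
 shows "divx (%q. a q *\<^sub>R w q) q = Dx a q (w q) + a q * divx w q"
 unfolding divx_def Dx_scaleR[OF assms] Dx_expand[OF a q, of "w q"]
 by (simp add: inner_add_left sum.distrib sum_distrib_left mult.commute add.commute)

lemma divx_diff:
 assumes "nice (Suc k) a" "nice (Suc j) w" "q : reg"
 shows "divx (%q. a q - w q) q = divx a q - divx w q"
proof -
 have "Dx (%q. a q - w q) q = (%h. Dx a q h - Dx w q h)"
  by (rule Dx_eqI) (rule has_derivative_diff[OF nice_deriv[OF assms(1,3)] nice_deriv[OF assms(2,3)]])
 thus ?thesis by (simp add: divx_def inner_diff_left sum_subtractf)
qed

text \<open>A cut-off in \<beta> gives the field compact support in the open slice. Its derivative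
  is of order 1/\<beta>, and the factor \<beta> in the bound on the product of \<nabla>\<beta> and U
  keeps the extra term bounded; pointwise that term is eventually 0, so dominated convergence
  removes it.\<close>

lemma flux_identity:
 assumes ps: "ps : H1 Omg" and t: "t : {0..T}" and U: "nice (Suc 0) U"
  and rh: "rh < dl" "!!q. q : reg ==> abs (rco q) > rh ==> U q = 0"
  and B: "!!q. q : reg ==> abs (gradx beta q \<bullet> U q) <= B * beta q"
 defines "I \<equiv> %x. indicator (slice t) x *\<^sub>R ((ps x)^2 * divx U (x, t) + 2 * ps x * (weak_grad Omg ps x \<bullet> U (x, t)))"
 shows "integrable lebesgue I" "integral\<^sup>L lebesgue I = 0"
proof -
 let ?g = "weak_grad Omg ps"
 note wg = H1_weak_grad[OF domain(1) ps]
 have sl: "slice t \<subseteq> Omg" by (auto simp: slice_def reg_def)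
 define u0 where "u0 x = indicator Omg x *\<^sub>R ps x" for x
 define g0 where "g0 x = indicator Omg x *\<^sub>R ?g x" for x
 have m0: "u0 : borel_measurable lebesgue" "g0 : borel_measurable lebesgue"
  using wg unfolding L2_on_def set_borel_measurable_def u0_def g0_def by auto
 have sq: "integrable lebesgue (%x. (u0 x)^2)" "integrable lebesgue (%x. (norm (g0 x))^2)"
 proof -
  have "(%x. (u0 x)^2) = (%x. indicator Omg x *\<^sub>R (norm (ps x))^2)" by (auto simp: u0_def indicator_def)
  thus "integrable lebesgue (%x. (u0 x)^2)" using wg(1) by (simp add: L2_on_def set_integrable_def)
  have "(%x. (norm (g0 x))^2) = (%x. indicator Omg x *\<^sub>R (norm (?g x))^2)" by (auto simp: g0_def indicator_def)
  thus "integrable lebesgue (%x. (norm (g0 x))^2)" using wg(3) by (simp add: L2_on_def set_integrable_def)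
 qed
 obtain BU where BU: "BU > 0" "ALL q:reg. norm (U q) <= BU" using nice_bounded[OF nice_mono[OF U]] by auto
 obtain BD where BD: "BD > 0" "ALL q:reg. norm (divx U q) <= BD" using nice_bounded[OF nice_divx[OF U]] by auto
 obtain BM where BM: "!!x. abs (moll 0 (x::real)) <= BM"
 proof -
  obtain b where b: "ALL x:{-2..2}. norm (moll 0 (x::real)) <= b"
   using compact_bound[OF compact_Icc continuous_on_subset[OF Ck_on_cont[OF Ck_on_moll] subset_UNIV]] by blast
  have "abs (moll 0 x) <= abs b" for x :: real
  proof (cases "abs x <= 2")
   case True
   hence "x : {-2..2}" by auto
   with b show ?thesis by force
  qed (simp add: moll_eq_0)
  thus ?thesis using that by blast
 qed
 \<comment> \<open>Rises from 0 to 1 while (k+1) b goes from 1 to 3.\<close>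
 define et where "et k b = step 0 (real (Suc k) * b - 2)" for k b
 define et' where "et' k b = real (Suc k) * moll 0 (real (Suc k) * b - 2)" for k b
 have det: "(et k has_real_derivative et' k b) (at b)" for k b
  unfolding et_def et'_def by (rule DERIV_cong[OF DERIV_chain2[OF step_DERIV]]) (auto intro!: derivative_eq_intros)
 have cket: "Ck_on 1 UNIV (et k)" for k unfolding et_def
  by (intro Ck_on_comp_real[OF Ck_on_step] Ck_on_diff Ck_on_mult Ck_on_const Ck_on_id open_UNIV)
 define P where "P k q = et k (beta q) *\<^sub>R U q" for k q
 have nP: "nice (Suc 0) (P k)" for k unfolding P_def
  by (intro nice_scaleR U nice_compose[OF nice_beta1] cket[unfolded One_nat_def])
 define F where "F k x = (if x : slice t then P k (x, t) else 0)" for k x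
 define K where "K k = (%P. gX G (fst P, snd P, t)) ` ({-rh..rh} \<times> {s : S. btil s >= inverse (real (Suc k))})" for k
 have ip: "inverse (real (Suc k)) > 0" for k by simp
 note K = compact_slab[OF t rh(1) ip, folded K_def]
 have F0: "F k x = 0" if "x ~: K k" for k x
 proof (cases "x : slice t")
  case True
  hence r: "(x, t) : reg" by (simp add: slice_def)
  have "abs (rco (x, t)) > rh \<or> beta (x, t) < inverse (real (Suc k))" using K(3)[OF True, of k] that by force
  hence "U (x, t) = 0 \<or> et k (beta (x, t)) = 0"
  proof
   assume "beta (x, t) < inverse (real (Suc k))"
   hence "real (Suc k) * beta (x, t) < 1" by (simp add: field_simps del: of_nat_Suc)
   thus ?thesis unfolding et_def by (intro disjI2 step_eq_0) simp
  qed (use rh(2)[OF r] in blast)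
  thus ?thesis by (auto simp: F_def P_def)
 qed (simp add: F_def)
 have ckF: "Ck_on 1 UNIV (F k)" for k
 proof (rule Ck_on_local)
  fix x
  show "EX V. open V & x : V & Ck_on 1 V (F k)"
  proof (cases "x : slice t")
   case True
   have "Ck_on 1 (slice t) (F k)"
    by (rule Ck_on_cong[OF open_slice, THEN iffD1, rotated]) (use nice_Ck_slice[OF nP] in \<open>auto simp: F_def\<close>)
   thus ?thesis using True open_slice by blast
  next
   case False
   have o: "open (- K k)" using compact_imp_closed[OF K(1)] by (rule open_Compl)
   have "Ck_on 1 (- K k) (F k)"
    by (rule Ck_on_cong[OF o, THEN iffD1, rotated, OF Ck_on_const[of 1 _ 0]]) (simp add: F0)
   thus ?thesis using o False K(2) by blast
  qed
 qed
 define dF where "dF k x = (SUM b:Basis. Df (F k) x b \<bullet> b)" for k x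
 have dF0: "dF k x = 0" if "x ~: slice t" for k x
 proof -
  have "x : - K k" using that K(2) by blast
  hence "Df (F k) x b = 0" for b
   by (rule Df_eq_0[rotated]) (use compact_imp_closed[OF K(1)] F0 in \<open>auto simp: open_Compl\<close>)
  thus ?thesis by (simp add: dF_def)
 qed
 have dF: "dF k x = et' k (beta (x, t)) * (gradx beta (x, t) \<bullet> U (x, t)) + et k (beta (x, t)) * divx U (x, t)" if x: "x : slice t" for k x
 proof -
  have r: "(x, t) : reg" using x by (simp add: slice_def)
  have "(F k has_derivative Dx (P k) (x, t)) (at x)"
   by (rule has_derivative_transform_within_open[OF nice_hd[OF nP r] open_slice x]) (simp add: F_def)
  hence "dF k x = divx (P k) (x, t)" unfolding dF_def divx_def using frechet_derivative_at by metis
  also have "... = Dx (%q. et k (beta q)) (x, t) (U (x, t)) + et k (beta (x, t)) * divx U (x, t)"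
   unfolding P_def by (rule divx_scaleR[OF nice_compose[OF nice_beta1 cket[unfolded One_nat_def]] U r])
  also have "Dx (%q. et k (beta q)) (x, t) = (%h. et' k (beta (x, t)) * Dx beta (x, t) h)"
   by (rule Dx_eqI) (use has_derivative_compose[OF nice_deriv[OF nice_beta1 r] det[unfolded has_field_derivative_def]] in simp)
  finally show ?thesis by (simp add: gradx_inner[OF nice_beta1 r])
 qed
 \<comment> \<open>On the support of \<open>et' k\<close> one has (k+1) b <= 3, which cancels the
   factor k+1 of the derivative.\<close>
 have cut: "abs (et' k b) * b <= 3 * BM" if "b > 0" for k b
 proof (cases "real (Suc k) * b <= 3")
  case True
  have "abs (et' k b) * b = abs (moll 0 (real (Suc k) * b - 2)) * (real (Suc k) * b)" by (simp add: et'_def abs_mult)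
  also have "... <= BM * 3" by (intro mult_mono BM True) (use BM[of 0] that in auto)
  finally show ?thesis by simp
 next
  case False
  hence "moll 0 (real (Suc k) * b - 2) = 0" by (intro moll_eq_0) simp
  thus ?thesis using BM[of 0] by (simp add: et'_def)
 qed
 have et1: "abs (et k b) <= 1" for k b using step_bounds[of 0] by (simp add: et_def abs_le_iff)
 define BB where "BB = 3 * BM * abs B + BD"
 have bF: "norm (F k x) <= BU" and bdF: "abs (dF k x) <= BB" for k x
 proof -
  show "norm (F k x) <= BU"
  proof (cases "x : slice t")
   case True
   have "abs (et k (beta (x, t))) * norm (U (x, t)) <= 1 * BU"
    by (rule mult_mono) (use True et1 BU in \<open>auto simp: slice_def\<close>)
   thus ?thesis using True by (simp add: F_def P_def)
  qed (use BU in \<open>simp add: F_def\<close>)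
  show "abs (dF k x) <= BB"
  proof (cases "x : slice t")
   case True
   hence r: "(x, t) : reg" by (simp add: slice_def)
   have "abs (gradx beta (x, t) \<bullet> U (x, t)) <= beta (x, t) * abs B"
    by (rule order_trans[OF B[OF r]]) (use beta_pos[OF r] in \<open>simp add: mult.commute mult_left_mono\<close>)
   hence "abs (et' k (beta (x, t))) * abs (gradx beta (x, t) \<bullet> U (x, t)) <= abs (et' k (beta (x, t))) * (beta (x, t) * abs B)"
    by (intro mult_left_mono) auto
   also have "... <= 3 * BM * abs B"
    using mult_right_mono[OF cut[OF beta_pos[OF r], of k], of "abs B"] by (simp add: mult.assoc)
   finally have 1: "abs (et' k (beta (x, t)) * (gradx beta (x, t) \<bullet> U (x, t))) <= 3 * BM * abs B" by (simp add: abs_mult)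
   have "abs (et k (beta (x, t))) * abs (divx U (x, t)) <= 1 * BD" by (rule mult_mono) (use et1 BD r in auto)
   hence "abs (et k (beta (x, t)) * divx U (x, t)) <= BD" by (simp add: abs_mult)
   with 1 show ?thesis unfolding dF[OF True] BB_def by (intro order_trans[OF abs_triangle_ineq] add_mono)
  next
   case False
   thus ?thesis using BM[of 0] BD(1) dF0[OF False] by (simp add: BB_def)
  qed
 qed
 have cF: "F k : borel_measurable lebesgue" "dF k : borel_measurable lebesgue" for k
 proof -
  have "continuous_on UNIV (F k)" by (rule Ck_on_cont[OF ckF])
  moreover have "continuous_on UNIV (dF k)" unfolding dF_def
   using ckF[of k] by (intro continuous_intros) (simp add: One_nat_def)
  ultimately show "F k : borel_measurable lebesgue" "dF k : borel_measurable lebesgue"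
   by (intro measurable_completion; simp add: borel_measurable_continuous_onI)+
 qed
 define A1 where "A1 k x = (u0 x)^2 * dF k x" for k x
 define A2 where "A2 k x = u0 x * (g0 x \<bullet> F k x)" for k x
 have bA: "norm (A1 k x) <= BB * (u0 x)^2" "norm (A2 k x) <= BU * ((u0 x)^2 + (norm (g0 x))^2)" for k x
 proof -
  show "norm (A1 k x) <= BB * (u0 x)^2"
   using mult_right_mono[OF bdF[of k x], of "(u0 x)^2"] by (simp add: A1_def abs_mult mult.commute)
  have "abs (u0 x) * (norm (g0 x) * norm (F k x)) <= abs (u0 x) * (norm (g0 x) * BU)" by (intro mult_left_mono bF) auto
  moreover have "abs (u0 x) * norm (g0 x) <= (u0 x)^2 + (norm (g0 x))^2"
   using sum_squares_bound[of "abs (u0 x)" "norm (g0 x)"] by (auto simp: power2_eq_square intro: order_trans[rotated])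
  hence "(abs (u0 x) * norm (g0 x)) * BU <= ((u0 x)^2 + (norm (g0 x))^2) * BU" using BU(1) by (intro mult_right_mono) auto
  moreover have "abs (g0 x \<bullet> F k x) <= norm (g0 x) * norm (F k x)" by (rule Cauchy_Schwarz_ineq2)
  hence "abs (u0 x) * abs (g0 x \<bullet> F k x) <= abs (u0 x) * (norm (g0 x) * norm (F k x))" by (intro mult_left_mono) auto
  ultimately show "norm (A2 k x) <= BU * ((u0 x)^2 + (norm (g0 x))^2)" by (simp add: A2_def abs_mult mult.commute mult.left_commute)
 qed
 have iB: "integrable lebesgue (%x. BB * (u0 x)^2)" "integrable lebesgue (%x. BU * ((u0 x)^2 + (norm (g0 x))^2))"
  using sq by auto
 have mA: "A1 k : borel_measurable lebesgue" "A2 k : borel_measurable lebesgue" for k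
  unfolding A1_def A2_def using m0 cF by measurable
 have z: "integral\<^sup>L lebesgue (A1 k) + 2 * integral\<^sup>L lebesgue (A2 k) = 0" for k
 proof -
  have "(LINT x:Omg|lebesgue. (ps x)^2 * dF k x) = - 2 * (LINT x:Omg|lebesgue. ps x * (?g x \<bullet> F k x))"
   unfolding dF_def by (rule weak_square_field[OF domain(1) wg(2,1,3) ckF K(1) order_trans[OF K(2) sl] F0])
  moreover have "(LINT x:Omg|lebesgue. (ps x)^2 * dF k x) = integral\<^sup>L lebesgue (A1 k)"
   unfolding set_lebesgue_integral_def A1_def by (rule Bochner_Integration.integral_cong) (auto simp: u0_def indicator_def)
  moreover have "(LINT x:Omg|lebesgue. ps x * (?g x \<bullet> F k x)) = integral\<^sup>L lebesgue (A2 k)"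
   unfolding set_lebesgue_integral_def A2_def by (rule Bochner_Integration.integral_cong) (auto simp: u0_def g0_def indicator_def)
  ultimately show ?thesis by simp
 qed
 define I1 where "I1 x = indicator (slice t) x *\<^sub>R ((u0 x)^2 * divx U (x, t))" for x
 define I2 where "I2 x = indicator (slice t) x *\<^sub>R (u0 x * (g0 x \<bullet> U (x, t)))" for x
 \<comment> \<open>At a fixed point the cut-off is 1 and its derivative 0 as soon as (k+1) \<beta>
   >= 4.\<close>
 have ev: "eventually (%k. A1 k x = I1 x & A2 k x = I2 x) sequentially" for x
 proof (cases "x : slice t")
  case True
  hence r: "(x, t) : reg" by (simp add: slice_def)
  obtain n where n: "real n > 4 / beta (x, t)" using reals_Archimedean2 by blast
  have "A1 k x = I1 x & A2 k x = I2 x" if "k >= n" for k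
  proof -
   have "4 / beta (x, t) <= real (Suc k)" using n that by simp
   hence 3: "real (Suc k) * beta (x, t) >= 4" using beta_pos[OF r] by (simp add: divide_le_eq del: of_nat_Suc)
   have "et k (beta (x, t)) = 1" unfolding et_def by (rule step_eq_1) (use 3 in linarith)
   moreover have "moll 0 (real (Suc k) * beta (x, t) - 2) = 0" by (rule moll_eq_0) (use 3 in auto)
   hence "et' k (beta (x, t)) = 0" unfolding et'_def by (simp del: of_nat_Suc)
   ultimately show ?thesis using True dF[OF True, of k] by (simp add: A1_def A2_def I1_def I2_def F_def P_def)
  qed
  thus ?thesis unfolding eventually_sequentially by blast
 next
  case False
  thus ?thesis by (simp add: A1_def A2_def I1_def I2_def F_def dF0)
 qed
 have lim: "(%k. A1 k x) \<longlonglongrightarrow> I1 x" "(%k. A2 k x) \<longlonglongrightarrow> I2 x" for x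
  by (rule tendsto_eventually, rule eventually_mono[OF ev[of x]], simp)+
 have mI: "I1 : borel_measurable lebesgue" "I2 : borel_measurable lebesgue"
  by (rule borel_measurable_LIMSEQ_real[OF lim(1) mA(1)]) (rule borel_measurable_LIMSEQ_real[OF lim(2) mA(2)])
 note dc1 = integrable_dominated_convergence[OF mI(1) mA(1) iB(1), OF AE_I2[OF lim(1)] AE_I2[OF bA(1)]]
  integral_dominated_convergence[OF mI(1) mA(1) iB(1), OF AE_I2[OF lim(1)] AE_I2[OF bA(1)]]
 note dc2 = integrable_dominated_convergence[OF mI(2) mA(2) iB(2), OF AE_I2[OF lim(2)] AE_I2[OF bA(2)]]
  integral_dominated_convergence[OF mI(2) mA(2) iB(2), OF AE_I2[OF lim(2)] AE_I2[OF bA(2)]]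
 have "(%k. integral\<^sup>L lebesgue (A1 k) + 2 * integral\<^sup>L lebesgue (A2 k)) \<longlonglongrightarrow> integral\<^sup>L lebesgue I1 + 2 * integral\<^sup>L lebesgue I2"
  by (intro tendsto_intros dc1 dc2)
 hence 0: "integral\<^sup>L lebesgue I1 + 2 * integral\<^sup>L lebesgue I2 = 0" unfolding z by (simp add: LIMSEQ_const_iff)
 have I: "I = (%x. I1 x + 2 * I2 x)"
 proof
  fix x
  show "I x = I1 x + 2 * I2 x"
  proof (cases "x : slice t")
   case True
   hence "x : Omg" using sl by blast
   with True show ?thesis by (simp add: I_def I1_def I2_def u0_def g0_def)
  qed (simp add: I_def I1_def I2_def)
 qed
 show "integrable lebesgue I" unfolding I using dc1(1) dc2(1) by simp
 show "integral\<^sup>L lebesgue I = 0" unfolding I using dc1(1) dc2(1) 0 by simp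
qed

end

text \<open>A power of one truncated parabola instead of a smooth bump: with base y, the derivative
  of y^3 is a multiple of y^2 r, and the square in \<open>normal_field\<close> comes out
  exactly.\<close>

definition bumpr :: "real => nat => real => real" where
 "bumpr r0 n r = (max 0 (1 - r^2 / r0^2)) ^ n"

lemma bumpr_DERIV:
 "(bumpr r0 2 has_real_derivative 2 * bumpr r0 1 r * (- 2 * r / r0^2)) (at r)"
 "(bumpr r0 3 has_real_derivative 3 * bumpr r0 2 r * (- 2 * r / r0^2)) (at r)"
proof -
 have d: "((%r. 1 - r^2 / r0^2) has_real_derivative - 2 * r / r0^2) (at r)"
  by (rule DERIV_cong[OF DERIV_diff[OF DERIV_const DERIV_cdivide[OF DERIV_pow]]]) simp
 show "(bumpr r0 2 has_real_derivative 2 * bumpr r0 1 r * (- 2 * r / r0^2)) (at r)"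
  using DERIV_chain2[OF max_power_DERIV[of 0] d] by (simp add: bumpr_def[abs_def] numeral_2_eq_2)
 show "(bumpr r0 3 has_real_derivative 3 * bumpr r0 2 r * (- 2 * r / r0^2)) (at r)"
  using DERIV_chain2[OF max_power_DERIV[of 1] d] by (simp add: bumpr_def[abs_def] numeral_2_eq_2 numeral_3_eq_3)
qed

lemma Ck_on_bumpr: "Ck_on n UNIV (bumpr r0 (Suc n))"
 unfolding bumpr_def[abs_def] divide_inverse power2_eq_square
 by (rule Ck_on_comp_real[OF Ck_on_max_power]) (intro Ck_on_diff Ck_on_mult Ck_on_const Ck_on_id open_UNIV)

lemma bumpr_bounds: "0 <= bumpr r0 n r" "bumpr r0 n r <= 1" "abs r >= r0 ==> r0 > 0 ==> bumpr r0 (Suc n) r = 0"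
proof -
 show "0 <= bumpr r0 n r" by (simp add: bumpr_def)
 show "bumpr r0 n r <= 1" unfolding bumpr_def by (rule power_le_one) auto
 show "bumpr r0 (Suc n) r = 0" if "abs r >= r0" "r0 > 0"
 proof -
  have "r0^2 <= r^2" using that by (simp add: abs_le_square_iff[symmetric])
  hence "1 - r^2 / r0^2 <= 0" using that(2) by (simp add: field_simps)
  thus ?thesis by (simp add: bumpr_def max_def)
 qed
qed

context contact_geometry
begin

abbreviation (input) "cutr r0 q \<equiv> bumpr r0 3 (rco q)"

text \<open>The left-hand side of the inequality is the divergence of ps^2 Q \<open>vfield\<close>,
  with p in the role of the normal derivative of ps.\<close>

definition normal_bound ::
  "real => real => real => (real => real) => ('a => real) => ('a \<times> real => real) => bool" where
 "normal_bound r0 C ep ph H Q \<longleftrightarrow> nice (Suc 0) Q & (ALL q:reg. abs (rco q) >= r0 --> Q q = 0) &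
   (ALL q:reg. ALL p ps. 2 * ps * (Q q * p) + ps^2 * divx (%q. Q q *\<^sub>R vfield q) q
    <= cutr r0 q * p^2
     + (cutr r0 q / ep^2 * ph ((rco q - ep * H (sco q)) / ep) + C) * ps^2)"

text \<open>Put L = g / ep - div v / 2 with v = \<open>vfield\<close>; the subtracted half cancels g
  div v / ep. With y the base of the cut-off, kp = r / r0^2 and B = y L + 3 kp, the field is Q = y^2
  B, and the divergence of Q v is y^3 ph / ep^2 - y B^2 + E with E bounded above. The two sides then
  differ by y (y p - B ps)^2 + (C - E) ps^2. Only derivatives along v occur, where s is fixed, so C
  does not depend on H.\<close>

lemma normal_field:
 assumes r0: "r0 > 0"
 shows "EX C>0. ALL ep>0. ALL g ph H. continuous_on UNIV ph -->
  (ALL z. (g has_real_derivative ph z - (g z)^2) (at z)) --> Ck_on 1 UNIV H -->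
  (EX Q. normal_bound r0 C ep ph H Q)"
proof -
 define om where "om = divx vfield"
 have nom: "nice k om" for k unfolding om_def by (rule nice_divx[OF nice_v])
 define om' where "om' q = Dx om q (vfield q)" for q
 have nom': "nice k om'" for k unfolding om'_def[abs_def] by (rule nice_Dx_field[OF nom nice_v])
 obtain C1 where C1: "C1 > 0" "ALL q:reg. norm (om q) <= C1" using nice_bounded[OF nom] by (elim exE conjE)
 obtain C2 where C2: "C2 > 0" "ALL q:reg. norm (om' q) <= C2" using nice_bounded[OF nom'] by (elim exE conjE)
 \<comment> \<open>Upper bound for the error E below; its two terms not represented here are
   nonpositive.\<close>
 define C where "C = C2 / 2 + 3 / r0^2 + 3 * (dl / r0^2) * C1"
 have "C > 0" using C1 C2 r0 dpos by (simp add: C_def add_pos_pos)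
 show ?thesis
 proof (intro exI[of _ C] conjI allI impI \<open>C > 0\<close>)
  fix ep :: real and g ph and H :: "'a => real"
  assume ep: "ep > 0" and ph: "continuous_on UNIV ph" and g: "ALL z. (g has_real_derivative ph z - (g z)^2) (at z)"
   and H: "Ck_on 1 UNIV H"
  have cg: "Ck_on (Suc 0) UNIV g"
  proof (rule Ck_on_SucI_real[OF open_UNIV])
   show "(g has_real_derivative ph z - (g z)^2) (at z)" for z using g ..
   have "continuous_on UNIV g" using g DERIV_isCont by (auto simp: continuous_on_eq_continuous_at)
   thus "Ck_on 0 UNIV (%z. ph z - (g z)^2)" using ph by (simp add: continuous_intros)
  qed
  define rh where "rh q = (rco q - ep * H (sco q)) / ep" for q
  have nrh: "nice (Suc 0) rh" unfolding rh_def[abs_def] divide_inverse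
   by (intro nice_mult nice_diff nice_const nice_r nice_compose[OF nice_s] H[unfolded One_nat_def])
  define L where "L q = g (rh q) / ep - om q / 2" for q
  \<comment> \<open>The second summand supplies the 3 kp in B: differentiating the cut-off produces
    - 6 y^2 kp L, of order 1 / ep, which is the mixed term of - y B^2.\<close>
  define Q where "Q q = cutr r0 q * L q + 3 / r0^2 * (bumpr r0 2 (rco q) * rco q)" for q
  have nb: "nice (Suc 0) (%q. cutr r0 q)" "nice (Suc 0) (%q. bumpr r0 2 (rco q))"
   using nice_compose[OF nice_r Ck_on_bumpr[of 2 r0]] nice_compose[OF nice_r Ck_on_bumpr[of 1 r0]]
   by (auto simp: numeral_2_eq_2 numeral_3_eq_3 intro: nice_mono)
  have nL: "nice (Suc 0) L" unfolding L_def[abs_def] divide_inverse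
   by (intro nice_diff nice_mult nom nice_const nice_compose[OF nrh cg])
  have nQ: "nice (Suc 0) Q" unfolding Q_def[abs_def]
   by (intro nice_add nice_mult nb nL nice_const nice_r)
  have Q0: "Q q = 0" if "abs (rco q) >= r0" for q
   using bumpr_bounds(3)[OF that r0] by (simp add: Q_def numeral_2_eq_2 numeral_3_eq_3)
  have "2 * ps * (Q q * p) + ps^2 * divx (%q. Q q *\<^sub>R vfield q) q
    <= cutr r0 q * p^2 + (cutr r0 q / ep^2 * ph (rh q) + C) * ps^2"
   if q: "q : reg" for q p ps
  proof -
   let ?s = "sco q" and ?r = "rco q"
   define y where "y = bumpr r0 1 ?r"
   have y: "0 <= y" "y <= 1" "bumpr r0 2 ?r = y^2" "bumpr r0 3 ?r = y ^ 3"
    using bumpr_bounds(1,2)[of r0 1 ?r] by (auto simp: y_def bumpr_def)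
   have I: "open {-dl<..<dl}" "?r : {-dl<..<dl}" using reg_facts(1)[OF q] by auto
   define l where "l a = (gX G (a, ?s, snd q), snd q)" for a
   have lr: "l ?r = q" unfolding l_def by (rule reg_facts(6)[OF q])
   have dom: "((%a. om (l a)) has_real_derivative om' q) (at ?r)"
    unfolding has_real_derivative_iff_has_vector_derivative l_def om'_def by (rule deriv_v[OF nom q])
   have dg: "((%a. g ((a - ep * H ?s) / ep)) has_real_derivative (ph (rh q) - (g (rh q))^2) / ep) (at ?r)"
   proof -
    have 1: "((%a. (a - ep * H ?s) / ep) has_real_derivative 1 / ep) (at ?r)"
     by (rule DERIV_cong[OF DERIV_cdivide[OF DERIV_diff[OF DERIV_ident DERIV_const]]]) simp
    have 2: "(g has_real_derivative ph (rh q) - (g (rh q))^2) (at ((?r - ep * H ?s) / ep))" using g by (simp add: rh_def)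
    show ?thesis using DERIV_chain2[OF 2 1] by simp
   qed
   have b3: "(bumpr r0 3 has_real_derivative 3 * y^2 * (- 2 * ?r / r0^2)) (at ?r)"
    using bumpr_DERIV(2)[of r0 ?r] by (simp only: y(3))
   have b2: "(bumpr r0 2 has_real_derivative 2 * y * (- 2 * ?r / r0^2)) (at ?r)"
    using bumpr_DERIV(1)[of r0 ?r] by (simp only: y_def)
   define D where "D = 3 * y^2 * (- 2 * ?r / r0^2) * L q + ((ph (rh q) - (g (rh q))^2) / ep / ep - om' q / 2) * y ^ 3
    + 3 / r0^2 * (2 * y * (- 2 * ?r / r0^2) * ?r + 1 * y^2)"
   have "((%a. bumpr r0 3 a * (g ((a - ep * H ?s) / ep) / ep - om (l a) / 2) + 3 / r0^2 * (bumpr r0 2 a * a)) has_real_derivative D) (at ?r)"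
    using DERIV_add[OF DERIV_mult[OF b3 DERIV_diff[OF DERIV_cdivide[OF dg, of ep] DERIV_cdivide[OF dom, of 2]]]
      DERIV_cmult[OF DERIV_mult[OF b2 DERIV_ident], of "3 / r0^2"]]
    by (simp add: D_def y(3,4) lr L_def rh_def)
   hence "((%a. Q (l a)) has_real_derivative D) (at ?r)"
    by (rule has_field_derivative_transform_within_open[OF _ I])
     (use line_coords[OF q] in \<open>auto simp: Q_def L_def rh_def l_def\<close>)
   hence QD: "Dx Q q (vfield q) = D"
    using deriv_v[OF nQ q] unfolding l_def has_real_derivative_iff_has_vector_derivative
    by (rule vector_derivative_unique_at[rotated])
   define kp where "kp = ?r / r0^2"
   define B where "B = y * L q + 3 * kp"
   define E where "E = - (y ^ 3) * (om q)^2 / 4 - y ^ 3 * om' q / 2 - 3 * y * kp^2 + 3 * y^2 / r0^2 + 3 * y^2 * kp * om q"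
   have QB: "Q q = y^2 * B" using y by (simp add: Q_def B_def kp_def algebra_simps power2_eq_square power3_eq_cube)
   have L2: "(g (rh q))^2 / ep / ep = (L q + om q / 2)^2" by (simp add: L_def power2_eq_square)
   have "D = 3 * y^2 * (- 2 * kp) * L q + (ph (rh q) / ep^2 - (L q + om q / 2)^2 - om' q / 2) * y ^ 3
     - 12 * y * kp^2 + 3 * y^2 / r0^2"
   proof -
    have 1: "(ph (rh q) - (g (rh q))^2) / ep / ep = ph (rh q) / ep^2 - (L q + om q / 2)^2"
     unfolding L2[symmetric] by (simp add: diff_divide_distrib power2_eq_square)
    have 2: "3 / r0^2 * (2 * y * (- 2 * ?r / r0^2) * ?r + 1 * y^2) = - 12 * y * kp^2 + 3 * y^2 / r0^2"
     by (simp add: kp_def power2_eq_square add_divide_distrib diff_divide_distrib algebra_simps)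
    show ?thesis unfolding D_def 1 2 by (simp add: kp_def)
   qed
   hence div: "divx (%q. Q q *\<^sub>R vfield q) q = y ^ 3 / ep^2 * ph (rh q) - y * B^2 + E"
    unfolding divx_scaleR[OF nQ nice_v q] QD om_def[symmetric] QB B_def E_def
    by (simp add: algebra_simps power2_eq_square power3_eq_cube)
   have "E <= C"
   proof -
    have "- (y ^ 3) * om' q / 2 <= C2 / 2"
    proof -
     have "y ^ 3 * abs (om' q) <= 1 * C2" by (rule mult_mono) (use y C2 q in \<open>auto intro: power_le_one\<close>)
     moreover have "y ^ 3 * (- om' q) <= y ^ 3 * abs (om' q)" using y by (intro mult_left_mono) auto
     ultimately show ?thesis by simp
    qed
    moreover have "y^2 <= 1" using y by (simp add: power_le_one)
    hence "3 * y^2 / r0^2 <= 3 / r0^2" by (intro divide_right_mono) auto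
    moreover have "3 * y^2 * kp * om q <= 3 * (dl / r0^2) * C1"
    proof -
     have "abs kp <= dl / r0^2" using reg_facts(1)[OF q] by (simp add: kp_def abs_divide divide_right_mono)
     hence "(3 * y^2) * abs kp <= 3 * (dl / r0^2)" by (rule mult_mono[rotated]) (use \<open>y^2 <= 1\<close> in auto)
     hence "3 * y^2 * abs kp * abs (om q) <= 3 * (dl / r0^2) * C1"
      by (rule mult_mono) (use C1 q dpos in auto)
     thus ?thesis by (rule order_trans[rotated]) (simp add: abs_mult[symmetric] mult.assoc mult_left_mono)
    qed
    moreover have "0 <= y ^ 3 * (om q)^2 / 4" "0 <= 3 * y * kp^2" using y(1) by simp_all
    ultimately show ?thesis unfolding E_def C_def by linarith
   qed
   hence "E * ps^2 <= C * ps^2" by (intro mult_right_mono) auto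
   moreover have "0 <= y * (y * p - B * ps)^2" using y(1) by simp
   ultimately show ?thesis unfolding div QB y(4) by (simp add: algebra_simps power2_eq_square power3_eq_cube)
  qed
  thus "EX Q. normal_bound r0 C ep ph H Q"
   using nQ Q0 unfolding normal_bound_def rh_def by blast
 qed
qed

definition decay_b :: "real => 'a \<times> real => real" where
 "decay_b nu q = (if sco q : gY G ` (bd \<times> {0..<2 * mu0}) then exp (- nu * b_coord G q) else 0)"

definition tangential_bound :: "real => real => real => real => real => ('a \<times> real => 'a) => bool" where
 "tangential_bound r0 gm c C ep W \<longleftrightarrow> nice (Suc 0) W & (ALL q:reg. abs (rco q) >= r0 --> W q = 0) &
  (ALL q:reg. abs (gradx beta q \<bullet> W q) <= C / ep * beta q &
   (ALL xv. abs (W q \<bullet> xv) <= C * norm (tang xv q)) &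
   c / ep * (cutr r0 q * decay_b (gm / ep) q) - C <= divx W q)"

text \<open>The derivative of 1 - exp (- k \<beta>) along Y is k exp (- k \<beta>)
  |\<nabla>\<beta>|^2, of order 1 / ep in the boundary layer, while the amplitude is at most k
  \<beta>, which gives tangency. Close to the boundary \<nabla>\<beta> is bounded below; further
  inside the decay factor itself is O(ep).\<close>

lemma tangential_field:
 assumes r0: "r0 > 0" and gm: "gm > 0"
 shows "EX c>0. EX C>0. ALL ep>0. EX W. tangential_bound r0 gm c C ep W"
proof -
 obtain cb where cb: "cb > 0" "ALL q:reg. sco q : gY G ` (bd \<times> {0..mu0 / 2}) --> cb <= norm (gradx beta q)"
  using beta_gradient by (elim exE conjE)
 have ng: "nice (Suc 0) (gradx beta)" by (rule nice_gradx) (use nice_beta in \<open>simp add: numeral_2_eq_2\<close>)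
 have nm: "nice k mfield" for k unfolding mfield_def by (rule nice_gradx[OF nice_r])
 \<comment> \<open>Corrected along \<open>vfield\<close>, on which \<beta> is constant: this makes
   the derivative of r along Y vanish and leaves that of \<beta> equal to
   |\<nabla>\<beta>|^2.\<close>
 define Y where "Y q = gradx beta q - (mfield q \<bullet> gradx beta q) *\<^sub>R vfield q" for q
 have nY: "nice (Suc 0) Y" unfolding Y_def[abs_def] by (intro nice_diff nice_scaleR nice_inner nm ng nice_v)
 have mY: "mfield q \<bullet> Y q = 0" "gradx beta q \<bullet> Y q = (norm (gradx beta q))^2" if "q : reg" for q
  using Dr_v[OF that] Dbeta_v[OF that] gradx_inner[OF nice_beta1 that, of "vfield q"]
  by (simp_all add: Y_def inner_diff_right power2_norm_eq_inner)
 obtain C1 where C1: "C1 > 0" "ALL q:reg. norm (Y q) <= C1" using nice_bounded[OF nice_mono[OF nY]] by auto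
 obtain C2 where C2: "C2 > 0" "ALL q:reg. norm (divx Y q) <= C2" using nice_bounded[OF nice_divx[OF nY]] by auto
 obtain C3 where C3: "C3 > 0" "ALL q:reg. norm (gradx beta q) <= C3" using nice_bounded[OF nice_mono[OF ng]] by auto
 \<comment> \<open>As \<beta> <= 3 b / mu0, this rate gives k \<beta> <= gm b / ep, so exp (- k
   \<beta>) dominates the decay factor.\<close>
 define gm' where "gm' = gm * mu0 / 3"
 have gm': "gm' > 0" using gm mu0 by (simp add: gm'_def)
 define c where "c = gm' * cb^2"
 define C where "C = C1 + C2 + gm' * C3^2 + c * (2 / (gm * mu0))"
 have c: "c > 0" using gm' cb by (simp add: c_def)
 have Cpos: "C > 0" "C1 <= C" "gm' * C3^2 <= C" "C2 + c * (2 / (gm * mu0)) <= C"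
  using C1 C2 C3 gm' c gm mu0 by (auto simp: C_def intro!: add_pos_nonneg)
 show ?thesis
 proof (rule exI[of _ c], rule conjI[OF c], rule exI[of _ C], rule conjI[OF Cpos(1)], intro allI impI)
  fix ep :: real assume ep: "ep > 0"
  define k where "k = gm' / ep"
  have k: "k > 0" using gm' ep by (simp add: k_def)
  define A where "A q = cutr r0 q * (1 - exp (- k * beta q))" for q
  have ce: "Ck_on (Suc 0) UNIV (%b. 1 - exp (- k * b))"
   by (rule Ck_on_SucI_real[of _ _ "%b. k * exp (- k * b)"]) (auto intro!: derivative_eq_intros continuous_intros)
  have nb: "nice (Suc 0) (%q. cutr r0 q)"
   using nice_compose[OF nice_r Ck_on_bumpr[of 2 r0]] by (auto simp: numeral_2_eq_2 numeral_3_eq_3 intro: nice_mono)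
  have nA: "nice (Suc 0) A" unfolding A_def[abs_def] by (intro nice_mult nb nice_compose[OF nice_beta1 ce])
  define W where "W q = A q *\<^sub>R Y q" for q
  have nW: "nice (Suc 0) W" unfolding W_def[abs_def] by (intro nice_scaleR nA nY)
  have W0: "W q = 0" if "abs (rco q) >= r0" for q
   using bumpr_bounds(3)[OF that r0, of 2] by (simp add: W_def A_def numeral_3_eq_3 numeral_2_eq_2)
  have "abs (gradx beta q \<bullet> W q) <= C / ep * beta q & (ALL xv. abs (W q \<bullet> xv) <= C * norm (tang xv q)) &
   c / ep * (cutr r0 q * decay_b (gm / ep) q) - C <= divx W q" if q: "q : reg" for q
  proof -
   define y where "y = cutr r0 q"
   have y: "0 <= y" "y <= 1" using bumpr_bounds by (auto simp: y_def)
   have kb: "k * beta q > 0" using k beta_pos[OF q] by simp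
   have e: "0 <= 1 - exp (- k * beta q)" "1 - exp (- k * beta q) <= 1" "1 - exp (- k * beta q) <= k * beta q"
    using kb exp_ge_add_one_self[of "- k * beta q"] by auto
   have A: "0 <= A q" "A q <= 1" "A q <= k * beta q"
   proof -
    show "0 <= A q" using y e by (simp add: A_def y_def[symmetric])
    have *: "A q <= 1 * (1 - exp (- k * beta q))" unfolding A_def y_def[symmetric] by (intro mult_right_mono y e)
    show "A q <= 1" "A q <= k * beta q" by (rule order_trans[OF *[unfolded mult_1] e(2)] order_trans[OF *[unfolded mult_1] e(3)])+
   qed
   have "abs (gradx beta q \<bullet> W q) = A q * (norm (gradx beta q))^2" using A mY(2)[OF q] by (simp add: W_def abs_mult)
   also have "... <= (k * beta q) * C3^2" by (intro mult_mono A power_mono) (use C3 q kb in auto)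
   also have "... = (gm' * C3^2) / ep * beta q" by (simp add: k_def)
   also have "... <= C / ep * beta q" by (intro mult_right_mono divide_right_mono Cpos) (use ep beta_pos[OF q] in auto)
   finally have 1: "abs (gradx beta q \<bullet> W q) <= C / ep * beta q" .
   have 2: "abs (W q \<bullet> xv) <= C * norm (tang xv q)" for xv
   proof -
    have "Y q \<bullet> xv = Y q \<bullet> tang xv q"
     using mY(1)[OF q] by (simp add: tang_def inner_diff_right inner_commute)
    hence "abs (Y q \<bullet> xv) <= norm (Y q) * norm (tang xv q)" using Cauchy_Schwarz_ineq2 by metis
    also have "... <= C * norm (tang xv q)" by (intro mult_right_mono) (use C1 Cpos(2) q in force)+
    finally have "A q * abs (Y q \<bullet> xv) <= 1 * (C * norm (tang xv q))" by (intro mult_mono A) auto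
    thus ?thesis using A(1) by (simp add: W_def abs_mult)
   qed
   have dr: "((%y. rco (y, snd q)) has_derivative Dx (rco) q) (at (fst q))" by (rule nice_deriv[OF nice_r q])
   have db: "((%y. beta (y, snd q)) has_derivative Dx beta q) (at (fst q))" by (rule nice_deriv[OF nice_beta1 q])
   obtain b' where b': "(bumpr r0 3 has_real_derivative b') (at (rco q))"
    using bumpr_DERIV(2) by blast
   have "((%y. bumpr r0 3 (rco (y, snd q))) has_derivative (%h. b' * Dx (rco) q h)) (at (fst q))"
    using has_derivative_compose[OF dr, of "bumpr r0 3" "(*) b'"] b' by (simp add: has_field_derivative_def)
   moreover have "((%y. 1 - exp (- k * beta (y, snd q))) has_derivative (%h. exp (- k * beta q) * (k * Dx beta q h))) (at (fst q))"
    using db by (auto intro!: derivative_eq_intros)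
   ultimately have "Dx A q = (%h. cutr r0 q * (exp (- k * beta q) * (k * Dx beta q h))
     + b' * Dx (rco) q h * (1 - exp (- k * beta q)))"
    by (intro Dx_eqI) (auto simp: A_def dest: has_derivative_mult)
   hence "Dx A q (Y q) = y * (exp (- k * beta q) * (k * (norm (gradx beta q))^2))"
    using mY[OF q] by (simp add: y_def mfield_inner[OF q] gradx_inner[OF nice_beta1 q])
   hence dW: "divx W q = y * (exp (- k * beta q) * (k * (norm (gradx beta q))^2)) + A q * divx Y q"
    unfolding W_def[abs_def] divx_scaleR[OF nA nY q] by simp
   have "abs (A q * divx Y q) <= 1 * C2" unfolding abs_mult by (intro mult_mono) (use A C2 q in auto)
   hence AY: "A q * divx Y q >= - C2" by simp
   have main: "c / ep * (y * decay_b (gm / ep) q) - c * (2 / (gm * mu0)) <= y * (exp (- k * beta q) * (k * (norm (gradx beta q))^2))"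
   proof (cases "sco q : gY G ` (bd \<times> {0..mu0 / 2})")
    case True
    then obtain sig b where b: "sco q = gY G (sig, b)" "sig : bd" "0 <= b" "b <= mu0 / 2" by auto
    have b2: "b : {0..2 * mu1}" using b mu0 by auto
    have bc: "b_coord G q = b" unfolding b_coord_def b(1) by (simp add: Y_inv_Y[OF b(2) b2])
    have "beta q <= 3 * b / mu0" unfolding beta_def b(1) btil_Y[OF b(2) b2] by (rule kap_facts(4)[OF b(3)])
    hence "k * beta q <= k * (3 * b / mu0)" using k by (intro mult_left_mono) auto
    also have "... = gm / ep * b" using mu0(1) by (simp add: k_def gm'_def)
    finally have "exp (- (gm / ep) * b) <= exp (- k * beta q)" by simp
    hence "decay_b (gm / ep) q <= exp (- k * beta q)" by (simp add: decay_b_def bc)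
    moreover have "k * cb^2 <= k * (norm (gradx beta q))^2" using cb True q k by (intro mult_left_mono power_mono) auto
    hence "c / ep <= k * (norm (gradx beta q))^2" by (simp add: c_def k_def)
    moreover have "decay_b (gm / ep) q >= 0" by (simp add: decay_b_def)
    ultimately have "decay_b (gm / ep) q * (c / ep) <= exp (- k * beta q) * (k * (norm (gradx beta q))^2)"
     using c ep by (intro mult_mono) auto
    hence "y * (decay_b (gm / ep) q * (c / ep)) <= y * (exp (- k * beta q) * (k * (norm (gradx beta q))^2))"
     using y by (intro mult_left_mono)
    moreover have "c * (2 / (gm * mu0)) >= 0" using c gm mu0 by simp
    ultimately show ?thesis by (simp add: mult.commute mult.left_commute)
   next
    case False
    \<comment> \<open>Either the factor is 0, or b > mu0 / 2 and exp (- x) <= 1 / x with x = gm b /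
      ep.\<close>
    have "decay_b (gm / ep) q <= 2 * ep / (gm * mu0)"
    proof (cases "sco q : gY G ` (bd \<times> {0..<2 * mu0})")
     case True
     then obtain sig b where b: "sco q = gY G (sig, b)" "sig : bd" "0 <= b" "b < 2 * mu0" by auto
     hence "b > mu0 / 2" using False by (force simp: image_iff)
     have "b : {0..2 * mu1}" using b mu0 by auto
     hence bc: "b_coord G q = b" unfolding b_coord_def b(1) by (simp add: Y_inv_Y[OF b(2)])
     define x where "x = gm / ep * b"
     have x: "x >= gm * mu0 / (2 * ep)" "gm * mu0 / (2 * ep) > 0"
      using mult_left_mono[of "mu0 / 2" b "gm / ep"] \<open>b > mu0 / 2\<close> gm ep mu0 by (auto simp: x_def)
     have "x <= exp x" using exp_ge_add_one_self[of x] by linarith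
     hence "exp (- x) <= inverse (gm * mu0 / (2 * ep))" unfolding exp_minus
      by (intro le_imp_inverse_le order_trans[OF x(1)] x(2))
     thus ?thesis using True by (simp add: decay_b_def bc x_def)
    qed (use gm ep mu0 in \<open>simp add: decay_b_def\<close>)
    hence "y * decay_b (gm / ep) q <= 1 * (2 * ep / (gm * mu0))"
     by (intro mult_mono y) (auto simp: decay_b_def)
    hence "c / ep * (y * decay_b (gm / ep) q) <= c / ep * (2 * ep / (gm * mu0))"
     using c ep by (intro mult_left_mono) auto
    also have "... = c * (2 / (gm * mu0))" using ep by simp
    finally have "c / ep * (y * decay_b (gm / ep) q) - c * (2 / (gm * mu0)) <= 0" by simp
    also have "0 <= y * (exp (- k * beta q) * (k * (norm (gradx beta q))^2))" using y(1) k by simp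
    finally show ?thesis .
   qed
   hence "c / ep * (cutr r0 q * decay_b (gm / ep) q) - C <= divx W q"
    unfolding dW y_def[symmetric] using AY Cpos(4) by linarith
   with 1 2 show ?thesis by blast
  qed
  thus "EX W. tangential_bound r0 gm c C ep W"
   using nW W0 unfolding tangential_bound_def by blast
 qed
qed

end

section \<open>The approximate solution\<close>

lemma Ck_on_poly:
 fixes p :: "'a::euclidean_space => real"
 shows "real_polynomial_function p ==> Ck_on k UNIV p"
proof (induction rule: real_polynomial_function.induct)
 case (linear f)
 thus ?case by (rule Ck_on_bounded_linear[OF open_UNIV _ Ck_on_id])
qed (auto intro: Ck_on_add Ck_on_mult)

text \<open>The remainders are measurable only as functions cut off by a set B; multiplying by the
  indicator of a measurable subset A gives a statement about A alone.\<close>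

lemma ind_meas_split:
 fixes w h k :: "'a::euclidean_space => real"
 assumes "A : sets lebesgue" "A \<subseteq> B" "set_borel_measurable lebesgue B h"
  "(%x. indicator A x * k x) : borel_measurable lebesgue" "!!x. x : A ==> w x = h x + k x"
 shows "(%x. indicator A x * w x) : borel_measurable lebesgue"
proof -
 have m: "(%x. indicator B x *\<^sub>R h x) : borel_measurable lebesgue" "indicator A : borel_measurable lebesgue"
  using assms(1,3) by (auto simp: set_borel_measurable_def)
 have "(%x. indicator A x * (indicator B x *\<^sub>R h x) + indicator A x * k x) : borel_measurable lebesgue"
  by (intro borel_measurable_add borel_measurable_times m assms(4))
 moreover have "(%x. indicator A x * w x) = (%x. indicator A x * (indicator B x *\<^sub>R h x) + indicator A x * k x)"
 proof
  fix x
  show "indicator A x * w x = indicator A x * (indicator B x *\<^sub>R h x) + indicator A x * k x"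
  proof (cases "x : A")
   case True
   hence "x : B" using assms(2) by blast
   with True assms(5) show ?thesis by simp
  qed simp
 qed
 ultimately show ?thesis by simp
qed

lemma ind_meas_continuous:
 fixes k :: "'a::euclidean_space => 'b::euclidean_space"
 assumes "A : sets borel" "continuous_on A k"
 shows "(%x. indicator A x *\<^sub>R k x) : borel_measurable lebesgue"
 using borel_measurable_continuous_on_indicator[OF assms] by (intro measurable_completion) simp

context contact_geometry
begin

lemma corner_point:
 assumes q: "q : reg" and s: "sco q : gY G ` (bd \<times> {0..<2 * mu0})"
 shows "sigma_coord G q : bd" "b_coord G q > 0" "q : corner_tube G dl (2 * mu0)"
proof -
 obtain sig b where b: "sco q = gY G (sig, b)" "sig : bd" "0 <= b" "b < 2 * mu0" using s by auto
 have "b : {0..2 * mu1}" using b mu0 by auto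
 hence *: "sigma_coord G q = sig" "b_coord G q = b"
  unfolding sigma_coord_def b_coord_def b(1) by (simp_all add: Y_inv_Y[OF b(2)])
 have "b ~= 0" using b(1,2) Y_0 reg_facts(3)[OF q] by auto
 with b * show "sigma_coord G q : bd" "b_coord G q > 0" by auto
 have "q = Xbar G (rco q, gY G (sig, b), snd q)" using reg_facts(6)[OF q] by (simp add: Xbar_eq b(1))
 thus "q : corner_tube G dl (2 * mu0)"
  unfolding corner_tube_def by (rule image_eqI) (use reg_facts(1,4)[OF q] b \<open>b ~= 0\<close> in auto)
qed

text \<open>The closure removed in \<open>inner_tube\<close> lies in the compact image of b <= mu0,
  which misses the points considered. The two expansions overlap, and splitting at 2 mu0 selects one
  of them at each point.\<close>

lemma inner_point:
 assumes q: "q : reg" and s: "sco q ~: gY G ` (bd \<times> {0..<2 * mu0})"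
 shows "q : inner_tube G dl mu0"
proof -
 obtain Xi where Xi: "homeomorphism (coord_dom G) (Xbar G ` coord_dom G) (Xbar G) Xi" using Xbar_homeo ..
 define D where "D = {-dl..dl} \<times> gY G ` (bd \<times> {0..mu0}) \<times> {0..T}"
 have YS: "gY G ` (bd \<times> {0..mu0}) \<subseteq> S"
  by (rule order_trans[OF image_mono Y_range]) (use mu0 in auto)
 have DC: "D \<subseteq> coord_dom G" using YS dpos by (auto simp: D_def coord_dom_def)
 have "compact D" unfolding D_def by (intro compact_Times compact_Icc compact_Y) (use mu0 in auto)
 hence "compact (Xbar G ` D)"
  by (rule compact_continuous_image[OF continuous_on_subset[OF homeomorphism_cont1[OF Xi] DC]])
 moreover have "corner_tube G dl mu0 \<subseteq> Xbar G ` D" unfolding corner_tube_def D_def by (intro image_mono Sigma_mono) auto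
 ultimately have "closure (corner_tube G dl mu0) \<subseteq> Xbar G ` D" by (intro closure_minimal compact_imp_closed)
 moreover have "q ~: Xbar G ` D"
 proof
  assume "q : Xbar G ` D"
  then obtain r s t where x: "q = Xbar G (r, s, t)" "(r, s, t) : D" by auto
  hence "sco q = s" using coords(2)[OF subsetD[OF DC x(2)]] by (simp add: Xbar_eq)
  hence "sco q : gY G ` (bd \<times> {0..mu0})" using x(2) by (simp add: D_def)
  moreover have "gY G ` (bd \<times> {0..mu0}) \<subseteq> gY G ` (bd \<times> {0..<2 * mu0})" using mu0 by (intro image_mono Sigma_mono) auto
  ultimately show False using s by blast
 qed
 ultimately show ?thesis using q by (auto simp: inner_tube_def reg_def)
qed

lemma Y_inv_continuous: "continuous_on (gY G ` (bd \<times> {0..2 * mu1})) (Y_inv G)"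
proof -
 obtain Yi where Yi: "homeomorphism (bd \<times> {0..2 * mu1}) (gY G ` (bd \<times> {0..2 * mu1})) (gY G) Yi"
  using Y_homeo by (elim exE conjE)
 show ?thesis
  by (rule continuous_on_cong[OF refl, THEN iffD1, OF _ homeomorphism_cont2[OF Yi]])
   (use homeomorphism_apply1[OF Yi] Y_inv_Y in auto)
qed

text \<open>\<Omega> is cut into four Borel pieces with one expansion each: \<open>Corn\<close> and
  \<open>Inn\<close> make up the slice, \<open>Dp\<close> and \<open>Dm\<close> its complement. On
  every piece the remainder is measurable and the leading term continuous.\<close>

lemma uA_facts:
 assumes cp: "corner_profile G gm u" and gm: "gm > 0" and cth: "continuous_on UNIV th"
  and ch: "continuous_on S (%s. h1 s t + ep * h2 ep s t)"
  and ap: "approximate_solution G th u h1 h2 K ep1 uA" and ep: "0 < ep" "ep <= ep1" and t: "t : {0..T}"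
  and Cu: "!!sig t p. sig : bd ==> t : {0..T} ==> p : half_plane ==> abs (u p sig t) <= Cu * exp (- gm * snd p)"
 shows "(%x. indicator Omg x * uA ep (x, t)) : borel_measurable lebesgue"
  "!!x. x : slice t ==> abs (uA ep (x, t) - th (rho_coord G h1 h2 ep (x, t))) <= abs K * ep^2 + ep * Cu * decay_b (gm / ep) (x, t)"
  "!!x. x : Omg - slice t ==> abs (uA ep (x, t) - 1) <= abs K * ep \<or> \<bar>uA ep (x, t) + 1\<bar> <= abs K * ep"
proof -
 note rem = bspec[OF bspec[OF ap[unfolded approximate_solution_def], of ep] t, unfolded remainder_on_def]
 have rem: "set_borel_measurable lebesgue (time_slice (inner_tube G dl mu0) t) (%x. uA ep (x, t) - th (rho_coord G h1 h2 ep (x, t)))"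
  "ALL x:time_slice (inner_tube G dl mu0) t. abs (uA ep (x, t) - th (rho_coord G h1 h2 ep (x, t))) <= K * ep^2"
  "set_borel_measurable lebesgue (time_slice (corner_tube G dl (2 * mu0)) t) (%x. uA ep (x, t) - (th (rho_coord G h1 h2 ep (x, t)) + ep * corner_term G u h1 h2 ep (x, t)))"
  "ALL x:time_slice (corner_tube G dl (2 * mu0)) t. abs (uA ep (x, t) - (th (rho_coord G h1 h2 ep (x, t)) + ep * corner_term G u h1 h2 ep (x, t))) <= K * ep^2"
  "set_borel_measurable lebesgue (time_slice (gQp G - tube G dl) t) (%x. uA ep (x, t) - 1)"
  "ALL x:time_slice (gQp G - tube G dl) t. abs (uA ep (x, t) - 1) <= K * ep"
  "set_borel_measurable lebesgue (time_slice (gQm G - tube G dl) t) (%x. uA ep (x, t) + 1)"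
  "ALL x:time_slice (gQm G - tube G dl) t. abs (uA ep (x, t) + 1) <= K * ep"
  using rem ep by simp_all
 define Corn where "Corn = {x : slice t. sco (x, t) : gY G ` (bd \<times> {0..<2 * mu0})}"
 define Inn where "Inn = slice t - Corn"
 have ctn: "continuous_on (slice t) (%x. a (x, t))" if "nice 0 a" for a :: "_ => 'c::real_normed_vector"
  using nice_Ck_slice[OF that, of t] by simp
 have oC: "open Corn"
 proof -
  have "openin (top_of_set S) (gY G ` (bd \<times> {0..<2 * mu0}))" using bspec[OF Y_open, of "2 * mu0"] mu0 by simp
  then obtain W where W: "open W" "gY G ` (bd \<times> {0..<2 * mu0}) = S Int W" by (auto simp: openin_open)
  have "Corn = slice t Int (%x. sco (x, t)) -` W"
   using reg_facts(2) unfolding Corn_def W(2) by (auto simp: slice_def)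
  thus ?thesis using continuous_open_preimage[OF ctn[OF nice_s] open_slice W(1)] by simp
 qed
 have sub: "Inn \<subseteq> time_slice (inner_tube G dl mu0) t" "Corn \<subseteq> time_slice (corner_tube G dl (2 * mu0)) t"
 proof (safe)
  fix x assume "x : Inn"
  hence "(x, t) : reg" "sco (x, t) ~: gY G ` (bd \<times> {0..<2 * mu0})" unfolding Inn_def Corn_def slice_def by simp_all
  from inner_point[OF this] show "x : time_slice (inner_tube G dl mu0) t" unfolding time_slice_def by simp
 next
  fix x assume "x : Corn"
  hence "(x, t) : reg" "sco (x, t) : gY G ` (bd \<times> {0..<2 * mu0})" unfolding Corn_def slice_def by simp_all
  from corner_point(3)[OF this] show "x : time_slice (corner_tube G dl (2 * mu0)) t" unfolding time_slice_def by simp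
 qed
 obtain Op Om where O: "open Op" "open Om" "gQp G = (closure Omg \<times> {0..T} - interface G) Int Op"
   "gQm G = (closure Omg \<times> {0..T} - interface G) Int Om" "closure Omg \<times> {0..T} - interface G = gQp G \<union> gQm G"
  using bulk_slices_open unfolding Let_def by (elim exE conjE)
 \<comment> \<open>Traces of open sets, hence Borel; off the slice these are exactly the two bulk
   regions at time t.\<close>
 define Dp where "Dp = (Omg - slice t) Int (%x. (x, t)) -` Op"
 define Dm where "Dm = (Omg - slice t) Int (%x. (x, t)) -` Om"
 have out: "(x, t) : closure Omg \<times> {0..T} - interface G" "(x, t) ~: tube G dl" if "x : Omg - slice t" for x
 proof -
  show "(x, t) ~: tube G dl" using that by (auto simp: slice_def reg_def)
  thus "(x, t) : closure Omg \<times> {0..T} - interface G"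
   using that t interface_tube[of dl] dpos closure_subset[of Omg] by auto
 qed
 have e: "(x, t) : gQp G \<longleftrightarrow> x : Dp" "(x, t) : gQm G \<longleftrightarrow> x : Dm" if x: "x : Omg - slice t" for x
 proof -
  have "(x, t) : gQp G \<longleftrightarrow> (x, t) : Op" by (subst O(3)) (simp only: Int_iff out(1)[OF x] simp_thms)
  thus "(x, t) : gQp G \<longleftrightarrow> x : Dp" using x by (simp add: Dp_def)
  have "(x, t) : gQm G \<longleftrightarrow> (x, t) : Om" by (subst O(4)) (simp only: Int_iff out(1)[OF x] simp_thms)
  thus "(x, t) : gQm G \<longleftrightarrow> x : Dm" using x by (simp add: Dm_def)
 qed
 have DOmg: "Dp \<subseteq> Omg - slice t" "Dm \<subseteq> Omg - slice t" by (simp_all add: Dp_def Dm_def)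
 have Dsub: "Dp \<subseteq> time_slice (gQp G - tube G dl) t" "Dm \<subseteq> time_slice (gQm G - tube G dl) t"
  unfolding time_slice_def using e DOmg out(2) by blast+
 have "bulk_partition G (gQm G) (gQp G)" using geo(4) unfolding bulk_regions_def by (rule conjunct1)
 hence disj: "gQm G Int gQp G = {}" unfolding bulk_partition_def by (elim conjE)
 have Dcov: "Omg - slice t = Dp \<union> Dm" "Dp Int Dm = {}"
 proof -
  have "x : Dp \<or> x : Dm" if x: "x : Omg - slice t" for x
   using out(1)[OF x] unfolding O(5) Un_iff e[OF x] .
  thus "Omg - slice t = Dp \<union> Dm" using DOmg by blast
  show "Dp Int Dm = {}" using e DOmg disj by blast
 qed
 have bor: "Inn : sets borel" "Corn : sets borel" "Dp : sets borel" "Dm : sets borel"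
 proof -
  have "open ((%x. (x, t)) -` Op)" "open ((%x. (x, t)) -` Om)" by (intro open_vimage O continuous_intros)+
  thus "Inn : sets borel" "Corn : sets borel" "Dp : sets borel" "Dm : sets borel"
   using oC open_slice domain(1) by (auto simp: Inn_def Dp_def Dm_def)
 qed
 hence leb: "Inn : sets lebesgue" "Corn : sets lebesgue" "Dp : sets lebesgue" "Dm : sets lebesgue" by auto
 have crh: "continuous_on (slice t) (%x. rho_coord G h1 h2 ep (x, t))"
  unfolding rho_coord_def snd_conv
  by (intro continuous_intros ctn[OF nice_r] continuous_on_compose2[OF ch ctn[OF nice_s]])
   (use ep reg_facts(2) in \<open>auto simp: slice_def\<close>)
 have cthrh: "continuous_on (slice t) (%x. th (rho_coord G h1 h2 ep (x, t)))"
  by (rule continuous_on_compose2[OF cth crh]) auto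
 have cY: "continuous_on Corn (%x. Y_inv G (sco (x, t)))"
  by (rule continuous_on_compose2[OF Y_inv_continuous continuous_on_subset[OF ctn[OF nice_s]]])
   (use mu0 in \<open>force simp: Corn_def\<close>)+
 have cc: "continuous_on Corn (%x. corner_term G u h1 h2 ep (x, t))"
 proof -
  have cp': "continuous_on Corn (%x. ((rho_coord G h1 h2 ep (x, t), b_coord G (x, t) / ep), sigma_coord G (x, t)))"
   unfolding b_coord_def sigma_coord_def
   by (intro continuous_intros cY continuous_on_subset[OF crh]) (use ep in \<open>auto simp: Corn_def\<close>)
  have "continuous_on Corn (%x. (%(p, sig). u p sig t) ((rho_coord G h1 h2 ep (x, t), b_coord G (x, t) / ep), sigma_coord G (x, t)))"
   by (rule continuous_on_compose2[OF corner_cont[OF cp gm t] cp'])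
    (use corner_point ep in \<open>auto simp: Corn_def half_plane_def slice_def\<close>)
  thus ?thesis by (simp add: corner_term_def)
 qed
 have m1: "(%x. indicator Inn x * uA ep (x, t)) : borel_measurable lebesgue"
  by (rule ind_meas_split[OF leb(1) sub(1) rem(1)])
   (use ind_meas_continuous[OF bor(1) continuous_on_subset[OF cthrh]] in \<open>auto simp: Inn_def\<close>)
 have m2: "(%x. indicator Corn x * uA ep (x, t)) : borel_measurable lebesgue"
  by (rule ind_meas_split[OF leb(2) sub(2) rem(3),
     where k="%x. th (rho_coord G h1 h2 ep (x, t)) + ep * corner_term G u h1 h2 ep (x, t)"])
   (use ind_meas_continuous[OF bor(2) continuous_on_add[OF continuous_on_subset[OF cthrh]
     continuous_on_mult_left[OF cc]]] in \<open>auto simp: Corn_def\<close>)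
 have m3: "(%x. indicator Dp x * uA ep (x, t)) : borel_measurable lebesgue"
  by (rule ind_meas_split[OF leb(3) Dsub(1) rem(5), where k="%x. 1"]) (use leb in auto)
 have m4: "(%x. indicator Dm x * uA ep (x, t)) : borel_measurable lebesgue"
  by (rule ind_meas_split[OF leb(4) Dsub(2) rem(7), where k="%x. -1"]) (use leb in auto)
 have ind: "indicator Omg x = indicator Inn x + indicator Corn x + (indicator Dp x + indicator Dm x :: real)" for x
 proof -
  have "slice t \<subseteq> Omg" "Corn \<subseteq> slice t" by (auto simp: slice_def reg_def Corn_def)
  thus ?thesis using Dcov by (auto simp: indicator_def Inn_def)
 qed
 show "(%x. indicator Omg x * uA ep (x, t)) : borel_measurable lebesgue"
  unfolding ind distrib_right by (intro borel_measurable_add m1 m2 m3 m4)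
 have KK: "K * ep^2 <= abs K * ep^2" "K * ep <= abs K * ep" using ep by (auto intro!: mult_right_mono)
 show "abs (uA ep (x, t) - th (rho_coord G h1 h2 ep (x, t))) <= abs K * ep^2 + ep * Cu * decay_b (gm / ep) (x, t)" if x: "x : slice t" for x
 proof (cases "x : Corn")
  case True
  hence r: "(x, t) : reg" "sco (x, t) : gY G ` (bd \<times> {0..<2 * mu0})" by (auto simp: Corn_def slice_def)
  have "abs (corner_term G u h1 h2 ep (x, t)) <= Cu * exp (- gm * (b_coord G (x, t) / ep))"
   using Cu[OF corner_point(1)[OF r] t, of "(rho_coord G h1 h2 ep (x, t), b_coord G (x, t) / ep)"] corner_point(2)[OF r] ep(1)
   by (simp add: corner_term_def half_plane_def)
  hence "abs (corner_term G u h1 h2 ep (x, t)) <= Cu * decay_b (gm / ep) (x, t)" using r(2) by (simp add: decay_b_def)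
  hence "ep * abs (corner_term G u h1 h2 ep (x, t)) <= ep * (Cu * decay_b (gm / ep) (x, t))"
   by (rule mult_left_mono) (use ep in simp)
  moreover have "abs (ep * corner_term G u h1 h2 ep (x, t)) = ep * abs (corner_term G u h1 h2 ep (x, t))" using ep by (simp add: abs_mult)
  moreover have "abs (uA ep (x, t) - (th (rho_coord G h1 h2 ep (x, t)) + ep * corner_term G u h1 h2 ep (x, t))) <= K * ep^2"
   using rem(4) sub(2) True by blast
  ultimately show ?thesis using KK(1) unfolding mult.assoc by linarith
 next
  case False
  hence "x : Inn" using x by (simp add: Inn_def)
  hence "abs (uA ep (x, t) - th (rho_coord G h1 h2 ep (x, t))) <= K * ep^2" using rem(2) sub(1) by blast
  moreover have "decay_b (gm / ep) (x, t) = 0" using False x by (simp add: decay_b_def Corn_def)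
  ultimately show ?thesis using KK(1) by simp
 qed
 show "abs (uA ep (x, t) - 1) <= abs K * ep \<or> \<bar>uA ep (x, t) + 1\<bar> <= abs K * ep" if "x : Omg - slice t" for x
 proof -
  have "x : Dp \<or> x : Dm" using that Dcov(1) by (simp only: Un_iff[symmetric])
  thus ?thesis
  proof
   assume "x : Dp"
   hence "abs (uA ep (x, t) - 1) <= K * ep" by (intro bspec[OF rem(6)] subsetD[OF Dsub(1)])
   thus ?thesis using KK(2) by linarith
  next
   assume "x : Dm"
   hence "abs (uA ep (x, t) + 1) <= K * ep" by (intro bspec[OF rem(8)] subsetD[OF Dsub(2)])
   thus ?thesis using KK(2) by linarith
  qed
 qed
qed

end

section \<open>The lower bound\<close>

text \<open>F is split into y F + (1 - y) F with y the cut-off. In y F the function F is compared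
  with p up to the approximation error. Where |rh| < R, the factor 1 - y <= 3 r^2 / r0^2 is O(ep^2)
  and compensates 1 / ep^2; elsewhere p >= c makes F nonnegative by the smallness of ep.\<close>

lemma potential_bound:
 fixes F p E L Cu Kp R c r0 r rh h ep :: real
 assumes ep: "0 < ep" "ep <= 1" "L * (Kp + 1 + Cu) * ep <= c" and r0: "r0 > 0" and L: "L >= 0" "Cu >= 0" "Kp >= 0"
  and E: "0 <= E" "E <= 1" and F: "F >= - L" "F >= p - L * ((Kp + 1) * ep^2 + ep * Cu * E)"
  and far: "abs rh >= R ==> p >= c" and rh: "r = ep * rh + ep * h" "abs h <= Ch" and R: "R > 0"
 shows "bumpr r0 3 r / ep^2 * p - L * Cu / ep * (bumpr r0 3 r * E) - (L * (Kp + 1) + 3 * L * (R + Ch)^2 / r0^2) <= 1 / ep^2 * F"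
proof -
 define y where "y = bumpr r0 3 r"
 have y: "0 <= y" "y <= 1" using bumpr_bounds by (auto simp: y_def)
 have "y * (p - L * ((Kp + 1) * ep^2 + ep * Cu * E)) <= y * F" by (intro mult_left_mono F y)
 moreover have "y * (L * (Kp + 1)) <= 1 * (L * (Kp + 1))" by (intro mult_right_mono y) (use L in auto)
 ultimately have "y * p - ep * (L * Cu * (y * E)) - ep^2 * (L * (Kp + 1)) <= y * F"
  using mult_left_mono[of "y * (L * (Kp + 1))" "L * (Kp + 1)" "ep^2"] by (simp add: algebra_simps)
 hence 1: "(y * p - ep * (L * Cu * (y * E)) - ep^2 * (L * (Kp + 1))) / ep^2 <= (y * F) / ep^2" by (intro divide_right_mono) auto
 have 2: "- (3 * L * (R + Ch)^2 / r0^2) <= ((1 - y) * F) / ep^2"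
 proof (cases "abs rh >= R")
  case True
  have "ep * ep <= ep * 1" by (rule mult_left_mono) (use ep in auto)
  moreover have "(ep * Cu) * E <= (ep * Cu) * 1" by (rule mult_left_mono) (use ep L E in auto)
  moreover have "(Kp + 1) * (ep * ep) <= (Kp + 1) * (ep * 1)"
   by (rule mult_left_mono) (use calculation(1) L in auto)
  ultimately have "(Kp + 1) * ep^2 + ep * Cu * E <= (Kp + 1 + Cu) * ep"
   unfolding power2_eq_square distrib_right by (simp add: mult.commute)
  hence "L * ((Kp + 1) * ep^2 + ep * Cu * E) <= L * ((Kp + 1 + Cu) * ep)" using L by (intro mult_left_mono)
  hence "L * ((Kp + 1) * ep^2 + ep * Cu * E) <= c" using ep(3) by (simp only: mult.assoc)
  hence "F >= 0" using F(2) far[OF True] by linarith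
  hence "((1 - y) * F) / ep^2 >= 0" using y by simp
  moreover have "3 * L * (R + Ch)^2 / r0^2 >= 0" using L by simp
  ultimately show ?thesis by linarith
 next
  case False
  have "abs r = ep * abs (rh + h)" using ep(1) by (simp add: rh(1) distrib_left[symmetric] abs_mult)
  also have "... <= ep * (R + Ch)" using False rh(2) ep(1) by (intro mult_left_mono) auto
  finally have "abs r^2 <= (ep * (R + Ch))^2" by (intro power_mono) auto
  hence r2: "r^2 <= ep^2 * (R + Ch)^2" by (simp add: power_mult_distrib)
  \<comment> \<open>Bernoulli for the cube, with w the truncated base and u = r^2 / r0^2.\<close>
  have "1 - w ^ 3 <= 3 * u" if "1 - u <= w" "0 <= w" for u w :: real
   using Bernoulli_inequality[of "w - 1" 3] that by simp
  from this[OF max.cobounded2 max.cobounded1] have "1 - y <= 3 * (r^2 / r0^2)" unfolding y_def bumpr_def .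
  also have "... <= 3 * (ep^2 * (R + Ch)^2 / r0^2)" by (intro mult_left_mono divide_right_mono r2) auto
  finally have "(1 - y) * L <= 3 * (ep^2 * (R + Ch)^2 / r0^2) * L" by (rule mult_right_mono) (use L in simp)
  moreover have "(1 - y) * (- L) <= (1 - y) * F" by (intro mult_left_mono F) (use y in simp)
  ultimately have "- (3 * L * (R + Ch)^2 / r0^2) * ep^2 <= (1 - y) * F" by (simp add: mult.commute mult.left_commute)
  thus ?thesis using ep(1) by (simp add: le_divide_eq)
 qed
 have "(y * p - ep * (L * Cu * (y * E)) - ep^2 * (L * (Kp + 1))) / ep^2 = y / ep^2 * p - L * Cu / ep * (y * E) - L * (Kp + 1)"
  using ep(1) by (simp add: field_simps power2_eq_square)
 moreover have "(y * F) / ep^2 + ((1 - y) * F) / ep^2 = 1 / ep^2 * F" by (simp add: add_divide_distrib[symmetric] algebra_simps)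
 ultimately show ?thesis using 1 2 unfolding y_def by linarith
qed

context contact_geometry
begin

text \<open>The pointwise inequality for the combined field: xv plays the gradient of ps, and La is
  the strength of the corner term to be dominated.\<close>

definition energy_bound ::
  "real => real => real => real => real => real => (real => real) => ('a => real) => ('a \<times> real => 'a) => bool" where
 "energy_bound r0 gm c1 La C ep ph H U \<longleftrightarrow> nice (Suc 0) U & (ALL q:reg. abs (rco q) >= r0 --> U q = 0) &
   (EX B. ALL q:reg. abs (gradx beta q \<bullet> U q) <= B * beta q) &
   (ALL q:reg. ALL xv ps. ps^2 * divx U q + 2 * ps * (xv \<bullet> U q)
    <= cutr r0 q * (vfield q \<bullet> xv)^2 + c1 * (norm (tang xv q))^2
     + (cutr r0 q / ep^2 * ph ((rco q - ep * H (sco q)) / ep)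
       - La / ep * (cutr r0 q * decay_b (gm / ep) q) + C) * ps^2)"

text \<open>With M = La / ct the divergence of M W outweighs the corner term, and its mixed term
  with the tangential gradient is absorbed by Young's inequality into c1 times the square of that
  gradient.\<close>

lemma energy_field:
 assumes r0: "r0 > 0" and gm: "gm > 0" and c1: "c1 > 0" and La: "La >= 0"
 shows "EX C>0. ALL ep>0. ALL g ph H. continuous_on UNIV ph -->
  (ALL z. (g has_real_derivative ph z - (g z)^2) (at z)) --> Ck_on 1 UNIV H -->
  (EX U. energy_bound r0 gm c1 La C ep ph H U)"
proof -
 obtain CN where CN: "CN > 0" "ALL ep>0. ALL g ph H. continuous_on UNIV ph -->
  (ALL z. (g has_real_derivative ph z - (g z)^2) (at z)) --> Ck_on 1 UNIV H --> (EX Q. normal_bound r0 CN ep ph H Q)"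
  using normal_field[OF r0] by (elim exE conjE)
 obtain ct CT where CT: "ct > 0" "CT > 0" "ALL ep>0. EX W. tangential_bound r0 gm ct CT ep W"
  using tangential_field[OF r0 gm] by (elim exE conjE)
 define M where "M = La / ct"
 have M: "M >= 0" "M * ct = La" using La CT(1) by (auto simp: M_def)
 \<comment> \<open>From the normal field, from the lower bound of div W, and from Young's
   inequality.\<close>
 define C where "C = CN + M * CT + (M * CT)^2 / c1"
 have C: "C > 0" using CN(1) M CT(2) c1 by (simp add: C_def add_pos_nonneg)
 show ?thesis
 proof (rule exI[of _ C], rule conjI[OF C], intro allI impI)
  fix ep :: real and g ph and H :: "'a => real"
  assume ep: "ep > 0" and ph: "continuous_on UNIV ph" and g: "ALL z. (g has_real_derivative ph z - (g z)^2) (at z)"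
   and H: "Ck_on 1 UNIV H"
  obtain Q where "normal_bound r0 CN ep ph H Q"
   using CN(2)[THEN spec, THEN mp, OF ep, THEN spec, THEN spec, THEN spec, THEN mp, OF ph, THEN mp, OF g, THEN mp, OF H] ..
  note Q = this[unfolded normal_bound_def, THEN conjunct1] this[unfolded normal_bound_def, THEN conjunct2, THEN conjunct1]
   this[unfolded normal_bound_def, THEN conjunct2, THEN conjunct2]
  obtain W where "tangential_bound r0 gm ct CT ep W"
   using CT(3)[THEN spec, THEN mp, OF ep] ..
  note W = this[unfolded tangential_bound_def, THEN conjunct1] this[unfolded tangential_bound_def, THEN conjunct2, THEN conjunct1]
   this[unfolded tangential_bound_def, THEN conjunct2, THEN conjunct2]
  have nV: "nice (Suc 0) (%q. Q q *\<^sub>R vfield q)" by (intro nice_scaleR Q(1) nice_v)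
  have nW: "nice (Suc 0) (%q. M *\<^sub>R W q)" by (intro nice_scaleR nice_const W(1))
  define U where "U q = Q q *\<^sub>R vfield q - M *\<^sub>R W q" for q
  have nU: "nice (Suc 0) U" unfolding U_def[abs_def] by (intro nice_diff nV nW)
  have U0: "ALL q:reg. abs (rco q) >= r0 --> U q = 0" using Q(2) W(2) by (simp add: U_def)
  have UB: "abs (gradx beta q \<bullet> U q) <= M * (CT / ep) * beta q" if q: "q : reg" for q
  proof -
   have "gradx beta q \<bullet> U q = - M * (gradx beta q \<bullet> W q)"
    using Dbeta_v[OF q] gradx_inner[OF nice_beta1 q, of "vfield q"] by (simp add: U_def inner_diff_right)
   hence "abs (gradx beta q \<bullet> U q) = M * abs (gradx beta q \<bullet> W q)" using M(1) by (simp add: abs_mult)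
   also have "... <= M * (CT / ep * beta q)" using W(3) q M(1) by (intro mult_left_mono) auto
   finally show ?thesis by (simp add: mult.assoc)
  qed
  have main: "ps^2 * divx U q + 2 * ps * (xv \<bullet> U q)
    <= cutr r0 q * (vfield q \<bullet> xv)^2 + c1 * (norm (tang xv q))^2
     + (cutr r0 q / ep^2 * ph ((rco q - ep * H (sco q)) / ep)
       - La / ep * (cutr r0 q * decay_b (gm / ep) q) + C) * ps^2" if q: "q : reg" for q xv ps
  proof -
   let ?y = "cutr r0 q" and ?p = "vfield q \<bullet> xv" and ?ta = "norm (tang xv q)"
   have Wq: "abs (W q \<bullet> xv) <= CT * ?ta" "ct / ep * (?y * decay_b (gm / ep) q) - CT <= divx W q"
    using bspec[OF W(3) q] by blast+
   have dU: "divx U q = divx (%q. Q q *\<^sub>R vfield q) q - M * divx W q"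
    unfolding U_def[abs_def] divx_diff[OF nV nW q] divx_scaleR[OF nice_const W(1) q] by (simp add: Dx_def)
   have xvU: "xv \<bullet> U q = Q q * ?p - M * (W q \<bullet> xv)" by (simp add: U_def inner_diff_right inner_commute)
   have "(ps^2 * M) * (ct / ep * (?y * decay_b (gm / ep) q) - CT) <= (ps^2 * M) * divx W q"
    by (intro mult_left_mono Wq) (use M in simp)
   hence 1: "- (ps^2 * (M * divx W q)) <= (M * CT - La / ep * (?y * decay_b (gm / ep) q)) * ps^2"
    unfolding M(2)[symmetric] by (simp add: algebra_simps)
   have "- 2 * ps * (M * (W q \<bullet> xv)) <= abs (2 * ps * (M * (W q \<bullet> xv)))" by simp
   also have "... = 2 * abs ps * M * abs (W q \<bullet> xv)" using M by (simp add: abs_mult)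
   also have "... <= 2 * abs ps * M * (CT * ?ta)" using Wq(1) M by (intro mult_left_mono) auto
   also have "... <= c1 * ?ta\<^sup>2 + (M * CT)^2 / c1 * ps^2"
   proof -
    have "0 <= (c1 * ?ta - M * CT * abs ps)^2 / c1" using c1 by simp
    also have "... = c1 * ?ta\<^sup>2 + (M * CT)^2 / c1 * ps^2 - 2 * abs ps * M * (CT * ?ta)"
     using c1 by (simp add: power2_diff power_mult_distrib field_simps power2_eq_square)
    finally show ?thesis by simp
   qed
   finally have 2: "- 2 * ps * (M * (W q \<bullet> xv)) <= c1 * ?ta\<^sup>2 + (M * CT)^2 / c1 * ps^2" .
   have 3: "2 * ps * (Q q * ?p) + ps^2 * divx (%q. Q q *\<^sub>R vfield q) q
    <= ?y * ?p\<^sup>2 + (?y / ep^2 * ph ((rco q - ep * H (sco q)) / ep) + CN) * ps^2"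
    using Q(3) q by blast
   show ?thesis using 1 2 3 unfolding dU xvU C_def by (simp add: algebra_simps)
  qed
  show "EX U. energy_bound r0 gm c1 La C ep ph H U"
   unfolding energy_bound_def by (intro exI[of _ U] conjI exI[of _ "M * (CT / ep)"] ballI allI nU U0 UB main)
 qed
qed

text \<open>The flux term integrates to 0, so the pointwise inequality on the slice can be
  integrated as it stands; off the slice F >= 0 lets the whole gradient survive. Slice and tube
  differ by a null set on the frontier.\<close>

lemma energy_integration:
 assumes ps: "ps : H1 Omg" and t: "t : {0..T}" and U: "nice (Suc 0) U"
  and U0: "r0 < dl" "ALL q:reg. abs (rco q) >= r0 --> U q = 0" and B: "ALL q:reg. abs (gradx beta q \<bullet> U q) <= B * beta q"
  and F: "(%x. indicator Omg x * F x) : borel_measurable lebesgue" "!!x. x : Omg ==> abs (F x) <= L"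
  and C: "C >= 0" and c0: "c0 > 0"
  and inn: "!!x. x : slice t ==> c0 * (norm (tang (weak_grad Omg ps x) (x, t)))^2 - C * (ps x)^2
    + ((ps x)^2 * divx U (x, t) + 2 * ps x * (weak_grad Omg ps x \<bullet> U (x, t)))
    <= (norm (weak_grad Omg ps x))^2 + F x * (ps x)^2"
  and out: "!!x. x : Omg - slice t ==> F x >= 0"
 shows "(LINT x:Omg|lebesgue. (norm (weak_grad Omg ps x))^2 + F x * (ps x)^2)
   >= - C * (L2_norm Omg ps)^2 + (L2_norm (Omg - time_slice (tube G dl) t) (weak_grad Omg ps))^2
    + c0 * (L2_norm (time_slice (tube G dl) t) (tangential_grad G t ps))^2"
proof -
 let ?g = "weak_grad Omg ps"
 note wg = H1_weak_grad[OF domain(1) ps]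
 have sl: "slice t \<subseteq> Omg" by (auto simp: slice_def reg_def)
 define I where "I x = indicator (slice t) x *\<^sub>R ((ps x)^2 * divx U (x, t) + 2 * ps x * (?g x \<bullet> U (x, t)))" for x
 have I: "integrable lebesgue I" "integral\<^sup>L lebesgue I = 0"
  using flux_identity[OF ps t U U0(1), of B] U0(2) B unfolding I_def by auto
 define P where "P x = indicator Omg x *\<^sub>R (norm (ps x))^2" for x
 define N where "N x = indicator Omg x *\<^sub>R (norm (?g x))^2" for x
 have iPN: "integrable lebesgue P" "integrable lebesgue N"
  using wg unfolding L2_on_def set_integrable_def P_def N_def by auto
 have Pval: "(L2_norm Omg ps)^2 = integral\<^sup>L lebesgue P"
  unfolding L2_norm_def set_lebesgue_integral_def P_def by (simp add: integral_nonneg_AE)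
 define N' where "N' x = indicator (Omg - slice t) x *\<^sub>R (norm (?g x))^2" for x
 define ta where "ta x = indicator (slice t) x *\<^sub>R (norm (tang (?g x) (x, t)))^2" for x
 have ssl: "slice t : sets lebesgue" "Omg : sets lebesgue" using open_slice domain(1) by auto
 have N'e: "N' = (%x. N x - indicator (slice t) x * N x)"
 proof
  show "N' x = N x - indicator (slice t) x * N x" for x
   using sl by (cases "x : slice t"; cases "x : Omg") (auto simp: N'_def N_def)
 qed
 have iN': "integrable lebesgue N'" unfolding N'e
  using Bochner_Integration.integrable_diff[OF iPN(2) integrable_mult_indicator[OF ssl(1) iPN(2)]] by simp
 have ita: "integrable lebesgue ta"
 proof -
  obtain CS where CS: "CS > 0" "ALL q:reg. ALL xv. (1 - CS * (rco q)^2) * (vfield q \<bullet> xv)^2 + (norm (tang xv q))^2 / 2 <= (norm xv)^2 &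
   (norm (tang xv q))^2 <= CS * (norm xv)^2" using gradient_splitting by (elim exE conjE)
  have ct: "continuous_on (slice t) (%x. vfield (x, t))" "continuous_on (slice t) (%x. mfield (x, t))"
   using nice_Ck_slice[OF nice_v[of 0], of t] nice_Ck_slice[OF nice_gradx[OF nice_r, of 0], of t] by (auto simp: mfield_def)
  have mg: "(%x. indicator Omg x *\<^sub>R ?g x) : borel_measurable lebesgue" using wg(3) by (simp add: L2_on_def set_borel_measurable_def)
  have mv: "(%x. indicator (slice t) x *\<^sub>R vfield (x, t)) : borel_measurable lebesgue"
   "(%x. indicator (slice t) x *\<^sub>R mfield (x, t)) : borel_measurable lebesgue"
   by (intro ind_meas_continuous ct borel_open open_slice)+
  have "(%x. (norm (indicator (slice t) x *\<^sub>R (indicator Omg x *\<^sub>R ?g x) - (indicator (slice t) x *\<^sub>R vfield (x, t) \<bullet> (indicator Omg x *\<^sub>R ?g x)) *\<^sub>R (indicator (slice t) x *\<^sub>R mfield (x, t))))^2) : borel_measurable lebesgue"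
   using mg mv ssl by measurable
  also have "(%x. (norm (indicator (slice t) x *\<^sub>R (indicator Omg x *\<^sub>R ?g x) - (indicator (slice t) x *\<^sub>R vfield (x, t) \<bullet> (indicator Omg x *\<^sub>R ?g x)) *\<^sub>R (indicator (slice t) x *\<^sub>R mfield (x, t))))^2) = ta"
   using sl by (intro ext) (auto simp: ta_def tang_def indicator_def)
  finally have "ta : borel_measurable lebesgue" .
  moreover have "norm (ta x) <= norm (CS * N x)" for x
  proof (cases "x : slice t")
   case True
   hence "(norm (tang (?g x) (x, t)))^2 <= CS * (norm (?g x))^2" using CS(2) by (auto simp: slice_def)
   thus ?thesis using True sl CS(1) by (simp add: ta_def N_def subset_iff)
  qed (simp add: ta_def)
  ultimately show ?thesis by (intro Bochner_Integration.integrable_bound[OF integrable_mult_right[OF iPN(2)], of _ CS]) auto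
 qed
 define J where "J x = indicator Omg x *\<^sub>R ((norm (?g x))^2 + F x * (ps x)^2)" for x
 have iJ: "integrable lebesgue J"
 proof -
  have "integrable lebesgue (%x. (indicator Omg x * F x) * P x)"
  proof (rule Bochner_Integration.integrable_bound[OF integrable_mult_right[OF iPN(1), of L]])
   show "(%x. indicator Omg x * F x * P x) : borel_measurable lebesgue"
    by (intro borel_measurable_times F(1) borel_measurable_integrable iPN)
   have "abs (indicator Omg x * F x) * abs (P x) <= abs (L * P x)" for x
    using F(2)[of x] by (auto simp: P_def abs_mult indicator_def intro!: mult_right_mono)
   thus "AE x in lebesgue. norm (indicator Omg x * F x * P x) <= norm (L * P x)" by (simp add: abs_mult)
  qed
  hence "integrable lebesgue (%x. N x + (indicator Omg x * F x) * P x)" using iPN(2) by simp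
  moreover have "J = (%x. N x + (indicator Omg x * F x) * P x)" by (auto simp: J_def N_def P_def indicator_def fun_eq_iff)
  ultimately show ?thesis by simp
 qed
 have "integral\<^sup>L lebesgue (%x. (c0 * ta x - C * P x) + (I x + N' x)) <= integral\<^sup>L lebesgue J"
 proof (rule integral_mono)
  show "integrable lebesgue (%x. (c0 * ta x - C * P x) + (I x + N' x))" using ita iPN I iN' by simp
  fix x
  show "(c0 * ta x - C * P x) + (I x + N' x) <= J x"
  proof (cases "x : slice t")
   case True
   thus ?thesis using inn[OF True] sl by (auto simp: ta_def P_def I_def N'_def J_def)
  next
   case False
   thus ?thesis using out[of x] C by (cases "x : Omg") (auto simp: ta_def P_def I_def N'_def J_def intro: order_trans[OF _ mult_nonneg_nonneg])
  qed
 qed (rule iJ)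
 also have "integral\<^sup>L lebesgue (%x. (c0 * ta x - C * P x) + (I x + N' x))
   = c0 * integral\<^sup>L lebesgue ta - C * integral\<^sup>L lebesgue P + integral\<^sup>L lebesgue N'"
  using ita iPN I iN' by simp
 finally have main: "c0 * integral\<^sup>L lebesgue ta - C * integral\<^sup>L lebesgue P + integral\<^sup>L lebesgue N' <= integral\<^sup>L lebesgue J" .
 have eq: "Omg - time_slice (tube G dl) t = Omg - slice t" by (auto simp: time_slice_def slice_def reg_def)
 have N'val: "(L2_norm (Omg - time_slice (tube G dl) t) ?g)^2 = integral\<^sup>L lebesgue N'"
  unfolding eq L2_norm_def set_lebesgue_integral_def N'_def by (simp add: integral_nonneg_AE)
 have "AE x in lebesgue. indicator (time_slice (tube G dl) t) x *\<^sub>R (norm (tangential_grad G t ps x))^2 = ta x"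
  using tube_slice_AE[OF t] tangential_grad_eq[OF t ps] by eventually_elim (auto simp: ta_def indicator_def)
 from lebesgue_cong(2)[OF this]
 have taval: "(L2_norm (time_slice (tube G dl) t) (tangential_grad G t ps))^2 = integral\<^sup>L lebesgue ta"
  unfolding L2_norm_def set_lebesgue_integral_def by (simp add: ta_def[abs_def] integral_nonneg_AE)
 show ?thesis unfolding N'val taval Pval set_lebesgue_integral_def J_def[symmetric] using main by simp
qed

end

context contact_geometry
begin

text \<open>For small r0 the cut-off is at most 1 - r^2 / r0^2 and hence at most the factor 1 - C
  r^2 of \<open>gradient_splitting\<close>; for |r| >= r0 it vanishes, and the plain bound on the
  tangential part is used.\<close>

lemma energy_splitting:
 "EX r0 c. 0 < r0 & r0 < dl & 0 < c & (ALL q:reg. ALL xv.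
  cutr r0 q * (vfield q \<bullet> xv)^2 + c * (norm (tang xv q))^2 <= (norm xv)^2)"
proof -
 obtain CS where CS: "CS > 0" "ALL q:reg. ALL xv. (1 - CS * (rco q)^2) * (vfield q \<bullet> xv)^2 + (norm (tang xv q))^2 / 2 <= (norm xv)^2 &
  (norm (tang xv q))^2 <= CS * (norm xv)^2" using gradient_splitting by (elim exE conjE)
 \<comment> \<open>The second entry gives r0 <= 1 and CS r0 <= 1, hence CS <= 1 / r0^2.\<close>
 define r0 where "r0 = min (dl / 2) (1 / (1 + CS))"
 define c where "c = min (1 / 2) (1 / CS)"
 have r0: "0 < r0" "r0 < dl" "r0 <= 1 / (1 + CS)" using dpos CS(1) by (auto simp: r0_def)
 have c: "0 < c" "c <= 1 / 2" "c <= 1 / CS" using CS(1) by (auto simp: c_def)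
 have "r0 * (1 + CS) <= 1" using r0(3) CS(1) by (simp add: pos_le_divide_eq)
 moreover have "0 < CS * r0" using r0(1) CS(1) by simp
 ultimately have "CS * r0 <= 1" "r0 <= 1" using r0(1) by (simp_all add: distrib_left mult.commute)
 hence "(CS * r0) * r0 <= 1 * 1" using r0(1) CS(1) by (intro mult_mono) auto
 hence rC: "CS <= 1 / r0^2" using r0(1) by (simp add: pos_le_divide_eq power2_eq_square mult.assoc)
 have "cutr r0 q * (vfield q \<bullet> xv)^2 + c * (norm (tang xv q))^2 <= (norm xv)^2" if q: "q : reg" for q xv
 proof -
  let ?r = "rco q"
  note CSq = CS(2)[THEN bspec, OF q, THEN spec, of xv]
  show ?thesis
  proof (cases "abs (?r) < r0")
   case True
   hence "?r\<^sup>2 <= r0^2" using r0(1) by (simp add: abs_le_square_iff[symmetric])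
   hence "0 <= 1 - ?r\<^sup>2 / r0^2" using r0(1) by (simp add: divide_le_eq)
   hence "bumpr r0 3 ?r <= (1 - ?r\<^sup>2 / r0^2) ^ 1"
    unfolding bumpr_def max_absorb2[OF \<open>0 <= 1 - ?r\<^sup>2 / r0^2\<close>] by (intro power_decreasing) auto
   moreover have "?r\<^sup>2 * CS <= ?r\<^sup>2 * (1 / r0^2)" by (intro mult_left_mono rC) simp
   ultimately have "bumpr r0 3 ?r <= 1 - CS * ?r\<^sup>2" by (simp add: mult.commute)
   hence "bumpr r0 3 ?r * (vfield q \<bullet> xv)^2 <= (1 - CS * ?r\<^sup>2) * (vfield q \<bullet> xv)^2" by (rule mult_right_mono) simp
   moreover have "c * (norm (tang xv q))^2 <= 1 / 2 * (norm (tang xv q))^2" by (intro mult_right_mono c) simp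
   ultimately show ?thesis using CSq by simp
  next
   case False
   hence "bumpr r0 3 ?r = 0" using bumpr_bounds(3)[of r0 ?r 2] r0(1) by simp
   moreover have "c * (norm (tang xv q))^2 <= 1 / CS * (CS * (norm xv)^2)"
    using CSq CS(1) c by (intro mult_mono) auto
   ultimately show ?thesis using CS(1) by simp
  qed
 qed
 thus ?thesis using r0 c by blast
qed

text \<open>Polynomials approximate h uniformly on the compact S, and uniform continuity of
  \<open>th\<close> on the range of the arguments turns this into closeness of the profiles. The
  polynomial may vary wildly with ep; only its sup bound enters the constants.\<close>

lemma height_approximation:
 fixes th :: "real => real"
 assumes th: "continuous_on UNIV th" and h: "continuous_on S h" "!!s. s : S ==> abs (h s) <= M" and ep: "ep > 0" and et: "et > 0"
 obtains H where "Ck_on 1 UNIV H" "!!s. s : S ==> abs (H s) <= M + 1"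
  "!!r s. abs r < dl ==> s : S ==> abs (th ((r - ep * h s) / ep) - th ((r - ep * H s) / ep)) <= et"
proof -
 \<comment> \<open>Bounds both arguments of \<open>th\<close>; the 1 accounts for the distance of H
   from h.\<close>
 define P where "P = dl / ep + M + 1"
 have "uniformly_continuous_on {-P..P} th"
  by (rule compact_uniformly_continuous[OF continuous_on_subset[OF th]]) auto
 then obtain d where d: "d > 0" "ALL x:{-P..P}. ALL y:{-P..P}. dist y x < d --> dist (th y) (th x) < et"
  unfolding uniformly_continuous_on_def using et by (elim allE[of _ et] impE exE conjE)
 have "min 1 d > 0" using d(1) by simp
 from Stone_Weierstrass_real_polynomial_function[OF S_facts(2) h(1) this]
 obtain H where H: "real_polynomial_function H" "!!s. s : S ==> abs (h s - H s) < min 1 d" by blast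
 show ?thesis
 proof
  show "Ck_on 1 UNIV H" by (rule Ck_on_poly[OF H(1)])
  show "abs (H s) <= M + 1" if "s : S" for s using h(2)[OF that] H(2)[OF that] by linarith
  fix r s assume r: "abs r < dl" and s: "s : S"
  have e: "(r - ep * a) / ep = r / ep - a" for a using ep by (simp add: field_simps)
  have "abs (r / ep) <= dl / ep" using r ep by (simp add: divide_right_mono)
  moreover have "abs (h s - H s) < 1" "abs (h s - H s) < d" using H(2)[OF s] by auto
  ultimately have "r / ep - h s : {-P..P}" "r / ep - H s : {-P..P}" "dist (r / ep - h s) (r / ep - H s) < d"
   using h(2)[OF s] unfolding P_def dist_real_def atLeastAtMost_iff by linarith+
  hence "dist (th (r / ep - h s)) (th (r / ep - H s)) < et" using d(2) by blast
  thus "abs (th ((r - ep * h s) / ep) - th ((r - ep * H s) / ep)) <= et" unfolding e dist_real_def by linarith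
 qed
qed

lemma spectral_lower_bound:
 assumes f: "double_well f" and op: "optimal_profile f th" and gm: "gm > 0" and cp: "corner_profile G gm u" and ep1: "ep1 > 0"
 shows "EX ep0>0. EX C>0. EX c0>0. ALL h1 h2 uA.
  height_function G C0 h1 --> (ALL ep:{0<..ep1}. height_function G C0 (h2 ep)) -->
  approximate_solution G th u h1 h2 K ep1 uA -->
  (ALL ep:{0<..ep0}. ALL t:{0..T}. ALL ps:H1 Omg.
   (LINT x:Omg|lebesgue. (norm (weak_grad Omg ps x))^2 + 1 / ep^2 * deriv (deriv f) (uA ep (x, t)) * (ps x)^2)
   >= - C * (L2_norm Omg ps)^2 + (L2_norm (Omg - time_slice (tube G dl) t) (weak_grad Omg ps))^2
    + c0 * (L2_norm (time_slice (tube G dl) t) (tangential_grad G t ps))^2)"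
proof -
 define f2 where "f2 = deriv (deriv f)"
 define Kp where "Kp = abs K"
 define Ch where "Ch = 2 * abs C0 + 1"
 have cf2: "continuous_on UNIV f2" unfolding f2_def by (rule well_derivs(4)[OF f])
 obtain g where g: "!!z. (g has_real_derivative (f2 (th z) - (g z)^2)) (at z)" "!!z. abs (th z) < 1" "continuous_on UNIV th"
  using profile_riccati[OF f op] unfolding f2_def by metis
 obtain R cth where R: "R > 0" "cth > 0" "!!z. abs z >= R ==> f2 (th z) >= cth"
  using profile_coercive[OF f op] unfolding f2_def by metis
 obtain Cu where Cu: "Cu > 0" "!!sig t p. sig : bd ==> t : {0..T} ==> p : half_plane ==> abs (u p sig t) <= Cu * exp (- gm * snd p)"
  using corner_bound[OF cp] by metis
 \<comment> \<open>2 + Kp + Cu bounds the values of \<open>uA\<close>, of the profile and of the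
   wells, so one L is both a bound and a Lipschitz constant of f'' there.\<close>
 obtain L where L: "L > 0" "!!x y. abs x <= 2 + Kp + Cu ==> abs y <= 2 + Kp + Cu ==> abs (f2 x - f2 y) <= L * abs (x - y)"
   "!!x. abs x <= 2 + Kp + Cu ==> abs (f2 x) <= L"
  using well_lipschitz[OF f, of "2 + Kp + Cu"] unfolding f2_def by metis
 obtain r0 c1 where r0: "0 < r0" "r0 < dl" "0 < c1" "ALL q:reg. ALL xv.
  cutr r0 q * (vfield q \<bullet> xv)^2 + c1 * (norm (tang xv q))^2 <= (norm xv)^2"
  using energy_splitting by (elim exE conjE)
 have Kp: "0 <= Kp" by (simp add: Kp_def)
 \<comment> \<open>One half of c1 absorbs the mixed term of W, the other half remains as c0; L Cu is
   the size of the corner term after the Lipschitz estimate for f''.\<close>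
 have ch: "0 < c1 / 2" "0 <= L * Cu" using r0(3) L(1) Cu(1) by auto
 obtain C' where C': "C' > 0" "ALL ep>0. ALL g ph H. continuous_on UNIV ph -->
  (ALL z. (g has_real_derivative ph z - (g z)^2) (at z)) --> Ck_on 1 UNIV H -->
  (EX U. energy_bound r0 gm (c1 / 2) (L * Cu) C' ep ph H U)"
  using energy_field[OF r0(1) gm ch] by (elim exE conjE)
 \<comment> \<open>Lower bound of f'' along the profile far from the interface and at the two wells;
   \<open>ep0\<close> keeps the total error L (Kp + 1 + Cu) ep at or below it.\<close>
 define cw where "cw = min cth (min (f2 1) (f2 (-1)))"
 have cw: "cw > 0" "cw <= cth" "cw <= f2 1" "cw <= f2 (-1)" using R(2) f by (auto simp: cw_def f2_def double_well_def)
 define D where "D = L * (Kp + 1 + Cu)"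
 have D: "D > 0" using L(1) Kp Cu(1) by (auto simp: D_def)
 define ep0 where "ep0 = min (min ep1 1) (cw / D)"
 define C where "C = C' + (L * (Kp + 1) + 3 * L * (R + Ch)^2 / r0^2)"
 have C: "C > 0" using C'(1) L(1) Kp by (simp add: C_def add_pos_nonneg)
 have ep0: "ep0 > 0" using ep1 cw(1) D by (simp add: ep0_def)
 have "(LINT x:Omg|lebesgue. (norm (weak_grad Omg ps x))^2 + 1 / ep^2 * f2 (uA ep (x, t)) * (ps x)^2)
   >= - C * (L2_norm Omg ps)^2 + (L2_norm (Omg - time_slice (tube G dl) t) (weak_grad Omg ps))^2
    + c1 / 2 * (L2_norm (time_slice (tube G dl) t) (tangential_grad G t ps))^2"
  if h1: "height_function G C0 h1" and h2: "ALL ep:{0<..ep1}. height_function G C0 (h2 ep)"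
   and ap: "approximate_solution G th u h1 h2 K ep1 uA"
   and e: "ep : {0<..ep0}" and t: "t : {0..T}" and ps: "ps : H1 Omg" for h1 h2 uA ep t ps
 proof -
  have ep: "0 < ep" "ep <= ep1" "ep <= 1" "ep <= cw / D" using e by (auto simp: ep0_def)
  have Dep: "L * (Kp + 1 + Cu) * ep <= cw" using ep(4) D by (simp add: D_def pos_le_divide_eq mult.commute)
  define h where "h s = h1 s t + ep * h2 ep s t" for s
  have hh: "height_function G C0 (h2 ep)" using h2 ep by auto
  have hc: "continuous_on S h" unfolding h_def
   using h1 hh t by (intro continuous_intros) (auto simp: height_function_def)
  have hb: "abs (h s) <= 2 * abs C0" if "s : S" for s
  proof -
   have "abs (h1 s t) <= C0" "abs (h2 ep s t) <= C0" using h1 hh t that by (auto simp: height_function_def)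
   moreover have "ep * abs (h2 ep s t) <= 1 * abs (h2 ep s t)" by (intro mult_right_mono ep(3)) simp
   ultimately show ?thesis using abs_triangle_ineq[of "h1 s t" "ep * h2 ep s t"] ep(1) unfolding h_def abs_mult by simp
  qed
  have ep2: "ep^2 > 0" using ep(1) by simp
  \<comment> \<open>Accuracy ep^2, the order of the remainder, whence Kp + 1 from here on.\<close>
  obtain H where H: "Ck_on 1 UNIV H" "!!s. s : S ==> abs (H s) <= 2 * abs C0 + 1"
   "!!r s. abs r < dl ==> s : S ==> abs (th ((r - ep * h s) / ep) - th ((r - ep * H s) / ep)) <= ep^2"
   using height_approximation[OF g(3) hc hb ep(1) ep2] by metis
  have cph: "continuous_on UNIV (%z. f2 (th z))"
   by (rule continuous_on_compose2[OF cf2 g(3)]) simp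
  obtain U where U': "energy_bound r0 gm (c1 / 2) (L * Cu) C' ep (%z. f2 (th z)) H U"
   using C'(2)[THEN spec, THEN mp, OF ep(1), THEN spec, THEN spec, THEN spec, THEN mp, OF cph, THEN mp, OF allI[OF g(1)], THEN mp, OF H(1)] ..
  note U = U'[unfolded energy_bound_def, THEN conjunct1] U'[unfolded energy_bound_def, THEN conjunct2, THEN conjunct1]
   U'[unfolded energy_bound_def, THEN conjunct2, THEN conjunct2, THEN conjunct2]
  obtain B where B: "ALL q:reg. abs (gradx beta q \<bullet> U q) <= B * beta q" using U' unfolding energy_bound_def by (elim conjE exE)
  note as = uA_facts[OF cp gm g(3) hc[unfolded h_def[abs_def]] ap ep(1,2) t, of Cu, folded Kp_def]
  have as: "(%x. indicator Omg x * uA ep (x, t)) : borel_measurable lebesgue"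
   "!!x. x : slice t ==> abs (uA ep (x, t) - th (rho_coord G h1 h2 ep (x, t))) <= Kp * ep^2 + ep * Cu * decay_b (gm / ep) (x, t)"
   "!!x. x : Omg - slice t ==> abs (uA ep (x, t) - 1) <= Kp * ep \<or> \<bar>uA ep (x, t) + 1\<bar> <= Kp * ep"
   by (rule as(1), erule (2) Cu(2)) (rule as(2), erule (2) Cu(2), assumption, rule as(3), erule (2) Cu(2), assumption)
  have in_bound: "abs (uA ep (x, t) - th ((rco (x, t) - ep * H (sco (x, t))) / ep)) <= (Kp + 1) * ep^2 + ep * Cu * decay_b (gm / ep) (x, t)"
   if x: "x : slice t" for x
  proof -
   have q: "(x, t) : reg" using x by (simp add: slice_def)
   have "rho_coord G h1 h2 ep (x, t) = (rco (x, t) - ep * h (sco (x, t))) / ep" by (simp add: rho_coord_def h_def)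
   thus ?thesis using as(2)[OF x] H(3)[OF reg_facts(1,2)[OF q]] by (simp add: distrib_right)
  qed
  have decay: "0 <= decay_b (gm / ep) q" "decay_b (gm / ep) q <= 1" if "q : reg" for q
   using corner_point(2)[OF that] gm ep(1) by (auto simp: decay_b_def less_imp_le)
  have uA_in: "abs (uA ep (x, t)) <= 2 + Kp + Cu" if x: "x : slice t" for x
  proof -
   have "(ep * Cu) * decay_b (gm / ep) (x, t) <= Cu * 1"
    using decay[of "(x, t)"] x ep Cu(1) by (intro mult_mono mult_left_le_one_le) (auto simp: slice_def)
   moreover have "(Kp + 1) * ep^2 <= (Kp + 1) * 1" using ep Kp by (intro mult_left_mono power_le_one) auto
   ultimately show ?thesis using in_bound[OF x] g(2)[of "(rco (x, t) - ep * H (sco (x, t))) / ep"]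
    unfolding mult_1_right by linarith
  qed
  have uA_out: "f2 (uA ep (x, t)) >= 0" "abs (uA ep (x, t)) <= 2 + Kp + Cu" if x: "x : Omg - slice t" for x
  proof -
   have Kep: "Kp * ep <= Kp * 1" by (intro mult_left_mono ep(3) Kp)
   have "EX sig::real. abs (uA ep (x, t) - sig) <= Kp * ep & abs sig = 1 & cw <= f2 sig"
    using as(3)[OF x] cw(3,4) by (elim disjE) (rule exI[of _ 1], simp, rule exI[of _ "-1"], simp)
   then obtain sig :: real where sig: "abs (uA ep (x, t) - sig) <= Kp * ep" "abs sig = 1" "cw <= f2 sig" by (elim exE conjE)
   show b: "abs (uA ep (x, t)) <= 2 + Kp + Cu" using sig Kep Cu(1) unfolding mult_1_right by linarith
   have "abs (f2 (uA ep (x, t)) - f2 sig) <= L * abs (uA ep (x, t) - sig)" using sig(2) Kp Cu(1) by (intro L(2) b) auto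
   also have "... <= L * ((Kp + 1 + Cu) * ep)"
   proof (rule mult_left_mono)
    have "Kp * ep <= (Kp + 1 + Cu) * ep" by (rule mult_right_mono) (use Cu(1) ep(1) in auto)
    thus "abs (uA ep (x, t) - sig) <= (Kp + 1 + Cu) * ep" using sig(1) by linarith
   qed (use L(1) in simp)
   finally show "f2 (uA ep (x, t)) >= 0" using Dep sig(3) unfolding mult.assoc by linarith
  qed
  have uA_all: "abs (f2 (uA ep (x, t))) <= L" if "x : Omg" for x
   using uA_in[of x] uA_out(2)[of x] that by (intro L(3)) blast
  show ?thesis
  proof (rule energy_integration[OF ps t U(1) r0(2) U(2) B])
   have "(%x. f2 (indicator Omg x * uA ep (x, t))) : borel_measurable lebesgue"
    using measurable_compose[OF as(1) borel_measurable_continuous_onI[OF cf2]] by simp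
   hence "(%x. indicator Omg x * (1 / ep^2 * f2 (indicator Omg x * uA ep (x, t)))) : borel_measurable lebesgue"
    using domain(1) by (intro borel_measurable_times borel_measurable_indicator) auto
   also have "(%x. indicator Omg x * (1 / ep^2 * f2 (indicator Omg x * uA ep (x, t)))) = (%x. indicator Omg x * (1 / ep^2 * f2 (uA ep (x, t))))"
    by (auto simp: indicator_def)
   finally show "(%x. indicator Omg x * (1 / ep^2 * f2 (uA ep (x, t)))) : borel_measurable lebesgue" .
   show "abs (1 / ep^2 * f2 (uA ep (x, t))) <= 1 / ep^2 * L" if "x : Omg" for x
    using mult_left_mono[OF uA_all[OF that], of "1 / ep^2"] by (simp add: abs_mult)
   show "C >= 0" "c1 / 2 > 0" using C r0(3) by auto
   show "1 / ep^2 * f2 (uA ep (x, t)) >= 0" if "x : Omg - slice t" for x using uA_out(1)[OF that] by simp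
   fix x assume x: "x : slice t"
   let ?q = "(x, t)" and ?xv = "weak_grad Omg ps x"
   let ?y = "bumpr r0 3 (rco ?q)" and ?rh = "(rco ?q - ep * H (sco ?q)) / ep" and ?E = "decay_b (gm / ep) ?q"
   have q: "?q : reg" and xO: "x : Omg" using x by (auto simp: slice_def reg_def)
   have "abs (f2 (uA ep ?q) - f2 (th ?rh)) <= L * abs (uA ep ?q - th ?rh)"
    using g(2)[of ?rh] Kp Cu(1) by (intro L(2) uA_in[OF x]) auto
   also have "... <= L * ((Kp + 1) * ep^2 + ep * Cu * ?E)" using L(1) by (intro mult_left_mono in_bound[OF x]) auto
   finally have F: "f2 (uA ep ?q) >= f2 (th ?rh) - L * ((Kp + 1) * ep^2 + ep * Cu * ?E)" by linarith
   have FL: "f2 (uA ep ?q) >= - L" using uA_all[OF xO] by linarith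
   have far: "f2 (th ?rh) >= cw" if "abs (?rh) >= R" using R(3)[OF that] cw(2) by linarith
   have req: "rco ?q = ep * ?rh + ep * H (sco ?q)" using ep(1) by simp
   have Hb: "abs (H (sco ?q)) <= Ch" unfolding Ch_def by (rule H(2)[OF reg_facts(2)[OF q]])
   have "?y / ep^2 * f2 (th ?rh) - L * Cu / ep * (?y * ?E) - (L * (Kp + 1) + 3 * L * (R + Ch)^2 / r0^2) <= 1 / ep^2 * f2 (uA ep ?q)"
    using L(1) Cu(1) by (intro potential_bound[OF ep(1,3) Dep r0(1) _ _ Kp decay[OF q] FL F far req Hb R(1)]) auto
   hence "?y / ep^2 * f2 (th ?rh) - L * Cu / ep * (?y * ?E) + C' <= 1 / ep^2 * f2 (uA ep ?q) + C" unfolding C_def by linarith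
   from mult_right_mono[OF this zero_le_power2[of "ps x"]]
   have "(?y / ep^2 * f2 (th ?rh) - L * Cu / ep * (?y * ?E) + C') * (ps x)^2 <= 1 / ep^2 * f2 (uA ep ?q) * (ps x)^2 + C * (ps x)^2"
    unfolding distrib_right .
   moreover have "(ps x)^2 * divx U ?q + 2 * ps x * (?xv \<bullet> U ?q) <= ?y * (vfield ?q \<bullet> ?xv)^2 + c1 / 2 * (norm (tang ?xv ?q))^2
     + (?y / ep^2 * f2 (th ?rh) - L * Cu / ep * (?y * ?E) + C') * (ps x)^2"
    using U(3)[THEN bspec, OF q] by (elim allE)
   moreover have "?y * (vfield ?q \<bullet> ?xv)^2 + c1 * (norm (tang ?xv ?q))^2 <= (norm ?xv)^2"
    using r0(4)[THEN bspec, OF q] by (elim allE)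
   moreover have "c1 * (norm (tang ?xv ?q))^2 = c1 / 2 * (norm (tang ?xv ?q))^2 + c1 / 2 * (norm (tang ?xv ?q))^2" by simp
   ultimately show "c1 / 2 * (norm (tang ?xv ?q))^2 - C * (ps x)^2 + ((ps x)^2 * divx U ?q + 2 * ps x * (?xv \<bullet> U ?q))
     <= (norm ?xv)^2 + 1 / ep^2 * f2 (uA ep ?q) * (ps x)^2" by linarith
  qed
 qed
 thus ?thesis unfolding f2_def[symmetric]
  by (intro exI[of _ ep0] exI[of _ C] exI[of _ "c1 / 2"] conjI ep0 C ch(1) allI impI ballI)
qed

end

theorem theorem6p16:
  fixes G :: "'a::euclidean_space interface_geometry"
    and f \<theta>0 :: "real \<Rightarrow> real"
    and u1C :: "real \<times> real \<Rightarrow> 'a \<Rightarrow> real \<Rightarrow> real"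
    and \<gamma> C0 K \<epsilon>1 :: real
  assumes "DIM('a) \<ge> 2"
    and "contact_angle_geometry G"
    and "double_well f"
    and "optimal_profile f \<theta>0"
    and "\<gamma> > 0"
    and "corner_profile G \<gamma> u1C"
    and "\<epsilon>1 > 0"
  shows "\<exists>\<epsilon>0>0. \<exists>C>0. \<exists>c0>0. \<forall>h1 h2 uA.
    height_function G C0 h1 \<longrightarrow> (\<forall>\<epsilon>\<in>{0<..\<epsilon>1}. height_function G C0 (h2 \<epsilon>)) \<longrightarrow>
    approximate_solution G \<theta>0 u1C h1 h2 K \<epsilon>1 uA \<longrightarrow>
    (\<forall>\<epsilon>\<in>{0<..\<epsilon>0}. \<forall>t\<in>{0..gT G}. \<forall>\<psi>\<in>H1 (gOmega G).
      (LINT x:gOmega G|lebesgue. (norm (weak_grad (gOmega G) \<psi> x))\<^sup>2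
          + 1 / \<epsilon>\<^sup>2 * deriv (deriv f) (uA \<epsilon> (x, t)) * (\<psi> x)\<^sup>2)
      \<ge> - C * (L2_norm (gOmega G) \<psi>)\<^sup>2
        + (L2_norm (gOmega G - time_slice (tube G (gdelta G)) t) (weak_grad (gOmega G) \<psi>))\<^sup>2
        + c0 * (L2_norm (time_slice (tube G (gdelta G)) t) (tangential_grad G t \<psi>))\<^sup>2)"
proof -
  interpret contact_geometry G by standard (rule assms(2))
  show ?thesis by (rule spectral_lower_bound[OF assms(3-7)])
qed

end
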